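(* Let $n\le\infty$ and let $O$ be an $n$-truncated collarable manifold operad. Then there is an isomorphism of $n$-truncated operads $O\cong W(O)$. Furthermore, for $m\le n$ the subspace of $W(O)(m)$ consisting of points which admit a representation by a decomposable labeled metric tree (one whose underlying tree has at least one edge) is a collar neighborhood of $\partial W(O)(m)=\mathrm{Decom}(W(O))(m)$.
   Context: Manifolds are topological manifolds and may be empty. **Trees and operads.** For a finite set $S$, an $S$-labeled tree is a finite rooted tree $T$ (vertex set $V(T)$) with label sets $lb(v)\subset S$ such that $S=\bigsqcup_v lb(v)$ and $|cld(v)|+|lb(v)|\ge 2$ for all $v$, where $cld(v)$ is the set of children of $v$; put $\overline{cld}(v)=cld(v)\sqcup lb(v)$. $\mathcal T(S)$ is the poset of $S$-labeled trees with $T\le T'$ if $T'$ is obtained from $T$ by contracting a set of edges (labels of merged vertices are united); $\bullet_S$ is the one-vertex tree. $\mathcal T_{\le n}$ is the category of all labeled trees with $|S|\le n$, with morphisms pairs (bijection of label sets, contraction). An $n$-truncated reduced operad $O$ ($O(0)=\emptyset$, $O(1)=*$) is a functor $\phi:\mathcal T_{\le n}\to\mathrm{Top}$ with compatible equivariant homeomorphisms $\phi(T)\cong\prod_{v}\phi(\bullet_{\overline{cld}(v)})$ under which contraction maps are products over the contracted subtrees; $O(S)=\phi(\bullet_S)$, $O(m)=O(\{1,\dots,m\})$. ($n=\infty$ gives ordinary reduced operads.) $\mathrm{Decom}(O)(S)=\bigcup_{T\ne\bullet_S}\mathrm{image}(\phi(T)\to\phi(\bullet_S))$. **Manifold operads.**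 $O$ is an $n$-truncated $d$-dimensional manifold operad if for all $S$ with $2\le|S|=m\le n$: $O(S)$ is a compact manifold of dimension $md-d-1$ with boundary $\mathrm{Decom}(O)(S)$, and $\mathrm{colim}_{\mathcal T(S)\setminus\bullet_S}\phi\to\mathrm{Decom}(O)(S)$ is a homeomorphism. It is collarable if for every $m\le n$ there is a $\Sigma_m$-equivariant collar neighborhood of $\partial O(m)\subset O(m)$. **W-construction.** An $O$-labeled metric $S$-tree is an $S$-labeled tree $T$ with an extra half-edge ("hair") attached to its root, a length in $[0,1]$ for each edge and for the hair, and a point of $O(\overline{cld}(v))$ for each $v\in V(T)$. $W_{[0,1]}(O)(S)=\big(\bigsqcup_{T\in\mathcal T(S)}\prod_{v\in V(T)}[0,1]\times O(\overline{cld}(v))\big)/\sim$ (the $[0,1]$ factor at $v$ is the length of the edge from $v$ to its parent, or of the hair if $v$ is the root), where $\sim$ contracts edges of length $0$ (but not a hair of length $0$) and composes the corresponding labels in $O$. Operad composition is grafting of trees, the hair of the grafted tree becoming an edge of the same length. $W(O)\subset W_{[0,1]}(O)$ is the suboperad of metric trees whose hair has length $1$. *)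

theory Defs
  imports "HOL-Analysis.Analysis" "HOL-Combinatorics.Permutations"
begin

section \<open>Topological manifolds with boundary\<close>

definition quotient_topology :: "'a topology \<Rightarrow> ('a \<Rightarrow> 'b) \<Rightarrow> 'b topology" where
  "quotient_topology X q =
     topology (\<lambda>U. U \<subseteq> q ` topspace X \<and> openin X {x \<in> topspace X. q x \<in> U})"

lemma openin_quotient_topology:
  "openin (quotient_topology X q) U \<longleftrightarrow>
     U \<subseteq> q ` topspace X \<and> openin X {x \<in> topspace X. q x \<in> U}"
proof -
  let ?P = "\<lambda>U. U \<subseteq> q ` topspace X \<and> openin X {x \<in> topspace X. q x \<in> U}"
  have "istopology ?P"
    unfolding istopology_def
  proof (intro conjI allI impI)
    fix S T assume "?P S" "?P T"
    moreover have "{x \<in> topspace X. q x \<in> S \<inter> T} =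
        {x \<in> topspace X. q x \<in> S} \<inter> {x \<in> topspace X. q x \<in> T}" by auto
    ultimately show "S \<inter> T \<subseteq> q ` topspace X" "openin X {x \<in> topspace X. q x \<in> S \<inter> T}"
      by auto
  next
    fix K assume K: "\<forall>U\<in>K. ?P U"
    then show "\<Union>K \<subseteq> q ` topspace X" by auto
    have "{x \<in> topspace X. q x \<in> \<Union>K} = (\<Union>U\<in>K. {x \<in> topspace X. q x \<in> U})" by auto
    moreover have "openin X (\<Union>U\<in>K. {x \<in> topspace X. q x \<in> U})"
      using K by (intro openin_Union) auto
    ultimately show "openin X {x \<in> topspace X. q x \<in> \<Union>K}" by simp
  qed
  then show ?thesis
    by (simp add: quotient_topology_def)
qed

lemma topspace_quotient_topology [simp]:
  "topspace (quotient_topology X q) = q ` topspace X"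
proof (rule antisym)
  show "topspace (quotient_topology X q) \<subseteq> q ` topspace X"
    by (metis openin_quotient_topology openin_topspace)
  have "{x \<in> topspace X. q x \<in> q ` topspace X} = topspace X" by auto
  then have "openin (quotient_topology X q) (q ` topspace X)"
    by (simp add: openin_quotient_topology)
  then show "q ` topspace X \<subseteq> topspace (quotient_topology X q)"
    by (rule openin_subset)
qed

lemma quotient_map_quotient_topology: "quotient_map X (quotient_topology X q) q"
  by (auto simp: quotient_map_def openin_quotient_topology)

definition second_countable_space :: "'a topology \<Rightarrow> bool" where
  "second_countable_space X \<longleftrightarrow>
     (\<exists>\<B>. countable \<B> \<and> (\<forall>B\<in>\<B>. openin X B) \<and>
          (\<forall>U x. openin X U \<and> x \<in> U \<longrightarrow> (\<exists>B\<in>\<B>. x \<in> B \<and> B \<subseteq> U)))"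

text \<open>For \<open>k = 0\<close> the coordinate \<open>x 0\<close> vanishes on the Euclidean space, so the half-space is a
  point.\<close>

definition half_space :: "nat \<Rightarrow> (nat \<Rightarrow> real) topology" where
  "half_space k = subtopology (Euclidean_space k) {x. 0 \<le> x 0}"

definition locally_modelled_at :: "'a topology \<Rightarrow> 'b topology \<Rightarrow> 'a \<Rightarrow> bool" where
  "locally_modelled_at X M x \<longleftrightarrow>
     (\<exists>U V. openin X U \<and> x \<in> U \<and> openin M V \<and>
            subtopology X U homeomorphic_space subtopology M V)"

text \<open>The dimension is an integer because a negative dimension does occur
  (for \<open>d = 0\<close> below); a manifold of negative dimension is empty.\<close>

definition topological_manifold :: "int \<Rightarrow> 'a topology \<Rightarrow> bool" where
  "topological_manifold k X \<longleftrightarrow>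
     Hausdorff_space X \<and> second_countable_space X \<and>
     (\<forall>x\<in>topspace X. 0 \<le> k \<and> locally_modelled_at X (half_space (nat k)) x)"

definition manifold_boundary :: "int \<Rightarrow> 'a topology \<Rightarrow> 'a set" where
  "manifold_boundary k X =
     {x \<in> topspace X. \<not> locally_modelled_at X (Euclidean_space (nat k)) x}"

definition is_collar ::
  "'a topology \<Rightarrow> 'a set \<Rightarrow> 'a set \<Rightarrow> ('a \<times> real \<Rightarrow> 'a) \<Rightarrow> bool" where
  "is_collar X B N c \<longleftrightarrow>
     N \<subseteq> topspace X \<and>
     homeomorphic_map (prod_topology (subtopology X B) (top_of_set {0..1})) (subtopology X N) c \<and>
     (\<forall>x\<in>B. c (x, 0) = x) \<and>
     openin X (c ` (B \<times> {0..<1}))"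

definition collar_neighborhood :: "'a topology \<Rightarrow> 'a set \<Rightarrow> 'a set \<Rightarrow> bool" where
  "collar_neighborhood X B N \<longleftrightarrow> (\<exists>c. is_collar X B N c)"


section \<open>Labeled trees\<close>

text \<open>The finite sets of the theory are the finite sets of natural numbers. A tree has
  natural numbers as vertices, which have to be distinct from its labels; then the
  disjoint union of the children and the labels of a vertex is an ordinary union.
  An edge is identified with its lower endpoint, a non-root vertex.\<close>

record ltree =
  verts :: "nat set"
  root :: nat
  parent :: "nat \<Rightarrow> nat"
  lb :: "nat \<Rightarrow> nat set"

definition labels :: "ltree \<Rightarrow> nat set" where
  "labels T = (\<Union>v\<in>verts T. lb T v)"

definition cld :: "ltree \<Rightarrow> nat \<Rightarrow> nat set" where
  "cld T v = {u \<in> verts T. u \<noteq> root T \<and> parent T u = v}"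

definition ocld :: "ltree \<Rightarrow> nat \<Rightarrow> nat set" where
  "ocld T v = cld T v \<union> lb T v"

definition labeled_tree :: "nat set \<Rightarrow> ltree \<Rightarrow> bool" where
  "labeled_tree S T \<longleftrightarrow>
     finite (verts T) \<and> root T \<in> verts T \<and>
     (\<forall>v\<in>verts T. v \<noteq> root T \<longrightarrow> parent T v \<in> verts T) \<and>
     (\<forall>v\<in>verts T. \<exists>k. (parent T ^^ k) v = root T) \<and>
     finite S \<and> labels T = S \<and> S \<inter> verts T = {} \<and>
     (\<forall>v\<in>verts T. \<forall>w\<in>verts T. v \<noteq> w \<longrightarrow> lb T v \<inter> lb T w = {}) \<and>
     (\<forall>v\<in>verts T. card (cld T v) + card (lb T v) \<ge> 2)"

text \<open>Trees with at least one edge, i.e. those different from the one-vertex tree.\<close>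

definition decomposable :: "ltree \<Rightarrow> bool" where
  "decomposable T \<longleftrightarrow> verts T \<noteq> {root T}"

text \<open>A morphism is a bijection \<open>\<sigma>\<close> of label sets together with the effect \<open>f\<close> on vertices of
  contracting a set of edges: an edge is contracted iff \<open>f\<close> identifies its endpoints, the remaining
  edges become the edges of \<open>T'\<close>, and each fiber of \<open>f\<close> has exactly one topmost vertex, that
  is, it is connected. The case of no contracted edges gives the isomorphisms of trees, and
  \<open>\<sigma> = id\<close> gives the preorder on trees with a fixed label set.\<close>

definition tree_mor :: "(nat \<Rightarrow> nat) \<Rightarrow> (nat \<Rightarrow> nat) \<Rightarrow> ltree \<Rightarrow> ltree \<Rightarrow> bool" where
  "tree_mor \<sigma> f T T' \<longleftrightarrow>
     bij_betw \<sigma> (labels T) (labels T') \<and>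
     f ` verts T = verts T' \<and> f (root T) = root T' \<and>
     (\<forall>v\<in>verts T. v \<noteq> root T \<longrightarrow>
        f v = f (parent T v) \<or> (f v \<noteq> root T' \<and> parent T' (f v) = f (parent T v))) \<and>
     (\<forall>w\<in>verts T'. \<exists>!v. v \<in> verts T \<and> f v = w \<and> (v = root T \<or> f (parent T v) \<noteq> w)) \<and>
     (\<forall>w\<in>verts T'. lb T' w = \<sigma> ` (\<Union>v\<in>{v \<in> verts T. f v = w}. lb T v))"

definition fiber_root :: "ltree \<Rightarrow> (nat \<Rightarrow> nat) \<Rightarrow> nat \<Rightarrow> nat" where
  "fiber_root T f w =
     (THE v. v \<in> verts T \<and> f v = w \<and> (v = root T \<or> f (parent T v) \<noteq> w))"

text \<open>The subtree of \<open>T\<close> contracted to \<open>w\<close>; the edges of \<open>T\<close> leaving it downwards become labels.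
  Hence \<open>ocld (fiber T f w) v = ocld T v\<close> for each vertex \<open>v\<close> of the fiber.\<close>

definition fiber :: "ltree \<Rightarrow> (nat \<Rightarrow> nat) \<Rightarrow> nat \<Rightarrow> ltree" where
  "fiber T f w =
     \<lparr>verts = {v \<in> verts T. f v = w}, root = fiber_root T f w, parent = parent T,
      lb = (\<lambda>v. lb T v \<union> {u \<in> cld T v. f u \<noteq> w})\<rparr>"

text \<open>For a morphism \<open>(\<sigma>, f)\<close> from \<open>T\<close> to \<open>T'\<close> this restricts to a bijection from
  \<open>labels (fiber T f w)\<close> to \<open>ocld T' w\<close>.\<close>

definition glue :: "ltree \<Rightarrow> (nat \<Rightarrow> nat) \<Rightarrow> (nat \<Rightarrow> nat) \<Rightarrow> nat \<Rightarrow> nat" where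
  "glue T \<sigma> f u = (if u \<in> verts T then f u else \<sigma> u)"


section \<open>Truncated reduced operads\<close>

text \<open>\<open>opspace P S\<close> is the space of operations with inputs \<open>S\<close>, \<open>oprelabel P S S' \<sigma>\<close> the action of a
  bijection \<open>\<sigma>\<close> from \<open>S\<close> to \<open>S'\<close>, and \<open>opcomp P T\<close> the composition along \<open>T\<close>. All data are used
  only for at least two inputs: the empty set of nullary operations and the single
  unary operation of a reduced operad carry no information, since no vertex of a labeled tree
  has fewer than two inputs.\<close>

record 'a operad =
  opspace :: "nat set \<Rightarrow> 'a topology"
  oprelabel :: "nat set \<Rightarrow> nat set \<Rightarrow> (nat \<Rightarrow> nat) \<Rightarrow> 'a \<Rightarrow> 'a"
  opcomp :: "ltree \<Rightarrow> (nat \<Rightarrow> 'a) \<Rightarrow> 'a"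

text \<open>The functor on trees: the value at a tree is the product over its vertices, and the
  map induced by a contraction is the product of the compositions along the contracted
  subtrees.\<close>

definition tree_space :: "'a operad \<Rightarrow> ltree \<Rightarrow> (nat \<Rightarrow> 'a) topology" where
  "tree_space P T = product_topology (\<lambda>v. opspace P (ocld T v)) (verts T)"

definition tree_map ::
  "'a operad \<Rightarrow> (nat \<Rightarrow> nat) \<Rightarrow> (nat \<Rightarrow> nat) \<Rightarrow> ltree \<Rightarrow> ltree \<Rightarrow> (nat \<Rightarrow> 'a) \<Rightarrow> nat \<Rightarrow> 'a" where
  "tree_map P \<sigma> f T T' x =
     (\<lambda>w\<in>verts T'.
        oprelabel P (labels (fiber T f w)) (ocld T' w) (glue T \<sigma> f)
          (opcomp P (fiber T f w) (restrict x (verts (fiber T f w)))))"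

text \<open>The set of inputs of an operation in an \<open>n\<close>-truncated operad.\<close>

definition arity_set :: "enat \<Rightarrow> nat set \<Rightarrow> bool" where
  "arity_set n S \<longleftrightarrow> finite S \<and> 2 \<le> card S \<and> enat (card S) \<le> n"

definition tree_upto :: "enat \<Rightarrow> ltree \<Rightarrow> bool" where
  "tree_upto n T \<longleftrightarrow> labeled_tree (labels T) T \<and> enat (card (labels T)) \<le> n"

text \<open>The third clause identifies the value of the functor at a one-vertex tree with
  \<open>opspace\<close>. The last one says that relabeling depends only on the bijection \<open>S \<rightarrow> S'\<close>,
  not on the values of \<open>\<sigma>\<close> outside \<open>S\<close>. Continuity of \<open>oprelabel\<close> and \<open>opcomp\<close>, and the usual
  associativity and equivariance laws, are the first two clauses for morphisms to one-vertex
  trees and between them.\<close>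

definition truncated_operad :: "enat \<Rightarrow> 'a operad \<Rightarrow> bool" where
  "truncated_operad n P \<longleftrightarrow>
     (\<forall>\<sigma> f T T'. tree_upto n T \<and> tree_upto n T' \<and> tree_mor \<sigma> f T T' \<longrightarrow>
        continuous_map (tree_space P T) (tree_space P T') (tree_map P \<sigma> f T T')) \<and>
     (\<forall>\<sigma> f \<tau> g T T' T''.
        tree_upto n T \<and> tree_upto n T' \<and> tree_upto n T'' \<and>
        tree_mor \<sigma> f T T' \<and> tree_mor \<tau> g T' T'' \<longrightarrow>
        (\<forall>x\<in>topspace (tree_space P T).
           tree_map P (\<tau> \<circ> \<sigma>) (g \<circ> f) T T'' x = tree_map P \<tau> g T' T'' (tree_map P \<sigma> f T T' x))) \<and>
     (\<forall>T. tree_upto n T \<and> \<not> decomposable T \<longrightarrow>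
        (\<forall>x\<in>topspace (tree_space P T). opcomp P T x = x (root T))) \<and>
     (\<forall>T. tree_upto n T \<longrightarrow>
        (\<forall>x\<in>topspace (tree_space P T). tree_map P id id T T x = x)) \<and>
     (\<forall>S S' \<sigma> \<tau>. arity_set n S \<and> bij_betw \<sigma> S S' \<and> (\<forall>s\<in>S. \<sigma> s = \<tau> s) \<longrightarrow>
        (\<forall>x\<in>topspace (opspace P S). oprelabel P S S' \<sigma> x = oprelabel P S S' \<tau> x))"

text \<open>An isomorphism is a natural isomorphism of the functors on trees that is the product
  of its components at the vertices.\<close>

definition operad_iso ::
  "enat \<Rightarrow> 'a operad \<Rightarrow> 'b operad \<Rightarrow> (nat set \<Rightarrow> 'a \<Rightarrow> 'b) \<Rightarrow> bool" where
  "operad_iso n P Q h \<longleftrightarrow>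
     truncated_operad n P \<and> truncated_operad n Q \<and>
     (\<forall>S. arity_set n S \<longrightarrow> homeomorphic_map (opspace P S) (opspace Q S) (h S)) \<and>
     (\<forall>\<sigma> f T T'. tree_upto n T \<and> tree_upto n T' \<and> tree_mor \<sigma> f T T' \<longrightarrow>
        (\<forall>x\<in>topspace (tree_space P T).
           tree_map Q \<sigma> f T T' (\<lambda>v\<in>verts T. h (ocld T v) (x v)) =
           (\<lambda>w\<in>verts T'. h (ocld T' w) (tree_map P \<sigma> f T T' x w))))"

definition Decom :: "'a operad \<Rightarrow> nat set \<Rightarrow> 'a set" where
  "Decom P S =
     (\<Union>T\<in>{T. labeled_tree S T \<and> decomposable T}. opcomp P T ` topspace (tree_space P T))"

text \<open>The colimit of the tree functor over all trees with label set \<open>S\<close> except the one-vertex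
  trees. The index category contains all isomorphic copies of a tree, and the isomorphisms between
  them, and is therefore equivalent to the poset of isomorphism classes of trees.\<close>

definition colim_sum :: "'a operad \<Rightarrow> nat set \<Rightarrow> (ltree \<times> (nat \<Rightarrow> 'a)) topology" where
  "colim_sum P S = sum_topology (tree_space P) {T. labeled_tree S T \<and> decomposable T}"

definition colim_step ::
  "'a operad \<Rightarrow> nat set \<Rightarrow> ltree \<times> (nat \<Rightarrow> 'a) \<Rightarrow> ltree \<times> (nat \<Rightarrow> 'a) \<Rightarrow> bool" where
  "colim_step P S p p' \<longleftrightarrow>
     p \<in> topspace (colim_sum P S) \<and> p' \<in> topspace (colim_sum P S) \<and>
     (\<exists>f. tree_mor id f (fst p) (fst p') \<and> snd p' = tree_map P id f (fst p) (fst p') (snd p))"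

definition colim_class ::
  "'a operad \<Rightarrow> nat set \<Rightarrow> ltree \<times> (nat \<Rightarrow> 'a) \<Rightarrow> (ltree \<times> (nat \<Rightarrow> 'a)) set" where
  "colim_class P S p = {p'. equivclp (colim_step P S) p p'}"

definition tree_colim :: "'a operad \<Rightarrow> nat set \<Rightarrow> (ltree \<times> (nat \<Rightarrow> 'a)) set topology" where
  "tree_colim P S = quotient_topology (colim_sum P S) (colim_class P S)"

text \<open>Composition is constant on each class.\<close>

definition colim_map :: "'a operad \<Rightarrow> (ltree \<times> (nat \<Rightarrow> 'a)) set \<Rightarrow> 'a" where
  "colim_map P c = the_elem ((\<lambda>(T, x). opcomp P T x) ` c)"

definition arity_dim :: "nat \<Rightarrow> nat \<Rightarrow> int" where
  "arity_dim d m = int m * int d - int d - 1"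

definition manifold_operad :: "enat \<Rightarrow> nat \<Rightarrow> 'a operad \<Rightarrow> bool" where
  "manifold_operad n d P \<longleftrightarrow>
     truncated_operad n P \<and>
     (\<forall>S. arity_set n S \<longrightarrow>
        compact_space (opspace P S) \<and>
        topological_manifold (arity_dim d (card S)) (opspace P S) \<and>
        manifold_boundary (arity_dim d (card S)) (opspace P S) = Decom P S \<and>
        homeomorphic_map (tree_colim P S) (subtopology (opspace P S) (Decom P S)) (colim_map P))"

definition collarable :: "enat \<Rightarrow> nat \<Rightarrow> 'a operad \<Rightarrow> bool" where
  "collarable n d P \<longleftrightarrow>
     (\<forall>m. 2 \<le> m \<and> enat m \<le> n \<longrightarrow>
        (let X = opspace P {1..m}; B = manifold_boundary (arity_dim d m) X;
             act = oprelabel P {1..m} {1..m}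
         in \<exists>N c. is_collar X B N c \<and>
              (\<forall>\<pi>. \<pi> permutes {1..m} \<longrightarrow>
                 (\<forall>x\<in>B. \<forall>t\<in>{0..1}. c (act \<pi> x, t) = act \<pi> (c (x, t))))))"


section \<open>The W-construction\<close>

text \<open>A metric tree is a tree with a point of \<open>[0,1] \<times> P(ocld v)\<close> at each vertex \<open>v\<close>. The
  number at \<open>v\<close> is the length of the edge from \<open>v\<close> to its parent, or of the hair if \<open>v\<close> is the
  root.\<close>

type_synonym 'a metric_tree = "ltree \<times> (nat \<Rightarrow> real \<times> 'a)"

definition metric_trees :: "'a operad \<Rightarrow> nat set \<Rightarrow> 'a metric_tree topology" where
  "metric_trees P S =
     sum_topology
       (\<lambda>T. product_topology
              (\<lambda>v. prod_topology (top_of_set {0..1}) (opspace P (ocld T v))) (verts T))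
       {T. labeled_tree S T}"

text \<open>\<open>p'\<close> is obtained from \<open>p\<close> by the morphism \<open>(\<sigma>, f)\<close>, which may contract only edges of
  length 0. The edge above a vertex \<open>w\<close> of the new tree is the edge above the topmost vertex of the
  subtree contracted to \<open>w\<close>; in particular the length of the hair does not change.\<close>

definition metric_mor ::
  "'a operad \<Rightarrow> (nat \<Rightarrow> nat) \<Rightarrow> (nat \<Rightarrow> nat) \<Rightarrow> 'a metric_tree \<Rightarrow> 'a metric_tree \<Rightarrow> bool" where
  "metric_mor P \<sigma> f p p' \<longleftrightarrow>
     (case (p, p') of ((T, x), (T', x')) \<Rightarrow>
        tree_mor \<sigma> f T T' \<and>
        (\<forall>v\<in>verts T. v \<noteq> root T \<and> f v = f (parent T v) \<longrightarrow> fst (x v) = 0) \<and>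
        x' = (\<lambda>w\<in>verts T'. (fst (x (fiber_root T f w)),
                            tree_map P \<sigma> f T T' (\<lambda>v. snd (x v)) w)))"

definition W_step :: "'a operad \<Rightarrow> nat set \<Rightarrow> 'a metric_tree \<Rightarrow> 'a metric_tree \<Rightarrow> bool" where
  "W_step P S p p' \<longleftrightarrow>
     p \<in> topspace (metric_trees P S) \<and> p' \<in> topspace (metric_trees P S) \<and>
     (\<exists>f. metric_mor P id f p p')"

definition W_class :: "'a operad \<Rightarrow> nat set \<Rightarrow> 'a metric_tree \<Rightarrow> 'a metric_tree set" where
  "W_class P S p = {p'. equivclp (W_step P S) p p'}"

definition W01_space :: "'a operad \<Rightarrow> nat set \<Rightarrow> 'a metric_tree set topology" where
  "W01_space P S = quotient_topology (metric_trees P S) (W_class P S)"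

text \<open>The metric trees obtained by relabeling a representative of \<open>c\<close> form a single class; the
  union below is that class. (A tree and its relabeling may have different vertices, because
  the new labels may occur among the old vertices.)\<close>

definition W_relabel ::
  "'a operad \<Rightarrow> nat set \<Rightarrow> nat set \<Rightarrow> (nat \<Rightarrow> nat) \<Rightarrow> 'a metric_tree set \<Rightarrow> 'a metric_tree set" where
  "W_relabel P S S' \<sigma> c =
     \<Union> {W_class P S' p' | p'. p' \<in> topspace (metric_trees P S') \<and>
                               (\<exists>p\<in>c. \<exists>f. metric_mor P \<sigma> f p p')}"

text \<open>\<open>grafting P T y G x\<close> says that \<open>(G, x)\<close> is obtained by grafting representatives of the
  classes \<open>y v\<close>, one for each vertex \<open>v\<close> of \<open>T\<close>: there is a contraction of \<open>G\<close> to \<open>T\<close> such that the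
  metric subtree contracted to \<open>v\<close>, with its leaving edges renamed to the children of \<open>v\<close>, represents
  \<open>y v\<close>. The hair of this subtree is the edge above its root in \<open>G\<close>, with the same
  length.\<close>

definition grafting ::
  "'a operad \<Rightarrow> ltree \<Rightarrow> (nat \<Rightarrow> 'a metric_tree set) \<Rightarrow> ltree \<Rightarrow> (nat \<Rightarrow> real \<times> 'a) \<Rightarrow> bool" where
  "grafting P T y G x \<longleftrightarrow>
     (\<exists>f. tree_mor id f G T \<and>
        (\<forall>v\<in>verts T.
           W_relabel P (labels (fiber G f v)) (ocld T v) (glue G id f)
             (W_class P (labels (fiber G f v))
                (fiber G f v, restrict x (verts (fiber G f v)))) = y v))"

definition W_comp ::
  "'a operad \<Rightarrow> ltree \<Rightarrow> (nat \<Rightarrow> 'a metric_tree set) \<Rightarrow> 'a metric_tree set" where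
  "W_comp P T y =
     \<Union> {W_class P (labels T) (G, x) | G x.
           (G, x) \<in> topspace (metric_trees P (labels T)) \<and> grafting P T y G x}"

definition W01 :: "'a operad \<Rightarrow> 'a metric_tree set operad" where
  "W01 P = \<lparr>opspace = W01_space P, oprelabel = W_relabel P, opcomp = W_comp P\<rparr>"

definition W :: "'a operad \<Rightarrow> 'a metric_tree set operad" where
  "W P = (W01 P)
     \<lparr>opspace := (\<lambda>S. subtopology (opspace (W01 P) S)
                       {c. \<exists>(T, x)\<in>c. fst (x (root T)) = 1})\<rparr>"

definition W_decomposable :: "'a operad \<Rightarrow> nat set \<Rightarrow> 'a metric_tree set set" where
  "W_decomposable P S =
     {c \<in> topspace (opspace (W P) S). \<exists>(T, x)\<in>c. decomposable T}"

end

theory Submission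
  imports Defs
begin

text \<open>
A metric tree with labels in \<open>P\<close> is evaluated to an operation of \<open>P\<close> by a process in time. An edge
of length \<open>l\<close> has the level \<open>1 + l\<close>. While the time runs from \<open>1\<close> to \<open>2\<close>, all labels are pushed
away from the boundary, and an edge is contracted, with composition of the labels at its ends, when
the time reaches its level. At time \<open>2\<close> a single operation is left. The pushing is by \<open>s / t\<close>
between the times \<open>s\<close> and \<open>t\<close>, where a factor multiplies the distance from the inner end of a
collar: factors multiply, the factor \<open>1\<close> is the identity, and smaller factors move everything off
the boundary (\<open>collar_scaling\<close>). The equivariance of the collars makes this compatible with
relabeling (\<open>scaling_all_inputs\<close>).

The result depends only on the class of the metric tree, because an edge of length \<open>0\<close> is
contracted at the start, before any label is scaled (\<open>eval_natural\<close>). It depends continuously on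
lengths and labels, because edges of the same level may be contracted in any order
(\<open>eval_continuous\<close>). It respects operadic composition, because the edges that grafting creates from
hairs of length \<open>1\<close> have level \<open>2\<close> and are contracted last, when the grafted trees have been
evaluated separately (\<open>eval_graft\<close>).

The process can be run backwards. A label that has been scaled by a factor less than \<open>1\<close> is not
decomposable, whereas a composite is; hence the times of contraction can be read off. At
such a time the previous tree is recovered, because an operation has only one decomposition into
indecomposable operations: this is what injectivity of the map from the colimit means
(\<open>finest_unique_all\<close>). So metric trees without edges of length \<open>0\<close> and with equal results are
isomorphic (\<open>eval_injective\<close>). Conversely, an operation that cannot be pulled back to time \<open>1\<close> by
scaling comes from a point of the boundary at some intermediate time, that is, from a composite of
operations with fewer inputs, and induction applies (\<open>eval_surjective\<close>).

Therefore the classes of metric trees with hair of length \<open>1\<close> correspond to the operations. This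
bijection is continuous from a compact space to a Hausdorff space, hence a homeomorphism, and
it transports the operad laws, the manifold structure and the boundary from \<open>P\<close> to \<open>W P\<close>. The last
contraction of a decomposable tree produces a boundary point at some time \<open>t\<close> between \<open>1\<close> and \<open>2\<close>,
which is scaled by \<open>t / 2\<close> afterwards. So the decomposable trees correspond to the half of the
collar next to the boundary (\<open>W_decomposable_value\<close>), which is a collar itself (\<open>half_collar\<close>).
\<close>

section \<open>Combinatorics of labeled trees\<close>

lemma tree_induct [consumes 2, case_names root step]:
  assumes T: "labeled_tree S T" and v: "v \<in> verts T"
    and r: "Q (root T)"
    and s: "\<And>v. v \<in> verts T \<Longrightarrow> v \<noteq> root T \<Longrightarrow> Q (parent T v) \<Longrightarrow> Q v"
  shows "Q v"
proof -
  obtain k where "(parent T ^^ k) v = root T" using T v by (auto simp: labeled_tree_def)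
  then show ?thesis using v
  proof (induction k arbitrary: v)
    case (Suc k)
    show ?case
    proof (cases "v = root T")
      case False
      then have "parent T v \<in> verts T" using T Suc.prems by (auto simp: labeled_tree_def)
      moreover have "(parent T ^^ k) (parent T v) = root T"
        using Suc.prems(1) by (simp add: funpow_swap1)
      ultimately show ?thesis using Suc s False by blast
    qed (use r in auto)
  qed (use r in auto)
qed

lemma ltD:
  assumes "labeled_tree S T"
  shows lt_finite: "finite (verts T)" and lt_root: "root T \<in> verts T"
    and lt_parent: "\<And>v. v \<in> verts T \<Longrightarrow> v \<noteq> root T \<Longrightarrow> parent T v \<in> verts T"
    and lt_finS: "finite S" and lt_labels: "labels T = S"
    and lt_disj: "S \<inter> verts T = {}"
    and lt_lb: "\<And>v. v \<in> verts T \<Longrightarrow> lb T v \<subseteq> S"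
    and lt_lbdisj: "\<And>v w s. v \<in> verts T \<Longrightarrow> w \<in> verts T \<Longrightarrow> s \<in> lb T v \<Longrightarrow> s \<in> lb T w \<Longrightarrow> v = w"
    and lt_lbex: "\<And>s. s \<in> S \<Longrightarrow> \<exists>v\<in>verts T. s \<in> lb T v"
proof -
  show "v = w" if "v \<in> verts T" "w \<in> verts T" "s \<in> lb T v" "s \<in> lb T w" for v w s
    using assms that unfolding labeled_tree_def by blast
qed (use assms in \<open>auto simp: labeled_tree_def labels_def\<close>)

lemma lt_finite_ocld:
  assumes "labeled_tree S T" "v \<in> verts T"
  shows "finite (cld T v)" "finite (lb T v)" "finite (ocld T v)" "cld T v \<inter> lb T v = {}"
proof -
  show 1: "finite (cld T v)" using lt_finite[OF assms(1)] by (simp add: cld_def)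
  show 2: "finite (lb T v)" using lt_lb[OF assms] lt_finS[OF assms(1)] by (rule finite_subset)
  show "finite (ocld T v)" using 1 2 by (simp add: ocld_def)
  show "cld T v \<inter> lb T v = {}"
    using lt_lb[OF assms] lt_disj[OF assms(1)] by (auto simp: cld_def)
qed

lemma lt_card_ocld:
  assumes "labeled_tree S T" "v \<in> verts T"
  shows "card (ocld T v) = card (cld T v) + card (lb T v)" "2 \<le> card (ocld T v)"
proof -
  show 1: "card (ocld T v) = card (cld T v) + card (lb T v)"
    using lt_finite_ocld[OF assms] by (simp add: ocld_def card_Un_disjoint)
  show "2 \<le> card (ocld T v)"
    using assms unfolding 1 by (auto simp: labeled_tree_def)
qed

text \<open>Induction from the root replaces the iterated parent function. In this form the property passes
from a tree to the trees that are built from it.\<close>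

lemma labeled_treeI:
  assumes "finite (verts T)" "root T \<in> verts T"
    and "\<And>v. v \<in> verts T \<Longrightarrow> v \<noteq> root T \<Longrightarrow> parent T v \<in> verts T"
    and ind: "\<And>Q v. Q (root T) \<Longrightarrow> (\<And>u. u \<in> verts T \<Longrightarrow> u \<noteq> root T \<Longrightarrow> Q (parent T u) \<Longrightarrow> Q u)
       \<Longrightarrow> v \<in> verts T \<Longrightarrow> Q v"
    and "finite S" "labels T = S" and dj: "S \<inter> verts T = {}"
    and "\<And>v w s. v \<in> verts T \<Longrightarrow> w \<in> verts T \<Longrightarrow> s \<in> lb T v \<Longrightarrow> s \<in> lb T w \<Longrightarrow> v = w"
    and c: "\<And>v. v \<in> verts T \<Longrightarrow> 2 \<le> card (ocld T v)"
  shows "labeled_tree S T"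
proof -
  have "\<exists>k. (parent T ^^ k) v = root T" if "v \<in> verts T" for v
  proof (rule ind[of "\<lambda>v. \<exists>k. (parent T ^^ k) v = root T"])
    show "\<exists>k. (parent T ^^ k) (root T) = root T" by (rule exI[of _ 0]) simp
    show "\<exists>k. (parent T ^^ k) u = root T"
      if *: "u \<in> verts T" "u \<noteq> root T" "\<exists>k. (parent T ^^ k) (parent T u) = root T" for u
    proof -
      obtain k where "(parent T ^^ k) (parent T u) = root T" using *(3) by blast
      then have "(parent T ^^ Suc k) u = root T" by (simp add: funpow_swap1)
      then show ?thesis by blast
    qed
  qed (use that in auto)
  moreover have "2 \<le> card (cld T v) + card (lb T v)" if v: "v \<in> verts T" for v
    using c[OF v] card_Un_le[of "cld T v" "lb T v"] by (simp add: ocld_def)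
  ultimately show ?thesis
    using assms unfolding labeled_tree_def by blast
qed

text \<open>Every non-root vertex is a child of one vertex and every label sits at one vertex. As
  each vertex has at least two inputs, this bounds the size of a tree with given labels.\<close>

lemma lt_sum_card:
  assumes T: "labeled_tree S T"
  shows "(\<Sum>v\<in>verts T. card (ocld T v)) + 1 = card (verts T) + card S"
proof -
  have f: "finite (verts T)" by (rule lt_finite[OF T])
  have "(\<Union>v\<in>verts T. cld T v) = verts T - {root T}"
    using lt_parent[OF T] by (auto simp: cld_def)
  moreover have "card (\<Union>v\<in>verts T. cld T v) = (\<Sum>v\<in>verts T. card (cld T v))"
    by (rule card_UN_disjoint) (use f lt_finite_ocld[OF T] in \<open>auto simp: cld_def\<close>)
  ultimately have 1: "(\<Sum>v\<in>verts T. card (cld T v)) + 1 = card (verts T)"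
    using f lt_root[OF T] card_Diff_singleton[of "root T" "verts T"] card_gt_0_iff[of "verts T"]
    by (metis One_nat_def Suc_pred add.right_neutral add_Suc_right empty_iff)
  have "card (\<Union>v\<in>verts T. lb T v) = (\<Sum>v\<in>verts T. card (lb T v))"
  proof (rule card_UN_disjoint)
    show "\<forall>i\<in>verts T. \<forall>j\<in>verts T. i \<noteq> j \<longrightarrow> lb T i \<inter> lb T j = {}"
      using lt_lbdisj[OF T] by blast
  qed (use f lt_finite_ocld[OF T] in auto)
  then have 2: "(\<Sum>v\<in>verts T. card (lb T v)) = card S"
    using lt_labels[OF T] by (simp add: labels_def)
  show ?thesis using 1 2 lt_card_ocld(1)[OF T] by (simp add: sum.distrib)
qed

lemma lt_card_ocld_le:
  assumes T: "labeled_tree S T" and w: "w \<in> verts T"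
  shows "card (ocld T w) + card (verts T) \<le> card S + 1"
proof -
  have f: "finite (verts T)" by (rule lt_finite[OF T])
  have "(\<Sum>v\<in>verts T. card (ocld T v)) = card (ocld T w) + (\<Sum>v\<in>verts T - {w}. card (ocld T v))"
    using f w by (simp add: sum.remove)
  moreover have "(\<Sum>v\<in>verts T - {w}. card (ocld T v)) \<ge> (\<Sum>v\<in>verts T - {w}. 2)"
    by (rule sum_mono) (use lt_card_ocld(2)[OF T] in auto)
  moreover have "card (verts T - {w}) + 1 = card (verts T)"
    using f w by (metis Suc_eq_plus1 card_Suc_Diff1)
  ultimately show ?thesis using lt_sum_card[OF T] by simp
qed

lemma lt_card_verts:
  assumes T: "labeled_tree S T" shows "card (verts T) + 1 \<le> card S"
  using lt_card_ocld_le[OF T lt_root[OF T]] lt_card_ocld(2)[OF T lt_root[OF T]] by simp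

lemma lt_card_labels:
  assumes T: "labeled_tree S T" shows "2 \<le> card S"
proof -
  have "0 < card (verts T)" using lt_finite[OF T] lt_root[OF T] by (auto simp: card_gt_0_iff)
  then show ?thesis using lt_card_verts[OF T] by simp
qed

lemma lt_card_ocld_less:
  assumes T: "labeled_tree S T" and w: "w \<in> verts T" and d: "decomposable T"
  shows "card (ocld T w) < card S"
proof -
  obtain v where v: "v \<in> verts T" "v \<noteq> root T" using d lt_root[OF T] by (auto simp: decomposable_def)
  then have "card {v, root T} \<le> card (verts T)"
    by (intro card_mono) (use lt_finite[OF T] lt_root[OF T] in auto)
  then show ?thesis using lt_card_ocld_le[OF T w] v by simp
qed

lemma lt_card_ocld_leS:
  assumes T: "labeled_tree S T" and w: "w \<in> verts T"
  shows "card (ocld T w) \<le> card S"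
proof -
  have "0 < card (verts T)" using lt_finite[OF T] lt_root[OF T] by (auto simp: card_gt_0_iff)
  then show ?thesis using lt_card_ocld_le[OF T w] by simp
qed

lemma decomposable_iff:
  assumes "labeled_tree S T" shows "decomposable T \<longleftrightarrow> (\<exists>v\<in>verts T. v \<noteq> root T)"
  using lt_root[OF assms] by (auto simp: decomposable_def)

text \<open>The values of \<open>parent\<close> at the root and of \<open>parent\<close> and \<open>lb\<close> outside the vertices are
  arbitrary; \<open>same_tree\<close> is equality of trees up to these values.\<close>

definition same_tree :: "ltree \<Rightarrow> ltree \<Rightarrow> bool" where
  "same_tree T T' \<longleftrightarrow> verts T' = verts T \<and> root T' = root T \<and>
     (\<forall>v\<in>verts T. v \<noteq> root T \<longrightarrow> parent T' v = parent T v) \<and> (\<forall>v\<in>verts T. lb T' v = lb T v)"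

definition corolla :: "nat set \<Rightarrow> nat \<Rightarrow> ltree" where
  "corolla S v = \<lparr>verts = {v}, root = v, parent = id, lb = (\<lambda>_. S)\<rparr>"

lemma corolla_simps [simp]:
  "verts (corolla S v) = {v}" "root (corolla S v) = v" "labels (corolla S v) = S"
  "cld (corolla S v) u = {}" "ocld (corolla S v) u = S" "\<not> decomposable (corolla S v)"
  "lb (corolla S v) u = S"
  by (auto simp: corolla_def labels_def cld_def ocld_def decomposable_def)

lemma corolla_labeled:
  assumes "finite S" "2 \<le> card S" "v \<notin> S" shows "labeled_tree S (corolla S v)"
  by (rule labeled_treeI) (use assms in auto)

lemma fresh_ex: "finite S \<Longrightarrow> \<exists>v::nat. v \<notin> S"
  using ex_new_if_finite[of S] by auto

section \<open>Morphisms of trees\<close>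

definition contracts :: "ltree \<Rightarrow> (nat \<Rightarrow> nat) \<Rightarrow> nat \<Rightarrow> bool" where
  "contracts T f v \<longleftrightarrow> v \<in> verts T \<and> v \<noteq> root T \<and> f v = f (parent T v)"

lemma morD:
  assumes "tree_mor \<sigma> f T T'"
  shows mor_bij: "bij_betw \<sigma> (labels T) (labels T')"
    and mor_img: "f ` verts T = verts T'"
    and mor_verts: "\<And>v. v \<in> verts T \<Longrightarrow> f v \<in> verts T'"
    and mor_root: "f (root T) = root T'"
    and mor_edge: "\<And>v. v \<in> verts T \<Longrightarrow> v \<noteq> root T \<Longrightarrow> f v \<noteq> f (parent T v) \<Longrightarrow>
       f v \<noteq> root T' \<and> parent T' (f v) = f (parent T v)"
    and mor_lb: "\<And>w. w \<in> verts T' \<Longrightarrow> lb T' w = \<sigma> ` (\<Union>v\<in>{v \<in> verts T. f v = w}. lb T v)"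
  using assms by (auto simp: tree_mor_def)

lemma mor_froot:
  assumes "tree_mor \<sigma> f T T'" "w \<in> verts T'"
  shows froot_in: "fiber_root T f w \<in> verts T" and froot_f: "f (fiber_root T f w) = w"
    and froot_top: "fiber_root T f w = root T \<or> f (parent T (fiber_root T f w)) \<noteq> w"
proof -
  have "\<exists>!v. v \<in> verts T \<and> f v = w \<and> (v = root T \<or> f (parent T v) \<noteq> w)"
    using assms by (auto simp: tree_mor_def)
  from theI'[OF this] show "fiber_root T f w \<in> verts T" "f (fiber_root T f w) = w"
      "fiber_root T f w = root T \<or> f (parent T (fiber_root T f w)) \<noteq> w"
    unfolding fiber_root_def by blast+
qed

lemma froot_eq:
  assumes "tree_mor \<sigma> f T T'" "v \<in> verts T" "v = root T \<or> f (parent T v) \<noteq> f v"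
  shows "fiber_root T f (f v) = v"
proof -
  have "\<forall>w\<in>verts T'. \<exists>!u. u \<in> verts T \<and> f u = w \<and> (u = root T \<or> f (parent T u) \<noteq> w)"
    using assms(1) unfolding tree_mor_def by (elim conjE)
  from bspec[OF this mor_verts[OF assms(1,2)]]
  have "\<exists>!u. u \<in> verts T \<and> f u = f v \<and> (u = root T \<or> f (parent T u) \<noteq> f v)" .
  then show ?thesis unfolding fiber_root_def by (rule the1_equality) (use assms in auto)
qed

lemma froot_root:
  assumes "tree_mor \<sigma> f T T'" "root T \<in> verts T" shows "fiber_root T f (root T') = root T"
  using froot_eq[OF assms] mor_root[OF assms(1)] by simp

lemma froot_nonroot:
  assumes m: "tree_mor \<sigma> f T T'" and w: "w \<in> verts T'" "w \<noteq> root T'"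
  shows "fiber_root T f w \<noteq> root T" "parent T' w = f (parent T (fiber_root T f w))"
    "\<not> contracts T f (fiber_root T f w)"
proof -
  show 1: "fiber_root T f w \<noteq> root T"
    using mor_root[OF m] froot_f[OF m w(1)] w(2) by metis
  show "parent T' w = f (parent T (fiber_root T f w))"
    using mor_edge[OF m froot_in[OF m w(1)] 1] froot_top[OF m w(1)] froot_f[OF m w(1)] 1 by auto
  show "\<not> contracts T f (fiber_root T f w)"
    using froot_top[OF m w(1)] froot_f[OF m w(1)] 1 by (auto simp: contracts_def)
qed

lemma mor_noncontr:
  assumes m: "tree_mor \<sigma> f T T'" and v: "v \<in> verts T" "v \<noteq> root T" "\<not> contracts T f v"
  shows "f v \<noteq> root T'" "parent T' (f v) = f (parent T v)" "fiber_root T f (f v) = v"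
  using mor_edge[OF m v(1,2)] froot_eq[OF m v(1)] v by (auto simp: contracts_def)

text \<open>The topmost vertices of the fibers are given by a function \<open>r\<close>, which splits the unique existence in
\<open>tree_mor\<close> into existence and uniqueness.\<close>

lemma tree_morI:
  assumes "bij_betw \<sigma> (labels T) (labels T')" "f ` verts T = verts T'" "f (root T) = root T'"
    and "\<And>v. v \<in> verts T \<Longrightarrow> v \<noteq> root T \<Longrightarrow> f v \<noteq> f (parent T v) \<Longrightarrow>
       f v \<noteq> root T' \<and> parent T' (f v) = f (parent T v)"
    and r: "\<And>w. w \<in> verts T' \<Longrightarrow> r w \<in> verts T \<and> f (r w) = w \<and> (r w = root T \<or> f (parent T (r w)) \<noteq> w)"
    and u: "\<And>v. v \<in> verts T \<Longrightarrow> v = root T \<or> f (parent T v) \<noteq> f v \<Longrightarrow> v = r (f v)"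
    and "\<And>w. w \<in> verts T' \<Longrightarrow> lb T' w = \<sigma> ` (\<Union>v\<in>{v \<in> verts T. f v = w}. lb T v)"
  shows "tree_mor \<sigma> f T T'"
proof -
  have "\<exists>!v. v \<in> verts T \<and> f v = w \<and> (v = root T \<or> f (parent T v) \<noteq> w)" if "w \<in> verts T'" for w
    by (rule ex1I[of _ "r w"]) (use r[OF that] u in auto)
  moreover have "\<forall>v\<in>verts T. v \<noteq> root T \<longrightarrow>
        f v = f (parent T v) \<or> (f v \<noteq> root T' \<and> parent T' (f v) = f (parent T v))"
    using assms(4) by blast
  ultimately show ?thesis unfolding tree_mor_def using assms(1-3,7) by simp
qed

lemma mor_lb_iff:
  assumes "tree_mor id f T T'" "w \<in> verts T'"
  shows "s \<in> lb T' w \<longleftrightarrow> (\<exists>v\<in>verts T. f v = w \<and> s \<in> lb T v)"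
  using mor_lb[OF assms] by auto

lemma tree_mor_cong:
  assumes T: "labeled_tree S T" and m: "tree_mor \<sigma> f T T'"
    and f: "\<And>v. v \<in> verts T \<Longrightarrow> g v = f v" and s: "\<And>s. s \<in> S \<Longrightarrow> \<tau> s = \<sigma> s"
  shows "tree_mor \<tau> g T T'"
proof (rule tree_morI[where r = "fiber_root T f"])
  show "bij_betw \<tau> (labels T) (labels T')"
    using mor_bij[OF m] bij_betw_cong[of "labels T" \<tau> \<sigma>] s lt_labels[OF T] by simp
  show "g ` verts T = verts T'" using mor_img[OF m] f by auto
  show "g (root T) = root T'" using mor_root[OF m] f lt_root[OF T] by simp
  fix v assume v: "v \<in> verts T"
  show "g v \<noteq> root T' \<and> parent T' (g v) = g (parent T v)" if "v \<noteq> root T" "g v \<noteq> g (parent T v)"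
    using mor_edge[OF m v] that v f lt_parent[OF T] by simp
  show "v = fiber_root T f (g v)" if "v = root T \<or> g (parent T v) \<noteq> g v"
    using froot_eq[OF m v] that v f lt_parent[OF T] by metis
next
  fix w assume w: "w \<in> verts T'"
  show "fiber_root T f w \<in> verts T \<and> g (fiber_root T f w) = w \<and>
     (fiber_root T f w = root T \<or> g (parent T (fiber_root T f w)) \<noteq> w)"
    using mor_froot[OF m w] f lt_parent[OF T] by metis
  have "{v \<in> verts T. g v = w} = {v \<in> verts T. f v = w}" using f by auto
  moreover have "\<tau> ` (\<Union>v\<in>{v \<in> verts T. f v = w}. lb T v) = \<sigma> ` (\<Union>v\<in>{v \<in> verts T. f v = w}. lb T v)"
    by (rule image_cong) (use s lt_lb[OF T] in auto)
  ultimately show "lb T' w = \<tau> ` (\<Union>v\<in>{v \<in> verts T. g v = w}. lb T v)"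
    using mor_lb[OF m w] by simp
qed

lemma fiber_root_cong:
  assumes "labeled_tree S T" "\<And>v. v \<in> verts T \<Longrightarrow> g v = f v"
  shows "fiber_root T g w = fiber_root T f w"
proof -
  have "(\<lambda>v. v \<in> verts T \<and> g v = w \<and> (v = root T \<or> g (parent T v) \<noteq> w)) =
    (\<lambda>v. v \<in> verts T \<and> f v = w \<and> (v = root T \<or> f (parent T v) \<noteq> w))"
    using assms(2) lt_parent[OF assms(1)] by (intro ext) (auto)
  then show ?thesis unfolding fiber_root_def by simp
qed

lemma fiber_cong:
  assumes "labeled_tree S T" "\<And>v. v \<in> verts T \<Longrightarrow> g v = f v"
  shows "fiber T g w = fiber T f w"
proof -
  have "{v \<in> verts T. g v = w} = {v \<in> verts T. f v = w}" using assms by auto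
  moreover have "{u \<in> cld T v. g u \<noteq> w} = {u \<in> cld T v. f u \<noteq> w}" for v
    using assms by (auto simp: cld_def)
  moreover have "fiber_root T g w = fiber_root T f w" using assms by (rule fiber_root_cong)
  ultimately show ?thesis unfolding fiber_def by simp
qed

lemma tree_mor_comp:
  assumes T: "labeled_tree S T" and m: "tree_mor \<sigma> f T T'" and m': "tree_mor \<tau> g T' T''"
  shows "tree_mor (\<tau> \<circ> \<sigma>) (g \<circ> f) T T''"
    and "\<And>w. w \<in> verts T'' \<Longrightarrow> fiber_root T (g \<circ> f) w = fiber_root T f (fiber_root T' g w)"
proof -
  define r where "r w = fiber_root T f (fiber_root T' g w)" for w
  have r: "r w \<in> verts T \<and> (g \<circ> f) (r w) = w \<and> (r w = root T \<or> (g \<circ> f) (parent T (r w)) \<noteq> w)"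
    if w: "w \<in> verts T''" for w
  proof -
    let ?u = "fiber_root T' g w"
    have u: "?u \<in> verts T'" "g ?u = w" "?u = root T' \<or> g (parent T' ?u) \<noteq> w" using mor_froot[OF m' w] by auto
    have r: "r w \<in> verts T" "f (r w) = ?u" using mor_froot[OF m u(1)] by (auto simp: r_def)
    moreover have "r w = root T \<or> g (f (parent T (r w))) \<noteq> w"
      using u froot_nonroot[OF m u(1)] froot_root[OF m lt_root[OF T]] by (metis r_def)
    ultimately show ?thesis using u by auto
  qed
  have u: "v = r ((g \<circ> f) v)" if v: "v \<in> verts T" "v = root T \<or> (g \<circ> f) (parent T v) \<noteq> (g \<circ> f) v" for v
  proof (cases "v = root T")
    case True
    then show ?thesis unfolding r_def
      using mor_root[OF m] mor_root[OF m'] froot_root[OF m lt_root[OF T]]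
         froot_root[OF m'] mor_verts[OF m lt_root[OF T]] by simp
  next
    case False
    then have nc: "\<not> contracts T f v" using v by (auto simp: contracts_def)
    note nn = mor_noncontr[OF m v(1) False nc]
    have "\<not> contracts T' g (f v)" using nn v False by (auto simp: contracts_def)
    from mor_noncontr(3)[OF m' mor_verts[OF m v(1)] nn(1) this]
    show ?thesis using nn by (simp add: r_def)
  qed
  show M: "tree_mor (\<tau> \<circ> \<sigma>) (g \<circ> f) T T''"
  proof (rule tree_morI[where r = r])
    show "bij_betw (\<tau> \<circ> \<sigma>) (labels T) (labels T'')" using mor_bij[OF m] mor_bij[OF m'] by (rule bij_betw_trans)
    show "(g \<circ> f) ` verts T = verts T''" using mor_img[OF m] mor_img[OF m'] by (metis image_comp)
    show "(g \<circ> f) (root T) = root T''" using mor_root[OF m] mor_root[OF m'] by simp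
    show "(g \<circ> f) v \<noteq> root T'' \<and> parent T'' ((g \<circ> f) v) = (g \<circ> f) (parent T v)"
      if "v \<in> verts T" "v \<noteq> root T" "(g \<circ> f) v \<noteq> (g \<circ> f) (parent T v)" for v
    proof -
      have nc: "\<not> contracts T f v" using that by (auto simp: contracts_def)
      note nn = mor_noncontr[OF m that(1,2) nc]
      show ?thesis using mor_edge[OF m' mor_verts[OF m that(1)] nn(1)] nn that by auto
    qed
    show "lb T'' w = (\<tau> \<circ> \<sigma>) ` (\<Union>v\<in>{v \<in> verts T. (g \<circ> f) v = w}. lb T v)" if w: "w \<in> verts T''" for w
    proof -
      have "(\<Union>v\<in>{v \<in> verts T'. g v = w}. lb T' v) = \<sigma> ` (\<Union>v\<in>{v \<in> verts T. (g \<circ> f) v = w}. lb T v)"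
        using mor_lb[OF m] mor_verts[OF m] by fastforce
      then show ?thesis using mor_lb[OF m' w] by (simp add: image_comp)
    qed
  qed (use r u in auto)
  show "fiber_root T (g \<circ> f) w = fiber_root T f (fiber_root T' g w)" if w: "w \<in> verts T''" for w
    using froot_eq[OF M, of "r w"] r[OF w] by (auto simp: r_def)
qed

lemma contracts_comp:
  assumes m: "tree_mor \<sigma> f T T'" and m': "tree_mor \<tau> g T' T''"
  shows "contracts T (g \<circ> f) v \<longleftrightarrow> contracts T f v \<or> (v \<in> verts T \<and> v \<noteq> root T \<and> \<not> contracts T f v \<and> contracts T' g (f v))"
proof (cases "v \<in> verts T \<and> v \<noteq> root T \<and> \<not> contracts T f v")
  case True
  note nn = mor_noncontr[OF m]
  show ?thesis using True nn[of v] mor_verts[OF m] by (auto simp: contracts_def)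
qed (auto simp: contracts_def)

text \<open>A morphism is determined by the edges that it contracts, up to a unique isomorphism; more
  generally a contraction of more edges factors through a contraction of fewer.\<close>

lemma tree_mor_factor:
  assumes T: "labeled_tree S T" and q: "tree_mor id q T T1" and g: "tree_mor \<sigma> g T T2"
    and c: "\<And>v. contracts T q v \<Longrightarrow> contracts T g v"
  obtains h where "tree_mor \<sigma> h T1 T2" "\<And>v. v \<in> verts T \<Longrightarrow> h (q v) = g v"
    "\<And>w. w \<in> verts T1 \<Longrightarrow> contracts T1 h w \<longleftrightarrow> contracts T g (fiber_root T q w)"
    "\<And>w. w \<in> verts T2 \<Longrightarrow> fiber_root T1 h w = q (fiber_root T g w)"
proof -
  define h where "h w = g (fiber_root T q w)" for w
  have hq: "h (q v) = g v" if "v \<in> verts T" for v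
    using T that
  proof (induction v rule: tree_induct)
    case root
    then show ?case using froot_root[OF q lt_root[OF T]] mor_root[OF q] by (simp add: h_def)
  next
    case (step v)
    show ?case
    proof (cases "contracts T q v")
      case True
      then have "h (q v) = h (q (parent T v))" by (simp add: contracts_def)
      then show ?thesis using step c[OF True] by (simp add: contracts_def)
    next
      case False
      then show ?thesis using froot_eq[OF q step(1)] step by (auto simp: contracts_def h_def)
    qed
  qed
  have par: "h (parent T1 w) = g (parent T (fiber_root T q w))" if "w \<in> verts T1" "w \<noteq> root T1" for w
    using froot_nonroot[OF q that] hq lt_parent[OF T froot_in[OF q that(1)]] by simp
  have fr: "fiber_root T g (g v) = v" if "v \<in> verts T" "v = root T \<or> \<not> contracts T g v" for v
    using froot_eq[OF g that(1)] that by (auto simp: contracts_def)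
  have M: "tree_mor \<sigma> h T1 T2"
  proof (rule tree_morI[where r = "\<lambda>w. q (fiber_root T g w)"])
    have "labels T1 = labels T" using mor_bij[OF q] by (simp add: bij_betw_def)
    then show "bij_betw \<sigma> (labels T1) (labels T2)" using mor_bij[OF g] by simp
    have "h ` q ` verts T = g ` verts T" by (simp add: image_image hq)
    then show "h ` verts T1 = verts T2" using mor_img[OF q] mor_img[OF g] by simp
    show "h (root T1) = root T2" using hq[OF lt_root[OF T]] mor_root[OF q] mor_root[OF g] by simp
    show "h w \<noteq> root T2 \<and> parent T2 (h w) = h (parent T1 w)"
      if "w \<in> verts T1" "w \<noteq> root T1" "h w \<noteq> h (parent T1 w)" for w
      using mor_edge[OF g froot_in[OF q that(1)]] froot_nonroot[OF q that(1,2)] par[OF that(1,2)] that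
      by (simp add: h_def)
  next
    fix w assume w: "w \<in> verts T2"
    let ?u = "fiber_root T g w"
    have u: "?u \<in> verts T" "g ?u = w" "?u = root T \<or> g (parent T ?u) \<noteq> w" using mor_froot[OF g w] by auto
    have "q ?u = root T1 \<or> h (parent T1 (q ?u)) \<noteq> w"
    proof (cases "?u = root T")
      case False
      then have "\<not> contracts T q ?u" using c u by (auto simp: contracts_def)
      then have "parent T1 (q ?u) = q (parent T ?u)" using mor_noncontr[OF q u(1) False] by simp
      then show ?thesis using hq lt_parent[OF T u(1) False] u False by simp
    qed (use mor_root[OF q] in simp)
    moreover have "h (q ?u) = w" using hq[OF u(1)] u(2) by (rule trans)
    ultimately show "q ?u \<in> verts T1 \<and> h (q ?u) = w \<and> (q ?u = root T1 \<or> h (parent T1 (q ?u)) \<noteq> w)"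
      using mor_verts[OF q u(1)] by (intro conjI)
    have "lb T2 w = \<sigma> ` (\<Union>v\<in>{v \<in> verts T. g v = w}. lb T v)" by (rule mor_lb[OF g w])
    also have "(\<Union>v\<in>{v \<in> verts T. g v = w}. lb T v) = (\<Union>v\<in>{v \<in> verts T1. h v = w}. lb T1 v)"
    proof (intro set_eqI iffI)
      fix s assume "s \<in> (\<Union>v\<in>{v \<in> verts T. g v = w}. lb T v)"
      then obtain v where v: "v \<in> verts T" "g v = w" "s \<in> lb T v" by blast
      have "q v \<in> verts T1" by (rule mor_verts[OF q v(1)])
      moreover have "s \<in> lb T1 (q v)" using mor_lb_iff[OF q calculation] v by blast
      moreover have "h (q v) = w" using hq[OF v(1)] v(2) by (rule trans)
      ultimately show "s \<in> (\<Union>v\<in>{v \<in> verts T1. h v = w}. lb T1 v)" by blast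
    next
      fix s assume "s \<in> (\<Union>v\<in>{v \<in> verts T1. h v = w}. lb T1 v)"
      then obtain u where u: "u \<in> verts T1" "h u = w" "s \<in> lb T1 u" by blast
      then obtain v where v: "v \<in> verts T" "q v = u" "s \<in> lb T v" using mor_lb_iff[OF q u(1)] by blast
      then have "g v = w" using hq[OF v(1)] u(2) by simp
      then show "s \<in> (\<Union>v\<in>{v \<in> verts T. g v = w}. lb T v)" using v by blast
    qed
    finally show "lb T2 w = \<sigma> ` (\<Union>v\<in>{v \<in> verts T1. h v = w}. lb T1 v)" .
  next
    fix w assume w: "w \<in> verts T1" "w = root T1 \<or> h (parent T1 w) \<noteq> h w"
    let ?u = "fiber_root T q w"
    have "?u = root T \<or> \<not> contracts T g ?u"
    proof (cases "w = root T1")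
      case False
      then show ?thesis using par[OF w(1)] w(2) by (auto simp: contracts_def h_def)
    qed (use froot_root[OF q lt_root[OF T]] in auto)
    then show "w = q (fiber_root T g (h w))"
      using fr[of ?u] froot_in[OF q w(1)] froot_f[OF q w(1)] by (simp add: h_def)
  qed
  have C: "contracts T1 h w \<longleftrightarrow> contracts T g (fiber_root T q w)" if w: "w \<in> verts T1" for w
  proof (cases "w = root T1")
    case True
    then show ?thesis using froot_root[OF q lt_root[OF T]] by (simp add: contracts_def)
  next
    case False
    then show ?thesis using par[OF w] froot_nonroot[OF q w] w froot_in[OF q w] by (auto simp: contracts_def h_def)
  qed
  have R: "fiber_root T1 h w = q (fiber_root T g w)" if w: "w \<in> verts T2" for w
  proof -
    have "fiber_root T (h \<circ> q) w = fiber_root T q (fiber_root T1 h w)"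
      using tree_mor_comp(2)[OF T q M w] .
    moreover have "fiber_root T (h \<circ> q) w = fiber_root T g w"
      by (rule fiber_root_cong[OF T]) (simp add: hq)
    ultimately show ?thesis using froot_f[OF q froot_in[OF M w]] by simp
  qed
  show thesis using M hq C R by (rule that)
qed

section \<open>Fibers, cuts and copies of trees\<close>

lemma fiber_simps [simp]:
  "verts (fiber T f w) = {v \<in> verts T. f v = w}" "root (fiber T f w) = fiber_root T f w"
  "parent (fiber T f w) = parent T" "lb (fiber T f w) v = lb T v \<union> {u \<in> cld T v. f u \<noteq> w}"
  by (simp_all add: fiber_def)

lemma fiber_root_iff:
  assumes "tree_mor \<sigma> f T T'" "v \<in> verts T"
  shows "fiber_root T f (f v) = v \<longleftrightarrow> \<not> contracts T f v"
proof
  assume "fiber_root T f (f v) = v"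
  then show "\<not> contracts T f v"
    using froot_top[OF assms(1) mor_verts[OF assms]] by (auto simp: contracts_def)
next
  assume "\<not> contracts T f v"
  then show "fiber_root T f (f v) = v"
    using froot_eq[OF assms] assms(2) by (auto simp: contracts_def)
qed

lemma fiber_nonroot:
  assumes m: "tree_mor \<sigma> f T T'" and v: "v \<in> verts T" "v \<noteq> fiber_root T f (f v)"
  shows "v \<noteq> root T" "f (parent T v) = f v"
  using fiber_root_iff[OF m v(1)] v(2) by (auto simp: contracts_def)

lemma cld_fiber:
  assumes T: "labeled_tree S T" and m: "tree_mor \<sigma> f T T'" and v: "v \<in> verts T"
  shows "cld (fiber T f (f v)) v = {u \<in> cld T v. f u = f v}"
proof -
  have "u \<noteq> fiber_root T f (f v) \<longleftrightarrow> u \<noteq> root T" if u: "u \<in> verts T" "f u = f v" "parent T u = v" for u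
    using fiber_root_iff[OF m u(1)] u by (auto simp: contracts_def)
  then show ?thesis by (auto simp: cld_def)
qed

lemma ocld_fiber:
  assumes T: "labeled_tree S T" and m: "tree_mor \<sigma> f T T'" and v: "v \<in> verts T"
  shows "ocld (fiber T f (f v)) v = ocld T v"
  using cld_fiber[OF assms] by (auto simp: ocld_def)

lemma labels_fiber:
  assumes T: "labeled_tree S T"
  shows "labels (fiber T f w) = (\<Union>v\<in>{v \<in> verts T. f v = w}. lb T v) \<union>
     {u \<in> verts T. u \<noteq> root T \<and> f u \<noteq> w \<and> f (parent T u) = w}"
  using lt_parent[OF T] by (auto simp: labels_def cld_def)

lemma fiber_labeled:
  assumes T: "labeled_tree S T" and m: "tree_mor \<sigma> f T T'" and w: "w \<in> verts T'"
  shows "labeled_tree (labels (fiber T f w)) (fiber T f w)"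
proof (rule labeled_treeI)
  show "finite (verts (fiber T f w))" using lt_finite[OF T] by simp
  show "root (fiber T f w) \<in> verts (fiber T f w)" using mor_froot[OF m w] by simp
  have par: "parent T v \<in> verts T \<and> f (parent T v) = w" if "v \<in> verts T" "f v = w" "v \<noteq> fiber_root T f w" for v
    using fiber_nonroot[OF m] lt_parent[OF T] that by metis
  then show "parent (fiber T f w) v \<in> verts (fiber T f w)"
    if "v \<in> verts (fiber T f w)" "v \<noteq> root (fiber T f w)" for v using that by simp
  fix Q v
  assume r: "Q (root (fiber T f w))"
    and s: "\<And>u. u \<in> verts (fiber T f w) \<Longrightarrow> u \<noteq> root (fiber T f w) \<Longrightarrow> Q (parent (fiber T f w) u) \<Longrightarrow> Q u"
    and v: "v \<in> verts (fiber T f w)"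
  have vT: "v \<in> verts T" using v by simp
  have "f v = w \<longrightarrow> Q v" using T vT
  proof (induction v rule: tree_induct)
    show "f (root T) = w \<longrightarrow> Q (root T)" using r froot_eq[OF m lt_root[OF T]] by auto
    show "f u = w \<longrightarrow> Q u" if "u \<in> verts T" "f (parent T u) = w \<longrightarrow> Q (parent T u)" for u
      using s[of u] r par[of u] that by (cases "u = fiber_root T f w") auto
  qed
  then show "Q v" using v by simp
next
  have "labels (fiber T f w) \<subseteq> S \<union> verts T"
    unfolding labels_fiber[OF T] using lt_lb[OF T] by auto
  then show "finite (labels (fiber T f w))"
    using lt_finS[OF T] lt_finite[OF T] by (meson finite_Un finite_subset)
  show "labels (fiber T f w) \<inter> verts (fiber T f w) = {}"
    unfolding labels_fiber[OF T] using lt_lb[OF T] lt_disj[OF T] by auto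
  show "v = u" if "v \<in> verts (fiber T f w)" "u \<in> verts (fiber T f w)"
      "s \<in> lb (fiber T f w) v" "s \<in> lb (fiber T f w) u" for v u s
  proof -
    have v: "v \<in> verts T" and u: "u \<in> verts T" using that by auto
    show ?thesis using that lt_lbdisj[OF T v u] lt_lb[OF T v] lt_lb[OF T u] lt_disj[OF T]
      by (auto simp: cld_def)
  qed
  show "2 \<le> card (ocld (fiber T f w) v)" if "v \<in> verts (fiber T f w)" for v
    using that ocld_fiber[OF T m, of v] lt_card_ocld(2)[OF T, of v] by auto
qed simp

lemma glue_bij:
  assumes T: "labeled_tree S T" and T': "labeled_tree S' T'" and m: "tree_mor \<sigma> f T T'"
    and w: "w \<in> verts T'"
  shows "bij_betw (glue T \<sigma> f) (labels (fiber T f w)) (ocld T' w)"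
proof (rule bij_betw_imageI)
  have inj: "inj_on \<sigma> S" and im: "\<sigma> ` S = S'"
    using mor_bij[OF m] lt_labels[OF T] lt_labels[OF T'] by (auto simp: bij_betw_def)
  let ?L = "\<Union>v\<in>{v \<in> verts T. f v = w}. lb T v"
  let ?C = "{u \<in> verts T. u \<noteq> root T \<and> f u \<noteq> w \<and> f (parent T u) = w}"
  have LS: "?L \<subseteq> S" using lt_lb[OF T] by auto
  have gL: "glue T \<sigma> f s = \<sigma> s" if "s \<in> S" for s
    using that lt_disj[OF T] by (auto simp: glue_def)
  have gC: "glue T \<sigma> f u = f u" if "u \<in> verts T" for u using that by (simp add: glue_def)
  have C: "u = fiber_root T f (f u)" if "u \<in> ?C" for u using froot_eq[OF m, of u] that by auto
  show "inj_on (glue T \<sigma> f) (labels (fiber T f w))"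
    unfolding labels_fiber[OF T]
  proof (rule inj_onI)
    fix x y assume x: "x \<in> ?L \<union> ?C" and y: "y \<in> ?L \<union> ?C" and e: "glue T \<sigma> f x = glue T \<sigma> f y"
    have d: "\<sigma> s \<noteq> f u" if "s \<in> S" "u \<in> verts T" for s u
      using that im mor_verts[OF m] lt_disj[OF T'] by (metis IntI emptyE imageI)
    consider "x \<in> ?L" "y \<in> ?L" | "x \<in> ?L" "y \<in> ?C" | "x \<in> ?C" "y \<in> ?L" | "x \<in> ?C" "y \<in> ?C"
      using x y by blast
    then show "x = y"
    proof cases
      case 1
      then have "x \<in> S" "y \<in> S" using LS by blast+
      then show ?thesis using e gL inj by (simp add: inj_on_eq_iff)
    next
      case 2
      then have "x \<in> S" "y \<in> verts T" using LS by blast+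
      then show ?thesis using e gL gC d by simp
    next
      case 3
      then have "y \<in> S" "x \<in> verts T" using LS by blast+
      then show ?thesis using e gL gC d by metis
    next
      case 4
      then have "f x = f y" using e gC by simp
      then show ?thesis using C[OF 4(1)] C[OF 4(2)] by simp
    qed
  qed
  have "glue T \<sigma> f ` ?L = lb T' w"
    unfolding mor_lb[OF m w] by (rule image_cong) (use LS gL in auto)
  moreover have "glue T \<sigma> f ` ?C = cld T' w"
  proof
    show "glue T \<sigma> f ` ?C \<subseteq> cld T' w"
      using mor_edge[OF m] mor_verts[OF m] gC by (auto simp: cld_def)
    show "cld T' w \<subseteq> glue T \<sigma> f ` ?C"
    proof
      fix u assume u: "u \<in> cld T' w"
      then have u': "u \<in> verts T'" "u \<noteq> root T'" "parent T' u = w" by (auto simp: cld_def)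
      let ?r = "fiber_root T f u"
      have r: "?r \<in> verts T" "f ?r = u" "?r \<noteq> root T" "f (parent T ?r) = w"
        using mor_froot[OF m u'(1)] froot_nonroot[OF m u'(1,2)] u'(3) by auto
      moreover have "u \<noteq> w" using froot_top[OF m u'(1)] r by auto
      ultimately have "?r \<in> ?C" by simp
      then show "u \<in> glue T \<sigma> f ` ?C" using gC[OF r(1)] r(2) by force
    qed
  qed
  ultimately show "glue T \<sigma> f ` labels (fiber T f w) = ocld T' w"
    unfolding labels_fiber[OF T] image_Un by (auto simp: ocld_def)
qed

lemma fiber_const:
  assumes T: "labeled_tree S T" shows "fiber T (\<lambda>_. v) v = T"
proof -
  have "fiber_root T (\<lambda>_. v) v = root T"
    unfolding fiber_root_def by (rule the_equality) (use lt_root[OF T] in auto)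
  then show ?thesis by (simp add: fiber_def)
qed

lemma const_mor:
  assumes T: "labeled_tree S T" and s: "bij_betw \<sigma> S S'"
  shows "tree_mor \<sigma> (\<lambda>_. v) T (corolla S' v)"
proof (rule tree_morI[where r = "\<lambda>_. root T"])
  show "(\<lambda>_. v) ` verts T = verts (corolla S' v)" using lt_root[OF T] by auto
  show "lb (corolla S' v) w = \<sigma> ` (\<Union>u\<in>{u \<in> verts T. v = w}. lb T u)" if "w \<in> verts (corolla S' v)" for w
    using that s lt_labels[OF T] by (auto simp: labels_def bij_betw_def)
qed (use T s lt_labels[OF T] lt_root[OF T] in auto)

subsection \<open>Contracting a prescribed set of edges\<close>

definition tdepth :: "ltree \<Rightarrow> nat \<Rightarrow> nat" where
  "tdepth T v = (LEAST k. (parent T ^^ k) v = root T)"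

lemma tdepth_parent:
  assumes T: "labeled_tree S T" and v: "v \<in> verts T" "v \<noteq> root T"
  shows "tdepth T (parent T v) < tdepth T v"
proof -
  obtain k where k: "(parent T ^^ k) v = root T" using T v by (auto simp: labeled_tree_def)
  have "tdepth T v = Suc (LEAST k. (parent T ^^ Suc k) v = root T)"
    unfolding tdepth_def by (rule Least_Suc[of "\<lambda>k. (parent T ^^ k) v = root T", OF k]) (use v in simp)
  then show ?thesis unfolding tdepth_def by (simp add: funpow_swap1)
qed

lemma parent_neq:
  assumes "labeled_tree S T" "v \<in> verts T" "v \<noteq> root T" shows "parent T v \<noteq> v"
  using tdepth_parent[OF assms] by auto

text \<open>The nearest vertex on the way from \<open>v\<close> to the root that lies in \<open>E\<close> or is the root. Merging all
vertices with the same such vertex contracts the edges outside \<open>E\<close> and keeps those in \<open>E\<close>, an edge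
being identified with its lower end; moreover the remaining vertices keep their names.\<close>

definition cut_top :: "ltree \<Rightarrow> nat set \<Rightarrow> nat \<Rightarrow> nat" where
  "cut_top T E v = (parent T ^^ (LEAST k. (parent T ^^ k) v \<in> insert (root T) E)) v"

definition cut_tree :: "ltree \<Rightarrow> nat set \<Rightarrow> ltree" where
  "cut_tree T E = \<lparr>verts = insert (root T) E, root = root T, parent = (\<lambda>v. cut_top T E (parent T v)),
     lb = (\<lambda>w. \<Union>v\<in>{v \<in> verts T. cut_top T E v = w}. lb T v)\<rparr>"

lemma cut_simps [simp]:
  "verts (cut_tree T E) = insert (root T) E" "root (cut_tree T E) = root T"
  "parent (cut_tree T E) v = cut_top T E (parent T v)"
  "lb (cut_tree T E) w = (\<Union>v\<in>{v \<in> verts T. cut_top T E v = w}. lb T v)"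
  by (simp_all add: cut_tree_def)

lemma cut_top_self: "v \<in> insert (root T) E \<Longrightarrow> cut_top T E v = v"
  unfolding cut_top_def by (subst Least_eq_0) auto

lemma cut_top_step:
  assumes T: "labeled_tree S T" and v: "v \<in> verts T" "v \<noteq> root T" "v \<notin> E"
  shows "cut_top T E v = cut_top T E (parent T v)"
proof -
  obtain k where "(parent T ^^ k) v = root T" using T v by (auto simp: labeled_tree_def)
  then have k: "(parent T ^^ k) v \<in> insert (root T) E" by simp
  have "(LEAST k. (parent T ^^ k) v \<in> insert (root T) E) =
      Suc (LEAST k. (parent T ^^ Suc k) v \<in> insert (root T) E)"
    by (rule Least_Suc[of "\<lambda>k. (parent T ^^ k) v \<in> insert (root T) E", OF k]) (use v in simp)
  then show ?thesis unfolding cut_top_def by (simp add: funpow_swap1)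
qed

lemma cut_top_in:
  assumes T: "labeled_tree S T" and v: "v \<in> verts T"
  shows "cut_top T E v \<in> insert (root T) E \<and> tdepth T (cut_top T E v) \<le> tdepth T v"
  using T v
proof (induction v rule: tree_induct)
  case root
  then show ?case using cut_top_self[of "root T" T E] by simp
next
  case (step v)
  show ?case
  proof (cases "v \<in> E")
    case True
    then show ?thesis using cut_top_self[of v T E] by simp
  next
    case False
    then show ?thesis using cut_top_step[OF T step(1,2) False] step tdepth_parent[OF T step(1,2)] by simp
  qed
qed

lemma cut_top_parent_neq:
  assumes T: "labeled_tree S T" and v: "v \<in> verts T" "v \<noteq> root T"
  shows "cut_top T E (parent T v) \<noteq> v"
  using cut_top_in[OF T lt_parent[OF T v], of E] tdepth_parent[OF T v] by auto

lemma cut_mor: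
  assumes T: "labeled_tree S T" and E: "E \<subseteq> verts T"
  shows "tree_mor id (cut_top T E) T (cut_tree T E)"
proof (rule tree_morI[where r = id])
  have "labels (cut_tree T E) = labels T"
    unfolding labels_def using cut_top_in[OF T, where E = E] by auto
  then show "bij_betw id (labels T) (labels (cut_tree T E))" by simp
  show "cut_top T E ` verts T = verts (cut_tree T E)"
  proof
    show "cut_top T E ` verts T \<subseteq> verts (cut_tree T E)" using cut_top_in[OF T, where E = E] by auto
    show "verts (cut_tree T E) \<subseteq> cut_top T E ` verts T"
    proof
      fix v assume "v \<in> verts (cut_tree T E)"
      then have "v \<in> verts T" "v = cut_top T E v" using cut_top_self[of v T E] E lt_root[OF T] by auto
      then show "v \<in> cut_top T E ` verts T" by blast
    qed
  qed
  show "cut_top T E (root T) = root (cut_tree T E)" by (simp add: cut_top_self)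
next
  fix v assume v: "v \<in> verts T"
  show "cut_top T E v \<noteq> root (cut_tree T E) \<and> parent (cut_tree T E) (cut_top T E v) = cut_top T E (parent T v)"
    if "v \<noteq> root T" "cut_top T E v \<noteq> cut_top T E (parent T v)"
  proof -
    have "v \<in> E" using cut_top_step[OF T v that(1)] that(2) by blast
    then show ?thesis using cut_top_self[of v T E] that by simp
  qed
  show "v = id (cut_top T E v)" if "v = root T \<or> cut_top T E (parent T v) \<noteq> cut_top T E v"
  proof -
    have "v \<in> insert (root T) E" using cut_top_step[OF T v, of E] that by (cases "v = root T") auto
    then show ?thesis using cut_top_self[of v T E] by simp
  qed
next
  fix w assume "w \<in> verts (cut_tree T E)"
  then show "id w \<in> verts T \<and> cut_top T E (id w) = w \<and> (id w = root T \<or> cut_top T E (parent T (id w)) \<noteq> w)"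
    using cut_top_self[of w T E] E lt_root[OF T] cut_top_parent_neq[OF T, of w E] by auto
qed simp

lemma cut_froot:
  assumes T: "labeled_tree S T" and E: "E \<subseteq> verts T" and w: "w \<in> insert (root T) E"
  shows "fiber_root T (cut_top T E) w = w"
proof -
  have wT: "w \<in> verts T" using w E lt_root[OF T] by auto
  have "fiber_root T (cut_top T E) (cut_top T E w) = w"
    by (rule froot_eq[OF cut_mor[OF T E] wT]) (use cut_top_self[OF w] cut_top_parent_neq[OF T wT] in auto)
  then show ?thesis by (simp add: cut_top_self[OF w])
qed

lemma cut_contracts:
  assumes T: "labeled_tree S T"
  shows "contracts T (cut_top T E) v \<longleftrightarrow> v \<in> verts T \<and> v \<noteq> root T \<and> v \<notin> E"
  using cut_top_step[OF T, of v E] cut_top_parent_neq[OF T, of v E] cut_top_self[of v T E]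
  by (auto simp: contracts_def)

lemma cut_labeled:
  assumes T: "labeled_tree S T" and E: "E \<subseteq> verts T"
  shows "labeled_tree S (cut_tree T E)"
proof (rule labeled_treeI)
  note m = cut_mor[OF T E]
  show "finite (verts (cut_tree T E))" using finite_subset[OF E lt_finite[OF T]] by simp
  show "root (cut_tree T E) \<in> verts (cut_tree T E)" by simp
  show "parent (cut_tree T E) v \<in> verts (cut_tree T E)" if "v \<in> verts (cut_tree T E)" "v \<noteq> root (cut_tree T E)" for v
    using cut_top_in[OF T lt_parent[OF T], of v E] that E by auto
  show "labels (cut_tree T E) = S" using mor_bij[OF m] lt_labels[OF T] by (simp add: bij_betw_def)
  show "S \<inter> verts (cut_tree T E) = {}" using lt_disj[OF T] E lt_root[OF T] by auto
  show "v = w" if "s \<in> lb (cut_tree T E) v" "s \<in> lb (cut_tree T E) w" for v w s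
    using that lt_lbdisj[OF T] by auto
  show "finite S" by (rule lt_finS[OF T])
next
  fix Q v
  assume r: "Q (root (cut_tree T E))"
    and s: "\<And>u. u \<in> verts (cut_tree T E) \<Longrightarrow> u \<noteq> root (cut_tree T E) \<Longrightarrow> Q (parent (cut_tree T E) u) \<Longrightarrow> Q u"
    and v: "v \<in> verts (cut_tree T E)"
  have vT: "v \<in> verts T" using v E lt_root[OF T] by auto
  have "Q (cut_top T E v)" using T vT
  proof (induction v rule: tree_induct)
    case root
    then show ?case using r by (simp add: cut_top_self)
  next
    case (step u)
    show ?case
    proof (cases "u \<in> E")
      case True
      then show ?thesis using s[of u] step cut_top_self[of u T E] by simp
    next
      case False
      then show ?thesis using cut_top_step[OF T step(1,2)] step by simp
    qed
  qed
  then show "Q v" using v cut_top_self[of v T E] by simp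
next
  fix w assume w: "w \<in> verts (cut_tree T E)"
  note m = cut_mor[OF T E]
  have ne: "cut_top T E (parent T u) \<noteq> u" if "u \<in> E" "u \<noteq> root T" for u
    using cut_top_parent_neq[OF T, of u E] that E by auto
  note ne = ne ne[symmetric]
  have "cld (cut_tree T E) w = {u \<in> verts T. u \<noteq> root T \<and> cut_top T E u \<noteq> w \<and> cut_top T E (parent T u) = w}"
    using cut_top_self[of _ T E] E ne cut_top_step[OF T, of _ E]
    by (auto simp: cld_def)
  then have "ocld (cut_tree T E) w = labels (fiber T (cut_top T E) w)"
    unfolding labels_fiber[OF T] by (auto simp: ocld_def)
  then show "2 \<le> card (ocld (cut_tree T E) w)"
    using lt_card_labels[OF fiber_labeled[OF T m w]] by simp
qed

subsection \<open>Isomorphisms\<close>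

lemma iso_inverse:
  assumes T: "labeled_tree S T" and m: "tree_mor \<sigma> f T T'" and c: "\<And>v. \<not> contracts T f v"
  shows "tree_mor (inv_into S \<sigma>) (fiber_root T f) T' T"
    "\<And>v. v \<in> verts T \<Longrightarrow> fiber_root T f (f v) = v"
    "\<And>w. \<not> contracts T' (fiber_root T f) w"
    "\<And>w. w \<in> verts T' \<Longrightarrow> f (fiber_root T f w) = w"
proof -
  have b: "bij_betw \<sigma> S (labels T')" using mor_bij[OF m] lt_labels[OF T] by simp
  show fr: "fiber_root T f (f v) = v" if "v \<in> verts T" for v
    using fiber_root_iff[OF m that] c by blast
  show ff: "f (fiber_root T f w) = w" if "w \<in> verts T'" for w
    by (rule froot_f[OF m that])
  have par: "fiber_root T f (parent T' w) = parent T (fiber_root T f w)" if "w \<in> verts T'" "w \<noteq> root T'" for w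
    using froot_nonroot[OF m that] fr lt_parent[OF T froot_in[OF m that(1)]] by simp
  show M: "tree_mor (inv_into S \<sigma>) (fiber_root T f) T' T"
  proof (rule tree_morI[where r = f])
    show "bij_betw (inv_into S \<sigma>) (labels T') (labels T)"
      using bij_betw_inv_into[OF b] lt_labels[OF T] by simp
    have "fiber_root T f ` f ` verts T = verts T" by (simp add: image_image fr)
    then show "fiber_root T f ` verts T' = verts T" using mor_img[OF m] by simp
    show "fiber_root T f (root T') = root T" by (rule froot_root[OF m lt_root[OF T]])
    show "fiber_root T f w \<noteq> root T \<and> parent T (fiber_root T f w) = fiber_root T f (parent T' w)"
      if "w \<in> verts T'" "w \<noteq> root T'" for w
      using par[OF that] froot_nonroot[OF m that] by simp
    show "w = f (fiber_root T f w)" if "w \<in> verts T'" for w using ff[OF that] by simp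
    fix v assume v: "v \<in> verts T"
    have "f v = root T' \<or> fiber_root T f (parent T' (f v)) \<noteq> v"
      using par[OF mor_verts[OF m v]] fr[OF v] parent_neq[OF T v] mor_root[OF m] by metis
    then show "f v \<in> verts T' \<and> fiber_root T f (f v) = v \<and> (f v = root T' \<or> fiber_root T f (parent T' (f v)) \<noteq> v)"
      using mor_verts[OF m v] fr[OF v] by simp
    have s: "{w \<in> verts T'. fiber_root T f w = v} = {f v}" using fr[OF v] ff mor_verts[OF m v] by auto
    have s': "{u \<in> verts T. f u = f v} = {v}"
    proof (intro equalityI subsetI)
      fix u assume "u \<in> {u \<in> verts T. f u = f v}"
      then have u: "u \<in> verts T" "f u = f v" by auto
      have "u = fiber_root T f (f u)" by (rule fr[OF u(1), symmetric])
      also have "\<dots> = v" unfolding u(2) by (rule fr[OF v])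
      finally show "u \<in> {v}" by simp
    qed (use v in simp)
    have "inv_into S \<sigma> ` lb T' (f v) = inv_into S \<sigma> ` \<sigma> ` lb T v"
      using mor_lb[OF m mor_verts[OF m v]] s' by simp
    also have "\<dots> = lb T v"
      using inv_into_image_cancel[OF bij_betw_imp_inj_on[OF b] lt_lb[OF T v]] .
    finally show "lb T v = inv_into S \<sigma> ` (\<Union>w\<in>{w \<in> verts T'. fiber_root T f w = v}. lb T' w)"
      unfolding s by simp
  qed
  show "\<not> contracts T' (fiber_root T f) w" for w
  proof
    assume "contracts T' (fiber_root T f) w"
    then have w: "w \<in> verts T'" "w \<noteq> root T'" "fiber_root T f w = fiber_root T f (parent T' w)"
      by (auto simp: contracts_def)
    show False
      using parent_neq[OF T froot_in[OF m w(1)] froot_nonroot(1)[OF m w(1,2)]] par[OF w(1,2)] w(3) by metis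
  qed
qed

text \<open>The values outside the vertices are fixed so that renaming into a given finite set of vertices
produces only finitely many trees.\<close>

definition rename :: "(nat \<Rightarrow> nat) \<Rightarrow> (nat \<Rightarrow> nat) \<Rightarrow> ltree \<Rightarrow> ltree" where
  "rename \<beta> \<sigma> T = \<lparr>verts = \<beta> ` verts T, root = \<beta> (root T),
     parent = (\<lambda>v. if v \<in> \<beta> ` verts T \<and> v \<noteq> \<beta> (root T) then \<beta> (parent T (inv_into (verts T) \<beta> v)) else 0),
     lb = (\<lambda>v. if v \<in> \<beta> ` verts T then \<sigma> ` lb T (inv_into (verts T) \<beta> v) else {})\<rparr>"

lemma rename_iso:
  assumes T: "labeled_tree S T" and s: "bij_betw \<sigma> S S'" and b: "inj_on \<beta> (verts T)"
    and d: "\<beta> ` verts T \<inter> S' = {}"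
  shows "labeled_tree S' (rename \<beta> \<sigma> T)" "tree_mor \<sigma> \<beta> T (rename \<beta> \<sigma> T)"
    "\<And>v. \<not> contracts T \<beta> v"
proof -
  let ?R = "rename \<beta> \<sigma> T"
  have [simp]: "verts ?R = \<beta> ` verts T" "root ?R = \<beta> (root T)" by (simp_all add: rename_def)
  have eq: "\<beta> v = \<beta> w \<longleftrightarrow> v = w" if "v \<in> verts T" "w \<in> verts T" for v w
    using b that by (simp add: inj_on_eq_iff)
  have par: "parent ?R (\<beta> v) = \<beta> (parent T v)" if "v \<in> verts T" "v \<noteq> root T" for v
    using that b eq[OF that(1) lt_root[OF T]] by (simp add: rename_def)
  have lbR: "lb ?R (\<beta> v) = \<sigma> ` lb T v" if "v \<in> verts T" for v
    using that b by (simp add: rename_def)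
  have si: "inj_on \<sigma> S" and sS: "\<sigma> ` S = S'" using s by (auto simp: bij_betw_def)
  have "labels ?R = \<sigma> ` labels T" unfolding labels_def using lbR by auto
  then have labR: "labels ?R = S'" using lt_labels[OF T] sS by simp
  show "labeled_tree S' ?R"
  proof (rule labeled_treeI)
    show "finite (verts ?R)" "root ?R \<in> verts ?R" using lt_finite[OF T] lt_root[OF T] by auto
    show "finite S'" using lt_finS[OF T] sS by blast
    show "parent ?R v \<in> verts ?R" if "v \<in> verts ?R" "v \<noteq> root ?R" for v
      using that par lt_parent[OF T] by auto
    show "S' \<inter> verts ?R = {}" using d by auto
    show "v = w" if h: "v \<in> verts ?R" "w \<in> verts ?R" "s \<in> lb ?R v" "s \<in> lb ?R w" for v w s
    proof -
      obtain v' w' where v': "v = \<beta> v'" "w = \<beta> w'" "v' \<in> verts T" "w' \<in> verts T" using h(1,2) by auto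
      then have "s \<in> \<sigma> ` lb T v'" "s \<in> \<sigma> ` lb T w'" using lbR h(3,4) by auto
      then obtain s1 s2 where "s = \<sigma> s1" "s1 \<in> lb T v'" "s = \<sigma> s2" "s2 \<in> lb T w'" by blast
      moreover have "s1 \<in> S" "s2 \<in> S" using calculation lt_lb[OF T v'(3)] lt_lb[OF T v'(4)] by auto
      ultimately have "s1 = s2" "s1 \<in> lb T v'" "s2 \<in> lb T w'" using si by (auto simp: inj_on_eq_iff)
      then have "v' = w'" using lt_lbdisj[OF T v'(3,4), of s1] by blast
      then show ?thesis using v'(1,2) by simp
    qed
    show "2 \<le> card (ocld ?R v)" if h: "v \<in> verts ?R" for v
    proof -
      obtain u where u: "v = \<beta> u" "u \<in> verts T" using h by auto
      have c: "cld ?R v = \<beta> ` cld T u"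
        using u par eq lt_root[OF T] lt_parent[OF T] by (auto simp: cld_def image_iff)
      have "card (cld ?R v) = card (cld T u)"
        unfolding c by (rule card_image) (use b in \<open>auto simp: cld_def inj_on_def\<close>)
      moreover have "card (lb ?R v) = card (lb T u)"
        unfolding u(1) lbR[OF u(2)] by (rule card_image) (use si lt_lb[OF T u(2)] in \<open>rule inj_on_subset\<close>)
      moreover have "card (ocld ?R v) = card (cld ?R v) + card (lb ?R v)"
        unfolding ocld_def
      proof (rule card_Un_disjoint)
        show "finite (cld ?R v)" unfolding c using lt_finite_ocld[OF T u(2)] by simp
        show "finite (lb ?R v)" unfolding u(1) lbR[OF u(2)] using lt_finite_ocld[OF T u(2)] by simp
        have "lb ?R v \<subseteq> S'" using labR h by (auto simp: labels_def)
        then show "cld ?R v \<inter> lb ?R v = {}" using d by (auto simp: cld_def)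
      qed
      ultimately show ?thesis using lt_card_ocld[OF T u(2)] by simp
    qed
    fix Q v
    assume r: "Q (root ?R)" and st: "\<And>u. u \<in> verts ?R \<Longrightarrow> u \<noteq> root ?R \<Longrightarrow> Q (parent ?R u) \<Longrightarrow> Q u"
      and "v \<in> verts ?R"
    then obtain u where u: "v = \<beta> u" "u \<in> verts T" by auto
    have "Q (\<beta> u)" using T u(2)
    proof (induction u rule: tree_induct)
      case (step u)
      then show ?case using st[of "\<beta> u"] par[OF step(1,2)] eq[OF step(1) lt_root[OF T]] by simp
    qed (use r in simp)
    then show "Q v" using u by simp
  qed (rule labR)
  show "tree_mor \<sigma> \<beta> T ?R"
  proof (rule tree_morI[where r = "inv_into (verts T) \<beta>"])
    show "bij_betw \<sigma> (labels T) (labels ?R)" using s labR lt_labels[OF T] by simp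
    fix w assume "w \<in> verts ?R"
    then obtain u where u: "w = \<beta> u" "u \<in> verts T" by auto
    show "inv_into (verts T) \<beta> w \<in> verts T \<and> \<beta> (inv_into (verts T) \<beta> w) = w \<and>
       (inv_into (verts T) \<beta> w = root T \<or> \<beta> (parent T (inv_into (verts T) \<beta> w)) \<noteq> w)"
      using u b eq[OF lt_parent[OF T u(2)] u(2)] parent_neq[OF T u(2)] by auto
    have "{v \<in> verts T. \<beta> v = w} = {u}" using u eq by auto
    then show "lb ?R w = \<sigma> ` (\<Union>v\<in>{v \<in> verts T. \<beta> v = w}. lb T v)" using lbR u by simp
  qed (use par eq lt_root[OF T] b in auto)
  show "\<not> contracts T \<beta> v" for v
    using eq[of v "parent T v"] lt_parent[OF T, of v] parent_neq[OF T, of v] by (auto simp: contracts_def)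
qed

lemma rename_ex:
  assumes T: "labeled_tree S T" and s: "bij_betw \<sigma> S S'"
  obtains T' f where "labeled_tree S' T'" "tree_mor \<sigma> f T T'" "\<And>v. \<not> contracts T f v"
proof -
  have "finite S'" using lt_finS[OF T] s by (auto simp: bij_betw_def)
  then obtain N where "\<forall>x\<in>S'. x < N" using finite_nat_set_iff_bounded by blast
  \<comment> \<open>New labels may be old vertices; a shift moves the vertices beyond all new labels.\<close>
  then have "(\<lambda>v. v + N) ` verts T \<inter> S' = {}" by force
  from rename_iso[OF T s _ this] show thesis using that by (simp add: inj_on_def)
qed

section \<open>Restriction, assembly and substitution\<close>

text \<open>A contraction in two steps is a family of contractions of fibers. The labels of a fiber
include vertices, the lower ends of the edges that leave it; hence \<open>glue G id q\<close> on labels.\<close>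

lemma fiber_restrict_mor:
  assumes G: "labeled_tree S G" and G1: "labeled_tree S G1" and T: "labeled_tree S' T"
    and q: "tree_mor id q G G1" and f1: "tree_mor \<sigma> f1 G1 T" and w: "w \<in> verts T"
  shows fiber_restrict_mor1: "tree_mor (glue G id q) q (fiber G (f1 \<circ> q) w) (fiber G1 f1 w)"
    and fiber_restrict_root: "\<And>u. u \<in> verts G1 \<Longrightarrow> f1 u = w \<Longrightarrow>
      fiber_root (fiber G (f1 \<circ> q) w) q u = fiber_root G q u"
    and fiber_restrict_same: "\<And>u. u \<in> verts G1 \<Longrightarrow> f1 u = w \<Longrightarrow>
      same_tree (fiber (fiber G (f1 \<circ> q) w) q u) (fiber G q u)"
    and fiber_restrict_contracts: "\<And>v. contracts (fiber G (f1 \<circ> q) w) q v \<longleftrightarrow> contracts G q v \<and> f1 (q v) = w"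
proof -
  define F F1 where "F = fiber G (f1 \<circ> q) w" and "F1 = fiber G1 f1 w"
  have f: "tree_mor \<sigma> (f1 \<circ> q) G T" using tree_mor_comp(1)[OF G q f1] by simp
  have fr: "fiber_root G (f1 \<circ> q) w = fiber_root G q (fiber_root G1 f1 w)"
    by (rule tree_mor_comp(2)[OF G q f1 w])
  note r1 = mor_froot[OF f1 w] and r = mor_froot[OF f w]
  have vF: "verts F = {v \<in> verts G. f1 (q v) = w}" and vF1: "verts F1 = {u \<in> verts G1. f1 u = w}"
    and pF: "parent F = parent G" and pF1: "parent F1 = parent G1"
    and rF: "root F = fiber_root G q (fiber_root G1 f1 w)" and rF1: "root F1 = fiber_root G1 f1 w"
    by (auto simp: F_def F1_def fr)
  have qr: "q (root F) = root F1" unfolding rF rF1 by (rule froot_f[OF q r1(1)])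
  have nr: "v \<noteq> root G \<and> f1 (q (parent G v)) = w" if "v \<in> verts F" "v \<noteq> root F" for v
    using fiber_nonroot[OF f, of v] that unfolding vF F_def by auto
  have C: "contracts F q v \<longleftrightarrow> contracts G q v \<and> f1 (q v) = w" for v
  proof
    assume "contracts F q v"
    then show "contracts G q v \<and> f1 (q v) = w" using nr[of v] by (auto simp: contracts_def vF pF)
  next
    assume h: "contracts G q v \<and> f1 (q v) = w"
    have "v \<noteq> root F"
    proof
      assume "v = root F"
      then have "fiber_root G q (q v) = v" using qr rF rF1 by simp
      then have "\<not> contracts G q v" using fiber_root_iff[OF q, of v] h unfolding contracts_def by blast
      then show False using h by blast
    qed
    then show "contracts F q v" using h by (auto simp: contracts_def vF pF)
  qed
  have FL: "labeled_tree (labels F) F" unfolding F_def by (rule fiber_labeled[OF G f w])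
  have lab: "labels F = (\<Union>v\<in>{v \<in> verts G. f1 (q v) = w}. lb G v) \<union>
     {u \<in> verts G. u \<noteq> root G \<and> f1 (q u) \<noteq> w \<and> f1 (q (parent G u)) = w}"
    unfolding F_def labels_fiber[OF G] by simp
  have lab1: "labels F1 = (\<Union>v\<in>{v \<in> verts G1. f1 v = w}. lb G1 v) \<union>
     {u \<in> verts G1. u \<noteq> root G1 \<and> f1 u \<noteq> w \<and> f1 (parent G1 u) = w}"
    unfolding F1_def labels_fiber[OF G1] by simp
  have gS: "glue G id q s = s" if "s \<in> S" for s using that lt_disj[OF G] by (auto simp: glue_def)
  have gV: "glue G id q u = q u" if "u \<in> verts G" for u using that by (simp add: glue_def)
  have gl: "glue G id q ` labels F \<subseteq> labels F1"
  proof
    fix y assume "y \<in> glue G id q ` labels F"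
    then obtain x where x: "x \<in> labels F" "y = glue G id q x" by blast
    show "y \<in> labels F1"
    proof (cases "x \<in> verts G")
      case False
      then obtain v where v: "v \<in> verts G" "f1 (q v) = w" "x \<in> lb G v" using x(1) unfolding lab by auto
      then have "y = x" using gS lt_lb[OF G v(1)] x(2) by auto
      moreover have "x \<in> lb G1 (q v)" using mor_lb_iff[OF q mor_verts[OF q v(1)]] v by blast
      ultimately show ?thesis unfolding lab1 using v mor_verts[OF q v(1)] by blast
    next
      case True
      then have u: "x \<noteq> root G" "f1 (q x) \<noteq> w" "f1 (q (parent G x)) = w"
        using x(1) lt_lb[OF G] lt_disj[OF G] unfolding lab by auto
      then have "\<not> contracts G q x" by (auto simp: contracts_def)
      note n = mor_noncontr[OF q True u(1) this]
      then show ?thesis unfolding lab1 using u gV[OF True] x(2) mor_verts[OF q True] by auto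
    qed
  qed
  have gg: "glue G1 \<sigma> f1 (glue G id q x) = glue G \<sigma> (f1 \<circ> q) x" if x: "x \<in> labels F" for x
  proof (cases "x \<in> verts G")
    case True
    then show ?thesis using mor_verts[OF q True] by (simp add: glue_def)
  next
    case False
    then have "x \<in> S" using x lt_lb[OF G] unfolding lab by auto
    then show ?thesis using False gS lt_disj[OF G1] by (auto simp: glue_def)
  qed
  have M: "tree_mor (glue G id q) q F F1"
  proof (rule tree_morI[where r = "fiber_root G q"])
    have "bij_betw (glue G \<sigma> (f1 \<circ> q)) (labels F) (ocld T w)"
      unfolding F_def by (rule glue_bij[OF G T f w])
    then have "bij_betw (glue G1 \<sigma> f1 \<circ> glue G id q) (labels F) (ocld T w)"
      using gg by (simp cong: bij_betw_cong)
    moreover have "bij_betw (glue G1 \<sigma> f1) (labels F1) (ocld T w)"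
      unfolding F1_def by (rule glue_bij[OF G1 T f1 w])
    ultimately show "bij_betw (glue G id q) (labels F) (labels F1)"
      using bij_betw_comp_iff2[OF _ gl] by blast
    show "q ` verts F = verts F1"
      unfolding vF vF1 using mor_img[OF q] by auto
    show "q (root F) = root F1" by (rule qr)
    show "q v \<noteq> root F1 \<and> parent F1 (q v) = q (parent F v)"
      if v: "v \<in> verts F" "v \<noteq> root F" "q v \<noteq> q (parent F v)" for v
    proof -
      have vG: "v \<in> verts G" "v \<noteq> root G" using v nr[of v] by (auto simp: vF)
      have "\<not> contracts G q v" using v by (auto simp: contracts_def pF)
      note n = mor_noncontr[OF q vG this]
      then show ?thesis using v rF rF1 pF pF1 by auto
    qed
    show "fiber_root G q u \<in> verts F \<and> q (fiber_root G q u) = u \<and>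
       (fiber_root G q u = root F \<or> q (parent F (fiber_root G q u)) \<noteq> u)" if u: "u \<in> verts F1" for u
    proof -
      have uG: "u \<in> verts G1" "f1 u = w" using u by (auto simp: vF1)
      note ru = mor_froot[OF q uG(1)]
      have "fiber_root G q u = root F" if "fiber_root G q u = root G"
      proof -
        have "f1 (q (root G)) = w" using ru that uG by simp
        then have "fiber_root G (f1 \<circ> q) w = root G" using froot_eq[OF f lt_root[OF G]] by simp
        then show ?thesis using that fr rF by simp
      qed
      then show ?thesis using ru uG by (auto simp: vF pF)
    qed
    show "v = fiber_root G q (q v)" if v: "v \<in> verts F" "v = root F \<or> q (parent F v) \<noteq> q v" for v
    proof (cases "v = root F")
      case True
      then show ?thesis using qr rF rF1 by simp
    next
      case False
      then show ?thesis using v froot_eq[OF q, of v] by (auto simp: vF pF)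
    qed
    show "lb F1 u = glue G id q ` (\<Union>v\<in>{v \<in> verts F. q v = u}. lb F v)" if u: "u \<in> verts F1" for u
    proof
      have uG: "u \<in> verts G1" "f1 u = w" using u by (auto simp: vF1)
      show "lb F1 u \<subseteq> glue G id q ` (\<Union>v\<in>{v \<in> verts F. q v = u}. lb F v)"
      proof
        fix x assume x: "x \<in> lb F1 u"
        then consider "x \<in> lb G1 u" | "x \<in> cld G1 u" "f1 x \<noteq> w" by (auto simp: F1_def)
        then show "x \<in> glue G id q ` (\<Union>v\<in>{v \<in> verts F. q v = u}. lb F v)"
        proof cases
          case 1
          then obtain v where v: "v \<in> verts G" "q v = u" "x \<in> lb G v" using mor_lb_iff[OF q uG(1)] by blast
          then have "glue G id q x = x" using gS lt_lb[OF G v(1)] by auto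
          then have "x = glue G id q x" by simp
          moreover have "v \<in> {v \<in> verts F. q v = u}" "x \<in> lb F v" using v uG by (auto simp: vF F_def)
          ultimately show ?thesis by blast
        next
          case 2
          then have x: "x \<in> verts G1" "x \<noteq> root G1" "parent G1 x = u" by (auto simp: cld_def)
          let ?y = "fiber_root G q x"
          note y = mor_froot[OF q x(1)] froot_nonroot[OF q x(1,2)]
          have py: "parent G ?y \<in> verts G" using lt_parent[OF G y(1) y(4)] .
          have "?y \<in> cld G (parent G ?y)" using y by (simp add: cld_def)
          then have "parent G ?y \<in> {v \<in> verts F. q v = u}" "?y \<in> lb F (parent G ?y)"
            using y x uG py 2 by (auto simp: vF F_def)
          moreover have "x = glue G id q ?y" using gV[OF y(1)] y(2) by simp
          ultimately show ?thesis by blast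
        qed
      qed
      show "glue G id q ` (\<Union>v\<in>{v \<in> verts F. q v = u}. lb F v) \<subseteq> lb F1 u"
      proof
        fix x assume "x \<in> glue G id q ` (\<Union>v\<in>{v \<in> verts F. q v = u}. lb F v)"
        then obtain y v where y: "x = glue G id q y" "v \<in> verts G" "q v = u" "y \<in> lb F v" by (auto simp: vF)
        then consider "y \<in> lb G v" | "y \<in> cld G v" "f1 (q y) \<noteq> w" by (auto simp: F_def)
        then show "x \<in> lb F1 u"
        proof cases
          case 1
          then have "x = y" using gS lt_lb[OF G y(2)] y(1) by auto
          then have "x \<in> lb G1 u" using mor_lb_iff[OF q uG(1)] y 1 by blast
          then show ?thesis by (simp add: F1_def)
        next
          case 2
          then have yG: "y \<in> verts G" "y \<noteq> root G" "parent G y = v" by (auto simp: cld_def)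
          have "\<not> contracts G q y" using yG 2 y uG by (auto simp: contracts_def)
          note n = mor_noncontr[OF q yG(1,2) this]
          have "q y \<in> cld G1 u" using n yG y mor_verts[OF q yG(1)] by (simp add: cld_def)
          then show ?thesis using gV[OF yG(1)] y 2 by (simp add: F1_def)
        qed
      qed
    qed
  qed
  show "tree_mor (glue G id q) q (fiber G (f1 \<circ> q) w) (fiber G1 f1 w)" using M by (simp add: F_def F1_def)
  show "contracts (fiber G (f1 \<circ> q) w) q v \<longleftrightarrow> contracts G q v \<and> f1 (q v) = w" for v
    using C by (simp add: F_def)
  show R: "fiber_root (fiber G (f1 \<circ> q) w) q u = fiber_root G q u" if u: "u \<in> verts G1" "f1 u = w" for u
  proof -
    let ?v = "fiber_root G q u"
    note v = mor_froot[OF q u(1)]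
    have "\<not> contracts G q ?v" using fiber_root_iff[OF q v(1)] v(2) by simp
    then have "\<not> contracts F q ?v" using C by blast
    then show ?thesis using fiber_root_iff[OF M, of ?v] v u by (simp add: vF F_def)
  qed
  show "same_tree (fiber (fiber G (f1 \<circ> q) w) q u) (fiber G q u)" if u: "u \<in> verts G1" "f1 u = w" for u
    unfolding same_tree_def
  proof (intro conjI ballI impI)
    show "root (fiber G q u) = root (fiber (fiber G (f1 \<circ> q) w) q u)" using R[OF u] by simp
    fix v assume "v \<in> verts (fiber (fiber G (f1 \<circ> q) w) q u)"
    then have v: "v \<in> verts G" "q v = u" by auto
    have cF: "cld F v = {x \<in> cld G v. f1 (q x) = w}"
      using cld_fiber[OF G f v(1)] v u by (simp add: F_def)
    show "lb (fiber G q u) v = lb (fiber (fiber G (f1 \<circ> q) w) q u) v"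
      using cF u unfolding F_def[symmetric] by (auto simp: F_def)
  qed (use u in auto)
qed

text \<open>Morphisms can be defined locally over a common contraction \<open>U\<close>. An edge of \<open>T\<close> inside a fiber is
respected by the morphism of this fiber. An edge between two fibers is at the same time the root of
one and a label of the other, and the condition on \<open>\<tau>\<close> says that both descriptions have the same
image.\<close>

lemma tree_mor_assemble:
  assumes T: "labeled_tree S T" and T'': "labeled_tree S T''"
    and f: "tree_mor id f T U" and f'': "tree_mor id f'' T'' U"
    and g: "\<And>w. w \<in> verts U \<Longrightarrow> tree_mor (\<tau> w) (g w) (fiber T f w) (fiber T'' f'' w)"
    and \<tau>: "\<And>w u. w \<in> verts U \<Longrightarrow> u \<in> labels (fiber T f w) \<Longrightarrow>
       \<tau> w u = (if u \<in> verts T then fiber_root T'' f'' (f u) else u)"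
  shows "tree_mor id (\<lambda>v. g (f v) v) T T''" "\<And>v. v \<in> verts T \<Longrightarrow> f'' (g (f v) v) = f v"
proof -
  have gv: "g (f v) v \<in> verts T'' \<and> f'' (g (f v) v) = f v" if v: "v \<in> verts T" for v
    using mor_verts[OF g[OF mor_verts[OF f v]], of v] v by simp
  show ff: "f'' (g (f v) v) = f v" if "v \<in> verts T" for v using gv[OF that] by simp
  have groot: "g w (fiber_root T f w) = fiber_root T'' f'' w" if "w \<in> verts U" for w
    using mor_root[OF g[OF that]] by simp
  have crit: "(v = root T \<or> g (f (parent T v)) (parent T v) \<noteq> g (f v) v) \<longleftrightarrow>
     (v = fiber_root T f (f v) \<or> g (f v) (parent T v) \<noteq> g (f v) v)" if v: "v \<in> verts T" for v
  proof (cases "v = fiber_root T f (f v)")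
    case True
    then have "\<not> contracts T f v" using fiber_root_iff[OF f v] by simp
    then show ?thesis using True v gv[OF v] gv[OF lt_parent[OF T v]] by (auto simp: contracts_def)
  next
    case False
    then show ?thesis using fiber_nonroot[OF f v] by auto
  qed
  define r where "r x = fiber_root (fiber T f (f'' x)) (g (f'' x)) x" for x
  show "tree_mor id (\<lambda>v. g (f v) v) T T''"
  proof (rule tree_morI[where r = r])
    show "bij_betw id (labels T) (labels T'')" using lt_labels[OF T] lt_labels[OF T''] by simp
    show "(\<lambda>v. g (f v) v) ` verts T = verts T''"
    proof (intro equalityI subsetI)
      fix x assume x: "x \<in> verts T''"
      have "x \<in> verts (fiber T'' f'' (f'' x))" using x by simp
      then have "x \<in> g (f'' x) ` verts (fiber T f (f'' x))"
        using mor_img[OF g[OF mor_verts[OF f'' x]]] by simp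
      then obtain v where v: "v \<in> verts T" "f v = f'' x" "x = g (f'' x) v" by auto
      then have "x = g (f v) v" by simp
      then show "x \<in> (\<lambda>v. g (f v) v) ` verts T" using v(1) by blast
    qed (use gv in auto)
    have rU: "root U \<in> verts U" using mor_verts[OF f lt_root[OF T]] mor_root[OF f] by simp
    show "g (f (root T)) (root T) = root T''"
      using groot[OF rU] froot_root[OF f lt_root[OF T]] froot_root[OF f'' lt_root[OF T'']] mor_root[OF f] by simp
    fix v assume v: "v \<in> verts T"
    let ?w = "f v"
    have w: "?w \<in> verts U" by (rule mor_verts[OF f v])
    show "g (f v) v \<noteq> root T'' \<and> parent T'' (g (f v) v) = g (f (parent T v)) (parent T v)"
      if n: "v \<noteq> root T" "g (f v) v \<noteq> g (f (parent T v)) (parent T v)"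
    proof (cases "v = fiber_root T f ?w")
      case False
      then have p: "f (parent T v) = f v" using fiber_nonroot[OF f v] by simp
      have "g ?w v \<noteq> root (fiber T'' f'' ?w) \<and> parent (fiber T'' f'' ?w) (g ?w v) = g ?w (parent T v)"
        using mor_edge[OF g[OF w], of v] v False n p by simp
      moreover have "fiber_root T'' f'' ?w = root T''" if "g ?w v = root T''"
        using froot_eq[OF f'' lt_root[OF T'']] that ff[OF v] by simp
      ultimately show ?thesis using p by auto
    next
      case True
      then have nc: "\<not> contracts T f v" using fiber_root_iff[OF f v] by simp
      let ?p = "parent T v" and ?w' = "f (parent T v)"
      have p: "?p \<in> verts T" by (rule lt_parent[OF T v n(1)])
      have w': "?w' \<in> verts U" by (rule mor_verts[OF f p])
      have "?w \<noteq> ?w'" using nc v n by (auto simp: contracts_def)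
      then have vl: "v \<in> lb (fiber T f ?w') ?p" using v n by (simp add: cld_def)
      then have vlab: "v \<in> labels (fiber T f ?w')" using p by (auto simp: labels_def)
      have "\<tau> ?w' v \<in> lb (fiber T'' f'' ?w') (g ?w' ?p)"
        using mor_lb[OF g[OF w'], of "g ?w' ?p"] gv[OF p] vl p by auto
      moreover have "\<tau> ?w' v = g ?w v" using \<tau>[OF w' vlab] v groot[OF w] True by simp
      moreover have "g ?w v \<notin> lb T'' (g ?w' ?p)"
        using gv[OF v] gv[OF p] lt_lb[OF T''] lt_disj[OF T''] by auto
      ultimately show ?thesis by (auto simp: cld_def)
    qed
    show "v = r (g (f v) v)" if "v = root T \<or> g (f (parent T v)) (parent T v) \<noteq> g (f v) v"
    proof -
      have "v = fiber_root T f ?w \<or> g ?w (parent T v) \<noteq> g ?w v" using crit[OF v] that by simp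
      then have "fiber_root (fiber T f ?w) (g ?w) (g ?w v) = v"
        using froot_eq[OF g[OF w], of v] v by simp
      then show ?thesis unfolding r_def ff[OF v] by simp
    qed
  next
    fix x assume x: "x \<in> verts T''"
    let ?w = "f'' x"
    have w: "?w \<in> verts U" by (rule mor_verts[OF f'' x])
    have xF: "x \<in> verts (fiber T'' f'' ?w)" using x by simp
    note rx = mor_froot[OF g[OF w] xF]
    have rv: "r x \<in> verts T" "f (r x) = ?w" using rx(1) by (auto simp: r_def)
    then have "r x = root T \<or> g (f (parent T (r x))) (parent T (r x)) \<noteq> x"
      using crit[OF rv(1)] rx(2,3) by (simp add: r_def)
    then show "r x \<in> verts T \<and> g (f (r x)) (r x) = x \<and>
        (r x = root T \<or> g (f (parent T (r x))) (parent T (r x)) \<noteq> x)"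
      using rv rx(2) by (simp add: r_def)
    have tS: "\<tau> ?w s = s" if "s \<in> S" "s \<in> labels (fiber T f ?w)" for s
      using \<tau>[OF w that(2)] that(1) lt_disj[OF T] by auto
    have tV: "\<tau> ?w s \<in> verts T''" if s: "s \<in> labels (fiber T f ?w)" "s \<in> verts T" for s
      using \<tau>[OF w s(1)] s froot_in[OF f'' mor_verts[OF f s(2)]] by simp
    have "lb T'' x = lb (fiber T'' f'' ?w) x \<inter> S"
      using lt_lb[OF T'' x] lt_disj[OF T''] by (auto simp: cld_def)
    also have "\<dots> = \<tau> ?w ` (\<Union>v\<in>{v \<in> verts (fiber T f ?w). g ?w v = x}. lb (fiber T f ?w) v) \<inter> S"
      using mor_lb[OF g[OF w] xF] by simp
    also have "\<dots> = (\<Union>v\<in>{v \<in> verts T. g (f v) v = x}. lb T v)" (is "?L = ?R")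
    proof (intro equalityI subsetI)
      fix s assume "s \<in> ?L"
      then obtain v y where y: "s = \<tau> ?w y" "s \<in> S" "v \<in> verts T" "f v = ?w" "g ?w v = x"
        "y \<in> lb (fiber T f ?w) v" by auto
      have yl: "y \<in> labels (fiber T f ?w)" using y unfolding labels_def by (intro UN_I[of v]) auto
      have "y \<notin> verts T" using tV[OF yl] y(1,2) lt_disj[OF T''] by auto
      then have "y \<in> lb T v" using y(6) by (auto simp: cld_def)
      then have "s = y" using tS[OF _ yl] lt_lb[OF T y(3)] y(1) by auto
      then show "s \<in> ?R" using y \<open>y \<in> lb T v\<close> by auto
    next
      fix s assume "s \<in> ?R"
      then obtain v where v: "v \<in> verts T" "g (f v) v = x" "s \<in> lb T v" by auto
      have fv: "f v = ?w" using ff[OF v(1)] v(2) by simp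
      have sS: "s \<in> S" using lt_lb[OF T v(1)] v(3) by auto
      have sl: "s \<in> lb (fiber T f ?w) v" using v by simp
      then have "s \<in> labels (fiber T f ?w)" using v fv unfolding labels_def by (intro UN_I[of v]) auto
      then have "\<tau> ?w s = s" using tS sS by blast
      moreover have "v \<in> {v \<in> verts (fiber T f ?w). g ?w v = x}" using v fv by simp
      ultimately show "s \<in> ?L" using sl sS by (metis (no_types, lifting) IntI UN_I image_eqI)
    qed
    finally show "lb T'' x = id ` (\<Union>v\<in>{v \<in> verts T. g (f v) v = x}. lb T v)" by simp
  qed
qed

text \<open>The vertices of \<open>G\<close> are the pairs of a vertex \<open>w\<close> of \<open>U\<close> and a vertex of \<open>Tr w\<close>, coded by numbers
beyond all labels. The root of \<open>Tr w\<close> is attached to the vertex of \<open>Tr (parent U w)\<close> that carries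
the label \<open>w\<close>.\<close>

lemma tree_substitution:
  assumes U: "labeled_tree S U" and Tr: "\<And>w. w \<in> verts U \<Longrightarrow> labeled_tree (ocld U w) (Tr w)"
  obtains G f \<tau> k where "labeled_tree S G" "tree_mor id f G U"
    "\<And>w. w \<in> verts U \<Longrightarrow> tree_mor (\<tau> w) (k w) (Tr w) (fiber G f w)"
    "\<And>w v. w \<in> verts U \<Longrightarrow> \<not> contracts (Tr w) (k w) v"
    "\<And>w s. w \<in> verts U \<Longrightarrow> s \<in> ocld U w \<Longrightarrow> glue G id f (\<tau> w s) = s"
proof -
  obtain N where N: "\<forall>x\<in>S. x < N" using lt_finS[OF U] finite_nat_set_iff_bounded by blast
  define e where "e w v = N + prod_encode (w, v)" for w v
  define dw where "dw x = fst (prod_decode (x - N))" for x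
  define dv where "dv x = snd (prod_decode (x - N))" for x
  have dec [simp]: "dw (e w v) = w" "dv (e w v) = v" for w v by (simp_all add: dw_def dv_def e_def)
  have e_inj [simp]: "e w v = e w' v' \<longleftrightarrow> w = w' \<and> v = v'" for w v w' v' by (simp add: e_def)
  have eS: "e w v \<notin> S" for w v using N by (auto simp: e_def)
  define h where "h w = (SOME v. v \<in> verts (Tr (parent U w)) \<and> w \<in> lb (Tr (parent U w)) v)" for w
  have ocldU: "labels (Tr w) = ocld U w" if "w \<in> verts U" for w using lt_labels[OF Tr[OF that]] .
  have hU: "h w \<in> verts (Tr (parent U w)) \<and> w \<in> lb (Tr (parent U w)) (h w)"
    if w: "w \<in> verts U" "w \<noteq> root U" for w
  proof -
    have "w \<in> ocld U (parent U w)" using w by (simp add: ocld_def cld_def)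
    then have "\<exists>v. v \<in> verts (Tr (parent U w)) \<and> w \<in> lb (Tr (parent U w)) v"
      using lt_lbex[OF Tr[OF lt_parent[OF U w]]] by blast
    then show ?thesis unfolding h_def by (rule someI_ex)
  qed
  have h_eq: "h w = v" if "w \<in> verts U" "w \<noteq> root U" "v \<in> verts (Tr (parent U w))"
      "w \<in> lb (Tr (parent U w)) v" for w v
    using lt_lbdisj[OF Tr[OF lt_parent[OF U that(1,2)]]] hU[OF that(1,2)] that(3,4) by blast
  define G where "G = \<lparr>verts = (\<lambda>(w, v). e w v) ` (SIGMA w:verts U. verts (Tr w)),
     root = e (root U) (root (Tr (root U))),
     parent = (\<lambda>x. if dv x \<noteq> root (Tr (dw x)) then e (dw x) (parent (Tr (dw x)) (dv x))
                   else e (parent U (dw x)) (h (dw x))),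
     lb = (\<lambda>x. lb (Tr (dw x)) (dv x) \<inter> S)\<rparr>"
  have vG: "x \<in> verts G \<longleftrightarrow> (\<exists>w v. x = e w v \<and> w \<in> verts U \<and> v \<in> verts (Tr w))" for x
    by (auto simp: G_def)
  have eG [simp]: "e w v \<in> verts G \<longleftrightarrow> w \<in> verts U \<and> v \<in> verts (Tr w)" for w v by (auto simp: vG)
  have rG: "root G = e (root U) (root (Tr (root U)))" by (simp add: G_def)
  have p1: "parent G (e w v) = e w (parent (Tr w) v)" if "v \<noteq> root (Tr w)" for w v
    using that by (simp add: G_def)
  have p2: "parent G (e w (root (Tr w))) = e (parent U w) (h w)" for w by (simp add: G_def)
  have lG: "lb G (e w v) = lb (Tr w) v \<inter> S" for w v by (simp add: G_def)
  have oS: "s \<in> ocld U w \<and> s \<in> S \<longleftrightarrow> s \<in> lb U w" if "w \<in> verts U" for s w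
    using lt_lb[OF U that] lt_disj[OF U] by (auto simp: ocld_def cld_def)
  have nS: "s \<in> cld U w" if "w \<in> verts U" "s \<in> ocld U w" "s \<notin> S" for s w
    using that oS[OF that(1)] lt_lb[OF U that(1)] by (auto simp: ocld_def)
  have rT: "root (Tr w) \<in> verts (Tr w)" if "w \<in> verts U" for w by (rule lt_root[OF Tr[OF that]])
  have lbT: "lb (Tr w) v \<subseteq> ocld U w" if "w \<in> verts U" "v \<in> verts (Tr w)" for w v
    by (rule lt_lb[OF Tr[OF that(1)] that(2)])
  have finG: "finite (verts G)"
    unfolding G_def using lt_finite[OF U] lt_finite[OF Tr] by (auto intro!: finite_imageI finite_SigmaI)
  have parG: "parent G x \<in> verts G" if "x \<in> verts G" "x \<noteq> root G" for x
  proof -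
    obtain w v where x: "x = e w v" "w \<in> verts U" "v \<in> verts (Tr w)" using \<open>x \<in> verts G\<close> by (auto simp: vG)
    show ?thesis
    proof (cases "v = root (Tr w)")
      case False
      then show ?thesis using p1 x lt_parent[OF Tr[OF x(2)] x(3)] by simp
    next
      case True
      then have "w \<noteq> root U" using \<open>x \<noteq> root G\<close> x rG by auto
      then show ?thesis using p2 x hU lt_parent[OF U x(2)] True by simp
    qed
  qed
  have labG: "labels G = S"
  proof
    show "labels G \<subseteq> S" by (auto simp: labels_def G_def)
    show "S \<subseteq> labels G"
    proof
      fix s assume s: "s \<in> S"
      then obtain w where w: "w \<in> verts U" "s \<in> lb U w" using lt_lbex[OF U] by blast
      then obtain v where v: "v \<in> verts (Tr w)" "s \<in> lb (Tr w) v" using lt_lbex[OF Tr[OF w(1)], of s] oS by blast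
      then have "e w v \<in> verts G" "s \<in> lb G (e w v)" using w lG s by auto
      then show "s \<in> labels G" unfolding labels_def by blast
    qed
  qed
  have GL: "labeled_tree S G"
  proof (rule labeled_treeI)
    show "finite (verts G)" by (rule finG)
    show "root G \<in> verts G" using rT lt_root[OF U] by (simp add: rG)
    show "parent G v \<in> verts G" if "v \<in> verts G" "v \<noteq> root G" for v by (rule parG[OF that])
    show "finite S" by (rule lt_finS[OF U])
    show "labels G = S" by (rule labG)
    show "S \<inter> verts G = {}" using eS by (auto simp: vG)
    show "x = y" if xy: "x \<in> verts G" "y \<in> verts G" "s \<in> lb G x" "s \<in> lb G y" for x y s
    proof -
      obtain w v where x: "x = e w v" "w \<in> verts U" "v \<in> verts (Tr w)" using xy(1) by (auto simp: vG)
      obtain w' v' where y: "y = e w' v'" "w' \<in> verts U" "v' \<in> verts (Tr w')" using xy(2) by (auto simp: vG)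
      have s: "s \<in> lb (Tr w) v" "s \<in> lb (Tr w') v'" "s \<in> S" using xy(3,4) x y lG by auto
      have "s \<in> lb U w" "s \<in> lb U w'" using s lbT[OF x(2,3)] lbT[OF y(2,3)] oS[OF x(2)] oS[OF y(2)] by blast+
      then have "w = w'" using lt_lbdisj[OF U x(2) y(2)] by blast
      moreover from this have "v = v'" using lt_lbdisj[OF Tr[OF x(2)] x(3)] y s by blast
      ultimately show ?thesis using x y by simp
    qed
    fix Q x
    assume r: "Q (root G)" and st: "\<And>u. u \<in> verts G \<Longrightarrow> u \<noteq> root G \<Longrightarrow> Q (parent G u) \<Longrightarrow> Q u"
      and xG: "x \<in> verts G"
    obtain w v where x: "x = e w v" "w \<in> verts U" "v \<in> verts (Tr w)" using xG by (auto simp: vG)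
    have inner: "Q (e w v)" if w: "w \<in> verts U" and v: "v \<in> verts (Tr w)" and Qr: "Q (e w (root (Tr w)))" for w v
      using Tr[OF w] v
    proof (induction v rule: tree_induct)
      case (step v)
      then show ?case using st[of "e w v"] p1 w by (auto simp: rG)
    qed (rule Qr)
    have "\<forall>v\<in>verts (Tr w). Q (e w v)" using U x(2)
    proof (induction w rule: tree_induct)
      case root
      then show ?case using inner[OF lt_root[OF U]] r rG by simp
    next
      case (step w)
      have "Q (e w (root (Tr w)))"
        using st[of "e w (root (Tr w))"] p2 step hU[OF step(1,2)] rT[OF step(1)] by (auto simp: rG)
      then show ?case using inner[OF step(1)] by blast
    qed
    then show "Q x" using x by simp
  next
    fix x assume "x \<in> verts G"
    then obtain w v where x: "x = e w v" "w \<in> verts U" "v \<in> verts (Tr w)" by (auto simp: vG)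
    define \<phi> where "\<phi> y = (if y \<in> verts (Tr w) then e w y else if y \<in> S then y else e y (root (Tr y)))" for y
    have dj: "y \<notin> verts (Tr w)" if "y \<in> ocld U w" for y using lt_disj[OF Tr[OF x(2)]] that by auto
    have c: "y \<in> verts U \<and> y \<noteq> root U \<and> parent U y = w \<and> y \<noteq> w" if "y \<in> ocld U w" "y \<notin> S" for y
      using nS[OF x(2) that] parent_neq[OF U, of y] by (auto simp: cld_def)
    have sub: "ocld (Tr w) v \<subseteq> verts (Tr w) \<union> ocld U w"
      using lbT[OF x(2,3)] by (auto simp: ocld_def cld_def)
    have "inj_on \<phi> (ocld (Tr w) v)"
    proof (rule inj_onI)
      fix y z assume yz: "y \<in> ocld (Tr w) v" "z \<in> ocld (Tr w) v" "\<phi> y = \<phi> z"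
      have "y \<in> verts (Tr w) \<or> y \<in> ocld U w" "z \<in> verts (Tr w) \<or> z \<in> ocld U w" using yz sub by auto
      then show "y = z" using yz(3) c[of y] c[of z] eS
        by (auto simp: \<phi>_def split: if_splits)
    qed
    moreover have "\<phi> ` ocld (Tr w) v \<subseteq> ocld G x"
    proof
      fix z assume "z \<in> \<phi> ` ocld (Tr w) v"
      then obtain y where y: "y \<in> cld (Tr w) v \<or> y \<in> lb (Tr w) v" "z = \<phi> y" by (auto simp: ocld_def)
      show "z \<in> ocld G x"
      proof (cases "y \<in> verts (Tr w)")
        case True
        then have "y \<in> cld (Tr w) v" using y(1) dj lbT[OF x(2,3)] by auto
        then show ?thesis using True y p1 x by (auto simp: \<phi>_def ocld_def cld_def rG)
      next
        case False
        then have yl: "y \<in> lb (Tr w) v" using y(1) by (auto simp: cld_def)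
        then have yo: "y \<in> ocld U w" using lbT[OF x(2,3)] by auto
        show ?thesis
        proof (cases "y \<in> S")
          case True
          then show ?thesis using False yl y x lG by (simp add: \<phi>_def ocld_def)
        next
          case nyS: False
          note cy = c[OF yo nyS]
          have "h y = v" using h_eq[of y v] cy x yl by simp
          then show ?thesis using False nyS y x cy p2 rT[of y] by (auto simp: \<phi>_def ocld_def cld_def rG)
        qed
      qed
    qed
    moreover have "finite (ocld G x)"
    proof (rule finite_subset)
      show "ocld G x \<subseteq> verts G \<union> S" using x lG by (auto simp: ocld_def cld_def)
      show "finite (verts G \<union> S)" using finG lt_finS[OF U] by simp
    qed
    ultimately have "card (ocld (Tr w) v) \<le> card (ocld G x)" by (rule card_inj_on_le)
    then show "2 \<le> card (ocld G x)" using lt_card_ocld(2)[OF Tr[OF x(2)] x(3)] by simp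
  qed
  have fM: "tree_mor id dw G U"
  proof (rule tree_morI[where r = "\<lambda>w. e w (root (Tr w))"])
    show "bij_betw id (labels G) (labels U)" using labG lt_labels[OF U] by simp
    show "dw ` verts G = verts U"
    proof (intro equalityI subsetI)
      fix w assume "w \<in> verts U"
      then show "w \<in> dw ` verts G" using rT[of w] by (intro image_eqI[of _ _ "e w (root (Tr w))"]) auto
    qed (auto simp: vG)
    show "dw (root G) = root U" by (simp add: rG)
    show "dw x \<noteq> root U \<and> parent U (dw x) = dw (parent G x)"
      if h: "x \<in> verts G" "x \<noteq> root G" "dw x \<noteq> dw (parent G x)" for x
    proof -
      obtain w v where x: "x = e w v" "w \<in> verts U" "v \<in> verts (Tr w)" using h(1) by (auto simp: vG)
      have "v = root (Tr w)" using h(3) p1 x by (cases "v = root (Tr w)") auto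
      then show ?thesis using x p2 h(2) by (auto simp: rG)
    qed
    show "e w (root (Tr w)) \<in> verts G \<and> dw (e w (root (Tr w))) = w \<and>
       (e w (root (Tr w)) = root G \<or> dw (parent G (e w (root (Tr w)))) \<noteq> w)" if "w \<in> verts U" for w
      using that rT[OF that] p2 parent_neq[OF U that] by (auto simp: rG)
    show "x = e (dw x) (root (Tr (dw x)))"
      if h: "x \<in> verts G" "x = root G \<or> dw (parent G x) \<noteq> dw x" for x
    proof -
      obtain w v where x: "x = e w v" "w \<in> verts U" "v \<in> verts (Tr w)" using h(1) by (auto simp: vG)
      have "v = root (Tr w)" using h(2) p1 x rG by (cases "v = root (Tr w)") auto
      then show ?thesis using x by simp
    qed
    show "lb U w = id ` (\<Union>x\<in>{x \<in> verts G. dw x = w}. lb G x)" if w: "w \<in> verts U" for w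
    proof -
      have "{x \<in> verts G. dw x = w} = e w ` verts (Tr w)" using w by (auto simp: vG)
      then have "(\<Union>x\<in>{x \<in> verts G. dw x = w}. lb G x) = ocld U w \<inter> S"
        using lG ocldU[OF w] by (auto simp: labels_def)
      then show ?thesis using oS[OF w] by auto
    qed
  qed
  have fr: "fiber_root G dw w = e w (root (Tr w))" if w: "w \<in> verts U" for w
  proof -
    have "e w (root (Tr w)) \<in> verts G" using w rT[OF w] by simp
    moreover have "e w (root (Tr w)) = root G \<or> dw (parent G (e w (root (Tr w)))) \<noteq> w"
      using w p2 parent_neq[OF U w] by (auto simp: rG)
    ultimately show ?thesis using froot_eq[OF fM, of "e w (root (Tr w))"] by simp
  qed
  define \<tau> where "\<tau> w s = (if s \<in> S then s else e s (root (Tr s)))" for w :: nat and s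
  have glu: "glue G id dw (\<tau> w s) = s" if w: "w \<in> verts U" "s \<in> ocld U w" for w s
  proof (cases "s \<in> S")
    case True
    then show ?thesis using lt_disj[OF GL] by (auto simp: \<tau>_def glue_def)
  next
    case False
    then have "s \<in> verts U" using nS[OF w] by (auto simp: cld_def)
    then show ?thesis using False rT[of s] by (simp add: \<tau>_def glue_def)
  qed
  have kM: "tree_mor (\<tau> w) (e w) (Tr w) (fiber G dw w)" if w: "w \<in> verts U" for w
  proof (rule tree_morI[where r = dv])
    have vF: "verts (fiber G dw w) = e w ` verts (Tr w)" using w by (auto simp: vG)
    have lF: "lb (fiber G dw w) (e w v) = \<tau> w ` lb (Tr w) v" if v: "v \<in> verts (Tr w)" for v
    proof (intro equalityI subsetI)
      fix y assume "y \<in> lb (fiber G dw w) (e w v)"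
      then consider "y \<in> lb (Tr w) v" "y \<in> S" | "y \<in> cld G (e w v)" "dw y \<noteq> w" using lG by auto
      then show "y \<in> \<tau> w ` lb (Tr w) v"
      proof cases
        case 1
        then show ?thesis by (intro image_eqI[of _ _ y]) (auto simp: \<tau>_def)
      next
        case 2
        then obtain w' v' where y: "y = e w' v'" "w' \<in> verts U" "v' \<in> verts (Tr w')" "w' \<noteq> w"
          "y \<noteq> root G" "parent G y = e w v" by (auto simp: cld_def vG)
        have r: "v' = root (Tr w')" using y p1[of v' w'] by (cases "v' = root (Tr w')") auto
        then have pw: "parent U w' = w" "h w' = v" using y p2[of w'] by auto
        have "w' \<noteq> root U" using y r rG by auto
        then have "w' \<in> lb (Tr w) v" using hU[of w'] y pw by auto
        moreover have "\<tau> w w' = y" using lt_disj[OF U] y r by (auto simp: \<tau>_def)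
        ultimately show ?thesis by blast
      qed
    next
      fix y assume "y \<in> \<tau> w ` lb (Tr w) v"
      then obtain s where s: "s \<in> lb (Tr w) v" "y = \<tau> w s" by blast
      have so: "s \<in> ocld U w" using lbT[OF w v] s by blast
      show "y \<in> lb (fiber G dw w) (e w v)"
      proof (cases "s \<in> S")
        case True
        then show ?thesis using s lG by (simp add: \<tau>_def)
      next
        case False
        then have c: "s \<in> verts U" "s \<noteq> root U" "parent U s = w" using nS[OF w so] by (auto simp: cld_def)
        then have "s \<noteq> w" using parent_neq[OF U c(1,2)] by metis
        moreover have "h s = v" using h_eq[of s v] c v s by simp
        ultimately show ?thesis using False s c p2[of s] rT[of s] by (auto simp: \<tau>_def cld_def rG)
      qed
    qed
    have inl: "\<tau> w ` ocld U w \<subseteq> labels (fiber G dw w)"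
    proof
      fix y assume "y \<in> \<tau> w ` ocld U w"
      then obtain s where s: "s \<in> ocld U w" "y = \<tau> w s" by blast
      then obtain v where v: "v \<in> verts (Tr w)" "s \<in> lb (Tr w) v" using lt_lbex[OF Tr[OF w]] by blast
      then have "y \<in> lb (fiber G dw w) (e w v)" "e w v \<in> verts (fiber G dw w)" using lF s w by auto
      then show "y \<in> labels (fiber G dw w)" unfolding labels_def by blast
    qed
    have "bij_betw (glue G id dw \<circ> \<tau> w) (ocld U w) (ocld U w)"
      using glu[OF w] by (simp add: bij_betw_cong[of "ocld U w" "glue G id dw \<circ> \<tau> w" id])
    then show "bij_betw (\<tau> w) (labels (Tr w)) (labels (fiber G dw w))"
      using bij_betw_comp_iff2[OF glue_bij[OF GL U fM w] inl] ocldU[OF w] by simp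
    show "e w ` verts (Tr w) = verts (fiber G dw w)" using vF by simp
    show "e w (root (Tr w)) = root (fiber G dw w)" using fr[OF w] by simp
    show "e w v \<noteq> root (fiber G dw w) \<and> parent (fiber G dw w) (e w v) = e w (parent (Tr w) v)"
      if "v \<in> verts (Tr w)" "v \<noteq> root (Tr w)" for v using that p1 fr[OF w] by simp
    show "dv x \<in> verts (Tr w) \<and> e w (dv x) = x \<and> (dv x = root (Tr w) \<or> e w (parent (Tr w) (dv x)) \<noteq> x)"
      if h: "x \<in> verts (fiber G dw w)" for x
    proof -
      obtain v where x: "x = e w v" "v \<in> verts (Tr w)" using h unfolding vF by blast
      then show ?thesis using parent_neq[OF Tr[OF w] x(2)] by auto
    qed
    show "lb (fiber G dw w) x = \<tau> w ` (\<Union>v\<in>{v \<in> verts (Tr w). e w v = x}. lb (Tr w) v)"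
      if h: "x \<in> verts (fiber G dw w)" for x
    proof -
      obtain v where x: "x = e w v" "v \<in> verts (Tr w)" using h unfolding vF by blast
      then have "{v \<in> verts (Tr w). e w v = x} = {v}" by auto
      then show ?thesis using lF x by simp
    qed
  qed simp
  have kC: "\<not> contracts (Tr w) (e w) v" if "w \<in> verts U" for w v
    using parent_neq[OF Tr[OF that], of v] by (auto simp: contracts_def)
  show thesis by (rule that[OF GL fM kM kC glu])
qed

section \<open>Elementary consequences of the operad axioms\<close>

lemma ocld_root_corolla:
  assumes T: "labeled_tree S T" and d: "\<not> decomposable T"
  shows "verts T = {root T}" "ocld T (root T) = S"
proof -
  show v: "verts T = {root T}" using d by (simp add: decomposable_def)
  have "cld T (root T) = {}" using v by (auto simp: cld_def)
  then show "ocld T (root T) = S" using lt_labels[OF T] v by (simp add: ocld_def labels_def)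
qed

lemma same_tree_cld: "same_tree T T' \<Longrightarrow> cld T' v = cld T v"
  by (auto simp: same_tree_def cld_def)

lemma same_tree_ocld: "same_tree T T' \<Longrightarrow> v \<in> verts T \<Longrightarrow> ocld T' v = ocld T v"
  unfolding ocld_def by (simp add: same_tree_cld) (simp add: same_tree_def)

lemma same_tree_labels: "same_tree T T' \<Longrightarrow> labels T' = labels T"
  by (auto simp: same_tree_def labels_def)

lemma same_tree_mor:
  assumes T: "labeled_tree S T" and s: "same_tree T T'"
  shows "labeled_tree S T'" "tree_mor id id T T'"
proof -
  have st: "verts T' = verts T" "root T' = root T"
    "\<And>v. v \<in> verts T \<Longrightarrow> v \<noteq> root T \<Longrightarrow> parent T' v = parent T v"
    "\<And>v. v \<in> verts T \<Longrightarrow> lb T' v = lb T v" using s by (auto simp: same_tree_def)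
  show "labeled_tree S T'"
  proof (rule labeled_treeI)
    fix Q v assume "Q (root T')" "\<And>u. u \<in> verts T' \<Longrightarrow> u \<noteq> root T' \<Longrightarrow> Q (parent T' u) \<Longrightarrow> Q u" "v \<in> verts T'"
    then show "Q v" using tree_induct[OF T, of v Q] st by auto
  next
    show "2 \<le> card (ocld T' v)" if "v \<in> verts T'" for v
      using that st same_tree_ocld[OF s] lt_card_ocld(2)[OF T] by simp
    show "v = w" if "v \<in> verts T'" "w \<in> verts T'" "s \<in> lb T' v" "s \<in> lb T' w" for v w s
      using that st lt_lbdisj[OF T, of v w s] by simp
  qed (use st lt_finite[OF T] lt_root[OF T] lt_parent[OF T] lt_finS[OF T] lt_disj[OF T]
        same_tree_labels[OF s] lt_labels[OF T] in auto)
  show "tree_mor id id T T'"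
  proof (rule tree_morI[where r = id])
    show "bij_betw id (labels T) (labels T')" using same_tree_labels[OF s] by simp
    show "id w \<in> verts T \<and> id (id w) = w \<and> (id w = root T \<or> id (parent T (id w)) \<noteq> w)"
      if "w \<in> verts T'" for w using that st parent_neq[OF T, of w] by auto
    show "lb T' w = id ` (\<Union>v\<in>{v \<in> verts T. id v = w}. lb T v)" if "w \<in> verts T'" for w
    proof -
      have "{v \<in> verts T. id v = w} = {w}" using that st by auto
      then show ?thesis using st(4)[of w] that st(1) by simp
    qed
  qed (use st in auto)
qed

text \<open>The functor laws determine a composition only together with a subsequent relabeling, and do not place
its bare value in a space of operations. In a manifold operad \<open>Decom P S\<close> is the boundary, which gives
the second assumption.\<close>

locale trunc_operad =
  fixes n :: enat and P :: "'a operad"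
  assumes oper: "truncated_operad n P"
    and Decom_subset: "arity_set n S \<Longrightarrow> Decom P S \<subseteq> topspace (opspace P S)"
begin

definition tree_in :: "nat set \<Rightarrow> ltree \<Rightarrow> bool" where
  "tree_in S T \<longleftrightarrow> labeled_tree S T \<and> enat (card S) \<le> n"

abbreviation Ops :: "nat set \<Rightarrow> 'a set" where "Ops S \<equiv> topspace (opspace P S)"
abbreviation pts :: "ltree \<Rightarrow> (nat \<Rightarrow> 'a) set" where "pts T \<equiv> topspace (tree_space P T)"

lemma tree_inD: assumes "tree_in S T"
  shows tin_lt: "labeled_tree S T" and tin_upto: "tree_upto n T" and tin_arity: "arity_set n S"
  using assms lt_labels lt_finS lt_card_labels by (auto simp: tree_in_def tree_upto_def arity_set_def)

lemma tree_inI: "labeled_tree S T \<Longrightarrow> arity_set n S \<Longrightarrow> tree_in S T"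
  by (simp add: tree_in_def arity_set_def)

lemma tin_ocld: "tree_in S T \<Longrightarrow> v \<in> verts T \<Longrightarrow> arity_set n (ocld T v)"
  unfolding arity_set_def
  using lt_card_ocld_leS[OF tin_lt] lt_card_ocld(2)[OF tin_lt] lt_finite_ocld(3)[OF tin_lt]
  by (meson enat_ord_simps(1) order_trans tree_in_def)

lemma arity_bij: "arity_set n S \<Longrightarrow> bij_betw \<sigma> S S' \<Longrightarrow> arity_set n S'"
  unfolding arity_set_def using bij_betw_same_card[of \<sigma> S S'] bij_betw_finite[of \<sigma> S S'] by simp

lemma tin_mor_bij: "tree_in S T \<Longrightarrow> tree_in S' T' \<Longrightarrow> tree_mor \<sigma> f T T' \<Longrightarrow> bij_betw \<sigma> S S'"
  using mor_bij[of \<sigma> f T T'] lt_labels[OF tin_lt] by metis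

lemma pts_iff: "x \<in> pts T \<longleftrightarrow> x \<in> (\<Pi>\<^sub>E v\<in>verts T. Ops (ocld T v))"
  by (simp add: tree_space_def)

lemma pts_D: "x \<in> pts T \<Longrightarrow> v \<in> verts T \<Longrightarrow> x v \<in> Ops (ocld T v)"
  unfolding pts_iff by auto

lemma pts_eqI: "x \<in> pts T \<Longrightarrow> y \<in> pts T \<Longrightarrow> (\<And>v. v \<in> verts T \<Longrightarrow> x v = y v) \<Longrightarrow> x = y"
  unfolding pts_iff by (rule PiE_ext)

lemma pts_restrict: "x \<in> pts T \<Longrightarrow> restrict x (verts T) = x"
  unfolding pts_iff by (rule PiE_restrict)

lemmas operad_laws = oper[unfolded truncated_operad_def]
lemmas law_cont = operad_laws[THEN conjunct1]
  and law_comp = operad_laws[THEN conjunct2, THEN conjunct1]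
  and law_corolla = operad_laws[THEN conjunct2, THEN conjunct2, THEN conjunct1]
  and law_id = operad_laws[THEN conjunct2, THEN conjunct2, THEN conjunct2, THEN conjunct1]
  and law_relabel = operad_laws[THEN conjunct2, THEN conjunct2, THEN conjunct2, THEN conjunct2]

lemma tree_map_cont:
  assumes "tree_in S T" "tree_in S' T'" "tree_mor \<sigma> f T T'"
  shows "continuous_map (tree_space P T) (tree_space P T') (tree_map P \<sigma> f T T')"
  using law_cont assms tin_upto by blast

lemma tree_map_in:
  assumes "tree_in S T" "tree_in S' T'" "tree_mor \<sigma> f T T'" "x \<in> pts T"
  shows "tree_map P \<sigma> f T T' x \<in> pts T'"
  using continuous_map_funspace[OF tree_map_cont[OF assms(1-3)]] assms(4) by blast

lemma tree_map_comp:
  assumes "tree_in S T" "tree_in S' T'" "tree_in S'' T''" "tree_mor \<sigma> f T T'" "tree_mor \<tau> g T' T''" "x \<in> pts T"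
  shows "tree_map P \<tau> g T' T'' (tree_map P \<sigma> f T T' x) = tree_map P (\<tau> \<circ> \<sigma>) (g \<circ> f) T T'' x"
  using law_comp assms tin_upto by metis

lemma opcomp_corolla:
  assumes "tree_in S T" "\<not> decomposable T" "x \<in> pts T"
  shows "opcomp P T x = x (root T)"
  using law_corolla assms tin_upto by blast

lemma tree_map_id:
  assumes "tree_in S T" "x \<in> pts T" shows "tree_map P id id T T x = x"
  using law_id assms tin_upto by blast

lemma oprel_cong:
  assumes "arity_set n S" "bij_betw \<sigma> S S'" "\<And>s. s \<in> S \<Longrightarrow> \<tau> s = \<sigma> s" "a \<in> Ops S"
  shows "oprelabel P S S' \<tau> a = oprelabel P S S' \<sigma> a"
  using law_relabel assms by metis

subsection \<open>Composition and relabeling\<close>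

text \<open>An operation is a label of a one-vertex tree. The laws for relabelings and compositions are
functor laws for morphisms to one-vertex trees, whose vertex has to be different from all labels
involved.\<close>

lemma opcomp_in:
  assumes T: "tree_in S T" and x: "x \<in> pts T" shows "opcomp P T x \<in> Ops S"
proof (cases "decomposable T")
  case True
  then show ?thesis using Decom_subset[OF tin_arity[OF T]] tin_lt[OF T] x by (auto simp: Decom_def)
next
  case False
  then show ?thesis
    using opcomp_corolla[OF T False x] pts_D[OF x lt_root[OF tin_lt[OF T]]] ocld_root_corolla(2)[OF tin_lt[OF T]] by simp
qed

lemma corolla_in: "arity_set n S \<Longrightarrow> v \<notin> S \<Longrightarrow> tree_in S (corolla S v)"
  by (simp add: tree_in_def arity_set_def corolla_labeled)

lemma corolla_pts: "a \<in> Ops S \<Longrightarrow> (\<lambda>u\<in>{v}. a) \<in> pts (corolla S v)"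
  by (simp add: pts_iff)

lemma tree_map_const:
  assumes T: "tree_in S T" and s: "bij_betw \<sigma> S S'" and x: "x \<in> pts T"
  shows "tree_map P \<sigma> (\<lambda>_. v) T (corolla S' v) x = (\<lambda>u\<in>{v}. oprelabel P S S' \<sigma> (opcomp P T x))"
proof -
  have "oprelabel P S S' (glue T \<sigma> (\<lambda>_. v)) (opcomp P T x) = oprelabel P S S' \<sigma> (opcomp P T x)"
    by (rule oprel_cong[OF tin_arity[OF T] s _ opcomp_in[OF T x]])
       (use lt_disj[OF tin_lt[OF T]] in \<open>auto simp: glue_def\<close>)
  then show ?thesis
    by (intro ext) (simp add: tree_map_def fiber_const[OF tin_lt[OF T]] lt_labels[OF tin_lt[OF T]] pts_restrict[OF x])
qed

lemma fresh2: "finite A \<Longrightarrow> finite B \<Longrightarrow> \<exists>v::nat. v \<notin> A \<and> v \<notin> B"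
  using fresh_ex[of "A \<union> B"] by auto

lemma oprel_corolla:
  assumes S: "arity_set n S" and s: "bij_betw \<sigma> S S'" and v: "v \<notin> S" and a: "a \<in> Ops S"
  shows "tree_map P \<sigma> (\<lambda>_. v) (corolla S v) (corolla S' v) (\<lambda>u\<in>{v}. a) = (\<lambda>u\<in>{v}. oprelabel P S S' \<sigma> a)"
proof -
  have "opcomp P (corolla S v) (\<lambda>u\<in>{v}. a) = a"
    using opcomp_corolla[OF corolla_in[OF S v] _ corolla_pts[OF a]] by simp
  then show ?thesis using tree_map_const[OF corolla_in[OF S v] s corolla_pts[OF a]] by simp
qed

lemma oprel_cont:
  assumes S: "arity_set n S" and s: "bij_betw \<sigma> S S'"
  shows "continuous_map (opspace P S) (opspace P S') (oprelabel P S S' \<sigma>)"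
proof -
  note S' = arity_bij[OF S s]
  obtain v where v: "v \<notin> S" "v \<notin> S'" using fresh2 S S' by (metis arity_set_def)
  have m: "tree_mor \<sigma> (\<lambda>_. v) (corolla S v) (corolla S' v)"
    by (rule const_mor[OF tin_lt[OF corolla_in[OF S v(1)]] s])
  have 1: "continuous_map (opspace P S) (tree_space P (corolla S v)) (\<lambda>a. \<lambda>u\<in>{v}. a)"
    unfolding tree_space_def by (auto simp: continuous_map_componentwise)
  have 2: "continuous_map (tree_space P (corolla S v)) (tree_space P (corolla S' v))
     (tree_map P \<sigma> (\<lambda>_. v) (corolla S v) (corolla S' v))"
    by (rule tree_map_cont[OF corolla_in[OF S v(1)] corolla_in[OF S' v(2)] m])
  have 3: "continuous_map (tree_space P (corolla S' v)) (opspace P S') (\<lambda>x. x v)"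
    unfolding tree_space_def
    using continuous_map_product_projection[of v "verts (corolla S' v)" "\<lambda>v. opspace P (ocld (corolla S' v) v)"]
    by simp
  have "continuous_map (opspace P S) (opspace P S')
    ((\<lambda>x. x v) \<circ> (tree_map P \<sigma> (\<lambda>_. v) (corolla S v) (corolla S' v) \<circ> (\<lambda>a. \<lambda>u\<in>{v}. a)))"
    by (intro continuous_map_compose[OF _ 3] continuous_map_compose[OF 1 2])
  then show ?thesis
    by (rule continuous_map_eq) (simp add: oprel_corolla[OF S s v(1)])
qed

lemma oprel_in: "arity_set n S \<Longrightarrow> bij_betw \<sigma> S S' \<Longrightarrow> a \<in> Ops S \<Longrightarrow> oprelabel P S S' \<sigma> a \<in> Ops S'"
  using continuous_map_funspace[OF oprel_cont] by blast

lemma oprel_comp: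
  assumes S: "arity_set n S" and s: "bij_betw \<sigma> S S'" and t: "bij_betw \<tau> S' S''" and a: "a \<in> Ops S"
  shows "oprelabel P S' S'' \<tau> (oprelabel P S S' \<sigma> a) = oprelabel P S S'' (\<tau> \<circ> \<sigma>) a"
proof -
  note S' = arity_bij[OF S s] note S'' = arity_bij[OF S' t]
  obtain v where v: "v \<notin> S \<union> S' \<union> S''" using fresh_ex[of "S \<union> S' \<union> S''"] S S' S'' by (auto simp: arity_set_def)
  then have v: "v \<notin> S" "v \<notin> S'" "v \<notin> S''" by auto
  note c = corolla_in[OF S v(1)] note c' = corolla_in[OF S' v(2)] note c'' = corolla_in[OF S'' v(3)]
  have m: "tree_mor \<sigma> (\<lambda>_. v) (corolla S v) (corolla S' v)" "tree_mor \<tau> (\<lambda>_. v) (corolla S' v) (corolla S'' v)"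
    using const_mor[OF tin_lt[OF c] s] const_mor[OF tin_lt[OF c'] t] by auto
  have e: "(\<lambda>_. v) \<circ> (\<lambda>_::nat. v) = (\<lambda>_. v)" by auto
  have "(\<lambda>u\<in>{v}. oprelabel P S' S'' \<tau> (oprelabel P S S' \<sigma> a)) = (\<lambda>u\<in>{v}. oprelabel P S S'' (\<tau> \<circ> \<sigma>) a)"
    using tree_map_comp[OF c c' c'' m corolla_pts[OF a]]
    unfolding e oprel_corolla[OF S s v(1) a] oprel_corolla[OF S' t v(2) oprel_in[OF S s a]]
      oprel_corolla[OF S bij_betw_trans[OF s t] v(1) a] .
  then show ?thesis by (metis restrict_apply' singletonI)
qed

lemma oprel_id:
  assumes S: "arity_set n S" and a: "a \<in> Ops S" shows "oprelabel P S S id a = a"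
proof -
  obtain v where v: "v \<notin> S" using fresh_ex S by (metis arity_set_def)
  note c = corolla_in[OF S v]
  have i: "bij_betw id S S" by simp
  have "tree_map P id (\<lambda>_. v) (corolla S v) (corolla S v) (\<lambda>u\<in>{v}. a) = tree_map P id id (corolla S v) (corolla S v) (\<lambda>u\<in>{v}. a)"
  proof -
    have "fiber (corolla S v) (\<lambda>_. v) w = fiber (corolla S v) id w" if "w = v" for w
      using that by (intro fiber_cong[OF tin_lt[OF c]]) simp
    moreover have "glue (corolla S v) id (\<lambda>_. v) = glue (corolla S v) id id" by (auto simp: glue_def)
    ultimately show ?thesis by (intro ext) (simp add: tree_map_def)
  qed
  then have "(\<lambda>u\<in>{v}. oprelabel P S S id a) = (\<lambda>u\<in>{v}. a)"
    using tree_map_id[OF c corolla_pts[OF a]] oprel_corolla[OF S i v a] by simp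
  then show ?thesis by (metis restrict_apply' singletonI)
qed

lemma oprel_id':
  assumes "arity_set n S" "a \<in> Ops S" "\<And>s. s \<in> S \<Longrightarrow> \<sigma> s = s" shows "oprelabel P S S \<sigma> a = a"
  using oprel_cong[of S id S \<sigma> a] oprel_id assms by simp

lemma oprel_inj:
  assumes S: "arity_set n S" and s: "bij_betw \<sigma> S S'" and a: "a \<in> Ops S" "b \<in> Ops S"
    and e: "oprelabel P S S' \<sigma> a = oprelabel P S S' \<sigma> b"
  shows "a = b"
proof -
  note i = bij_betw_inv_into[OF s]
  have "oprelabel P S' S (inv_into S \<sigma>) (oprelabel P S S' \<sigma> c) = c" if "c \<in> Ops S" for c
    unfolding oprel_comp[OF S s i that]
    by (rule oprel_id'[OF S that]) (use s in \<open>auto simp: bij_betw_def\<close>)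
  then show ?thesis using a e by metis
qed

lemma opcomp_nat:
  assumes T: "tree_in S T" and T': "tree_in S' T'" and m: "tree_mor \<sigma> f T T'" and x: "x \<in> pts T"
  shows "opcomp P T' (tree_map P \<sigma> f T T' x) = oprelabel P S S' \<sigma> (opcomp P T x)"
proof -
  note S = tin_arity[OF T] note S' = tin_arity[OF T'] note s = tin_mor_bij[OF T T' m]
  obtain v where v: "v \<notin> S'" using fresh_ex S' by (metis arity_set_def)
  note c = corolla_in[OF S' v]
  have mc: "tree_mor id (\<lambda>_. v) T' (corolla S' v)" by (rule const_mor[OF tin_lt[OF T']]) simp
  have i: "bij_betw id S' S'" by simp
  note fx = tree_map_in[OF T T' m x]
  have e: "(\<lambda>_. v) \<circ> f = (\<lambda>_. v)" by auto
  have "(\<lambda>u\<in>{v}. oprelabel P S' S' id (opcomp P T' (tree_map P \<sigma> f T T' x))) = (\<lambda>u\<in>{v}. oprelabel P S S' \<sigma> (opcomp P T x))"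
    using tree_map_comp[OF T T' c m mc x] tree_map_const[OF T' i fx, of v] tree_map_const[OF T s x, of v]
    unfolding e by simp
  then have "oprelabel P S' S' id (opcomp P T' (tree_map P \<sigma> f T T' x)) = oprelabel P S S' \<sigma> (opcomp P T x)"
    by (metis restrict_apply' singletonI)
  then show ?thesis using oprel_id[OF S' opcomp_in[OF T' fx]] by simp
qed

lemma same_tree_in: "tree_in S T \<Longrightarrow> same_tree T T' \<Longrightarrow> tree_in S T'"
  using same_tree_mor(1) by (auto simp: tree_in_def)

lemma opcomp_same:
  assumes T: "tree_in S T" and s: "same_tree T T'" and x: "x \<in> pts T"
  shows "opcomp P T' x = opcomp P T x"
proof -
  note T' = same_tree_in[OF T s] note m = same_tree_mor(2)[OF tin_lt[OF T] s]
  have "tree_map P id id T T' x = tree_map P id id T T x"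
    unfolding tree_map_def using s same_tree_ocld[OF s] by (intro ext) (auto simp: same_tree_def)
  then have e: "tree_map P id id T T' x = x" using tree_map_id[OF T x] by simp
  show ?thesis using opcomp_nat[OF T T' m x] oprel_id[OF tin_arity[OF T] opcomp_in[OF T x]] unfolding e by simp
qed

subsection \<open>Components of induced maps\<close>

lemma fiber_in:
  assumes T: "tree_in S T" and T': "tree_in S' T'" and m: "tree_mor \<sigma> f T T'" and w: "w \<in> verts T'"
  shows "tree_in (labels (fiber T f w)) (fiber T f w)"
proof -
  have "card (labels (fiber T f w)) = card (ocld T' w)"
    by (rule bij_betw_same_card[OF glue_bij[OF tin_lt[OF T] tin_lt[OF T'] m w]])
  then show ?thesis
    using fiber_labeled[OF tin_lt[OF T] m w] tin_ocld[OF T' w] by (simp add: tree_in_def arity_set_def)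
qed

lemma fiber_pts:
  assumes T: "tree_in S T" and m: "tree_mor \<sigma> f T T'" and x: "x \<in> pts T"
  shows "restrict x (verts (fiber T f w)) \<in> pts (fiber T f w)"
  unfolding pts_iff
proof (rule PiE_I)
  fix v assume v: "v \<in> verts (fiber T f w)"
  then have "v \<in> verts T" "f v = w" by auto
  then show "restrict x (verts (fiber T f w)) v \<in> Ops (ocld (fiber T f w) v)"
    using ocld_fiber[OF tin_lt[OF T] m, of v] pts_D[OF x, of v] by auto
qed auto

lemma tree_map_apply:
  "w \<in> verts T' \<Longrightarrow> tree_map P \<sigma> f T T' x w =
     oprelabel P (labels (fiber T f w)) (ocld T' w) (glue T \<sigma> f)
       (opcomp P (fiber T f w) (restrict x (verts (fiber T f w))))"
  by (simp add: tree_map_def)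

lemma fiber_comp_in:
  assumes "tree_in S T" "tree_in S' T'" "tree_mor \<sigma> f T T'" "w \<in> verts T'" "x \<in> pts T"
  shows "opcomp P (fiber T f w) (restrict x (verts (fiber T f w))) \<in> Ops (labels (fiber T f w))"
  by (rule opcomp_in[OF fiber_in[OF assms(1-4)] fiber_pts[OF assms(1,3,5)]])

lemma tree_map_cong:
  assumes T: "tree_in S T" and T': "tree_in S' T'" and m: "tree_mor \<sigma> f T T'"
    and f: "\<And>v. v \<in> verts T \<Longrightarrow> g v = f v" and s: "\<And>s. s \<in> S \<Longrightarrow> \<tau> s = \<sigma> s" and x: "x \<in> pts T"
  shows "tree_map P \<tau> g T T' x = tree_map P \<sigma> f T T' x"
proof (rule ext)
  fix w
  show "tree_map P \<tau> g T T' x w = tree_map P \<sigma> f T T' x w"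
  proof (cases "w \<in> verts T'")
    case True
    note b = glue_bij[OF tin_lt[OF T] tin_lt[OF T'] m True]
    have gl: "glue T \<tau> g u = glue T \<sigma> f u" if u: "u \<in> labels (fiber T f w)" for u
    proof (cases "u \<in> verts T")
      case False
      then have "u \<in> S" using u lt_lb[OF tin_lt[OF T]] unfolding labels_fiber[OF tin_lt[OF T]] by auto
      then show ?thesis using False s by (simp add: glue_def)
    qed (simp add: glue_def f)
    have fc: "fiber T g w = fiber T f w" by (rule fiber_cong[OF tin_lt[OF T]]) (rule f)
    show ?thesis
      unfolding tree_map_apply[OF True] fc
      by (rule oprel_cong[OF tin_arity[OF fiber_in[OF T T' m True]] b _ fiber_comp_in[OF T T' m True x]])
         (rule gl)
  qed (simp add: tree_map_def)
qed

lemma tree_map_noncontr: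
  assumes T: "tree_in S T" and T': "tree_in S' T'" and m: "tree_mor \<sigma> f T T'" and w: "w \<in> verts T'"
    and c: "\<And>v. v \<in> verts T \<Longrightarrow> f v = w \<Longrightarrow> \<not> contracts T f v" and x: "x \<in> pts T"
  shows "labels (fiber T f w) = ocld T (fiber_root T f w)"
    "bij_betw (glue T \<sigma> f) (ocld T (fiber_root T f w)) (ocld T' w)"
    "tree_map P \<sigma> f T T' x w = oprelabel P (ocld T (fiber_root T f w)) (ocld T' w) (glue T \<sigma> f) (x (fiber_root T f w))"
proof -
  let ?F = "fiber T f w" and ?r = "fiber_root T f w"
  note r = mor_froot[OF m w]
  have v: "v = ?r" if "v \<in> verts T" "f v = w" for v
  proof -
    have "fiber_root T f (f v) = v" using fiber_root_iff[OF m that(1)] c[OF that] by blast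
    then show ?thesis unfolding that(2) by (rule sym)
  qed
  have "verts ?F = {?r}" unfolding fiber_simps using v r(1,2) by blast
  then have nd: "\<not> decomposable ?F" unfolding decomposable_def fiber_simps(2) by blast
  note F = fiber_in[OF T T' m w]
  show l: "labels ?F = ocld T ?r"
    using ocld_root_corolla(2)[OF tin_lt[OF F] nd] ocld_fiber[OF tin_lt[OF T] m r(1)] r(2) by simp
  show "bij_betw (glue T \<sigma> f) (ocld T ?r) (ocld T' w)"
    using glue_bij[OF tin_lt[OF T] tin_lt[OF T'] m w] l by simp
  have "opcomp P ?F (restrict x (verts ?F)) = x ?r"
    using opcomp_corolla[OF F nd fiber_pts[OF T m x]] r by simp
  then show "tree_map P \<sigma> f T T' x w = oprelabel P (ocld T ?r) (ocld T' w) (glue T \<sigma> f) (x ?r)"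
    unfolding tree_map_apply[OF w] l by simp
qed

text \<open>Induced maps are local over a common contraction, which reduces equations between them to the
fibers.\<close>

lemma tree_map_restrict:
  assumes G: "tree_in S G" and G1: "tree_in S G1" and T: "tree_in S' T"
    and q: "tree_mor id q G G1" and f1: "tree_mor \<sigma> f1 G1 T" and w: "w \<in> verts T" and x: "x \<in> pts G"
  shows "tree_map P (glue G id q) q (fiber G (f1 \<circ> q) w) (fiber G1 f1 w) (restrict x (verts (fiber G (f1 \<circ> q) w)))
     = restrict (tree_map P id q G G1 x) (verts (fiber G1 f1 w))"
proof -
  define F F1 where "F = fiber G (f1 \<circ> q) w" and "F1 = fiber G1 f1 w"
  note lts = tin_lt[OF G] tin_lt[OF G1] tin_lt[OF T]
  have f: "tree_mor \<sigma> (f1 \<circ> q) G T" using tree_mor_comp(1)[OF tin_lt[OF G] q f1] by simp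
  note M = fiber_restrict_mor1[OF lts q f1 w, folded F_def F1_def]
  have Fin: "tree_in (labels F) F" unfolding F_def by (rule fiber_in[OF G T f w])
  have F1in: "tree_in (labels F1) F1" unfolding F1_def by (rule fiber_in[OF G1 T f1 w])
  have xF: "restrict x (verts F) \<in> pts F" unfolding F_def by (rule fiber_pts[OF G f x])
  have "tree_map P (glue G id q) q F F1 (restrict x (verts F)) u = restrict (tree_map P id q G G1 x) (verts F1) u" for u
  proof (cases "u \<in> verts F1")
    case True
    then have u: "u \<in> verts G1" "f1 u = w" by (auto simp: F1_def)
    note st = fiber_restrict_same[OF lts q f1 w u, folded F_def]
    let ?H = "fiber F q u"
    have H: "tree_in (labels ?H) ?H" by (rule fiber_in[OF Fin F1in M True])
    have vs: "verts (fiber G q u) = verts ?H" using st by (simp add: same_tree_def)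
    have vF: "verts ?H \<subseteq> verts F" by auto
    have y: "restrict (restrict x (verts F)) (verts ?H) = restrict x (verts (fiber G q u))"
      unfolding vs using vF by (auto simp: restrict_def fun_eq_iff)
    have yp: "restrict x (verts (fiber G q u)) \<in> pts ?H"
      using fiber_pts[OF Fin M xF, of u] unfolding y .
    have lb: "labels (fiber G q u) = labels ?H" by (rule same_tree_labels[OF st])
    have cmp: "opcomp P (fiber G q u) (restrict x (verts (fiber G q u))) = opcomp P ?H (restrict x (verts (fiber G q u)))"
      by (rule opcomp_same[OF H st yp])
    have oc: "ocld F1 u = ocld G1 u" unfolding F1_def using ocld_fiber[OF tin_lt[OF G1] f1 u(1)] u(2) by simp
    have gl: "glue F (glue G id q) q s = glue G id q s" for s by (auto simp: glue_def F_def)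
    show ?thesis
      unfolding tree_map_apply[OF True] y using True cmp
      by (simp add: tree_map_apply[OF u(1)] lb oc gl[abs_def])
  qed (simp add: tree_map_def)
  then show ?thesis unfolding F_def F1_def by blast
qed

subsection \<open>Decomposable operations\<close>

lemma Decom_iff: "a \<in> Decom P S \<longleftrightarrow> (\<exists>T x. labeled_tree S T \<and> decomposable T \<and> x \<in> pts T \<and> a = opcomp P T x)"
  by (auto simp: Decom_def)

lemma mor_noncontr_decomposable:
  assumes T: "labeled_tree S T" and m: "tree_mor \<sigma> f T T'" and c: "\<And>v. \<not> contracts T f v" and d: "decomposable T"
  shows "decomposable T'"
proof -
  obtain v where v: "v \<in> verts T" "v \<noteq> root T" using d decomposable_iff[OF T] by blast
  then have "f v \<in> verts T'" "f v \<noteq> root T'" using mor_noncontr(1)[OF m v c] mor_verts[OF m] by auto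
  then show ?thesis by (auto simp: decomposable_def)
qed

lemma oprel_Decom:
  assumes S: "arity_set n S" and s: "bij_betw \<sigma> S S'" and a: "a \<in> Decom P S"
  shows "oprelabel P S S' \<sigma> a \<in> Decom P S'"
proof -
  obtain T x where T: "labeled_tree S T" "decomposable T" "x \<in> pts T" "a = opcomp P T x"
    using a unfolding Decom_iff by blast
  obtain T' f where T': "labeled_tree S' T'" "tree_mor \<sigma> f T T'" "\<And>v. \<not> contracts T f v"
    using rename_ex[OF T(1) s] by blast
  note t = tree_inI[OF T(1) S] note t' = tree_inI[OF T'(1) arity_bij[OF S s]]
  have "oprelabel P S S' \<sigma> a = opcomp P T' (tree_map P \<sigma> f T T' x)"
    using opcomp_nat[OF t t' T'(2) T(3)] T(4) by simp
  then show ?thesis unfolding Decom_iff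
    using T'(1) mor_noncontr_decomposable[OF T(1) T'(2,3) T(2)] tree_map_in[OF t t' T'(2) T(3)] by blast
qed

text \<open>The fiber over the image of a contracted edge contains this edge.\<close>

lemma contracted_Decom:
  assumes T: "tree_in S T" and T': "tree_in S' T'" and m: "tree_mor \<sigma> f T T'" and c: "contracts T f v" and x: "x \<in> pts T"
  shows "f v \<in> verts T'" "tree_map P \<sigma> f T T' x (f v) \<in> Decom P (ocld T' (f v))"
proof -
  have v: "v \<in> verts T" using c by (simp add: contracts_def)
  show w: "f v \<in> verts T'" by (rule mor_verts[OF m v])
  note F = fiber_in[OF T T' m w]
  have "v \<noteq> fiber_root T f (f v)" using fiber_root_iff[OF m v] c by simp
  then have "decomposable (fiber T f (f v))" using v by (auto simp: decomposable_def)
  then have "opcomp P (fiber T f (f v)) (restrict x (verts (fiber T f (f v)))) \<in> Decom P (labels (fiber T f (f v)))"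
    unfolding Decom_iff using tin_lt[OF F] fiber_pts[OF T m x] by blast
  then show "tree_map P \<sigma> f T T' x (f v) \<in> Decom P (ocld T' (f v))"
    unfolding tree_map_apply[OF w]
    by (rule oprel_Decom[OF tin_arity[OF F] glue_bij[OF tin_lt[OF T] tin_lt[OF T'] m w]])
qed

end

section \<open>Finest decompositions are unique\<close>

lemma nondec_mor:
  assumes T: "labeled_tree S T" and T': "labeled_tree S' T'" and d: "\<not> decomposable T'" and s: "bij_betw \<sigma> S S'"
  shows "tree_mor \<sigma> (\<lambda>_. root T') T T'"
proof (rule tree_morI[where r = "\<lambda>_. root T"])
  have v: "verts T' = {root T'}" using d by (simp add: decomposable_def)
  show "bij_betw \<sigma> (labels T) (labels T')" using s lt_labels[OF T] lt_labels[OF T'] by simp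
  show "(\<lambda>_. root T') ` verts T = verts T'" using v lt_root[OF T] by auto
  show "lb T' w = \<sigma> ` (\<Union>u\<in>{u \<in> verts T. root T' = w}. lb T u)" if w: "w \<in> verts T'" for w
  proof -
    have "w = root T'" using w v by simp
    moreover have "lb T' w = S'" using w v lt_labels[OF T'] by (auto simp: labels_def)
    moreover have "\<sigma> ` S = S'" using s by (auto simp: bij_betw_def)
    ultimately show ?thesis using lt_labels[OF T] by (auto simp: labels_def)
  qed
  show "root T \<in> verts T \<and> root T' = w \<and> (root T = root T \<or> root T' \<noteq> w)" if "w \<in> verts T'" for w
    using that v lt_root[OF T] by auto
qed auto

text \<open>Injectivity of the map from the colimit to \<open>Decom P S\<close>, in terms of representatives.\<close>

locale unique_operad = trunc_operad +
  assumes colim_inj: "\<lbrakk>arity_set n S; labeled_tree S T; decomposable T; x \<in> topspace (tree_space P T);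
     labeled_tree S T'; decomposable T'; x' \<in> topspace (tree_space P T'); opcomp P T x = opcomp P T' x'\<rbrakk>
     \<Longrightarrow> equivclp (colim_step P S) (T, x) (T', x')"
begin

definition prime_labels :: "ltree \<Rightarrow> (nat \<Rightarrow> 'a) \<Rightarrow> bool" where
  "prime_labels T x \<longleftrightarrow> (\<forall>v\<in>verts T. x v \<notin> Decom P (ocld T v))"

text \<open>Only the source of the morphism has to be indecomposable. Between two trees with indecomposable
labels there are morphisms in both directions, which is the uniqueness.\<close>

definition finest_unique :: "nat set \<Rightarrow> bool" where
  "finest_unique S \<longleftrightarrow> (\<forall>T T' x x'. labeled_tree S T \<longrightarrow> labeled_tree S T' \<longrightarrow> x \<in> pts T \<longrightarrow> x' \<in> pts T' \<longrightarrow>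
     prime_labels T x \<longrightarrow> opcomp P T x = opcomp P T' x' \<longrightarrow>
     (\<exists>g. tree_mor id g T T' \<and> tree_map P id g T T' x = x'))"

lemma tree_map_nondec:
  assumes T: "tree_in S T" and T': "tree_in S' T'" and d: "\<not> decomposable T'" and s: "bij_betw \<sigma> S S'" and x: "x \<in> pts T"
  shows "tree_map P \<sigma> (\<lambda>_. root T') T T' x = (\<lambda>u\<in>{root T'}. oprelabel P S S' \<sigma> (opcomp P T x))"
proof -
  note v = ocld_root_corolla[OF tin_lt[OF T'] d]
  have "tree_map P \<sigma> (\<lambda>_. root T') T T' x = tree_map P \<sigma> (\<lambda>_. root T') T (corolla S' (root T')) x"
    using v by (intro ext) (auto simp: tree_map_def)
  then show ?thesis using tree_map_const[OF T s x] by simp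
qed

text \<open>Reduced to the case of equal label sets by renaming \<open>T'\<close> along the inverse of \<open>\<sigma>\<close>.\<close>

lemma finest_unique_bij:
  assumes U: "finest_unique S" and T: "tree_in S T" and T': "tree_in S' T'" and s: "bij_betw \<sigma> S S'"
    and x: "x \<in> pts T" and x': "x' \<in> pts T'" and i: "prime_labels T x"
    and e: "oprelabel P S S' \<sigma> (opcomp P T x) = opcomp P T' x'"
  shows "\<exists>g. tree_mor \<sigma> g T T' \<and> tree_map P \<sigma> g T T' x = x'"
proof -
  note S = tin_arity[OF T] note S' = tin_arity[OF T']
  let ?\<iota> = "inv_into S \<sigma>"
  note b = bij_betw_inv_into[OF s]
  obtain R k where R: "labeled_tree S R" and k: "tree_mor ?\<iota> k T' R" and kc: "\<And>v. \<not> contracts T' k v"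
    using rename_ex[OF tin_lt[OF T'] b] by blast
  note Rin = tree_inI[OF R S]
  define y where "y = tree_map P ?\<iota> k T' R x'"
  have y: "y \<in> pts R" unfolding y_def by (rule tree_map_in[OF T' Rin k x'])
  have "opcomp P R y = oprelabel P S' S ?\<iota> (oprelabel P S S' \<sigma> (opcomp P T x))"
    unfolding y_def opcomp_nat[OF T' Rin k x'] e ..
  also have "\<dots> = opcomp P T x"
    unfolding oprel_comp[OF S s b opcomp_in[OF T x]]
    by (rule oprel_id'[OF S opcomp_in[OF T x]]) (use s in \<open>auto simp: bij_betw_def\<close>)
  finally obtain g where g: "tree_mor id g T R" "tree_map P id g T R x = y"
    using U tin_lt[OF T] R x y i unfolding finest_unique_def by metis
  note inv = iso_inverse[OF tin_lt[OF T'] k kc]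
  let ?k = "fiber_root T' k" and ?\<sigma> = "inv_into S' ?\<iota>"
  have s2: "?\<sigma> s = \<sigma> s" if "s \<in> S" for s using inv_into_inv_into_eq[OF s that] .
  have M: "tree_mor (?\<sigma> \<circ> id) (?k \<circ> g) T T'" by (rule tree_mor_comp(1)[OF tin_lt[OF T] g(1) inv(1)])
  have "tree_map P (?\<sigma> \<circ> id) (?k \<circ> g) T T' x = tree_map P ?\<sigma> ?k R T' y"
    using tree_map_comp[OF T Rin T' g(1) inv(1) x] g(2) by simp
  also have "\<dots> = tree_map P (?\<sigma> \<circ> ?\<iota>) (?k \<circ> k) T' T' x'"
    unfolding y_def by (rule tree_map_comp[OF T' Rin T' k inv(1) x'])
  also have "\<dots> = tree_map P id id T' T' x'"
  proof (rule tree_map_cong[OF T' T' _ _ _ x'])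
    show "tree_mor id id T' T'" by (rule same_tree_mor(2)[OF tin_lt[OF T']]) (simp add: same_tree_def)
    show "(?k \<circ> k) v = id v" if "v \<in> verts T'" for v using inv(2)[OF that] by simp
    show "(?\<sigma> \<circ> ?\<iota>) s = id s" if "s \<in> S'" for s
      using that b by (auto simp: bij_betw_def)
  qed
  also have "\<dots> = x'" by (rule tree_map_id[OF T' x'])
  finally have E: "tree_map P (?\<sigma> \<circ> id) (?k \<circ> g) T T' x = x'" .
  have M': "tree_mor \<sigma> (?k \<circ> g) T T'" by (rule tree_mor_cong[OF tin_lt[OF T] M]) (use s2 in auto)
  have "tree_map P \<sigma> (?k \<circ> g) T T' x = tree_map P (?\<sigma> \<circ> id) (?k \<circ> g) T T' x"
    by (rule tree_map_cong[OF T T' M _ _ x]) (use s2 in auto)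
  then show ?thesis using M' E by metis
qed

text \<open>Over each vertex of \<open>U\<close> the fibers of the two trees decompose the same operation, so
uniqueness in the fibers gives morphisms between them, and these assemble.\<close>

lemma diamond_step:
  assumes T: "tree_in S T" and T'': "tree_in S T''" and U: "tree_in S U"
    and f: "tree_mor id f T U" and f'': "tree_mor id f'' T'' U"
    and x: "x \<in> pts T" and x'': "x'' \<in> pts T''" and i: "prime_labels T x"
    and e: "tree_map P id f T U x = tree_map P id f'' T'' U x''"
    and D: "\<And>w. w \<in> verts U \<Longrightarrow> finest_unique (labels (fiber T f w))"
  shows "\<exists>g. tree_mor id g T T'' \<and> tree_map P id g T T'' x = x'' \<and> (\<forall>v\<in>verts T. f'' (g v) = f v)"
proof -
  note lT = tin_lt[OF T] note lT'' = tin_lt[OF T''] note lU = tin_lt[OF U]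
  define \<tau> where "\<tau> w = inv_into (labels (fiber T'' f'' w)) (glue T'' id f'') \<circ> glue T id f" for w
  have \<tau>: "\<tau> w u = (if u \<in> verts T then fiber_root T'' f'' (f u) else u)"
    if w: "w \<in> verts U" and u: "u \<in> labels (fiber T f w)" for w u
  proof -
    have inj: "inj_on (glue T'' id f'') (labels (fiber T'' f'' w))"
      using glue_bij[OF lT'' lU f'' w] by (simp add: bij_betw_def)
    show ?thesis
    proof (cases "u \<in> verts T")
      case True
      then have uu: "u \<noteq> root T" "f u \<noteq> w" "f (parent T u) = w"
        using u lt_lb[OF lT] lt_disj[OF lT] unfolding labels_fiber[OF lT] by auto
      then have p: "f u \<noteq> root U" "parent U (f u) = w" using mor_edge[OF f True] by auto
      note fu = mor_verts[OF f True]
      let ?r = "fiber_root T'' f'' (f u)"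
      have r: "?r \<in> verts T''" "f'' ?r = f u" "?r \<noteq> root T''" "f'' (parent T'' ?r) = w"
        using mor_froot[OF f'' fu] froot_nonroot[OF f'' fu p(1)] p(2) by auto
      then have "?r \<in> labels (fiber T'' f'' w)" unfolding labels_fiber[OF lT''] using uu by auto
      then have "inv_into (labels (fiber T'' f'' w)) (glue T'' id f'') (f u) = ?r"
        by (rule inv_into_f_eq[OF inj]) (use r in \<open>simp add: glue_def\<close>)
      then show ?thesis using True by (simp add: \<tau>_def glue_def)
    next
      case False
      then obtain v where v: "v \<in> verts T" "f v = w" "u \<in> lb T v" using u unfolding labels_fiber[OF lT] by auto
      then have "u \<in> lb U w" using mor_lb_iff[OF f w] by blast
      then obtain v'' where v'': "v'' \<in> verts T''" "f'' v'' = w" "u \<in> lb T'' v''" using mor_lb_iff[OF f'' w] by blast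
      then have "u \<in> labels (fiber T'' f'' w)" unfolding labels_fiber[OF lT''] by blast
      moreover have "u \<notin> verts T''" using v'' lt_lb[OF lT''] lt_disj[OF lT''] by blast
      ultimately have "inv_into (labels (fiber T'' f'' w)) (glue T'' id f'') u = u"
        by (intro inv_into_f_eq[OF inj]) (simp_all add: glue_def)
      then show ?thesis using False by (simp add: \<tau>_def glue_def)
    qed
  qed
  have "\<exists>g. tree_mor (\<tau> w) g (fiber T f w) (fiber T'' f'' w) \<and>
      tree_map P (\<tau> w) g (fiber T f w) (fiber T'' f'' w) (restrict x (verts (fiber T f w))) =
      restrict x'' (verts (fiber T'' f'' w))" if w: "w \<in> verts U" for w
  proof (rule finest_unique_bij[OF D[OF w]])
    note b = glue_bij[OF lT lU f w] note b'' = glue_bij[OF lT'' lU f'' w]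
    show F: "tree_in (labels (fiber T f w)) (fiber T f w)" by (rule fiber_in[OF T U f w])
    show F'': "tree_in (labels (fiber T'' f'' w)) (fiber T'' f'' w)" by (rule fiber_in[OF T'' U f'' w])
    show bt: "bij_betw (\<tau> w) (labels (fiber T f w)) (labels (fiber T'' f'' w))"
      unfolding \<tau>_def by (rule bij_betw_trans[OF b bij_betw_inv_into[OF b'']])
    show "restrict x (verts (fiber T f w)) \<in> pts (fiber T f w)" by (rule fiber_pts[OF T f x])
    show "restrict x'' (verts (fiber T'' f'' w)) \<in> pts (fiber T'' f'' w)" by (rule fiber_pts[OF T'' f'' x''])
    show "prime_labels (fiber T f w) (restrict x (verts (fiber T f w)))"
      unfolding prime_labels_def
    proof
      fix v assume v: "v \<in> verts (fiber T f w)"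
      then have "v \<in> verts T" "f v = w" by auto
      then show "restrict x (verts (fiber T f w)) v \<notin> Decom P (ocld (fiber T f w) v)"
        using ocld_fiber[OF lT f, of v] i by (auto simp: prime_labels_def)
    qed
    let ?a = "opcomp P (fiber T f w) (restrict x (verts (fiber T f w)))"
    let ?b = "opcomp P (fiber T'' f'' w) (restrict x'' (verts (fiber T'' f'' w)))"
    have a: "?a \<in> Ops (labels (fiber T f w))" by (rule fiber_comp_in[OF T U f w x])
    have bb: "?b \<in> Ops (labels (fiber T'' f'' w))" by (rule fiber_comp_in[OF T'' U f'' w x''])
    show "oprelabel P (labels (fiber T f w)) (labels (fiber T'' f'' w)) (\<tau> w) ?a = ?b"
    proof (rule oprel_inj[OF tin_arity[OF F''] b'' oprel_in[OF tin_arity[OF F] bt a] bb])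
      have "oprelabel P (labels (fiber T f w)) (ocld U w) (glue T'' id f'' \<circ> \<tau> w) ?a =
          oprelabel P (labels (fiber T f w)) (ocld U w) (glue T id f) ?a"
      proof (rule oprel_cong[OF tin_arity[OF F] b _ a])
        fix s assume "s \<in> labels (fiber T f w)"
        then have "glue T id f s \<in> ocld U w" using b by (auto simp: bij_betw_def)
        then show "(glue T'' id f'' \<circ> \<tau> w) s = glue T id f s"
          using b'' by (simp add: \<tau>_def bij_betw_inv_into_right)
      qed
      then show "oprelabel P (labels (fiber T'' f'' w)) (ocld U w) (glue T'' id f'')
         (oprelabel P (labels (fiber T f w)) (labels (fiber T'' f'' w)) (\<tau> w) ?a) =
         oprelabel P (labels (fiber T'' f'' w)) (ocld U w) (glue T'' id f'') ?b"
        using fun_cong[OF e, of w] unfolding tree_map_apply[OF w] oprel_comp[OF tin_arity[OF F] bt b'' a] by simp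
    qed
  qed
  then obtain g where g: "\<And>w. w \<in> verts U \<Longrightarrow> tree_mor (\<tau> w) (g w) (fiber T f w) (fiber T'' f'' w)"
    and gx: "\<And>w. w \<in> verts U \<Longrightarrow> tree_map P (\<tau> w) (g w) (fiber T f w) (fiber T'' f'' w)
      (restrict x (verts (fiber T f w))) = restrict x'' (verts (fiber T'' f'' w))" by metis
  define h where "h v = g (f v) v" for v
  have h: "tree_mor id h T T''" and fh: "\<And>v. v \<in> verts T \<Longrightarrow> f'' (h v) = f v"
    unfolding h_def using tree_mor_assemble[OF lT lT'' f f'' g \<tau>] by blast+
  have "tree_map P id h T T'' x = x''"
  proof (rule pts_eqI[OF tree_map_in[OF T T'' h x] x''])
    fix u assume u: "u \<in> verts T''"
    let ?w = "f'' u"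
    have w: "?w \<in> verts U" by (rule mor_verts[OF f'' u])
    have fc: "fiber T (f'' \<circ> h) ?w = fiber T f ?w" by (rule fiber_cong[OF lT]) (simp add: fh)
    have "tree_map P (glue T id h) h (fiber T f ?w) (fiber T'' f'' ?w) (restrict x (verts (fiber T f ?w))) =
       tree_map P (\<tau> ?w) (g ?w) (fiber T f ?w) (fiber T'' f'' ?w) (restrict x (verts (fiber T f ?w)))"
    proof (rule tree_map_cong[OF fiber_in[OF T U f w] fiber_in[OF T'' U f'' w] g[OF w] _ _ fiber_pts[OF T f x]])
      show "h v = g ?w v" if "v \<in> verts (fiber T f ?w)" for v using that by (simp add: h_def)
      fix s assume s: "s \<in> labels (fiber T f ?w)"
      show "glue T id h s = \<tau> ?w s"
      proof (cases "s \<in> verts T")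
        case True
        then have "s \<noteq> root T" "f s \<noteq> ?w" "f (parent T s) = ?w"
          using s lt_lb[OF lT] lt_disj[OF lT] unfolding labels_fiber[OF lT] by auto
        then have "fiber_root T f (f s) = s" using froot_eq[OF f True] by simp
        then have "g (f s) s = fiber_root T'' f'' (f s)" using mor_root[OF g[OF mor_verts[OF f True]]] by simp
        then show ?thesis using True \<tau>[OF w s] by (simp add: glue_def h_def)
      next
        case False
        then show ?thesis using \<tau>[OF w s] by (simp add: glue_def)
      qed
    qed
    then have "restrict (tree_map P id h T T'' x) (verts (fiber T'' f'' ?w)) = restrict x'' (verts (fiber T'' f'' ?w))"
      using tree_map_restrict[OF T T'' U h f'' w x] gx[OF w] unfolding fc by simp
    from fun_cong[OF this, of u] show "tree_map P id h T T'' x u = x'' u" using u by simp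
  qed
  then show ?thesis using h fh by blast
qed

text \<open>An operation determines its decomposition into indecomposable ones. Injectivity of the map
  from the colimit gives a zigzag of contractions between two decompositions; going
  along it, a morphism from the finest tree survives a backward step by comparing the
  fibers, which have fewer inputs.\<close>

lemma finest_unique_all: "arity_set n S \<Longrightarrow> finest_unique S"
proof (induction "card S" arbitrary: S rule: less_induct)
  case less
  show ?case unfolding finest_unique_def
  proof (intro allI impI)
    fix T T' x x'
    assume lT: "labeled_tree S T" and lT': "labeled_tree S T'" and x: "x \<in> pts T" and x': "x' \<in> pts T'"
      and i: "prime_labels T x" and e: "opcomp P T x = opcomp P T' x'"
    note T = tree_inI[OF lT less.prems] note T' = tree_inI[OF lT' less.prems]
    show "\<exists>g. tree_mor id g T T' \<and> tree_map P id g T T' x = x'"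
    proof (cases "decomposable T'")
      case False
      note v = ocld_root_corolla[OF lT' False]
      have "tree_map P id (\<lambda>_. root T') T T' x = x'"
      proof (rule pts_eqI[OF _ x'])
        note m = nondec_mor[OF lT lT' False, of id]
        show "tree_map P id (\<lambda>_. root T') T T' x \<in> pts T'" by (rule tree_map_in[OF T T' m x]) simp
        show "tree_map P id (\<lambda>_. root T') T T' x u = x' u" if "u \<in> verts T'" for u
          using tree_map_nondec[OF T T' False _ x, of id] oprel_id[OF less.prems opcomp_in[OF T x]] that v e
            opcomp_corolla[OF T' False x'] by simp
      qed
      then show ?thesis using nondec_mor[OF lT lT' False, of id] by auto
    next
      case True
      have d: "decomposable T"
      proof (rule ccontr)
        assume nd: "\<not> decomposable T"
        then have "opcomp P T x \<notin> Decom P S"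
          using i opcomp_corolla[OF T nd x] ocld_root_corolla[OF lT nd] by (simp add: prime_labels_def)
        then show False using e True lT' x' unfolding Decom_iff by blast
      qed
      have "equivclp (colim_step P S) (T, x) (T', x')"
        by (rule colim_inj[OF less.prems lT d x lT' True x' e])
      then have "\<exists>g. tree_mor id g T (fst (T', x')) \<and> tree_map P id g T (fst (T', x')) x = snd (T', x')"
      proof (induction rule: equivclp_induct)
        case base
        have "tree_mor id id T T" by (rule same_tree_mor(2)[OF lT]) (simp add: same_tree_def)
        then show ?case unfolding fst_conv snd_conv using tree_map_id[OF T x] by blast
      next
        case (step p q)
        obtain Y y Z z where pq: "p = (Y, y)" "q = (Z, z)" by (metis surj_pair)
        have top: "p \<in> topspace (colim_sum P S)" "q \<in> topspace (colim_sum P S)"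
          using step(2) by (auto simp: colim_step_def)
        have Y: "tree_in S Y" "decomposable Y" "y \<in> pts Y" and Z: "tree_in S Z" "decomposable Z" "z \<in> pts Z"
          using top pq tree_inI[OF _ less.prems] by (auto simp: colim_sum_def)
        obtain g where g: "tree_mor id g T Y" "tree_map P id g T Y x = y" using step(3) unfolding pq fst_conv snd_conv by blast
        from step(2) show ?case
        proof
          assume "colim_step P S p q"
          then obtain f where f: "tree_mor id f Y Z" "z = tree_map P id f Y Z y" unfolding pq colim_step_def fst_conv snd_conv by blast
          have "tree_mor id (f \<circ> g) T Z" using tree_mor_comp(1)[OF lT g(1) f(1)] by simp
          moreover have "tree_map P id (f \<circ> g) T Z x = z"
            using tree_map_comp[OF T Y(1) Z(1) g(1) f(1) x] f(2) g(2) by simp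
          ultimately show ?thesis unfolding pq fst_conv snd_conv by blast
        next
          assume "colim_step P S q p"
          then obtain f where f: "tree_mor id f Z Y" "y = tree_map P id f Z Y z" unfolding pq colim_step_def fst_conv snd_conv by blast
          have "\<exists>h. tree_mor id h T Z \<and> tree_map P id h T Z x = z \<and> (\<forall>v\<in>verts T. f (h v) = g v)"
          proof (rule diamond_step[OF T Z(1) Y(1) g(1) f(1) x Z(3) i])
            show "tree_map P id g T Y x = tree_map P id f Z Y z" using g f by simp
            fix w assume w: "w \<in> verts Y"
            have "card (labels (fiber T g w)) = card (ocld Y w)"
              by (rule bij_betw_same_card[OF glue_bij[OF lT tin_lt[OF Y(1)] g(1) w]])
            then have "card (labels (fiber T g w)) < card S"
              using lt_card_ocld_less[OF tin_lt[OF Y(1)] w Y(2)] by simp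
            then show "finest_unique (labels (fiber T g w))"
              using less.hyps tin_arity[OF fiber_in[OF T Y(1) g(1) w]] by blast
          qed
          then show ?thesis unfolding pq fst_conv snd_conv by blast
        qed
      qed
      then show ?thesis unfolding fst_conv snd_conv .
    qed
  qed
qed

lemma diamond:
  assumes T: "tree_in S T" and T'': "tree_in S T''" and U: "tree_in S U"
    and f: "tree_mor id f T U" and f'': "tree_mor id f'' T'' U"
    and x: "x \<in> pts T" and x'': "x'' \<in> pts T''" and i: "prime_labels T x"
    and e: "tree_map P id f T U x = tree_map P id f'' T'' U x''"
  shows "\<exists>g. tree_mor id g T T'' \<and> tree_map P id g T T'' x = x'' \<and> (\<forall>v\<in>verts T. f'' (g v) = f v)"
  by (rule diamond_step[OF assms finest_unique_all[OF tin_arity[OF fiber_in[OF T U f]]]])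

end

section \<open>Evaluation of metric trees\<close>

text \<open>
The model is a collar \<open>B \<times> [0,1]\<close> in \<open>X\<close>, where \<open>s t\<close> multiplies the distance from the inner end by
\<open>t\<close> and fixes the points outside the collar. The last clause says that the points missed by \<open>s t\<close> are
those that \<open>B\<close> passes under the factors between \<open>t\<close> and \<open>1\<close>.\<close>

definition is_scaling :: "'a topology \<Rightarrow> 'a set \<Rightarrow> (real \<Rightarrow> 'a \<Rightarrow> 'a) \<Rightarrow> bool" where
  "is_scaling X B s \<longleftrightarrow>
     continuous_map (prod_topology (top_of_set {0..1}) X) X (\<lambda>(t, a). s t a) \<and>
     (\<forall>a\<in>topspace X. s 1 a = a) \<and>
     (\<forall>a\<in>topspace X. \<forall>t\<in>{0..1}. \<forall>u\<in>{0..1}. s t (s u a) = s (t * u) a) \<and>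
     (\<forall>a\<in>topspace X. \<forall>b\<in>topspace X. \<forall>t. 0 < t \<and> t \<le> 1 \<and> s t a = s t b \<longrightarrow> a = b) \<and>
     (\<forall>a\<in>topspace X. \<forall>t. 0 \<le> t \<and> t < 1 \<longrightarrow> s t a \<notin> B) \<and>
     (\<forall>a\<in>topspace X. \<forall>t. 0 < t \<and> t \<le> 1 \<longrightarrow>
        (\<exists>b\<in>topspace X. a = s t b) \<or> (\<exists>b\<in>B. \<exists>u. t \<le> u \<and> u \<le> 1 \<and> a = s u b))"

locale scaled_operad = unique_operad +
  fixes sc :: "nat set \<Rightarrow> real \<Rightarrow> 'a \<Rightarrow> 'a"
  assumes scaling: "arity_set n S \<Longrightarrow> is_scaling (opspace P S) (Decom P S) (sc S)"
    and sc_rel: "arity_set n S \<Longrightarrow> bij_betw \<sigma> S S' \<Longrightarrow> a \<in> topspace (opspace P S) \<Longrightarrow> t \<in> {0..1} \<Longrightarrow>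
       oprelabel P S S' \<sigma> (sc S t a) = sc S' t (oprelabel P S S' \<sigma> a)"
begin

lemma assumes "arity_set n S"
  shows sc_cont: "continuous_map (prod_topology (top_of_set {0..1}) (opspace P S)) (opspace P S) (\<lambda>(t, a). sc S t a)"
    and sc_1: "\<And>a. a \<in> Ops S \<Longrightarrow> sc S 1 a = a"
    and sc_mult: "\<And>a t u. a \<in> Ops S \<Longrightarrow> t \<in> {0..1} \<Longrightarrow> u \<in> {0..1} \<Longrightarrow> sc S t (sc S u a) = sc S (t * u) a"
    and sc_inj: "\<And>a b t. a \<in> Ops S \<Longrightarrow> b \<in> Ops S \<Longrightarrow> 0 < t \<Longrightarrow> t \<le> 1 \<Longrightarrow> sc S t a = sc S t b \<Longrightarrow> a = b"
    and sc_interior: "\<And>a t. a \<in> Ops S \<Longrightarrow> 0 \<le> t \<Longrightarrow> t < 1 \<Longrightarrow> sc S t a \<notin> Decom P S"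
    and sc_cover: "\<And>a t. a \<in> Ops S \<Longrightarrow> 0 < t \<Longrightarrow> t \<le> 1 \<Longrightarrow>
       (\<exists>b\<in>Ops S. a = sc S t b) \<or> (\<exists>b\<in>Decom P S. \<exists>u. t \<le> u \<and> u \<le> 1 \<and> a = sc S u b)"
  using scaling[OF assms] unfolding is_scaling_def by blast+

lemma sc_in: "arity_set n S \<Longrightarrow> a \<in> Ops S \<Longrightarrow> t \<in> {0..1} \<Longrightarrow> sc S t a \<in> Ops S"
  using continuous_map_funspace[OF sc_cont] by (force simp: Pi_iff)

definition scale :: "ltree \<Rightarrow> real \<Rightarrow> (nat \<Rightarrow> 'a) \<Rightarrow> nat \<Rightarrow> 'a" where
  "scale T t x = (\<lambda>v\<in>verts T. sc (ocld T v) t (x v))"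

lemma scale_in: "tree_in S T \<Longrightarrow> x \<in> pts T \<Longrightarrow> t \<in> {0..1} \<Longrightarrow> scale T t x \<in> pts T"
  unfolding pts_iff scale_def by (auto intro!: sc_in tin_ocld)

lemma scale_1: assumes "tree_in S T" "x \<in> pts T" shows "scale T 1 x = x"
  by (rule pts_eqI[OF scale_in[OF assms] assms(2)])
     (use assms in \<open>auto simp: scale_def sc_1 tin_ocld pts_D\<close>)

lemma scale_mult:
  assumes "tree_in S T" "x \<in> pts T" "t \<in> {0..1}" "u \<in> {0..1}"
  shows "scale T t (scale T u x) = scale T (t * u) x"
  unfolding scale_def by (rule restrict_ext) (use assms in \<open>auto simp: sc_mult tin_ocld pts_D\<close>)

lemma scale_inj:
  assumes T: "tree_in S T" and x: "x \<in> pts T" and y: "y \<in> pts T" and t: "0 < t" "t \<le> 1" and e: "scale T t x = scale T t y"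
  shows "x = y"
proof (rule pts_eqI[OF x y])
  fix v assume v: "v \<in> verts T"
  have "sc (ocld T v) t (x v) = sc (ocld T v) t (y v)" using fun_cong[OF e, of v] v by (simp add: scale_def)
  then show "x v = y v" by (rule sc_inj[OF tin_ocld[OF T v] pts_D[OF x v] pts_D[OF y v] t])
qed

lemma scale_prime:
  assumes "tree_in S T" "x \<in> pts T" "0 \<le> t" "t < 1" shows "prime_labels T (scale T t x)"
  using assms by (auto simp: prime_labels_def scale_def sc_interior tin_ocld pts_D)

text \<open>Isomorphisms only relabel. Scaling does not commute with composition.\<close>

lemma scale_mor:
  assumes T: "tree_in S T" and T': "tree_in S' T'" and m: "tree_mor \<sigma> f T T'" and c: "\<And>v. \<not> contracts T f v"
    and x: "x \<in> pts T" and t: "t \<in> {0..1}"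
  shows "tree_map P \<sigma> f T T' (scale T t x) = scale T' t (tree_map P \<sigma> f T T' x)"
proof (rule pts_eqI[OF tree_map_in[OF T T' m scale_in[OF T x t]] scale_in[OF T' tree_map_in[OF T T' m x] t]])
  fix w assume w: "w \<in> verts T'"
  let ?r = "fiber_root T f w"
  note r = froot_in[OF m w]
  note n1 = tree_map_noncontr[OF T T' m w c x] and n2 = tree_map_noncontr[OF T T' m w c scale_in[OF T x t]]
  have "tree_map P \<sigma> f T T' (scale T t x) w =
      oprelabel P (ocld T ?r) (ocld T' w) (glue T \<sigma> f) (sc (ocld T ?r) t (x ?r))"
    unfolding n2(3) using r by (simp add: scale_def)
  also have "\<dots> = sc (ocld T' w) t (tree_map P \<sigma> f T T' x w)"
    unfolding n1(3) by (rule sc_rel[OF tin_ocld[OF T r] n1(2) pts_D[OF x r] t])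
  finally show "tree_map P \<sigma> f T T' (scale T t x) w = scale T' t (tree_map P \<sigma> f T T' x) w"
    using w by (simp add: scale_def)
qed

lemma scale_cont:
  assumes T: "tree_in S T" and x: "continuous_map Z (tree_space P T) x" and t: "continuous_map Z euclideanreal t"
    and tr: "\<And>z. z \<in> topspace Z \<Longrightarrow> t z \<in> {0..1}"
  shows "continuous_map Z (tree_space P T) (\<lambda>z. scale T (t z) (x z))"
  unfolding tree_space_def continuous_map_componentwise
proof (intro conjI ballI)
  show "(\<lambda>z. scale T (t z) (x z)) ` topspace Z \<subseteq> extensional (verts T)" by (auto simp: scale_def)
  fix v assume v: "v \<in> verts T"
  have "continuous_map Z (opspace P (ocld T v)) (\<lambda>z. x z v)"
    using x v unfolding tree_space_def continuous_map_componentwise by blast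
  moreover have "continuous_map Z (top_of_set {0..1}) t" using t tr by (auto simp: continuous_map_in_subtopology)
  ultimately have "continuous_map Z (opspace P (ocld T v)) ((\<lambda>(t, a). sc (ocld T v) t a) \<circ> (\<lambda>z. (t z, x z v)))"
    by (intro continuous_map_compose[OF _ sc_cont[OF tin_ocld[OF T v]]] continuous_map_pairedI)
  then show "continuous_map Z (opspace P (ocld T v)) (\<lambda>z. scale T (t z) (x z) v)"
    by (rule continuous_map_eq) (use v in \<open>simp add: scale_def\<close>)
qed

subsection \<open>Contracting the edges of low level\<close>

text \<open>The present time is \<open>s\<close>, the final time is \<open>r\<close>, and the edges to be contracted in between have the
levels \<open>a\<close>. The root is excluded because the hair is never contracted.\<close>

definition levels :: "real \<Rightarrow> real \<Rightarrow> ltree \<Rightarrow> (nat \<Rightarrow> real) \<Rightarrow> bool" where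
  "levels s r T a \<longleftrightarrow> 0 < s \<and> s \<le> r \<and> (\<forall>v\<in>verts T. v \<noteq> root T \<longrightarrow> s \<le> a v \<and> a v \<le> r)"

definition minlev :: "ltree \<Rightarrow> (nat \<Rightarrow> real) \<Rightarrow> real" where
  "minlev T a = Min (a ` (verts T - {root T}))"

definition above :: "ltree \<Rightarrow> (nat \<Rightarrow> real) \<Rightarrow> real \<Rightarrow> nat set" where
  "above T a m = {v \<in> verts T - {root T}. m < a v}"

text \<open>What is left when the edges of level at most \<open>m\<close> have been contracted.\<close>

abbreviation low :: "ltree \<Rightarrow> (nat \<Rightarrow> real) \<Rightarrow> real \<Rightarrow> ltree" where
  "low T a m \<equiv> cut_tree T (above T a m)"

abbreviation lowmap :: "ltree \<Rightarrow> (nat \<Rightarrow> real) \<Rightarrow> real \<Rightarrow> nat \<Rightarrow> nat" where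
  "lowmap T a m \<equiv> cut_top T (above T a m)"

lemma minlev:
  assumes T: "tree_in S T" and d: "decomposable T"
  shows "\<exists>v\<in>verts T. v \<noteq> root T \<and> a v = minlev T a" "\<And>v. v \<in> verts T \<Longrightarrow> v \<noteq> root T \<Longrightarrow> minlev T a \<le> a v"
proof -
  have f: "finite (a ` (verts T - {root T}))" using lt_finite[OF tin_lt[OF T]] by simp
  have ne: "a ` (verts T - {root T}) \<noteq> {}" using d decomposable_iff[OF tin_lt[OF T]] by auto
  show "\<exists>v\<in>verts T. v \<noteq> root T \<and> a v = minlev T a" using Min_in[OF f ne] unfolding minlev_def by auto
  show "minlev T a \<le> a v" if "v \<in> verts T" "v \<noteq> root T" for v
    unfolding minlev_def by (rule Min_le[OF f]) (use that in auto)
qed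

lemma low:
  assumes T: "tree_in S T"
  shows low_in: "tree_in S (low T a m)" and low_mor: "tree_mor id (lowmap T a m) T (low T a m)"
    and low_contracts: "\<And>v. contracts T (lowmap T a m) v \<longleftrightarrow> v \<in> verts T \<and> v \<noteq> root T \<and> a v \<le> m"
    and low_froot: "\<And>w. w \<in> verts (low T a m) \<Longrightarrow> fiber_root T (lowmap T a m) w = w"
    and low_verts: "\<And>w. w \<in> verts (low T a m) \<longleftrightarrow> w = root T \<or> (w \<in> verts T \<and> w \<noteq> root T \<and> m < a w)"
    and low_self: "\<And>v. v \<in> verts T \<Longrightarrow> v \<noteq> root T \<Longrightarrow> m < a v \<Longrightarrow> lowmap T a m v = v"
proof -
  note lT = tin_lt[OF T]
  have E: "above T a m \<subseteq> verts T" by (auto simp: above_def)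
  show "tree_in S (low T a m)" by (rule tree_inI[OF cut_labeled[OF lT E] tin_arity[OF T]])
  show "tree_mor id (lowmap T a m) T (low T a m)" by (rule cut_mor[OF lT E])
  show "contracts T (lowmap T a m) v \<longleftrightarrow> v \<in> verts T \<and> v \<noteq> root T \<and> a v \<le> m" for v
    unfolding cut_contracts[OF lT] by (auto simp: above_def)
  show "fiber_root T (lowmap T a m) w = w" if "w \<in> verts (low T a m)" for w
    using cut_froot[OF lT E] that by simp
  show "w \<in> verts (low T a m) \<longleftrightarrow> w = root T \<or> (w \<in> verts T \<and> w \<noteq> root T \<and> m < a w)" for w
    by (auto simp: above_def)
  show "lowmap T a m v = v" if "v \<in> verts T" "v \<noteq> root T" "m < a v" for v
    by (rule cut_top_self) (use that in \<open>simp add: above_def\<close>)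
qed

lemma low_card:
  assumes T: "tree_in S T" and v: "v \<in> verts T" "v \<noteq> root T" "a v \<le> m"
  shows "card (verts (low T a m)) < card (verts T)"
proof (rule psubset_card_mono[OF lt_finite[OF tin_lt[OF T]]])
  have "v \<notin> verts (low T a m)" using v by (simp add: above_def)
  moreover have "verts (low T a m) \<subseteq> verts T" using lt_root[OF tin_lt[OF T]] by (auto simp: above_def)
  ultimately show "verts (low T a m) \<subset> verts T" using v(1) by blast
qed

lemma low_levels: "tree_in S T \<Longrightarrow> levels s r T a \<Longrightarrow> s \<le> m \<Longrightarrow> m \<le> r \<Longrightarrow> levels m r (low T a m) a"
  by (auto simp: levels_def above_def)

lemma levels_minlev:
  assumes "tree_in S T" "decomposable T" "levels s r T a"
  shows "0 < minlev T a" "s \<le> minlev T a" "minlev T a \<le> r" "s / minlev T a \<in> {0..1}"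
proof -
  obtain v where "v \<in> verts T" "v \<noteq> root T" "a v = minlev T a" using minlev(1)[OF assms(1,2)] by blast
  then show "0 < minlev T a" "s \<le> minlev T a" "minlev T a \<le> r" "s / minlev T a \<in> {0..1}"
    using assms(3) by (auto simp: levels_def)
qed

text \<open>At each step the time jumps from \<open>s\<close> to the least level \<open>m\<close>: the labels are scaled by \<open>s / m\<close>, and the
edges of level \<open>m\<close> are contracted. The label of the last vertex is scaled until the final time \<open>r\<close>.
The test for \<open>labeled_tree\<close> ensures that the number of vertices decreases.\<close>

function eval :: "real \<Rightarrow> real \<Rightarrow> ltree \<Rightarrow> (nat \<Rightarrow> real) \<Rightarrow> (nat \<Rightarrow> 'a) \<Rightarrow> 'a" where
  "eval r s T a x =
     (if labeled_tree (labels T) T \<and> decomposable T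
      then eval r (minlev T a) (low T a (minlev T a)) a
             (tree_map P id (lowmap T a (minlev T a)) T (low T a (minlev T a)) (scale T (s / minlev T a) x))
      else sc (ocld T (root T)) (s / r) (x (root T)))"
  by auto
termination
proof (relation "Wellfounded.measure (\<lambda>(r, s, T, a, x). card (verts T))")
  fix r s :: real and T :: ltree and a :: "nat \<Rightarrow> real" and x :: "nat \<Rightarrow> 'a"
  assume h: "labeled_tree (labels T) T \<and> decomposable T"
  have f: "finite (a ` (verts T - {root T}))" using h lt_finite by auto
  have ne: "a ` (verts T - {root T}) \<noteq> {}" using h decomposable_iff by auto
  have "minlev T a \<in> a ` (verts T - {root T})" unfolding minlev_def by (rule Min_in[OF f ne])
  then obtain v where v': "minlev T a = a v" "v \<in> verts T - {root T}" by (rule imageE)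
  then have v: "v \<in> verts T" "v \<noteq> root T" "a v = minlev T a" by auto
  have "v \<notin> verts (low T a (minlev T a))" using v by (simp add: above_def)
  moreover have "verts (low T a (minlev T a)) \<subseteq> verts T" using h lt_root by (auto simp: above_def)
  ultimately have "verts (low T a (minlev T a)) \<subset> verts T" using v(1) by blast
  then show "((r, minlev T a, low T a (minlev T a), a,
      tree_map P id (lowmap T a (minlev T a)) T (low T a (minlev T a)) (scale T (s / minlev T a) x)), r, s, T, a, x)
    \<in> Wellfounded.measure (\<lambda>(r, s, T, a, x). card (verts T))"
    using psubset_card_mono[OF lt_finite] h by auto
qed simp

declare eval.simps [simp del]

lemma eval_dec:
  assumes "tree_in S T" "decomposable T"
  shows "eval r s T a x = eval r (minlev T a) (low T a (minlev T a)) a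
     (tree_map P id (lowmap T a (minlev T a)) T (low T a (minlev T a)) (scale T (s / minlev T a) x))"
  using assms(2) tin_lt[OF assms(1)] lt_labels[OF tin_lt[OF assms(1)]] by (subst eval.simps) simp

lemma eval_nondec:
  assumes "tree_in S T" "\<not> decomposable T" shows "eval r s T a x = sc S (s / r) (x (root T))"
  using assms(2) ocld_root_corolla(2)[OF tin_lt[OF assms(1)] assms(2)] by (subst eval.simps) simp

lemma eval_induct [consumes 2, case_names nondec dec]:
  assumes "tree_in S T" "levels s r T a"
    and "\<And>s T. tree_in S T \<Longrightarrow> levels s r T a \<Longrightarrow> \<not> decomposable T \<Longrightarrow> Q s T"
    and "\<And>s T. tree_in S T \<Longrightarrow> levels s r T a \<Longrightarrow> decomposable T \<Longrightarrow> Q (minlev T a) (low T a (minlev T a)) \<Longrightarrow> Q s T"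
  shows "Q s T"
  using assms(1,2)
proof (induction "card (verts T)" arbitrary: s T rule: less_induct)
  case less
  show ?case
  proof (cases "decomposable T")
    case True
    obtain v where v: "v \<in> verts T" "v \<noteq> root T" "a v = minlev T a" using minlev(1)[OF less.prems(1) True] by blast
    note lm = levels_minlev[OF less.prems(1) True less.prems(2)]
    have "Q (minlev T a) (low T a (minlev T a))"
      by (rule less.hyps[OF low_card[OF less.prems(1) v(1,2)] low_in[OF less.prems(1)]
            low_levels[OF less.prems lm(2,3)]]) (use v in simp)
    then show ?thesis using assms(4) less.prems True by blast
  qed (use assms(3) less.prems in blast)
qed

lemma levels_frac: "levels s r T a \<Longrightarrow> s / r \<in> {0..1}"
  by (auto simp: levels_def)

lemma eval_in:
  assumes "tree_in S T" "levels s r T a" "x \<in> pts T" shows "eval r s T a x \<in> Ops S"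
proof -
  have "\<forall>x\<in>pts T. eval r s T a x \<in> Ops S"
    using assms(1,2)
  proof (induction rule: eval_induct)
    case (nondec s T)
    then show ?case
      using eval_nondec[OF nondec(1,3)] sc_in[OF tin_arity[OF nondec(1)]] levels_frac[OF nondec(2)]
        pts_D[OF _ lt_root[OF tin_lt[OF nondec(1)]]] ocld_root_corolla(2)[OF tin_lt[OF nondec(1)] nondec(3)] by simp
  next
    case (dec s T)
    show ?case
    proof
      fix x assume x: "x \<in> pts T"
      have "tree_map P id (lowmap T a (minlev T a)) T (low T a (minlev T a)) (scale T (s / minlev T a) x)
         \<in> pts (low T a (minlev T a))"
        by (rule tree_map_in[OF dec(1) low_in[OF dec(1)] low_mor[OF dec(1)]
             scale_in[OF dec(1) x levels_minlev(4)[OF dec(1,3,2)]]])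
      then show "eval r s T a x \<in> Ops S" using dec(4) unfolding eval_dec[OF dec(1,3)] by blast
    qed
  qed
  then show ?thesis using assms(3) by blast
qed

text \<open>No edge is contracted between the times \<open>s\<close> and \<open>m\<close>.\<close>

lemma eval_flow:
  assumes T: "tree_in S T" and l: "levels m r T a" and s: "0 < s" "s \<le> m" and x: "x \<in> pts T"
  shows "eval r s T a x = eval r m T a (scale T (s / m) x)"
proof -
  have m: "0 < m" "m \<le> r" using l by (auto simp: levels_def)
  have sm: "s / m \<in> {0..1}" using s m by auto
  show ?thesis
  proof (cases "decomposable T")
    case True
    note lm = levels_minlev[OF T True l]
    have "scale T (m / minlev T a) (scale T (s / m) x) = scale T (s / minlev T a) x"
      using scale_mult[OF T x lm(4) sm] m by simp
    then show ?thesis unfolding eval_dec[OF T True] by simp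
  next
    case False
    have v: "root T \<in> verts T" by (rule lt_root[OF tin_lt[OF T]])
    have o: "ocld T (root T) = S" by (rule ocld_root_corolla(2)[OF tin_lt[OF T] False])
    have "sc S (m / r) (sc S (s / m) (x (root T))) = sc S (s / r) (x (root T))"
      using sc_mult[OF tin_arity[OF T], of "x (root T)" "m / r" "s / m"] pts_D[OF x v] sm m o by simp
    then show ?thesis unfolding eval_nondec[OF T False] using v o by (simp add: scale_def)
  qed
qed

text \<open>All levels are at most \<open>r\<close>, so from \<open>r\<close> to \<open>r'\<close> the process only scales.\<close>

lemma eval_rescale:
  assumes T: "tree_in S T" and l: "levels s r T a" and r: "r \<le> r'" and x: "x \<in> pts T"
  shows "eval r' s T a x = sc S (r / r') (eval r s T a x)"
proof -
  have "\<forall>x\<in>pts T. eval r' s T a x = sc S (r / r') (eval r s T a x)"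
    using T l
  proof (induction rule: eval_induct)
    case (nondec s T)
    show ?case
    proof
      fix x assume x: "x \<in> pts T"
      have o: "ocld T (root T) = S" by (rule ocld_root_corolla(2)[OF tin_lt[OF nondec(1)] nondec(3)])
      have "sc S (r / r') (sc S (s / r) (x (root T))) = sc S (s / r') (x (root T))"
        using sc_mult[OF tin_arity[OF nondec(1)], of "x (root T)" "r / r'" "s / r"]
          pts_D[OF x lt_root[OF tin_lt[OF nondec(1)]]] nondec(2) r o by (simp add: levels_def)
      then show "eval r' s T a x = sc S (r / r') (eval r s T a x)"
        unfolding eval_nondec[OF nondec(1,3)] by simp
    qed
  next
    case (dec s T)
    show ?case
    proof
      fix x assume x: "x \<in> pts T"
      have "tree_map P id (lowmap T a (minlev T a)) T (low T a (minlev T a)) (scale T (s / minlev T a) x)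
         \<in> pts (low T a (minlev T a))"
        by (rule tree_map_in[OF dec(1) low_in[OF dec(1)] low_mor[OF dec(1)]
             scale_in[OF dec(1) x levels_minlev(4)[OF dec(1,3,2)]]])
      then show "eval r' s T a x = sc S (r / r') (eval r s T a x)"
        using dec(4) unfolding eval_dec[OF dec(1,3)] by blast
    qed
  qed
  then show ?thesis using x by blast
qed

text \<open>Contracting edges whose level is the present time does not change the result, because
the process contracts these edges first, with the factor \<open>1\<close>. With \<open>f\<close> an isomorphism this is
equivariance; the induction over the steps of the process mixes both cases.\<close>

lemma eval_natural:
  assumes "tree_in S T" "tree_in S' T'" "tree_mor \<sigma> f T T'" "levels s r T a"
    and "\<And>v. contracts T f v \<Longrightarrow> a v = s"
    and "\<And>w. w \<in> verts T' \<Longrightarrow> w \<noteq> root T' \<Longrightarrow> a' w = a (fiber_root T f w)"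
    and "x \<in> pts T"
  shows "eval r s T' a' (tree_map P \<sigma> f T T' x) = oprelabel P S S' \<sigma> (eval r s T a x)"
  using assms
proof (induction "card (verts T)" arbitrary: T T' f s x a' rule: less_induct)
  case less
  note T = less.prems(1) note T' = less.prems(2) note m = less.prems(3) note l = less.prems(4)
    and c = less.prems(5) and lv = less.prems(6) and x = less.prems(7)
  note lT = tin_lt[OF T] note lT' = tin_lt[OF T'] note b = tin_mor_bij[OF T T' m]
  have s: "0 < s" "s \<le> r" using l by (auto simp: levels_def)
  show ?case
  proof (cases "decomposable T")
    case False
    note v = ocld_root_corolla[OF lT False]
    have v': "verts T' = {root T'}" using mor_img[OF m] mor_root[OF m] v(1) by simp
    then have d': "\<not> decomposable T'" by (simp add: decomposable_def)
    note fx = tree_map_in[OF T T' m x]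
    have "tree_map P \<sigma> f T T' x (root T') = oprelabel P S S' \<sigma> (x (root T))"
      using opcomp_nat[OF T T' m x] opcomp_corolla[OF T False x] opcomp_corolla[OF T' d' fx] by simp
    then show ?thesis
      unfolding eval_nondec[OF T False] eval_nondec[OF T' d']
      using sc_rel[OF tin_arity[OF T] b _ levels_frac[OF l]] pts_D[OF x, of "root T"] v by simp
  next
    case True
    let ?m = "minlev T a"
    note lm = levels_minlev[OF T True l]
    obtain v0 where v0: "v0 \<in> verts T" "v0 \<noteq> root T" "a v0 = ?m" using minlev(1)[OF T True] by blast
    define T1 q X where "T1 = low T a ?m" and "q = lowmap T a ?m" and "X = scale T (s / ?m) x"
    note lq = low[OF T, where a = a and m = ?m, folded T1_def q_def]
    have X: "X \<in> pts T" unfolding X_def by (rule scale_in[OF T x lm(4)])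
    have alev: "a v = ?m" if "contracts T q v" for v
      using that minlev(2)[OF T True] lq(3) by (auto intro: antisym)
    \<comment> \<open>Bring \<open>T'\<close> to the stage \<open>T2\<close> that corresponds to \<open>T1\<close>. It takes a step of its own if some edge of
      level \<open>?m\<close> is left in it, and none if \<open>f\<close> has contracted all of them.\<close>
    have "\<exists>T2 g a2. tree_in S' T2 \<and> tree_mor \<sigma> g T T2 \<and> (\<forall>v. contracts T g v \<longrightarrow> a v \<le> ?m) \<and>
       (\<forall>v. contracts T q v \<longrightarrow> contracts T g v) \<and> (\<forall>w\<in>verts T2. w \<noteq> root T2 \<longrightarrow> a2 w = a (fiber_root T g w)) \<and>
       eval r s T' a' (tree_map P \<sigma> f T T' x) = eval r ?m T2 a2 (tree_map P \<sigma> g T T2 X)"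
    proof (cases "\<exists>w\<in>verts T'. w \<noteq> root T' \<and> a' w = ?m")
      case w: True
      define T2 q' where "T2 = low T' a' ?m" and "q' = lowmap T' a' ?m"
      note lq' = low[OF T', where a = a' and m = ?m, folded T2_def q'_def]
      have d': "decomposable T'" using w decomposable_iff[OF lT'] by blast
      have ge: "?m \<le> a' w" if "w \<in> verts T'" "w \<noteq> root T'" for w
        using lv[OF that] minlev(2)[OF T True froot_in[OF m that(1)] froot_nonroot(1)[OF m that]] by simp
      have mm: "minlev T' a' = ?m"
      proof (rule antisym)
        show "minlev T' a' \<le> ?m" using w minlev(2)[OF T' d'] by metis
        show "?m \<le> minlev T' a'" using minlev(1)[OF T' d', of a'] ge by metis
      qed
      have M: "tree_mor \<sigma> (q' \<circ> f) T T2" using tree_mor_comp(1)[OF lT m lq'(2)] by simp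
      have fX: "scale T' (s / ?m) (tree_map P \<sigma> f T T' x) = tree_map P \<sigma> f T T' X"
      proof (cases "\<exists>v. contracts T f v")
        case False
        then show ?thesis unfolding X_def using scale_mor[OF T T' m _ x lm(4)] by simp
      next
        case True
        then obtain v where v: "contracts T f v" by blast
        then have "a v = s" "?m \<le> a v" using c[OF v] minlev(2)[OF T \<open>decomposable T\<close>] by (auto simp: contracts_def)
        then have "s / ?m = 1" using lm by simp
        then show ?thesis unfolding X_def using scale_1[OF T x] scale_1[OF T' tree_map_in[OF T T' m x]] by simp
      qed
      have cg: "contracts T (q' \<circ> f) v \<longleftrightarrow> contracts T f v \<or>
          v \<in> verts T \<and> v \<noteq> root T \<and> \<not> contracts T f v \<and> contracts T' q' (f v)" for v
        by (rule contracts_comp[OF m lq'(2)])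
      have nc: "a' (f v) = a v \<and> f v \<in> verts T' \<and> f v \<noteq> root T'"
        if "v \<in> verts T" "v \<noteq> root T" "\<not> contracts T f v" for v
        using lv[OF mor_verts[OF m that(1)]] mor_noncontr[OF m that] mor_verts[OF m that(1)] by simp
      have "a v \<le> ?m" if "contracts T (q' \<circ> f) v" for v
        using that c[of v] lm(2) nc[of v] lq'(3)[of "f v"] unfolding cg by auto
      moreover have "contracts T (q' \<circ> f) v" if "contracts T q v" for v
        using alev[OF that] that nc[of v] lq'(3)[of "f v"] lq(3)[of v] unfolding cg by auto
      moreover have "a' w = a (fiber_root T (q' \<circ> f) w)" if w2: "w \<in> verts T2" "w \<noteq> root T2" for w
      proof -
        have "w \<in> verts T'" "w \<noteq> root T'" using w2 lq'(5) by (auto simp: T2_def)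
        then show ?thesis
          using tree_mor_comp(2)[OF lT m lq'(2) w2(1)] lq'(4)[OF w2(1)] lv by simp
      qed
      moreover have "eval r s T' a' (tree_map P \<sigma> f T T' x) = eval r ?m T2 a' (tree_map P \<sigma> (q' \<circ> f) T T2 X)"
        unfolding eval_dec[OF T' d'] mm fX
        using tree_map_comp[OF T T' lq'(1) m lq'(2) X] by (simp add: T2_def q'_def)
      ultimately show ?thesis using lq'(1) M by blast
    next
      case nw: False
      have cf: "contracts T f v" if "contracts T q v" for v
      proof (rule ccontr)
        assume n: "\<not> contracts T f v"
        have v: "v \<in> verts T" "v \<noteq> root T" using that by (auto simp: contracts_def)
        have "a' (f v) = a v" using lv[OF mor_verts[OF m v(1)]] mor_noncontr[OF m v n] by simp
        then show False using nw alev[OF that] mor_verts[OF m v(1)] mor_noncontr(1)[OF m v n] by auto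
      qed
      have "?m = s" using cf[of v0] c[of v0] v0 lq(3) by simp
      then have "X = x" unfolding X_def using s scale_1[OF T x] by simp
      then show ?thesis using T' m cf c lv \<open>?m = s\<close> by (intro exI[of _ T'] exI[of _ f] exI[of _ a']) auto
    qed
    then obtain T2 g a2 where T2: "tree_in S' T2" and g: "tree_mor \<sigma> g T T2" and gc: "\<And>v. contracts T g v \<Longrightarrow> a v \<le> ?m"
      and qg: "\<And>v. contracts T q v \<Longrightarrow> contracts T g v"
      and a2: "\<And>w. w \<in> verts T2 \<Longrightarrow> w \<noteq> root T2 \<Longrightarrow> a2 w = a (fiber_root T g w)"
      and e: "eval r s T' a' (tree_map P \<sigma> f T T' x) = eval r ?m T2 a2 (tree_map P \<sigma> g T T2 X)" by blast
    obtain h where h: "tree_mor \<sigma> h T1 T2" and hq: "\<And>v. v \<in> verts T \<Longrightarrow> h (q v) = g v"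
      and hc: "\<And>w. w \<in> verts T1 \<Longrightarrow> contracts T1 h w \<longleftrightarrow> contracts T g (fiber_root T q w)"
      and hr: "\<And>w. w \<in> verts T2 \<Longrightarrow> fiber_root T1 h w = q (fiber_root T g w)"
      using tree_mor_factor[OF lT lq(2) g qg] by blast
    have nh: "\<not> contracts T1 h w" for w
    proof
      assume cw: "contracts T1 h w"
      then have w: "w \<in> verts T1" "w \<noteq> root T1" by (auto simp: contracts_def)
      then have "a w \<le> ?m" using hc[OF w(1)] cw lq(4)[OF w(1)] gc by simp
      then show False using w lq(5)[of w] by (simp add: T1_def)
    qed
    have "eval r ?m T2 a2 (tree_map P \<sigma> h T1 T2 (tree_map P id q T T1 X)) =
       oprelabel P S S' \<sigma> (eval r ?m T1 a (tree_map P id q T T1 X))"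
    proof (rule less.hyps[OF _ lq(1) T2 h])
      show "card (verts T1) < card (verts T)" unfolding T1_def by (rule low_card[OF T v0(1,2)]) (use v0 in simp)
      show "levels ?m r T1 a" unfolding T1_def by (rule low_levels[OF T l lm(2,3)])
      show "a v = ?m" if "contracts T1 h v" for v using nh that by blast
      show "tree_map P id q T T1 X \<in> pts T1" by (rule tree_map_in[OF T lq(1,2) X])
      show "a2 w = a (fiber_root T1 h w)" if w: "w \<in> verts T2" "w \<noteq> root T2" for w
      proof -
        let ?u = "fiber_root T g w"
        have u: "?u \<in> verts T" "?u \<noteq> root T" "\<not> contracts T g ?u"
          using froot_in[OF g w(1)] froot_nonroot[OF g w] by auto
        then have "\<not> a ?u \<le> ?m" using qg lq(3) by blast
        then have "q ?u = ?u" using lq(6)[OF u(1,2)] by simp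
        then show ?thesis using a2[OF w] hr[OF w(1)] by simp
      qed
    qed
    moreover have "tree_map P \<sigma> h T1 T2 (tree_map P id q T T1 X) = tree_map P \<sigma> g T T2 X"
      unfolding tree_map_comp[OF T lq(1) T2 lq(2) h X]
      by (rule tree_map_cong[OF T T2 g _ _ X]) (use hq in auto)
    ultimately show ?thesis
      unfolding e eval_dec[OF T True] by (simp add: T1_def q_def X_def)
  qed
qed

lemma eval_contract:
  assumes T: "tree_in S T" and T': "tree_in S T'" and m: "tree_mor id f T T'" and l: "levels s r T a"
    and c: "\<And>v. contracts T f v \<Longrightarrow> a v = s"
    and lv: "\<And>w. w \<in> verts T' \<Longrightarrow> w \<noteq> root T' \<Longrightarrow> a' w = a (fiber_root T f w)" and x: "x \<in> pts T"
  shows "eval r s T' a' (tree_map P id f T T' x) = eval r s T a x"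
  using eval_natural[OF assms] oprel_id[OF tin_arity[OF T] eval_in[OF T l x]] by simp

subsection \<open>Continuity\<close>

text \<open>If \<open>v\<close> has the least level, the process may start by contracting this edge alone at the time
\<open>a v\<close>: the other edges of the same level are then contracted next, with the factor \<open>1\<close>.\<close>

lemma eval_contract_min:
  assumes T: "tree_in S T" and l: "levels s r T a" and v: "v \<in> verts T" "v \<noteq> root T"
    and mn: "\<And>u. u \<in> verts T \<Longrightarrow> u \<noteq> root T \<Longrightarrow> a v \<le> a u" and x: "x \<in> pts T"
  shows "eval r s T a x = eval r (a v) (cut_tree T (verts T - {root T, v})) a
     (tree_map P id (cut_top T (verts T - {root T, v})) T (cut_tree T (verts T - {root T, v})) (scale T (s / a v) x))"
proof -
  let ?E = "verts T - {root T, v}"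
  note lT = tin_lt[OF T]
  have E: "?E \<subseteq> verts T" by auto
  have s: "0 < s" "s \<le> a v" "a v \<le> r" using l v by (auto simp: levels_def)
  have l': "levels (a v) r T a" using l mn s by (auto simp: levels_def)
  have t: "s / a v \<in> {0..1}" using s by auto
  note X = scale_in[OF T x t]
  have "eval r (a v) (cut_tree T ?E) a (tree_map P id (cut_top T ?E) T (cut_tree T ?E) (scale T (s / a v) x)) =
     eval r (a v) T a (scale T (s / a v) x)"
  proof (rule eval_contract[OF T _ cut_mor[OF lT E] l' _ _ X])
    show "tree_in S (cut_tree T ?E)" by (rule tree_inI[OF cut_labeled[OF lT E] tin_arity[OF T]])
    show "a u = a v" if "contracts T (cut_top T ?E) u" for u using that unfolding cut_contracts[OF lT] by auto
    show "a w = a (fiber_root T (cut_top T ?E) w)" if "w \<in> verts (cut_tree T ?E)" for w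
      using cut_froot[OF lT E, of w] that by simp
  qed
  then show ?thesis using eval_flow[OF T l' s(1,2) x] by simp
qed

text \<open>The parameter space is covered by finitely many closed sets, on each of which a fixed edge has the
least level. On such a set the process starts with the contraction of this edge, which is the
same for all parameters.\<close>

lemma eval_continuous:
  fixes Z :: "'z topology"
  assumes "tree_in S T" "continuous_map Z euclideanreal s"
    and "\<And>v. v \<in> verts T \<Longrightarrow> continuous_map Z euclideanreal (\<lambda>z. a z v)"
    and "continuous_map Z (tree_space P T) x" and "\<And>z. z \<in> topspace Z \<Longrightarrow> levels (s z) r T (a z)"
  shows "continuous_map Z (opspace P S) (\<lambda>z. eval r (s z) T (a z) (x z))"
  using assms
proof (induction "card (verts T)" arbitrary: T Z s x rule: less_induct)
  case less
  note T = less.prems(1) and s = less.prems(2) and a = less.prems(3) and x = less.prems(4) and l = less.prems(5)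
  note lT = tin_lt[OF T]
  have xin: "x z \<in> pts T" if "z \<in> topspace Z" for z using continuous_map_funspace[OF x] that by blast
  show ?case
  proof (cases "decomposable T")
    case False
    note o = ocld_root_corolla[OF lT False]
    have "continuous_map Z euclideanreal (\<lambda>z. s z / r)"
      using l s by (intro continuous_map_real_divide) (force simp: levels_def)+
    then have "continuous_map Z (tree_space P T) (\<lambda>z. scale T (s z / r) (x z))"
      by (rule scale_cont[OF T x]) (rule levels_frac[OF l])
    then have "continuous_map Z (opspace P (ocld T (root T))) (\<lambda>z. scale T (s z / r) (x z) (root T))"
      unfolding tree_space_def continuous_map_componentwise using lt_root[OF lT] by blast
    then show ?thesis
      using o by (simp add: scale_def eval_nondec[OF T False])
  next
    case True
    define I where "I = verts T - {root T}"
    define C where "C v = {z \<in> topspace Z. \<forall>u\<in>I. a z v \<le> a z u}" for v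
    have fI: "finite I" using lt_finite[OF lT] by (simp add: I_def)
    have aI: "continuous_map Z euclideanreal (\<lambda>z. a z v)" if "v \<in> I" for v using a that by (simp add: I_def)
    show ?thesis
    proof (rule pasting_lemma_closed[where I = I and T = C and f = "\<lambda>_ z. eval r (s z) T (a z) (x z)"])
      show "finite I" by (rule fI)
      fix v assume v: "v \<in> I"
      have "closedin Z {z \<in> topspace Z. a z u - a z v \<in> {0..}}" if "u \<in> I" for u
        by (rule closedin_continuous_map_preimage[OF continuous_map_diff[OF aI[OF that] aI[OF v]]]) simp
      then have "closedin Z (topspace Z \<inter> (\<Inter>u\<in>I. {z \<in> topspace Z. a z u - a z v \<in> {0..}}))"
        using fI by (cases "I = {}") (auto intro!: closedin_Int closedin_Inter)
      moreover have "C v = topspace Z \<inter> (\<Inter>u\<in>I. {z \<in> topspace Z. a z u - a z v \<in> {0..}})" by (auto simp: C_def)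
      ultimately show "closedin Z (C v)" by simp
      let ?Z = "subtopology Z (C v)" and ?E = "verts T - {root T, v}"
      let ?x = "\<lambda>z. tree_map P id (cut_top T ?E) T (cut_tree T ?E) (scale T (s z / a z v) (x z))"
      have vT: "v \<in> verts T" "v \<noteq> root T" using v by (auto simp: I_def)
      have E: "?E \<subseteq> verts T" by auto
      have cin: "tree_in S (cut_tree T ?E)" by (rule tree_inI[OF cut_labeled[OF lT E] tin_arity[OF T]])
      have lz: "0 < s z" "s z \<le> a z v" "a z v \<le> r" if "z \<in> topspace Z" for z
        using l[OF that] vT by (auto simp: levels_def)
      have xz: "continuous_map ?Z (tree_space P T) (\<lambda>z. scale T (s z / a z v) (x z))"
      proof (rule scale_cont[OF T continuous_map_from_subtopology[OF x]])
        have "a z v \<noteq> 0" if "z \<in> topspace ?Z" for z using lz[of z] that by simp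
        then show "continuous_map ?Z euclideanreal (\<lambda>z. s z / a z v)"
          using s aI[OF v] by (intro continuous_map_real_divide continuous_map_from_subtopology)
        show "s z / a z v \<in> {0..1}" if "z \<in> topspace ?Z" for z using lz[of z] that by simp
      qed
      have "continuous_map ?Z (opspace P S) (\<lambda>z. eval r (a z v) (cut_tree T ?E) (a z) (?x z))"
      proof (rule less.hyps[OF _ cin])
        have "verts (cut_tree T ?E) = verts T - {v}" using lt_root[OF lT] vT by auto
        then show "card (verts (cut_tree T ?E)) < card (verts T)"
          using card_Diff1_less[OF lt_finite[OF lT] vT(1)] by (simp only:)
        show "continuous_map ?Z euclideanreal (\<lambda>z. a z v)" by (rule continuous_map_from_subtopology[OF aI[OF v]])
        show "continuous_map ?Z euclideanreal (\<lambda>z. a z u)" if "u \<in> verts (cut_tree T ?E)" for u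
          by (rule continuous_map_from_subtopology[OF a]) (use that lt_root[OF lT] in auto)
        show "continuous_map ?Z (tree_space P (cut_tree T ?E)) ?x"
          using continuous_map_compose[OF xz tree_map_cont[OF T cin cut_mor[OF lT E]]] by (simp add: o_def)
        show "levels (a z v) r (cut_tree T ?E) (a z)" if "z \<in> topspace ?Z" for z
          using that lz[of z] l[of z] by (auto simp: levels_def C_def I_def)
      qed
      then show "continuous_map ?Z (opspace P S) (\<lambda>z. eval r (s z) T (a z) (x z))"
      proof (rule continuous_map_eq)
        fix z assume z: "z \<in> topspace ?Z"
        show "eval r (a z v) (cut_tree T ?E) (a z) (?x z) = eval r (s z) T (a z) (x z)"
          by (rule eval_contract_min[OF T l vT _ xin, symmetric]) (use z in \<open>auto simp: C_def I_def\<close>)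
      qed
    next
      fix z assume z: "z \<in> topspace Z"
      obtain v where "v \<in> verts T" "v \<noteq> root T" "a z v = minlev T (a z)" using minlev(1)[OF T True] by blast
      then show "\<exists>j. j \<in> I \<and> z \<in> C j \<and> eval r (s z) T (a z) (x z) = eval r (s z) T (a z) (x z)"
        using minlev(2)[OF T True, of _ "a z"] z by (intro exI[of _ v]) (auto simp: I_def C_def)
    qed simp
  qed
qed

subsection \<open>Grafting\<close>

lemma eval_const_level:
  assumes G: "tree_in S G" and l: "levels s r G a" and c: "\<And>v. v \<in> verts G \<Longrightarrow> v \<noteq> root G \<Longrightarrow> a v = r" and x: "x \<in> pts G"
  shows "eval r s G a x = opcomp P G (scale G (s / r) x)"
proof -
  note S = tin_arity[OF G]
  obtain v where v: "v \<notin> S" using fresh_ex S by (metis arity_set_def)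
  note cin = corolla_in[OF S v]
  have s: "0 < s" "s \<le> r" "0 < r" using l by (auto simp: levels_def)
  have l': "levels r r G a" using s c by (auto simp: levels_def)
  have X: "scale G (s / r) x \<in> pts G" by (rule scale_in[OF G x levels_frac[OF l]])
  have m: "tree_mor id (\<lambda>_. v) G (corolla S v)" by (rule const_mor[OF tin_lt[OF G]]) simp
  have "eval r r G a (scale G (s / r) x) = eval r r (corolla S v) a (tree_map P id (\<lambda>_. v) G (corolla S v) (scale G (s / r) x))"
    by (rule eval_contract[OF G cin m l' _ _ X, symmetric]) (use c in \<open>auto simp: contracts_def\<close>)
  also have "\<dots> = sc S 1 (opcomp P G (scale G (s / r) x))"
    using eval_nondec[OF cin, of r r a] tree_map_const[OF G _ X, of id S v] oprel_id[OF S opcomp_in[OF G X]] s by simp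
  also have "\<dots> = opcomp P G (scale G (s / r) x)" by (rule sc_1[OF S opcomp_in[OF G X]])
  finally show ?thesis using eval_flow[OF G l' s(1,2) x] by simp
qed

lemma fiber_levels:
  assumes "tree_mor \<sigma> f G T" "levels s r G a" shows "levels s r (fiber G f w) a"
  using fiber_nonroot[OF assms(1)] assms(2) by (auto simp: levels_def)

lemma scale_fiber:
  assumes "tree_in S G" "tree_mor \<sigma> f G T"
  shows "scale (fiber G f w) t (restrict x (verts (fiber G f w))) = restrict (scale G t x) (verts (fiber G f w))"
proof
  fix v
  show "scale (fiber G f w) t (restrict x (verts (fiber G f w))) v = restrict (scale G t x) (verts (fiber G f w)) v"
  proof (cases "v \<in> verts (fiber G f w)")
    case True
    then have "v \<in> verts G" "f v = w" by auto
    then show ?thesis using ocld_fiber[OF tin_lt[OF assms(1)] assms(2), of v] by (simp add: scale_def)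
  qed (auto simp: scale_def)
qed

text \<open>The edges that survive a contraction to \<open>T\<close> are contracted at the final time; all earlier
contractions happen inside the fibers. So the process runs separately in the fibers, followed by
composition along \<open>T\<close>.\<close>

lemma eval_graft:
  assumes "tree_in S G" "tree_in S T" "tree_mor id f G T" "levels s r G a"
    and "\<And>v. v \<in> verts G \<Longrightarrow> v \<noteq> root G \<Longrightarrow> \<not> contracts G f v \<Longrightarrow> a v = r" and "x \<in> pts G"
  shows "eval r s G a x = opcomp P T (\<lambda>w\<in>verts T. oprelabel P (labels (fiber G f w)) (ocld T w) (glue G id f)
     (eval r s (fiber G f w) a (restrict x (verts (fiber G f w)))))"
  using assms
proof (induction "card (verts G)" arbitrary: G f s x rule: less_induct)
  case less
  note G = less.prems(1) and T = less.prems(2) and f = less.prems(3) and l = less.prems(4)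
    and nc = less.prems(5) and x = less.prems(6)
  note lG = tin_lt[OF G] note lT = tin_lt[OF T]
  have s: "0 < s" "s \<le> r" using l by (auto simp: levels_def)
  show ?case
  proof (cases "\<forall>v\<in>verts G. v \<noteq> root G \<longrightarrow> a v = r")
    case True
    have X: "scale G (s / r) x \<in> pts G" by (rule scale_in[OF G x levels_frac[OF l]])
    have "tree_map P id f G T (scale G (s / r) x) = (\<lambda>w\<in>verts T. oprelabel P (labels (fiber G f w)) (ocld T w) (glue G id f)
      (eval r s (fiber G f w) a (restrict x (verts (fiber G f w)))))"
      unfolding tree_map_def
    proof (rule restrict_ext)
      fix w assume w: "w \<in> verts T"
      have "eval r s (fiber G f w) a (restrict x (verts (fiber G f w))) =
         opcomp P (fiber G f w) (scale (fiber G f w) (s / r) (restrict x (verts (fiber G f w))))"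
        by (rule eval_const_level[OF fiber_in[OF G T f w] fiber_levels[OF f l] _ fiber_pts[OF G f x]])
           (use fiber_nonroot[OF f] True in auto)
      then show "oprelabel P (labels (fiber G f w)) (ocld T w) (glue G id f)
          (opcomp P (fiber G f w) (restrict (scale G (s / r) x) (verts (fiber G f w)))) =
        oprelabel P (labels (fiber G f w)) (ocld T w) (glue G id f)
          (eval r s (fiber G f w) a (restrict x (verts (fiber G f w))))"
        using scale_fiber[OF G f] by simp
    qed
    moreover have "eval r s G a x = opcomp P T (tree_map P id f G T (scale G (s / r) x))"
      using eval_const_level[OF G l _ x] True opcomp_nat[OF G T f X]
        oprel_id[OF tin_arity[OF G] opcomp_in[OF G X]] by simp
    ultimately show ?thesis by simp
  next
    case False
    then obtain u where u: "u \<in> verts G" "u \<noteq> root G" "a u \<noteq> r" by blast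
    then have d: "decomposable G" using decomposable_iff[OF lG] by blast
    define m where "m = minlev G a"
    note lm = levels_minlev[OF G d l, folded m_def]
    have "a u < r" using u l by (auto simp: levels_def less_le)
    then have mr: "m < r" using minlev(2)[OF G d u(1,2), of a] by (simp add: m_def)
    obtain v0 where v0: "v0 \<in> verts G" "v0 \<noteq> root G" "a v0 = m" using minlev(1)[OF G d] m_def by metis
    define G1 q X where "G1 = low G a m" and "q = lowmap G a m" and "X = scale G (s / m) x"
    note lq = low[OF G, where a = a and m = m, folded G1_def q_def]
    have X: "X \<in> pts G" unfolding X_def by (rule scale_in[OF G x lm(4)])
    have lvm: "levels m r G a" using l lm minlev(2)[OF G d] by (auto simp: levels_def m_def)
    have qf: "contracts G f v" if "contracts G q v" for v
      using that nc[of v] lq(3)[of v] mr by auto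
    obtain h where h: "tree_mor id h G1 T" and hq: "\<And>v. v \<in> verts G \<Longrightarrow> h (q v) = f v"
      and hc: "\<And>w. w \<in> verts G1 \<Longrightarrow> contracts G1 h w \<longleftrightarrow> contracts G f (fiber_root G q w)"
      and "\<And>w. w \<in> verts T \<Longrightarrow> fiber_root G1 h w = q (fiber_root G f w)"
      using tree_mor_factor[OF lG lq(2) f qf] by blast
    have y: "tree_map P id q G G1 X \<in> pts G1" by (rule tree_map_in[OF G lq(1,2) X])
    have "eval r s G a x = eval r m G1 a (tree_map P id q G G1 X)"
      unfolding eval_dec[OF G d] m_def G1_def q_def X_def ..
    also have "\<dots> = opcomp P T (\<lambda>w\<in>verts T. oprelabel P (labels (fiber G1 h w)) (ocld T w) (glue G1 id h)
     (eval r m (fiber G1 h w) a (restrict (tree_map P id q G G1 X) (verts (fiber G1 h w)))))"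
    proof (rule less.hyps[OF _ lq(1) T h _ _ y])
      show "card (verts G1) < card (verts G)" unfolding G1_def by (rule low_card[OF G v0(1,2)]) (use v0 in simp)
      show "levels m r G1 a" unfolding G1_def by (rule low_levels[OF G l lm(2,3)])
      show "a w = r" if "w \<in> verts G1" "w \<noteq> root G1" "\<not> contracts G1 h w" for w
        using nc[of w] that hc[OF that(1)] lq(4)[OF that(1)] lq(5)[of w] by (auto simp: G1_def)
    qed
    also have "\<dots> = opcomp P T (\<lambda>w\<in>verts T. oprelabel P (labels (fiber G f w)) (ocld T w) (glue G id f)
     (eval r s (fiber G f w) a (restrict x (verts (fiber G f w)))))"
    proof (rule arg_cong[where f = "opcomp P T"], rule restrict_ext)
      fix w assume w: "w \<in> verts T"
      define F F1 where "F = fiber G f w" and "F1 = fiber G1 h w"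
      have Fh: "fiber G (h \<circ> q) w = F" unfolding F_def by (rule fiber_cong[OF lG]) (simp add: hq)
      have Fin: "tree_in (labels F) F" and F1in: "tree_in (labels F1) F1"
        unfolding F_def F1_def by (rule fiber_in[OF G T f w], rule fiber_in[OF lq(1) T h w])
      note rm = fiber_restrict_mor[OF lG tin_lt[OF lq(1)] lT lq(2) h w, unfolded Fh F1_def[symmetric]]
      have xF: "restrict x (verts F) \<in> pts F" and XF: "restrict X (verts F) \<in> pts F"
        unfolding F_def by (rule fiber_pts[OF G f x], rule fiber_pts[OF G f X])
      have lF: "levels m r F a" unfolding F_def by (rule fiber_levels[OF f lvm])
      have "eval r m F1 a (tree_map P (glue G id q) q F F1 (restrict X (verts F))) =
          oprelabel P (labels F) (labels F1) (glue G id q) (eval r m F a (restrict X (verts F)))"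
      proof (rule eval_natural[OF Fin F1in rm(1) lF _ _ XF])
        show "a v = m" if "contracts F q v" for v
          using that minlev(2)[OF G d, of v a] lq(3)[of v] unfolding rm(4) m_def by (auto intro: antisym)
        show "a u = a (fiber_root F q u)" if u: "u \<in> verts F1" for u
        proof -
          have "u \<in> verts G1" "h u = w" using u by (auto simp: F1_def)
          then show ?thesis using rm(2) lq(4) by simp
        qed
      qed
      moreover have "restrict (tree_map P id q G G1 X) (verts F1) = tree_map P (glue G id q) q F F1 (restrict X (verts F))"
        using tree_map_restrict[OF G lq(1) T lq(2) h w X] unfolding Fh F1_def[symmetric] by simp
      moreover have "eval r m F a (restrict X (verts F)) = eval r s F a (restrict x (verts F))"
        using eval_flow[OF Fin lF s(1) lm(2) xF] scale_fiber[OF G f, where w = w] unfolding F_def X_def by simp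
      ultimately have e: "eval r m F1 a (restrict (tree_map P id q G G1 X) (verts F1)) =
         oprelabel P (labels F) (labels F1) (glue G id q) (eval r s F a (restrict x (verts F)))" by simp
      have lsF: "levels s r F a" unfolding F_def by (rule fiber_levels[OF f l])
      have ein: "eval r s F a (restrict x (verts F)) \<in> Ops (labels F)" by (rule eval_in[OF Fin lsF xF])
      have b1: "bij_betw (glue G id q) (labels F) (labels F1)" using mor_bij[OF rm(1)] .
      have b2: "bij_betw (glue G1 id h) (labels F1) (ocld T w)"
        unfolding F1_def by (rule glue_bij[OF tin_lt[OF lq(1)] lT h w])
      have b3: "bij_betw (glue G id f) (labels F) (ocld T w)"
        unfolding F_def by (rule glue_bij[OF lG lT f w])
      have "oprelabel P (labels F) (ocld T w) (glue G1 id h \<circ> glue G id q) (eval r s F a (restrict x (verts F))) =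
         oprelabel P (labels F) (ocld T w) (glue G id f) (eval r s F a (restrict x (verts F)))"
      proof (rule oprel_cong[OF tin_arity[OF Fin] b3 _ ein])
        fix z assume z: "z \<in> labels F"
        show "(glue G1 id h \<circ> glue G id q) z = glue G id f z"
        proof (cases "z \<in> verts G")
          case True
          then show ?thesis using mor_verts[OF lq(2) True] hq[OF True] by (simp add: glue_def)
        next
          case False
          then have "z \<in> S" using z lt_lb[OF lG] unfolding F_def labels_fiber[OF lG] by auto
          then show ?thesis using False lt_disj[OF tin_lt[OF lq(1)]] by (auto simp: glue_def)
        qed
      qed
      then show "oprelabel P (labels (fiber G1 h w)) (ocld T w) (glue G1 id h)
           (eval r m (fiber G1 h w) a (restrict (tree_map P id q G G1 X) (verts (fiber G1 h w)))) =
        oprelabel P (labels (fiber G f w)) (ocld T w) (glue G id f)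
          (eval r s (fiber G f w) a (restrict x (verts (fiber G f w))))"
        using e oprel_comp[OF tin_arity[OF Fin] b1 b2 ein] unfolding F_def[symmetric] F1_def[symmetric] by simp
    qed
    finally show ?thesis .
  qed
qed

lemma graft_ex:
  assumes U: "tree_in S U" and Tr: "\<And>w. w \<in> verts U \<Longrightarrow> tree_in (ocld U w) (Tr w)"
    and X: "\<And>w. w \<in> verts U \<Longrightarrow> X w \<in> pts (Tr w)"
  obtains G f \<tau> k z where "tree_in S G" "tree_mor id f G U"
    "\<And>w. w \<in> verts U \<Longrightarrow> tree_mor (\<tau> w) (k w) (Tr w) (fiber G f w)"
    "\<And>w v. w \<in> verts U \<Longrightarrow> \<not> contracts (Tr w) (k w) v"
    "\<And>w s. w \<in> verts U \<Longrightarrow> s \<in> ocld U w \<Longrightarrow> glue G id f (\<tau> w s) = s"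
    "z \<in> pts G"
    "\<And>w. w \<in> verts U \<Longrightarrow> restrict z (verts (fiber G f w)) = tree_map P (\<tau> w) (k w) (Tr w) (fiber G f w) (X w)"
proof -
  obtain G f \<tau> k where lG: "labeled_tree S G" and f: "tree_mor id f G U"
    and k: "\<And>w. w \<in> verts U \<Longrightarrow> tree_mor (\<tau> w) (k w) (Tr w) (fiber G f w)"
    and kc: "\<And>w v. w \<in> verts U \<Longrightarrow> \<not> contracts (Tr w) (k w) v"
    and gl: "\<And>w s. w \<in> verts U \<Longrightarrow> s \<in> ocld U w \<Longrightarrow> glue G id f (\<tau> w s) = s"
    using tree_substitution[OF tin_lt[OF U] tin_lt[OF Tr]] by metis
  note G = tree_inI[OF lG tin_arity[OF U]]
  define y where "y w = tree_map P (\<tau> w) (k w) (Tr w) (fiber G f w) (X w)" for w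
  have y: "y w \<in> pts (fiber G f w)" if "w \<in> verts U" for w
    unfolding y_def by (rule tree_map_in[OF Tr[OF that] fiber_in[OF G U f that] k[OF that] X[OF that]])
  define z where "z = (\<lambda>u\<in>verts G. y (f u) u)"
  have z: "z \<in> pts G"
    unfolding pts_iff
  proof (rule PiE_I)
    fix u assume u: "u \<in> verts G"
    show "z u \<in> Ops (ocld G u)"
      using pts_D[OF y[OF mor_verts[OF f u]], of u] u ocld_fiber[OF lG f u] by (simp add: z_def)
  qed (simp add: z_def)
  have "restrict z (verts (fiber G f w)) = y w" if w: "w \<in> verts U" for w
    by (rule pts_eqI[OF fiber_pts[OF G f z] y[OF w]]) (simp add: z_def)
  then show thesis using that[OF G f k kc gl z] unfolding y_def by blast
qed

subsection \<open>Injectivity\<close>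

definition level_iso :: "ltree \<Rightarrow> (nat \<Rightarrow> real) \<Rightarrow> (nat \<Rightarrow> 'a) \<Rightarrow> ltree \<Rightarrow> (nat \<Rightarrow> real) \<Rightarrow> (nat \<Rightarrow> 'a) \<Rightarrow> bool" where
  "level_iso T a x T' a' x' \<longleftrightarrow> (\<exists>g. tree_mor id g T T' \<and> (\<forall>v. \<not> contracts T g v) \<and> tree_map P id g T T' x = x' \<and>
     (\<forall>v\<in>verts T. v \<noteq> root T \<longrightarrow> a' (g v) = a v))"

text \<open>Just after a contraction some label is decomposable, but a tree that has only been scaled since an
earlier time has no such label.\<close>

lemma contraction_time_unique:
  assumes T: "tree_in S T" and T': "tree_in S T'" and d: "decomposable T" and m: "m = minlev T a" "0 < s" "s < m"
    and x: "x \<in> pts T" and x': "x' \<in> pts T'"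
    and iso: "level_iso (low T a m) a (tree_map P id (lowmap T a m) T (low T a m) (scale T (s / m) x)) T' a' (scale T' (s / m) x')"
  shows False
proof -
  note lq = low[OF T, where a = a and m = m]
  have sm: "s / m \<in> {0..1}" "0 \<le> s / m" "s / m < 1" using m by auto
  note X = scale_in[OF T x sm(1)]
  obtain g where g: "tree_mor id g (low T a m) T'"
    and e: "tree_map P id g (low T a m) T' (tree_map P id (lowmap T a m) T (low T a m) (scale T (s / m) x)) = scale T' (s / m) x'"
    using iso unfolding level_iso_def by blast
  obtain v0 where v0: "v0 \<in> verts T" "v0 \<noteq> root T" "a v0 = m" using minlev(1)[OF T d] m by metis
  let ?f = "g \<circ> lowmap T a m"
  have f: "tree_mor id ?f T T'" using tree_mor_comp(1)[OF tin_lt[OF T] lq(2) g] by simp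
  have "contracts T (lowmap T a m) v0" using lq(3)[of v0] v0 by simp
  then have c: "contracts T ?f v0" using contracts_comp[OF lq(2) g] by blast
  have "tree_map P id ?f T T' (scale T (s / m) x) = scale T' (s / m) x'"
    using tree_map_comp[OF T lq(1) T' lq(2) g X] e by simp
  then show False
    using contracted_Decom[OF T T' f c X] scale_prime[OF T' x' sm(2,3)] by (auto simp: prime_labels_def)
qed

text \<open>The process is run backwards. The first contractions of the two trees occur at the same time, as
decomposable labels are present only just after a contraction. By induction the trees are isomorphic
after it. Before it, all labels are indecomposable, as they have been scaled by a factor less
than \<open>1\<close>; here the levels have to be greater than \<open>s\<close>. Thus both trees are finest decompositions of
the same operations.\<close>

lemma eval_injective:
  assumes "tree_in S T" "tree_in S T'" "levels s r T a" "levels s r T' a'"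
    and "\<And>v. v \<in> verts T \<Longrightarrow> v \<noteq> root T \<Longrightarrow> s < a v" and "\<And>v. v \<in> verts T' \<Longrightarrow> v \<noteq> root T' \<Longrightarrow> s < a' v"
    and "x \<in> pts T" "x' \<in> pts T'" and "eval r s T a x = eval r s T' a' x'"
  shows "level_iso T a x T' a' x'"
  using assms
proof (induction "card (verts T) + card (verts T')" arbitrary: T T' s x x' a a' rule: less_induct)
  case less
  note T = less.prems(1) and T' = less.prems(2) and l = less.prems(3) and l' = less.prems(4) and st = less.prems(5)
    and st' = less.prems(6) and x = less.prems(7) and x' = less.prems(8) and e = less.prems(9)
  note S = tin_arity[OF T] note lT = tin_lt[OF T] note lT' = tin_lt[OF T']
  have s: "0 < s" "s \<le> r" using l by (auto simp: levels_def)
  \<comment> \<open>The first contraction of \<open>A\<close> cannot come before every contraction of \<open>B\<close>.\<close>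
  have early: False
    if A: "tree_in S A" "tree_in S B" "decomposable A" "levels s r A \<alpha>" "levels s r B \<beta>"
        "\<And>v. v \<in> verts A \<Longrightarrow> v \<noteq> root A \<Longrightarrow> s < \<alpha> v" "\<And>v. v \<in> verts B \<Longrightarrow> v \<noteq> root B \<Longrightarrow> minlev A \<alpha> < \<beta> v"
        "y \<in> pts A" "z \<in> pts B" "eval r s A \<alpha> y = eval r s B \<beta> z" "card (verts A) + card (verts B) = card (verts T) + card (verts T')"
    for A B \<alpha> \<beta> y z
  proof -
    let ?m = "minlev A \<alpha>"
    note lm = levels_minlev[OF A(1,3,4)]
    obtain v0 where v0: "v0 \<in> verts A" "v0 \<noteq> root A" "\<alpha> v0 = ?m" using minlev(1)[OF A(1,3)] by blast
    then have sm: "s < ?m" using A(6)[of v0] by simp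
    note lq = low[OF A(1), where a = \<alpha> and m = ?m]
    note Y = scale_in[OF A(1,8) lm(4)] note Z = scale_in[OF A(2,9) lm(4)]
    have lB: "levels ?m r B \<beta>" using A(5,7) lm by (auto simp: levels_def less_imp_le)
    have "level_iso (low A \<alpha> ?m) \<alpha> (tree_map P id (lowmap A \<alpha> ?m) A (low A \<alpha> ?m) (scale A (s / ?m) y)) B \<beta> (scale B (s / ?m) z)"
    proof (rule less.hyps[OF _ lq(1) A(2) low_levels[OF A(1,4) lm(2,3)] lB _ A(7) tree_map_in[OF A(1) lq(1,2) Y] Z])
      show "card (verts (low A \<alpha> ?m)) + card (verts B) < card (verts T) + card (verts T')"
        using low_card[OF A(1) v0(1,2), of \<alpha> ?m] v0 A(11) by linarith
      show "?m < \<alpha> v" if "v \<in> verts (low A \<alpha> ?m)" "v \<noteq> root (low A \<alpha> ?m)" for v using that lq(5)[of v] by simp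
      show "eval r ?m (low A \<alpha> ?m) \<alpha> (tree_map P id (lowmap A \<alpha> ?m) A (low A \<alpha> ?m) (scale A (s / ?m) y)) =
        eval r ?m B \<beta> (scale B (s / ?m) z)"
        using A(10) eval_dec[OF A(1,3), of r s \<alpha> y] eval_flow[OF A(2) lB s(1) lm(2) A(9)] by simp
    qed
    then show False using contraction_time_unique[OF A(1,2,3) refl s(1) sm A(8,9)] by blast
  qed
  show ?case
  proof (cases "decomposable T")
    case nd: False
    have nd': "\<not> decomposable T'"
    proof
      assume d': "decomposable T'"
      show False by (rule early[OF T' T d' l' l st' _ x' x e[symmetric]]) (use nd decomposable_iff[OF lT] in auto)
    qed
    note v = ocld_root_corolla[OF lT nd] note v' = ocld_root_corolla[OF lT' nd']
    have r: "x (root T) \<in> Ops S" "x' (root T') \<in> Ops S"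
      using pts_D[OF x lt_root[OF lT]] pts_D[OF x' lt_root[OF lT']] v v' by auto
    have "sc S (s / r) (x (root T)) = sc S (s / r) (x' (root T'))"
      using e unfolding eval_nondec[OF T nd] eval_nondec[OF T' nd'] .
    then have xx: "x (root T) = x' (root T')" by (rule sc_inj[OF S r, rotated 2]) (use s in auto)
    have m: "tree_mor id (\<lambda>_. root T') T T'" by (rule nondec_mor[OF lT lT' nd']) simp
    have "tree_map P id (\<lambda>_. root T') T T' x = x'"
    proof (rule pts_eqI[OF tree_map_in[OF T T' m x] x'])
      show "tree_map P id (\<lambda>_. root T') T T' x u = x' u" if "u \<in> verts T'" for u
        using tree_map_nondec[OF T T' nd' _ x, of id] oprel_id[OF S opcomp_in[OF T x]] opcomp_corolla[OF T nd x] that v' xx by simp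
    qed
    then show ?thesis unfolding level_iso_def using m v by (intro exI[of _ "\<lambda>_. root T'"]) (auto simp: contracts_def)
  next
    case d: True
    have d': "decomposable T'"
    proof (rule ccontr)
      assume nd': "\<not> decomposable T'"
      show False by (rule early[OF T T' d l l' st _ x x' e]) (use nd' decomposable_iff[OF lT'] in auto)
    qed
    have "\<not> minlev T a < minlev T' a'"
    proof
      assume h: "minlev T a < minlev T' a'"
      show False by (rule early[OF T T' d l l' st _ x x' e]) (use h minlev(2)[OF T' d', of _ a'] in force)+
    qed
    moreover have "\<not> minlev T' a' < minlev T a"
    proof
      assume h: "minlev T' a' < minlev T a"
      show False by (rule early[OF T' T d' l' l st' _ x' x e[symmetric]]) (use h minlev(2)[OF T d, of _ a] in force)+
    qed
    ultimately have mm: "minlev T' a' = minlev T a" by simp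
    define m where "m = minlev T a"
    note lm = levels_minlev[OF T d l, folded m_def]
    obtain v0 where v0: "v0 \<in> verts T" "v0 \<noteq> root T" "a v0 = m" using minlev(1)[OF T d] m_def by metis
    obtain v1 where v1: "v1 \<in> verts T'" "v1 \<noteq> root T'" "a' v1 = m" using minlev(1)[OF T' d', of a'] mm m_def by metis
    have sm: "0 < s / m" "0 \<le> s / m" "s / m < 1" using st[OF v0(1,2)] v0 s by auto
    define T1 q X where "T1 = low T a m" and "q = lowmap T a m" and "X = scale T (s / m) x"
    define T1' q' X' where "T1' = low T' a' m" and "q' = lowmap T' a' m" and "X' = scale T' (s / m) x'"
    note lq = low[OF T, where a = a and m = m, folded T1_def q_def]
    note lq' = low[OF T', where a = a' and m = m, folded T1'_def q'_def]
    have X: "X \<in> pts T" and X': "X' \<in> pts T'" unfolding X_def X'_def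
      by (rule scale_in[OF T x lm(4)], rule scale_in[OF T' x' lm(4)])
    have "level_iso T1 a (tree_map P id q T T1 X) T1' a' (tree_map P id q' T' T1' X')"
    proof (rule less.hyps[OF _ lq(1) lq'(1) _ _ _ _ tree_map_in[OF T lq(1,2) X] tree_map_in[OF T' lq'(1,2) X']])
      show "card (verts T1) + card (verts T1') < card (verts T) + card (verts T')"
        unfolding T1_def T1'_def using low_card[OF T v0(1,2), of a m] low_card[OF T' v1(1,2), of a' m] v0 v1 by linarith
      show "levels m r T1 a" "levels m r T1' a'" unfolding T1_def T1'_def
        by (rule low_levels[OF T l lm(2,3)], rule low_levels[OF T' l' lm(2,3)])
      show "m < a v" if "v \<in> verts T1" "v \<noteq> root T1" for v using that lq(5)[of v] by (simp add: T1_def)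
      show "m < a' v" if "v \<in> verts T1'" "v \<noteq> root T1'" for v using that lq'(5)[of v] by (simp add: T1'_def)
      show "eval r m T1 a (tree_map P id q T T1 X) = eval r m T1' a' (tree_map P id q' T' T1' X')"
        using e unfolding eval_dec[OF T d] eval_dec[OF T' d'] mm
        unfolding m_def[symmetric] T1_def q_def X_def T1'_def q'_def X'_def .
    qed
    then obtain g1 where g1: "tree_mor id g1 T1 T1'" "\<And>v. \<not> contracts T1 g1 v"
      "tree_map P id g1 T1 T1' (tree_map P id q T T1 X) = tree_map P id q' T' T1' X'"
      "\<And>v. v \<in> verts T1 \<Longrightarrow> v \<noteq> root T1 \<Longrightarrow> a' (g1 v) = a v" unfolding level_iso_def by blast
    have f: "tree_mor id (g1 \<circ> q) T T1'" using tree_mor_comp(1)[OF lT lq(2) g1(1)] by simp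
    have "tree_map P id (g1 \<circ> q) T T1' X = tree_map P id q' T' T1' X'"
      using tree_map_comp[OF T lq(1) lq'(1) lq(2) g1(1) X] g1(3) by simp
    \<comment> \<open>The isomorphism after the first contraction lifts to the finest decompositions before it.\<close>
    then obtain g where g: "tree_mor id g T T'" and gX: "tree_map P id g T T' X = X'"
      and gg: "\<And>v. v \<in> verts T \<Longrightarrow> q' (g v) = g1 (q v)"
      using diamond[OF T T' lq'(1) f lq'(2) X X'] scale_prime[OF T x sm(2,3)] unfolding X_def comp_apply by metis
    have gc: "\<not> contracts T g v" for v
      using contracted_Decom[OF T T' g _ X, of v] scale_prime[OF T' x' sm(2,3)] gX unfolding X'_def prime_labels_def by metis
    have "scale T' (s / m) (tree_map P id g T T' x) = scale T' (s / m) x'"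
      using scale_mor[OF T T' g gc x lm(4)] gX unfolding X_def X'_def by simp
    then have gx: "tree_map P id g T T' x = x'"
      by (rule scale_inj[OF T' tree_map_in[OF T T' g x] x' sm(1), rotated]) (use sm in simp)
    \<comment> \<open>The edges contracted at the time \<open>m\<close> correspond under \<open>g\<close>; for the others the levels agree by induction.\<close>
    have "a' (g v) = a v" if v: "v \<in> verts T" "v \<noteq> root T" for v
    proof -
      note gv = mor_verts[OF g v(1)] mor_noncontr[OF g v gc]
      note pv = lt_parent[OF lT v]
      have qp: "q' (parent T' (g v)) = g1 (q (parent T v))" using gv(3) gg[OF pv] by simp
      show ?thesis
      proof (cases "m < a v")
        case True
        have nc: "\<not> contracts T q v" using lq(3)[of v] True by simp
        then have "\<not> contracts T (g1 \<circ> q) v" using contracts_comp[OF lq(2) g1(1)] g1(2) by blast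
        then have "g1 (q v) \<noteq> g1 (q (parent T v))" using v by (simp add: contracts_def)
        then have "\<not> contracts T' q' (g v)" using gg[OF v(1)] qp by (simp add: contracts_def)
        then have "m < a' (g v)" using lq'(3)[of "g v"] gv by simp
        then have "g v = q' (g v)" using lq'(6)[OF gv(1,2)] by simp
        also have "\<dots> = g1 v" using gg[OF v(1)] lq(6)[OF v True] by simp
        finally show ?thesis using g1(4)[of v] lq(5)[of v] v True by (simp add: T1_def)
      next
        case False
        then have "contracts T q v" using lq(3)[of v] v by simp
        then have "q' (g v) = q' (parent T' (g v))" using gg[OF v(1)] qp by (simp add: contracts_def)
        then have "contracts T' q' (g v)" using gv by (simp add: contracts_def)
        then have "a' (g v) \<le> m" using lq'(3)[of "g v"] by simp
        then show ?thesis
          using False minlev(2)[OF T d v, of a] minlev(2)[OF T' d' gv(1,2), of a'] mm by (simp add: m_def)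
      qed
    qed
    then show ?thesis unfolding level_iso_def using g gc gx by blast
  qed
qed

subsection \<open>Surjectivity\<close>

definition reached :: "nat set \<Rightarrow> real \<Rightarrow> 'a \<Rightarrow> ltree \<Rightarrow> (nat \<Rightarrow> real) \<Rightarrow> (nat \<Rightarrow> 'a) \<Rightarrow> bool" where
  "reached S r z T a x \<longleftrightarrow> tree_in S T \<and> (\<forall>v\<in>verts T. 1 \<le> a v \<and> a v \<le> r) \<and> x \<in> pts T \<and> eval r 1 T a x = z"

text \<open>Trees that reach the components of \<open>y\<close> at the time \<open>M\<close> are grafted along edges of level \<open>M\<close>.\<close>

lemma reached_comp:
  assumes U: "tree_in S U" and d: "decomposable U" and y: "y \<in> pts U" and M: "1 \<le> M"
    and R: "\<And>w. w \<in> verts U \<Longrightarrow> \<exists>T a x. reached (ocld U w) M (y w) T a x"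
  shows "\<exists>T a x. reached S M (opcomp P U y) T a x \<and> decomposable T"
proof -
  have "\<exists>Tr A X. \<forall>w. w \<in> verts U \<longrightarrow> reached (ocld U w) M (y w) (Tr w) (A w) (X w)"
    using R by metis
  then obtain Tr A X where r: "\<And>w. w \<in> verts U \<Longrightarrow> reached (ocld U w) M (y w) (Tr w) (A w) (X w)" by blast
  have Tr: "tree_in (ocld U w) (Tr w)" and A: "\<And>v. v \<in> verts (Tr w) \<Longrightarrow> 1 \<le> A w v \<and> A w v \<le> M"
    and X: "X w \<in> pts (Tr w)" and ev: "eval M 1 (Tr w) (A w) (X w) = y w" if "w \<in> verts U" for w
    using r[OF that] by (auto simp: reached_def)
  obtain G f \<tau> k z where G: "tree_in S G" and f: "tree_mor id f G U"
    and k: "\<And>w. w \<in> verts U \<Longrightarrow> tree_mor (\<tau> w) (k w) (Tr w) (fiber G f w)"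
    and kc: "\<And>w v. w \<in> verts U \<Longrightarrow> \<not> contracts (Tr w) (k w) v"
    and gl: "\<And>w s. w \<in> verts U \<Longrightarrow> s \<in> ocld U w \<Longrightarrow> glue G id f (\<tau> w s) = s"
    and z: "z \<in> pts G"
    and zr: "\<And>w. w \<in> verts U \<Longrightarrow> restrict z (verts (fiber G f w)) = tree_map P (\<tau> w) (k w) (Tr w) (fiber G f w) (X w)"
    using graft_ex[OF U Tr X] by metis
  \<comment> \<open>The edges inside the grafted trees keep their level, the new ones get level \<open>M\<close>.\<close>
  define b where "b u = (if contracts G f u then A (f u) (fiber_root (Tr (f u)) (k (f u)) u) else M)" for u
  have b: "1 \<le> b u \<and> b u \<le> M" for u
  proof (cases "contracts G f u")
    case True
    then have u: "u \<in> verts G" by (simp add: contracts_def)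
    note w = mor_verts[OF f u]
    have "fiber_root (Tr (f u)) (k (f u)) u \<in> verts (Tr (f u))" by (rule froot_in[OF k[OF w]]) (use u in simp)
    then show ?thesis using A[OF w] True by (simp add: b_def)
  qed (use M in \<open>simp add: b_def\<close>)
  have lG: "levels 1 M G b" using M b by (simp add: levels_def)
  have F: "eval M 1 (fiber G f w) b (restrict z (verts (fiber G f w))) = oprelabel P (ocld U w) (labels (fiber G f w)) (\<tau> w) (y w)"
    if w: "w \<in> verts U" for w
    unfolding zr[OF w] ev[OF w, symmetric]
  proof (rule eval_natural[OF Tr[OF w] fiber_in[OF G U f w] k[OF w] _ _ _ X[OF w]])
    show "levels 1 M (Tr w) (A w)" using A[OF w] M by (simp add: levels_def)
    show "A w v = 1" if "contracts (Tr w) (k w) v" for v using kc[OF w] that by blast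
    show "b u = A w (fiber_root (Tr w) (k w) u)" if u: "u \<in> verts (fiber G f w)" "u \<noteq> root (fiber G f w)" for u
    proof -
      have "u \<in> verts G" "f u = w" "contracts G f u" using u fiber_root_iff[OF f, of u] by auto
      then show ?thesis by (simp add: b_def)
    qed
  qed
  have "eval M 1 G b z = opcomp P U (\<lambda>w\<in>verts U. oprelabel P (labels (fiber G f w)) (ocld U w) (glue G id f)
     (eval M 1 (fiber G f w) b (restrict z (verts (fiber G f w)))))"
    by (rule eval_graft[OF G U f lG _ z]) (simp add: b_def)
  also have "(\<lambda>w\<in>verts U. oprelabel P (labels (fiber G f w)) (ocld U w) (glue G id f)
     (eval M 1 (fiber G f w) b (restrict z (verts (fiber G f w))))) = restrict y (verts U)"
  proof (rule restrict_ext)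
    fix w assume w: "w \<in> verts U"
    note g = glue_bij[OF tin_lt[OF G] tin_lt[OF U] f w]
    have t: "bij_betw (\<tau> w) (ocld U w) (labels (fiber G f w))"
      by (rule tin_mor_bij[OF Tr[OF w] fiber_in[OF G U f w] k[OF w]])
    show "oprelabel P (labels (fiber G f w)) (ocld U w) (glue G id f)
        (eval M 1 (fiber G f w) b (restrict z (verts (fiber G f w)))) = y w"
      unfolding F[OF w] oprel_comp[OF tin_ocld[OF U w] t g pts_D[OF y w]]
      by (rule oprel_id'[OF tin_ocld[OF U w] pts_D[OF y w]]) (simp add: gl[OF w])
  qed
  finally have e: "eval M 1 G b z = opcomp P U y" unfolding pts_restrict[OF y] .
  have "decomposable G"
  proof (rule ccontr)
    assume "\<not> decomposable G"
    then have "verts U = {root U}" using mor_img[OF f] mor_root[OF f] by (simp add: decomposable_def)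
    then show False using d by (simp add: decomposable_def)
  qed
  then show ?thesis using G z b e unfolding reached_def by blast
qed

lemma reached_rescale:
  assumes "reached S M y T a x" "1 \<le> M" "M \<le> r" shows "reached S r (sc S (M / r) y) T a x"
  using assms eval_rescale[of S T 1 M a r x] by (force simp: reached_def levels_def)

text \<open>An operation in the image of the scaling by \<open>1 / r\<close> comes from a one-vertex tree. Any other is a
boundary point \<open>b\<close> scaled by some \<open>u\<close> between \<open>1 / r\<close> and \<open>1\<close>, so a contraction has to produce \<open>b\<close> at the
time \<open>u * r\<close>. The operations of which \<open>b\<close> is composed have fewer inputs, and by induction they are
reached at this time.\<close>

lemma eval_surjective: "arity_set n S \<Longrightarrow> 1 \<le> r \<Longrightarrow> z \<in> Ops S \<Longrightarrow> \<exists>T a x. reached S r z T a x"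
proof (induction "card S" arbitrary: S r z rule: less_induct)
  case less
  note S = less.prems(1) and r = less.prems(2) and z = less.prems(3)
  have "0 < 1 / r" "1 / r \<le> 1" using r by auto
  then consider (scaled) b where "b \<in> Ops S" "z = sc S (1 / r) b"
    | (collar) b u where "b \<in> Decom P S" "1 / r \<le> u" "u \<le> 1" "z = sc S u b"
    using sc_cover[OF S z] by blast
  then show ?case
  proof cases
    case scaled
    obtain v where v: "v \<notin> S" using fresh_ex S by (metis arity_set_def)
    note c = corolla_in[OF S v]
    have "reached S r z (corolla S v) (\<lambda>_. 1) (\<lambda>u\<in>{v}. b)"
      using c corolla_pts[OF scaled(1)] scaled r eval_nondec[OF c] by (simp add: reached_def)
    then show ?thesis by blast
  next
    case collar
    obtain U y where U: "labeled_tree S U" "decomposable U" "y \<in> pts U" "b = opcomp P U y"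
      using collar(1) unfolding Decom_iff by blast
    note Uin = tree_inI[OF U(1) S]
    have M: "1 \<le> u * r" "u * r \<le> r" using collar r by (simp_all add: field_simps)
    have "\<exists>T a x. reached S (u * r) b T a x \<and> decomposable T"
      unfolding U(4)
    proof (rule reached_comp[OF Uin U(2,3) M(1)])
      fix w assume w: "w \<in> verts U"
      show "\<exists>T a x. reached (ocld U w) (u * r) (y w) T a x"
        by (rule less.hyps[OF lt_card_ocld_less[OF U(1) w U(2)] tin_ocld[OF Uin w] M(1) pts_D[OF U(3) w]])
    qed
    then obtain T a x where "reached S (u * r) b T a x" by blast
    from reached_rescale[OF this M] show ?thesis using collar r by auto
  qed
qed

lemma eval_surjective_Decom:
  assumes S: "arity_set n S" and b: "b \<in> Decom P S" and u: "1 / r \<le> u" "u \<le> 1" and r: "1 \<le> r"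
  shows "\<exists>T a x. reached S r (sc S u b) T a x \<and> decomposable T"
proof -
  obtain U y where U: "labeled_tree S U" "decomposable U" "y \<in> pts U" "b = opcomp P U y"
    using b unfolding Decom_iff by blast
  note Uin = tree_inI[OF U(1) S]
  have M: "1 \<le> u * r" "u * r \<le> r" using u r by (simp_all add: field_simps)
  obtain T a x where T: "reached S (u * r) b T a x" "decomposable T"
    using reached_comp[OF Uin U(2,3) M(1)] eval_surjective[OF tin_ocld[OF Uin] M(1) pts_D[OF U(3)]] U(4) by metis
  from reached_rescale[OF T(1) M] T(2) r show ?thesis by auto
qed

text \<open>The last contraction, at a time \<open>t\<close> between \<open>s\<close> and \<open>r\<close>, produces a decomposable operation, which is
then scaled by \<open>u = t / r\<close>.\<close>

lemma eval_decomposable: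
  assumes "tree_in S T" "levels s r T a" "decomposable T" "x \<in> pts T"
  shows "\<exists>b\<in>Decom P S. \<exists>u. s / r \<le> u \<and> u \<le> 1 \<and> eval r s T a x = sc S u b"
proof -
  have "decomposable T \<longrightarrow> (\<forall>x\<in>pts T. \<exists>b\<in>Decom P S. \<exists>u. s / r \<le> u \<and> u \<le> 1 \<and> eval r s T a x = sc S u b)"
    using assms(1,2)
  proof (induction rule: eval_induct)
    case (dec s T)
    let ?m = "minlev T a"
    note lm = levels_minlev[OF dec(1,3,2)] note lq = low[OF dec(1), where a = a and m = ?m]
    obtain v0 where v0: "v0 \<in> verts T" "v0 \<noteq> root T" "a v0 = ?m" using minlev(1)[OF dec(1,3)] by blast
    have mr: "s / r \<le> ?m / r" "?m / r \<le> 1" using lm by (auto intro: divide_right_mono)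
    show ?case
    proof (intro impI ballI)
      fix x assume x: "x \<in> pts T"
      note X = scale_in[OF dec(1) x lm(4)]
      let ?y = "tree_map P id (lowmap T a ?m) T (low T a ?m) (scale T (s / ?m) x)"
      have y: "?y \<in> pts (low T a ?m)" by (rule tree_map_in[OF dec(1) lq(1,2) X])
      show "\<exists>b\<in>Decom P S. \<exists>u. s / r \<le> u \<and> u \<le> 1 \<and> eval r s T a x = sc S u b"
      proof (cases "decomposable (low T a ?m)")
        case True
        then obtain b u where "b \<in> Decom P S" "?m / r \<le> u" "u \<le> 1" "eval r ?m (low T a ?m) a ?y = sc S u b"
          using dec(4) y by blast
        then show ?thesis unfolding eval_dec[OF dec(1,3)] using mr order_trans by blast
      next
        case False
        note v = ocld_root_corolla[OF tin_lt[OF lq(1)] False]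
        have "contracts T (lowmap T a ?m) v0" using lq(3)[of v0] v0 by simp
        from contracted_Decom[OF dec(1) lq(1,2) this X]
        have "?y (root (low T a ?m)) \<in> Decom P S" using v by auto
        then show ?thesis unfolding eval_dec[OF dec(1,3)] eval_nondec[OF lq(1) False] using mr by blast
      qed
    qed
  qed simp
  then show ?thesis using assms(3,4) by blast
qed

end

section \<open>Transport of operad structures\<close>

context trunc_operad
begin

lemma tree_upto_iff: "tree_upto n T \<longleftrightarrow> tree_in (labels T) T"
  by (simp add: tree_upto_def tree_in_def)

text \<open>Every law of \<open>Q\<close> is an equation or a continuity statement, and may be checked after applying the
homeomorphisms \<open>k\<close>. The closure of \<open>Q\<close> under its operations has to be assumed, because a record of
type \<open>operad\<close> may take any values.\<close>

lemma transport_operad: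
  fixes Q :: "'b operad" and k :: "nat set \<Rightarrow> 'b \<Rightarrow> 'a"
  assumes hom: "\<And>S. arity_set n S \<Longrightarrow> homeomorphic_map (opspace Q S) (opspace P S) (k S)"
    and rel_in: "\<And>S S' \<sigma> c. arity_set n S \<Longrightarrow> bij_betw \<sigma> S S' \<Longrightarrow> c \<in> topspace (opspace Q S) \<Longrightarrow>
       oprelabel Q S S' \<sigma> c \<in> topspace (opspace Q S')"
    and rel: "\<And>S S' \<sigma> c. arity_set n S \<Longrightarrow> bij_betw \<sigma> S S' \<Longrightarrow> c \<in> topspace (opspace Q S) \<Longrightarrow>
       k S' (oprelabel Q S S' \<sigma> c) = oprelabel P S S' \<sigma> (k S c)"
    and comp_in: "\<And>S T y. tree_in S T \<Longrightarrow> y \<in> topspace (tree_space Q T) \<Longrightarrow> opcomp Q T y \<in> topspace (opspace Q S)"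
    and comp: "\<And>S T y. tree_in S T \<Longrightarrow> y \<in> topspace (tree_space Q T) \<Longrightarrow>
       k S (opcomp Q T y) = opcomp P T (\<lambda>v\<in>verts T. k (ocld T v) (y v))"
  shows "operad_iso n P Q (\<lambda>S. inv_into (topspace (opspace Q S)) (k S))"
    and "\<And>S. arity_set n S \<Longrightarrow> k S ` Decom Q S = Decom P S"
proof -
  define j where "j S = inv_into (topspace (opspace Q S)) (k S)" for S
  have ktop: "k S ` topspace (opspace Q S) = Ops S" and kinj: "inj_on (k S) (topspace (opspace Q S))"
    if "arity_set n S" for S
    using hom[OF that] by (auto simp: homeomorphic_eq_everything_map)
  have kj: "k S (j S a) = a" if "arity_set n S" "a \<in> Ops S" for S a
    unfolding j_def by (rule f_inv_into_f) (use that ktop in auto)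
  have jk: "j S (k S c) = c" if "arity_set n S" "c \<in> topspace (opspace Q S)" for S c
    unfolding j_def by (rule inv_into_f_f[OF kinj[OF that(1)] that(2)])
  have jin: "j S a \<in> topspace (opspace Q S)" if "arity_set n S" "a \<in> Ops S" for S a
    unfolding j_def by (rule inv_into_into) (use that ktop in auto)
  have jhom: "homeomorphic_map (opspace P S) (opspace Q S) (j S)" if S: "arity_set n S" for S
  proof -
    obtain g where g: "homeomorphic_maps (opspace Q S) (opspace P S) (k S) g"
      using hom[OF S] unfolding homeomorphic_map_maps by blast
    have "homeomorphic_map (opspace P S) (opspace Q S) g" using g homeomorphic_maps_sym homeomorphic_map_maps by blast
    moreover have "g a = j S a" if "a \<in> Ops S" for a
    proof -
      have "k S (g a) = a" "g a \<in> topspace (opspace Q S)"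
        using g that unfolding homeomorphic_maps_def continuous_map_def by auto
      then show ?thesis using jk[OF S] by metis
    qed
    ultimately show ?thesis by (rule homeomorphic_map_eq)
  qed
  have Qpts: "y \<in> topspace (tree_space Q T) \<longleftrightarrow> y \<in> (\<Pi>\<^sub>E v\<in>verts T. topspace (opspace Q (ocld T v)))" for y T
    by (simp add: tree_space_def)
  define KK where "KK T y = (\<lambda>v\<in>verts T. k (ocld T v) (y v))" for T y
  define JJ where "JJ T x = (\<lambda>v\<in>verts T. j (ocld T v) (x v))" for T x
  have KKin: "KK T y \<in> pts T" if "tree_in S T" "y \<in> topspace (tree_space Q T)" for S T y
    using that(2) ktop[OF tin_ocld[OF that(1)]] unfolding pts_iff Qpts KK_def by (auto intro!: PiE_I)
  have JJin: "JJ T x \<in> topspace (tree_space Q T)" if "tree_in S T" "x \<in> pts T" for S T x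
    using that(2) jin[OF tin_ocld[OF that(1)]] unfolding pts_iff Qpts JJ_def by (auto intro!: PiE_I)
  have JK: "JJ T (KK T y) = y" if "tree_in S T" "y \<in> topspace (tree_space Q T)" for S T y
  proof (rule PiE_ext)
    show "JJ T (KK T y) \<in> (\<Pi>\<^sub>E v\<in>verts T. topspace (opspace Q (ocld T v)))" "y \<in> (\<Pi>\<^sub>E v\<in>verts T. topspace (opspace Q (ocld T v)))"
      using JJin[OF that(1) KKin[OF that]] that(2) unfolding Qpts by auto
    show "JJ T (KK T y) v = y v" if "v \<in> verts T" for v
      using that jk[OF tin_ocld[OF \<open>tree_in S T\<close> that]] \<open>y \<in> topspace (tree_space Q T)\<close>
      unfolding Qpts by (auto simp: JJ_def KK_def)
  qed
  have KJ: "KK T (JJ T x) = x" if "tree_in S T" "x \<in> pts T" for S T x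
    by (rule pts_eqI[OF KKin[OF that(1) JJin[OF that]] that(2)])
       (use that kj[OF tin_ocld[OF that(1)]] pts_D[OF that(2)] in \<open>auto simp: JJ_def KK_def\<close>)
  have KKcont: "continuous_map (tree_space Q T) (tree_space P T) (KK T)" if T: "tree_in S T" for S T
    unfolding tree_space_def continuous_map_componentwise
  proof (intro conjI ballI)
    show "KK T ` topspace (product_topology (\<lambda>v. opspace Q (ocld T v)) (verts T)) \<subseteq> extensional (verts T)"
      by (auto simp: KK_def)
    fix v assume v: "v \<in> verts T"
    have "continuous_map (product_topology (\<lambda>v. opspace Q (ocld T v)) (verts T)) (opspace P (ocld T v)) (k (ocld T v) \<circ> (\<lambda>y. y v))"
      by (rule continuous_map_compose[OF continuous_map_product_projection[OF v]])
         (rule homeomorphic_imp_continuous_map[OF hom[OF tin_ocld[OF T v]]])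
    then show "continuous_map (product_topology (\<lambda>v. opspace Q (ocld T v)) (verts T)) (opspace P (ocld T v)) (\<lambda>y. KK T y v)"
      using v by (simp add: KK_def o_def)
  qed
  have JJcont: "continuous_map (tree_space P T) (tree_space Q T) (JJ T)" if T: "tree_in S T" for S T
    unfolding tree_space_def continuous_map_componentwise
  proof (intro conjI ballI)
    show "JJ T ` topspace (product_topology (\<lambda>v. opspace P (ocld T v)) (verts T)) \<subseteq> extensional (verts T)"
      by (auto simp: JJ_def)
    fix v assume v: "v \<in> verts T"
    have "continuous_map (product_topology (\<lambda>v. opspace P (ocld T v)) (verts T)) (opspace Q (ocld T v)) (j (ocld T v) \<circ> (\<lambda>y. y v))"
      by (rule continuous_map_compose[OF continuous_map_product_projection[OF v]])
         (rule homeomorphic_imp_continuous_map[OF jhom[OF tin_ocld[OF T v]]])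
    then show "continuous_map (product_topology (\<lambda>v. opspace P (ocld T v)) (verts T)) (opspace Q (ocld T v)) (\<lambda>y. JJ T y v)"
      using v by (simp add: JJ_def o_def)
  qed
  have nat: "tree_map Q \<sigma> f T T' y \<in> topspace (tree_space Q T')"
    "KK T' (tree_map Q \<sigma> f T T' y) = tree_map P \<sigma> f T T' (KK T y)"
    if T: "tree_in S T" and T': "tree_in S' T'" and m: "tree_mor \<sigma> f T T'" and y: "y \<in> topspace (tree_space Q T)"
    for \<sigma> f S S' T T' y
  proof -
    have c: "oprelabel Q (labels (fiber T f w)) (ocld T' w) (glue T \<sigma> f) (opcomp Q (fiber T f w) (restrict y (verts (fiber T f w))))
        \<in> topspace (opspace Q (ocld T' w)) \<and>
       k (ocld T' w) (oprelabel Q (labels (fiber T f w)) (ocld T' w) (glue T \<sigma> f) (opcomp Q (fiber T f w) (restrict y (verts (fiber T f w))))) =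
       oprelabel P (labels (fiber T f w)) (ocld T' w) (glue T \<sigma> f) (opcomp P (fiber T f w) (restrict (KK T y) (verts (fiber T f w))))"
      if w: "w \<in> verts T'" for w
    proof -
      let ?F = "fiber T f w"
      note F = fiber_in[OF T T' m w] and b = glue_bij[OF tin_lt[OF T] tin_lt[OF T'] m w]
      have oc: "ocld ?F v = ocld T v" if "v \<in> verts ?F" for v using ocld_fiber[OF tin_lt[OF T] m, of v] that by auto
      have yF: "restrict y (verts ?F) \<in> topspace (tree_space Q ?F)"
        using y oc unfolding Qpts by (intro PiE_I) auto
      have "(\<lambda>v\<in>verts ?F. k (ocld ?F v) (restrict y (verts ?F) v)) = restrict (KK T y) (verts ?F)"
        by (rule restrict_ext) (use oc in \<open>simp add: KK_def\<close>)
      then show ?thesis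
        using comp[OF F yF] rel[OF tin_arity[OF F] b comp_in[OF F yF]] rel_in[OF tin_arity[OF F] b comp_in[OF F yF]] by simp
    qed
    show "tree_map Q \<sigma> f T T' y \<in> topspace (tree_space Q T')"
      unfolding Qpts using c by (intro PiE_I) (auto simp: tree_map_def)
    show "KK T' (tree_map Q \<sigma> f T T' y) = tree_map P \<sigma> f T T' (KK T y)"
      unfolding KK_def[of T'] tree_map_def[of P] by (rule restrict_ext) (use c in \<open>simp add: tree_map_def\<close>)
  qed
  have KKinj: "y = y'" if "tree_in S T" "y \<in> topspace (tree_space Q T)" "y' \<in> topspace (tree_space Q T)" "KK T y = KK T y'" for S T y y'
    by (rule trans[OF JK[OF that(1,2), symmetric] trans[OF arg_cong[OF that(4), of "JJ T"] JK[OF that(1,3)]]])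
  have tQ: "truncated_operad n Q"
    unfolding truncated_operad_def tree_upto_iff
  proof (intro conjI allI impI ballI)
    fix \<sigma> f T T' assume h: "tree_in (labels T) T \<and> tree_in (labels T') T' \<and> tree_mor \<sigma> f T T'"
    then have T: "tree_in (labels T) T" and T': "tree_in (labels T') T'" and m: "tree_mor \<sigma> f T T'" by auto
    have "continuous_map (tree_space Q T) (tree_space Q T') (JJ T' \<circ> (tree_map P \<sigma> f T T' \<circ> KK T))"
      by (intro continuous_map_compose[OF _ JJcont[OF T']] continuous_map_compose[OF KKcont[OF T] tree_map_cont[OF T T' m]])
    then show "continuous_map (tree_space Q T) (tree_space Q T') (tree_map Q \<sigma> f T T')"
    proof (rule continuous_map_eq)
      fix y assume y: "y \<in> topspace (tree_space Q T)"
      show "(JJ T' \<circ> (tree_map P \<sigma> f T T' \<circ> KK T)) y = tree_map Q \<sigma> f T T' y"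
        using JK[OF T' nat(1)[OF T T' m y]] unfolding nat(2)[OF T T' m y] by simp
    qed
  next
    fix \<sigma> f \<tau> g T T' T'' y
    assume h: "tree_in (labels T) T \<and> tree_in (labels T') T' \<and> tree_in (labels T'') T'' \<and> tree_mor \<sigma> f T T' \<and> tree_mor \<tau> g T' T''"
      and y: "y \<in> topspace (tree_space Q T)"
    then have T: "tree_in (labels T) T" "tree_in (labels T') T'" "tree_in (labels T'') T''"
      and m: "tree_mor \<sigma> f T T'" and m': "tree_mor \<tau> g T' T''" by auto
    have mc: "tree_mor (\<tau> \<circ> \<sigma>) (g \<circ> f) T T''" by (rule tree_mor_comp(1)[OF tin_lt[OF T(1)] m m'])
    note fy = nat(1)[OF T(1,2) m y]
    show "tree_map Q (\<tau> \<circ> \<sigma>) (g \<circ> f) T T'' y = tree_map Q \<tau> g T' T'' (tree_map Q \<sigma> f T T' y)"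
    proof (rule KKinj[OF T(3) nat(1)[OF T(1,3) mc y] nat(1)[OF T(2,3) m' fy]])
      show "KK T'' (tree_map Q (\<tau> \<circ> \<sigma>) (g \<circ> f) T T'' y) = KK T'' (tree_map Q \<tau> g T' T'' (tree_map Q \<sigma> f T T' y))"
        unfolding nat(2)[OF T(1,3) mc y] nat(2)[OF T(2,3) m' fy] nat(2)[OF T(1,2) m y]
        by (rule tree_map_comp[OF T m m' KKin[OF T(1) y], symmetric])
    qed
  next
    fix T y assume h: "tree_in (labels T) T \<and> \<not> decomposable T" and y: "y \<in> topspace (tree_space Q T)"
    then have T: "tree_in (labels T) T" and d: "\<not> decomposable T" by auto
    note v = ocld_root_corolla[OF tin_lt[OF T] d]
    have "y (root T) \<in> topspace (opspace Q (labels T))"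
      using PiE_mem[OF y[unfolded Qpts] lt_root[OF tin_lt[OF T]]] unfolding v(2) .
    moreover have "k (labels T) (opcomp Q T y) = k (labels T) (y (root T))"
      using comp[OF T y] opcomp_corolla[OF T d KKin[OF T y]] v(2) lt_root[OF tin_lt[OF T]] unfolding KK_def by simp
    ultimately show "opcomp Q T y = y (root T)"
      using kinj[OF tin_arity[OF T]] comp_in[OF T y] by (auto simp: inj_on_def)
  next
    fix T y assume T: "tree_in (labels T) T" and y: "y \<in> topspace (tree_space Q T)"
    have m: "tree_mor id id T T" by (rule same_tree_mor(2)[OF tin_lt[OF T]]) (simp add: same_tree_def)
    show "tree_map Q id id T T y = y"
      by (rule KKinj[OF T nat(1)[OF T T m y] y]) (unfold nat(2)[OF T T m y], rule tree_map_id[OF T KKin[OF T y]])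
  next
    fix S S' :: "nat set" and \<sigma> \<tau> c assume h: "arity_set n S \<and> bij_betw \<sigma> S S' \<and> (\<forall>s\<in>S. \<sigma> s = \<tau> s)" and c: "c \<in> topspace (opspace Q S)"
    then have S: "arity_set n S" and s: "bij_betw \<sigma> S S'" and e: "\<And>s. s \<in> S \<Longrightarrow> \<tau> s = \<sigma> s" by auto
    have t: "bij_betw \<tau> S S'" using s e by (simp cong: bij_betw_cong)
    have kc: "k S c \<in> Ops S" using ktop[OF S] c by auto
    have "k S' (oprelabel Q S S' \<sigma> c) = k S' (oprelabel Q S S' \<tau> c)"
      using rel[OF S s c] rel[OF S t c] oprel_cong[OF S s e kc] by simp
    then show "oprelabel Q S S' \<sigma> c = oprelabel Q S S' \<tau> c"
      using kinj[OF arity_bij[OF S s]] rel_in[OF S s c] rel_in[OF S t c] by (auto simp: inj_on_def)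
  qed
  have "operad_iso n P Q j"
    unfolding operad_iso_def tree_upto_iff
  proof (intro conjI allI impI ballI oper tQ jhom)
    fix \<sigma> f T T' x
    assume "tree_in (labels T) T \<and> tree_in (labels T') T' \<and> tree_mor \<sigma> f T T'" and x: "x \<in> pts T"
    then have T: "tree_in (labels T) T" and T': "tree_in (labels T') T'" and m: "tree_mor \<sigma> f T T'" by auto
    note Jx = JJin[OF T x] note fx = tree_map_in[OF T T' m x]
    have "KK T' (tree_map Q \<sigma> f T T' (JJ T x)) = KK T' (JJ T' (tree_map P \<sigma> f T T' x))"
      using nat(2)[OF T T' m Jx] KJ[OF T x] KJ[OF T' fx] by simp
    from KKinj[OF T' nat(1)[OF T T' m Jx] JJin[OF T' fx] this]
    show "tree_map Q \<sigma> f T T' (\<lambda>v\<in>verts T. j (ocld T v) (x v)) = (\<lambda>w\<in>verts T'. j (ocld T' w) (tree_map P \<sigma> f T T' x w))"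
      unfolding JJ_def .
  qed
  then show "operad_iso n P Q (\<lambda>S. inv_into (topspace (opspace Q S)) (k S))" unfolding j_def[abs_def] .
  show "k S ` Decom Q S = Decom P S" if S: "arity_set n S" for S
  proof (intro equalityI subsetI)
    fix a assume "a \<in> k S ` Decom Q S"
    then obtain T y where T: "labeled_tree S T" "decomposable T" "y \<in> topspace (tree_space Q T)" "a = k S (opcomp Q T y)"
      by (auto simp: Decom_def)
    note Tin = tree_inI[OF T(1) S]
    have "a = opcomp P T (KK T y)" using comp[OF Tin T(3)] T(4) by (simp add: KK_def)
    then show "a \<in> Decom P S" unfolding Decom_iff using T(1,2) KKin[OF Tin T(3)] by blast
  next
    fix a assume "a \<in> Decom P S"
    then obtain T x where T: "labeled_tree S T" "decomposable T" "x \<in> pts T" "a = opcomp P T x" unfolding Decom_iff by blast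
    note Tin = tree_inI[OF T(1) S]
    have "a = k S (opcomp Q T (JJ T x))" using comp[OF Tin JJin[OF Tin T(3)]] KJ[OF Tin T(3)] T(4) by (simp add: KK_def)
    moreover have "opcomp Q T (JJ T x) \<in> Decom Q S" using T(1,2) JJin[OF Tin T(3)] by (auto simp: Decom_def)
    ultimately show "a \<in> k S ` Decom Q S" by blast
  qed
qed

end

section \<open>Classes of metric trees\<close>

text \<open>The number of vertices is bounded by the number of labels, so the vertices can be renamed into a
fixed finite set.\<close>

lemma finite_tree_representatives:
  assumes S: "finite S"
  obtains F where "finite F" "\<And>T. T \<in> F \<Longrightarrow> labeled_tree S T"
    "\<And>T. labeled_tree S T \<Longrightarrow> \<exists>T'\<in>F. \<exists>f. tree_mor id f T T' \<and> (\<forall>v. \<not> contracts T f v)"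
proof -
  obtain N where N: "\<forall>x\<in>S. x < N" using S finite_nat_set_iff_bounded by blast
  define V where "V = {N..<N + card S}"
  define A where "A = {p. \<forall>x. (x \<in> V \<longrightarrow> p x \<in> insert 0 V) \<and> (x \<notin> V \<longrightarrow> p x = (0::nat))}"
  define B where "B = {l. \<forall>x. (x \<in> V \<longrightarrow> l x \<in> Pow S) \<and> (x \<notin> V \<longrightarrow> l x = {})}"
  define R where "R = (\<lambda>(W, r, p, l). \<lparr>verts = W, root = r, parent = p, lb = l\<rparr>) ` (Pow V \<times> V \<times> A \<times> B)"
  have "finite A" unfolding A_def by (rule finite_set_of_finite_funs) (auto simp: V_def)
  moreover have "finite B" unfolding B_def by (rule finite_set_of_finite_funs) (use S in \<open>auto simp: V_def\<close>)
  ultimately have fR: "finite R" unfolding R_def by (intro finite_imageI finite_cartesian_product) (auto simp: V_def)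
  show thesis
  proof (rule that[of "{T \<in> R. labeled_tree S T}"])
    show "finite {T \<in> R. labeled_tree S T}" using fR by simp
    fix T assume T: "labeled_tree S T"
    have "card (verts T) \<le> card V" using lt_card_verts[OF T] by (simp add: V_def)
    then obtain \<beta> where \<beta>: "inj_on \<beta> (verts T)" "\<beta> ` verts T \<subseteq> V"
      using inj_on_iff_card_le[OF lt_finite[OF T], of V] by (auto simp: V_def)
    have "\<beta> ` verts T \<inter> S = {}" using \<beta>(2) N by (force simp: V_def)
    note r = rename_iso[OF T _ \<beta>(1) this, of id, simplified]
    have "rename \<beta> id T \<in> R"
      unfolding R_def
    proof (rule image_eqI[of _ _ "(\<beta> ` verts T, \<beta> (root T), parent (rename \<beta> id T), lb (rename \<beta> id T))"])
      have "parent (rename \<beta> id T) \<in> A"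
        unfolding A_def mem_Collect_eq
      proof (intro allI conjI impI)
        fix x assume "x \<in> V"
        have "\<beta> (parent T (inv_into (verts T) \<beta> x)) \<in> V" if x: "x \<in> \<beta> ` verts T" "x \<noteq> \<beta> (root T)"
        proof -
          have "inv_into (verts T) \<beta> x \<in> verts T" "inv_into (verts T) \<beta> x \<noteq> root T"
            using x inv_into_into[OF x(1)] f_inv_into_f[OF x(1)] by auto
          then show ?thesis using lt_parent[OF T] \<beta>(2) by blast
        qed
        then show "parent (rename \<beta> id T) x \<in> insert 0 V" by (simp add: rename_def)
      next
        fix x assume "x \<notin> V"
        then show "parent (rename \<beta> id T) x = 0" using \<beta>(2) by (auto simp: rename_def)
      qed
      moreover have "lb (rename \<beta> id T) \<in> B"
        unfolding B_def mem_Collect_eq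
      proof (intro allI conjI impI)
        fix x
        show "lb (rename \<beta> id T) x \<in> Pow S"
          using lt_lb[OF T inv_into_into[of x \<beta> "verts T"]] by (auto simp: rename_def)
        show "lb (rename \<beta> id T) x = {}" if "x \<notin> V" using \<beta>(2) that by (auto simp: rename_def)
      qed
      ultimately show "(\<beta> ` verts T, \<beta> (root T), parent (rename \<beta> id T), lb (rename \<beta> id T)) \<in> Pow V \<times> V \<times> A \<times> B"
        using \<beta>(2) lt_root[OF T] by auto
    qed (simp add: rename_def)
    then show "\<exists>T'\<in>{T \<in> R. labeled_tree S T}. \<exists>f. tree_mor id f T T' \<and> (\<forall>v. \<not> contracts T f v)"
      using r by blast
  qed auto
qed

locale compact_operad = scaled_operad +
  assumes compact_ops: "arity_set n S \<Longrightarrow> compact_space (opspace P S)"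
    and Hausdorff_ops: "arity_set n S \<Longrightarrow> Hausdorff_space (opspace P S)"
begin

abbreviation mtrees :: "nat set \<Rightarrow> 'a metric_tree set" where
  "mtrees S \<equiv> topspace (metric_trees P S)"

definition level :: "(nat \<Rightarrow> real \<times> 'a) \<Rightarrow> nat \<Rightarrow> real" where
  "level x v = 1 + fst (x v)"

definition label :: "ltree \<Rightarrow> (nat \<Rightarrow> real \<times> 'a) \<Rightarrow> nat \<Rightarrow> 'a" where
  "label T x = (\<lambda>v\<in>verts T. snd (x v))"

definition "value" :: "'a metric_tree \<Rightarrow> 'a" where
  "value p = eval 2 1 (fst p) (level (snd p)) (label (fst p) (snd p))"

definition hair :: "'a metric_tree \<Rightarrow> real" where
  "hair p = fst (snd p (root (fst p)))"

lemma mtrees_iff: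
  "(T, x) \<in> mtrees S \<longleftrightarrow> labeled_tree S T \<and> x \<in> (\<Pi>\<^sub>E v\<in>verts T. {0..1} \<times> Ops (ocld T v))"
  by (simp add: metric_trees_def)

lemma mtreesD:
  assumes S: "arity_set n S" and p: "(T, x) \<in> mtrees S"
  shows "tree_in S T" "label T x \<in> pts T" "levels 1 2 T (level x)"
    and "\<And>v. v \<in> verts T \<Longrightarrow> fst (x v) \<in> {0..1}" and "\<And>v. v \<in> verts T \<Longrightarrow> snd (x v) \<in> Ops (ocld T v)"
    and "value (T, x) \<in> Ops S" "hair (T, x) \<in> {0..1}"
proof -
  show T: "tree_in S T" using p S by (simp add: mtrees_iff tree_inI)
  have xv: "x v \<in> {0..1} \<times> Ops (ocld T v)" if "v \<in> verts T" for v using p that unfolding mtrees_iff by auto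
  then show f: "fst (x v) \<in> {0..1}" and s: "snd (x v) \<in> Ops (ocld T v)" if "v \<in> verts T" for v
    using that by (force simp: mem_Times_iff)+
  show l: "label T x \<in> pts T" unfolding pts_iff label_def by (rule PiE_I) (use s in auto)
  show lv: "levels 1 2 T (level x)" using f by (auto simp: levels_def level_def)
  show "value (T, x) \<in> Ops S" using eval_in[OF T lv l] by (simp add: value_def)
  show "hair (T, x) \<in> {0..1}" using f[OF lt_root[OF tin_lt[OF T]]] by (simp add: hair_def)
qed

lemma eval_level_cong:
  assumes T: "tree_in S T" and l: "levels s r T a" and x: "x \<in> pts T"
    and a: "\<And>v. v \<in> verts T \<Longrightarrow> v \<noteq> root T \<Longrightarrow> a' v = a v"
  shows "eval r s T a' x = eval r s T a x"
proof -
  have m: "tree_mor id id T T" by (rule same_tree_mor(2)[OF tin_lt[OF T]]) (simp add: same_tree_def)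
  have nc: "\<not> contracts T id v" for v using parent_neq[OF tin_lt[OF T], of v] by (auto simp: contracts_def)
  have "eval r s T a' (tree_map P id id T T x) = eval r s T a x"
  proof (rule eval_contract[OF T T m l _ _ x])
    show "a v = s" if "contracts T id v" for v using nc that by blast
    show "a' w = a (fiber_root T id w)" if "w \<in> verts T" "w \<noteq> root T" for w
    proof -
      have "fiber_root T id (id w) = w" using fiber_root_iff[OF m that(1)] nc by blast
      then show ?thesis using a[OF that] by simp
    qed
  qed
  then show ?thesis using tree_map_id[OF T x] by simp
qed

lemma tree_map_label: "tree_map P \<sigma> f T T' (\<lambda>v. snd (x v)) = tree_map P \<sigma> f T T' (label T x)"
proof -
  have "restrict (\<lambda>v. snd (x v)) (verts (fiber T f w)) = restrict (label T x) (verts (fiber T f w))" for w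
    by (auto simp: label_def restrict_def fun_eq_iff)
  then show ?thesis by (simp add: tree_map_def)
qed

text \<open>The edges that may be contracted in a metric tree have the starting time \<open>1\<close> of the process as
their level.\<close>

lemma metric_mor_value:
  assumes S: "arity_set n S" and S': "arity_set n S'" and p: "(T, x) \<in> mtrees S" and p': "(T', x') \<in> mtrees S'"
    and m: "metric_mor P \<sigma> f (T, x) (T', x')"
  shows "value (T', x') = oprelabel P S S' \<sigma> (value (T, x))" "hair (T', x') = hair (T, x)"
proof -
  note T = mtreesD[OF S p] and T' = mtreesD[OF S' p']
  have f: "tree_mor \<sigma> f T T'" and z: "\<And>v. contracts T f v \<Longrightarrow> fst (x v) = 0"
    and x': "x' = (\<lambda>w\<in>verts T'. (fst (x (fiber_root T f w)), tree_map P \<sigma> f T T' (label T x) w))"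
    using m by (auto simp: metric_mor_def contracts_def tree_map_label)
  have fx: "tree_map P \<sigma> f T T' (label T x) \<in> pts T'" by (rule tree_map_in[OF T(1) T'(1) f T(2)])
  have "label T' x' = tree_map P \<sigma> f T T' (label T x)"
    by (rule pts_eqI[OF T'(2) fx]) (simp add: label_def x')
  moreover have "eval 2 1 T' (level x') (tree_map P \<sigma> f T T' (label T x)) =
     oprelabel P S S' \<sigma> (eval 2 1 T (level x) (label T x))"
    by (rule eval_natural[OF T(1) T'(1) f T(3) _ _ T(2)]) (use z in \<open>auto simp: level_def x'\<close>)
  ultimately show "value (T', x') = oprelabel P S S' \<sigma> (value (T, x))" by (simp add: value_def)
  show "hair (T', x') = hair (T, x)"
    using lt_root[OF tin_lt[OF T'(1)]] froot_root[OF f lt_root[OF tin_lt[OF T(1)]]] by (simp add: hair_def x')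
qed

lemma metric_mor_ex:
  assumes S: "arity_set n S" and S': "arity_set n S'" and p: "(T, x) \<in> mtrees S" and T': "labeled_tree S' T'"
    and f: "tree_mor \<sigma> f T T'" and z: "\<And>v. contracts T f v \<Longrightarrow> fst (x v) = 0"
  obtains x' where "(T', x') \<in> mtrees S'" "metric_mor P \<sigma> f (T, x) (T', x')"
    "\<And>w. w \<in> verts T' \<Longrightarrow> fst (x' w) = fst (x (fiber_root T f w))"
proof -
  note T = mtreesD[OF S p]
  define x' where "x' = (\<lambda>w\<in>verts T'. (fst (x (fiber_root T f w)), tree_map P \<sigma> f T T' (label T x) w))"
  note fx = tree_map_in[OF T(1) tree_inI[OF T' S'] f T(2)]
  have "(T', x') \<in> mtrees S'"
    unfolding mtrees_iff
  proof (intro conjI T' PiE_I)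
    show "x' w \<in> {0..1} \<times> Ops (ocld T' w)" if "w \<in> verts T'" for w
      using T(4)[OF froot_in[OF f that]] pts_D[OF fx that] that by (simp add: x'_def)
  qed (simp add: x'_def)
  moreover have "metric_mor P \<sigma> f (T, x) (T', x')"
    using f z by (auto simp: metric_mor_def contracts_def tree_map_label x'_def)
  ultimately show thesis by (rule that) (simp add: x'_def)
qed

lemma W_equiv_invariant:
  assumes S: "arity_set n S" and p: "p \<in> mtrees S" and e: "equivclp (W_step P S) p q"
  shows "q \<in> mtrees S" "value q = value p" "hair q = hair p"
proof -
  have st: "u \<in> mtrees S \<and> w \<in> mtrees S \<and> value w = value u \<and> hair w = hair u" if step: "W_step P S u w" for u w
  proof -
    obtain T x T' x' where uw: "u = (T, x)" "w = (T', x')" by (metis surj_pair)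
    obtain f where f: "metric_mor P id f (T, x) (T', x')" and i: "(T, x) \<in> mtrees S" "(T', x') \<in> mtrees S"
      using step unfolding uw W_step_def by blast
    show ?thesis
      using metric_mor_value[OF S S i f] oprel_id[OF S mtreesD(6)[OF S i(1)]] i uw by simp
  qed
  have "q \<in> mtrees S \<and> value q = value p \<and> hair q = hair p" using e
  proof (induction rule: equivclp_induct)
    case (step y z)
    then show ?case using st[of y z] st[of z y] by auto
  qed (use p in simp)
  then show "q \<in> mtrees S" "value q = value p" "hair q = hair p" by auto
qed

lemma W_reduce:
  assumes S: "arity_set n S" and p: "(T, x) \<in> mtrees S"
  obtains T0 x0 where "(T0, x0) \<in> mtrees S" "W_step P S (T, x) (T0, x0)"
    "\<And>v. v \<in> verts T0 \<Longrightarrow> v \<noteq> root T0 \<Longrightarrow> 1 < level x0 v"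
proof -
  note T = mtreesD[OF S p]
  note lq = low[OF T(1), where a = "level x" and m = 1]
  have z: "fst (x v) = 0" if "contracts T (lowmap T (level x) 1) v" for v
    using that T(4)[of v] lq(3)[of v] by (simp add: level_def)
  obtain x0 where x0: "(low T (level x) 1, x0) \<in> mtrees S" "metric_mor P id (lowmap T (level x) 1) (T, x) (low T (level x) 1, x0)"
    "\<And>w. w \<in> verts (low T (level x) 1) \<Longrightarrow> fst (x0 w) = fst (x (fiber_root T (lowmap T (level x) 1) w))"
    using metric_mor_ex[OF S S p tin_lt[OF lq(1)] lq(2) z] by blast
  show thesis
  proof (rule that[OF x0(1)])
    show "W_step P S (T, x) (low T (level x) 1, x0)" using p x0 by (auto simp: W_step_def)
    show "1 < level x0 v" if "v \<in> verts (low T (level x) 1)" "v \<noteq> root (low T (level x) 1)" for v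
      using that x0(3)[OF that(1)] lq(4)[OF that(1)] lq(5)[of v] by (auto simp: level_def)
  qed
qed

text \<open>Together with invariance this makes the value and the length of the hair a complete invariant of the
class of a metric tree. Once the edges of length \<open>0\<close> are contracted, all levels exceed the starting
time, and injectivity of the evaluation yields an isomorphism.\<close>

lemma W_equiv_complete:
  assumes S: "arity_set n S" and p: "p \<in> mtrees S" and q: "q \<in> mtrees S" and v: "value p = value q" and h: "hair p = hair q"
  shows "equivclp (W_step P S) p q"
proof -
  obtain T1 x1 T2 x2 where pq: "p = (T1, x1)" "q = (T2, x2)" by (metis surj_pair)
  obtain T x where p0: "(T, x) \<in> mtrees S" and sp: "W_step P S p (T, x)"
    and st: "\<And>v. v \<in> verts T \<Longrightarrow> v \<noteq> root T \<Longrightarrow> 1 < level x v"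
    using W_reduce[OF S] p unfolding pq by metis
  obtain T' x' where q0: "(T', x') \<in> mtrees S" and sq: "W_step P S q (T', x')"
    and st': "\<And>v. v \<in> verts T' \<Longrightarrow> v \<noteq> root T' \<Longrightarrow> 1 < level x' v"
    using W_reduce[OF S] q unfolding pq by metis
  note T = mtreesD[OF S p0] note T' = mtreesD[OF S q0]
  note ip = W_equiv_invariant[OF S p r_into_equivclp[of "W_step P S", OF sp]] note iq = W_equiv_invariant[OF S q r_into_equivclp[of "W_step P S", OF sq]]
  have "eval 2 1 T (level x) (label T x) = eval 2 1 T' (level x') (label T' x')"
    using v ip(2) iq(2) by (simp add: value_def)
  from eval_injective[OF T(1) T'(1) T(3) T'(3) st st' T(2) T'(2) this]
  obtain g where g: "tree_mor id g T T'" "\<And>v. \<not> contracts T g v" "tree_map P id g T T' (label T x) = label T' x'"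
    "\<And>v. v \<in> verts T \<Longrightarrow> v \<noteq> root T \<Longrightarrow> level x' (g v) = level x v" unfolding level_iso_def by blast
  have "x' = (\<lambda>w\<in>verts T'. (fst (x (fiber_root T g w)), tree_map P id g T T' (label T x) w))"
  proof (rule extensionalityI[where A = "verts T'"])
    show "x' \<in> extensional (verts T')" using q0 by (auto simp: mtrees_iff PiE_def)
    show "(\<lambda>w\<in>verts T'. (fst (x (fiber_root T g w)), tree_map P id g T T' (label T x) w)) \<in> extensional (verts T')" by simp
    fix w assume w: "w \<in> verts T'"
    have "fst (x' w) = fst (x (fiber_root T g w))"
    proof (cases "w = root T'")
      case True
      then show ?thesis using h ip(3) iq(3) froot_root[OF g(1) lt_root[OF tin_lt[OF T(1)]]] by (simp add: hair_def)
    next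
      case False
      then show ?thesis using g(4)[OF froot_in[OF g(1) w]] froot_nonroot[OF g(1) w False] froot_f[OF g(1) w] by (simp add: level_def)
    qed
    moreover have "snd (x' w) = tree_map P id g T T' (label T x) w" unfolding g(3) using w by (simp add: label_def)
    ultimately show "x' w = (\<lambda>w\<in>verts T'. (fst (x (fiber_root T g w)), tree_map P id g T T' (label T x) w)) w"
      using w by (simp add: prod_eq_iff)
  qed
  then have "metric_mor P id g (T, x) (T', x')"
    using g(1,2) by (auto simp: metric_mor_def contracts_def tree_map_label)
  then have "W_step P S (T, x) (T', x')" using p0 q0 by (auto simp: W_step_def)
  then show ?thesis
    using sp sq by (meson converse_r_into_equivclp equivclp_trans r_into_equivclp)
qed

text \<open>For \<open>a\<close> an operation and \<open>t\<close> between \<open>0\<close> and \<open>1\<close> these are the points of the W-construction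
with hairs of arbitrary length.\<close>

definition metric_class :: "nat set \<Rightarrow> 'a \<Rightarrow> real \<Rightarrow> 'a metric_tree set" where
  "metric_class S a t = {q \<in> mtrees S. value q = a \<and> hair q = t}"

lemma W_class_eq:
  assumes "arity_set n S" "p \<in> mtrees S" shows "W_class P S p = metric_class S (value p) (hair p)"
proof (intro equalityI subsetI)
  fix q assume "q \<in> W_class P S p"
  then have "equivclp (W_step P S) p q" by (simp add: W_class_def)
  from W_equiv_invariant[OF assms this] show "q \<in> metric_class S (value p) (hair p)" by (simp add: metric_class_def)
next
  fix q assume "q \<in> metric_class S (value p) (hair p)"
  then have "q \<in> mtrees S" "value p = value q" "hair p = hair q" by (simp_all add: metric_class_def)
  from W_equiv_complete[OF assms this] show "q \<in> W_class P S p" by (simp add: W_class_def)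
qed

lemma reached_metric_tree:
  assumes S: "arity_set n S" and R: "reached S 2 a T l x" and t: "t \<in> {0..1}"
  obtains y where "(T, y) \<in> metric_class S a t"
proof -
  have T: "tree_in S T" and l: "\<And>v. v \<in> verts T \<Longrightarrow> 1 \<le> l v \<and> l v \<le> 2" and x: "x \<in> pts T" and e: "eval 2 1 T l x = a"
    using R by (auto simp: reached_def)
  define y where "y = (\<lambda>v\<in>verts T. (if v = root T then t else l v - 1, x v))"
  have p: "(T, y) \<in> mtrees S"
    unfolding mtrees_iff
  proof (intro conjI tin_lt[OF T] PiE_I)
    show "y v \<in> {0..1} \<times> Ops (ocld T v)" if "v \<in> verts T" for v
      using l[OF that] pts_D[OF x that] that t by (simp add: y_def)
  qed (simp add: y_def)
  have "label T y = restrict x (verts T)" unfolding label_def by (rule restrict_ext) (simp add: y_def)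
  then have "label T y = x" by (simp only: pts_restrict[OF x])
  moreover have "eval 2 1 T (level y) x = eval 2 1 T l x"
    by (rule eval_level_cong[OF T _ x]) (use l in \<open>auto simp: levels_def level_def y_def\<close>)
  moreover have "hair (T, y) = t" using lt_root[OF tin_lt[OF T]] by (simp add: hair_def y_def)
  ultimately have "(T, y) \<in> metric_class S a t" using p e by (simp add: metric_class_def value_def)
  then show thesis by (rule that)
qed

lemma metric_class_ex:
  assumes S: "arity_set n S" and a: "a \<in> Ops S" and t: "t \<in> {0..1}"
  shows "metric_class S a t \<noteq> {}"
  using eval_surjective[OF S _ a, of 2] reached_metric_tree[OF S _ t] by force

lemma metric_class_inj:
  assumes "arity_set n S" "a \<in> Ops S" "t \<in> {0..1}" "metric_class S a t = metric_class S b u"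
  shows "a = b" "t = u"
  using metric_class_ex[OF assms(1-3)] assms(4) by (auto simp: metric_class_def)

end

section \<open>The W-construction as a copy of the operad\<close>

lemma continuous_map_from_sum:
  assumes "\<And>i. i \<in> I \<Longrightarrow> continuous_map (X i) Y (\<lambda>x. f (i, x))"
  shows "continuous_map (sum_topology X I) Y f"
  unfolding continuous_map
proof (intro conjI allI impI)
  show "f ` topspace (sum_topology X I) \<subseteq> topspace Y"
    using assms by (force simp: continuous_map_def)
  fix U assume U: "openin Y U"
  have "openin (X i) {x. (i, x) \<in> {p \<in> topspace (sum_topology X I). f p \<in> U}}" if "i \<in> I" for i
  proof -
    have "{x. (i, x) \<in> {p \<in> topspace (sum_topology X I). f p \<in> U}} = {x \<in> topspace (X i). f (i, x) \<in> U}"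
      using that by auto
    then show ?thesis using openin_continuous_map_preimage[OF assms[OF that] U] by simp
  qed
  then show "openin (sum_topology X I) {p \<in> topspace (sum_topology X I). f p \<in> U}"
    by (simp add: openin_sum_topology)
qed

lemma W_simps [simp]:
  "opspace (W P) S = subtopology (W01_space P S) {c. \<exists>(T, x)\<in>c. fst (x (root T)) = 1}"
  "oprelabel (W P) = W_relabel P" "opcomp (W P) = W_comp P"
  by (simp_all add: W_def W01_def)

context compact_operad
begin

text \<open>The element of \<open>W P\<close> that corresponds to the operation \<open>a\<close>.\<close>

definition point :: "nat set \<Rightarrow> 'a \<Rightarrow> 'a metric_tree set" where
  "point S a = metric_class S a 1"

definition class_value :: "'a metric_tree set \<Rightarrow> 'a" where
  "class_value c = value (SOME p. p \<in> c)"

lemma class_value_metric_class: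
  assumes "arity_set n S" "a \<in> Ops S" "t \<in> {0..1}" shows "class_value (metric_class S a t) = a"
proof -
  have "(SOME p. p \<in> metric_class S a t) \<in> metric_class S a t"
    using metric_class_ex[OF assms] by (rule some_in_eq[THEN iffD2])
  then show ?thesis by (simp add: class_value_def metric_class_def)
qed

lemma class_value_W_class:
  assumes "arity_set n S" "p \<in> mtrees S" shows "class_value (W_class P S p) = value p"
proof -
  obtain T x where p: "p = (T, x)" by (metis surj_pair)
  show ?thesis unfolding W_class_eq[OF assms]
    by (rule class_value_metric_class[OF assms(1)]) (use mtreesD[OF assms(1)] assms(2) p in auto)
qed

lemma W_topspace:
  assumes S: "arity_set n S" shows "topspace (opspace (W P) S) = point S ` Ops S"
proof (intro equalityI subsetI)
  fix c assume "c \<in> topspace (opspace (W P) S)"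
  then obtain p T x where p: "p \<in> mtrees S" "c = W_class P S p" "(T, x) \<in> c" "fst (x (root T)) = 1"
    by (auto simp: W01_space_def)
  obtain T0 x0 where p0: "p = (T0, x0)" by (metis surj_pair)
  have "hair (T, x) = hair p" using p(2,3) unfolding W_class_eq[OF S p(1)] by (simp add: metric_class_def)
  then have "c = point S (value p)" using p W_class_eq[OF S p(1)] by (simp add: point_def hair_def)
  moreover have "value p \<in> Ops S" using mtreesD(6)[OF S] p(1) p0 by blast
  ultimately show "c \<in> point S ` Ops S" by blast
next
  fix c assume "c \<in> point S ` Ops S"
  then obtain a where a: "a \<in> Ops S" "c = metric_class S a 1" by (auto simp: point_def)
  obtain p where p: "p \<in> c" using metric_class_ex[OF S a(1), of 1] a(2) by auto
  obtain T x where Tx: "p = (T, x)" by (metis surj_pair)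
  have pm: "p \<in> mtrees S" "value p = a" "hair p = 1" using p a(2) by (auto simp: metric_class_def)
  then have "c = W_class P S p" using W_class_eq[OF S pm(1)] a(2) by simp
  then have "c \<in> topspace (W01_space P S)" using pm(1) by (simp add: W01_space_def)
  moreover have "fst (x (root T)) = 1" using pm(3) Tx by (simp add: hair_def)
  ultimately show "c \<in> topspace (opspace (W P) S)" using p Tx by auto
qed

lemma point_value:
  assumes "arity_set n S" "c \<in> topspace (opspace (W P) S)"
  shows "class_value c \<in> Ops S" "c = point S (class_value c)"
proof -
  obtain a where a: "a \<in> Ops S" "c = point S a" using assms(2) unfolding W_topspace[OF assms(1)] by blast
  then have "class_value c = a" using class_value_metric_class[OF assms(1) a(1), of 1] by (simp add: point_def)
  then show "class_value c \<in> Ops S" "c = point S (class_value c)" using a by auto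
qed

lemma value_continuous:
  assumes S: "arity_set n S" shows "continuous_map (metric_trees P S) (opspace P S) value"
  unfolding metric_trees_def
proof (rule continuous_map_from_sum)
  fix T assume "T \<in> {T. labeled_tree S T}"
  then have T: "tree_in S T" using S by (simp add: tree_inI)
  let ?Z = "product_topology (\<lambda>v. prod_topology (top_of_set {0..1}) (opspace P (ocld T v))) (verts T)"
  have pr: "continuous_map ?Z (prod_topology (top_of_set {0..1}) (opspace P (ocld T v))) (\<lambda>x. x v)" if "v \<in> verts T" for v
    by (rule continuous_map_product_projection[OF that])
  have lev: "continuous_map ?Z euclideanreal (\<lambda>x. level x v)" if "v \<in> verts T" for v
  proof -
    have "continuous_map ?Z (top_of_set {0..1}) (\<lambda>x. fst (x v))"
      using continuous_map_fst_of[OF pr[OF that]] by (simp add: o_def)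
    then have "continuous_map ?Z euclideanreal (\<lambda>x. fst (x v))" by (rule continuous_map_into_fulltopology)
    then show ?thesis unfolding level_def by (intro continuous_map_add) auto
  qed
  have lab: "continuous_map ?Z (tree_space P T) (label T)"
    unfolding tree_space_def continuous_map_componentwise
  proof (intro conjI ballI)
    show "label T ` topspace ?Z \<subseteq> extensional (verts T)" by (auto simp: label_def)
    show "continuous_map ?Z (opspace P (ocld T v)) (\<lambda>x. label T x v)" if "v \<in> verts T" for v
      using continuous_map_snd_of[OF pr[OF that]] that by (simp add: label_def o_def)
  qed
  have "levels 1 2 T (level x)" if "x \<in> topspace ?Z" for x
  proof -
    have "fst (x v) \<in> {0..1}" if "v \<in> verts T" for v using \<open>x \<in> topspace ?Z\<close> that by (force simp: PiE_iff mem_Times_iff)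
    then show ?thesis by (auto simp: levels_def level_def)
  qed
  then have "continuous_map ?Z (opspace P S) (\<lambda>x. eval 2 1 T (level x) (label T x))"
    by (intro eval_continuous[OF T _ lev lab]) simp_all
  then show "continuous_map ?Z (opspace P S) (\<lambda>x. value (T, x))" by (simp add: value_def)
qed

lemma class_value_continuous:
  assumes S: "arity_set n S" shows "continuous_map (opspace (W P) S) (opspace P S) class_value"
proof -
  have q: "quotient_map (metric_trees P S) (W01_space P S) (W_class P S)"
    unfolding W01_space_def by (rule quotient_map_quotient_topology)
  have "continuous_map (metric_trees P S) (opspace P S) (class_value \<circ> W_class P S)"
    by (rule continuous_map_eq[OF value_continuous[OF S]]) (simp add: class_value_W_class[OF S])
  then have "continuous_map (W01_space P S) (opspace P S) class_value"
    by (rule continuous_compose_quotient_map[OF q])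
  then show ?thesis by (simp add: continuous_map_from_subtopology)
qed

text \<open>Finitely many trees suffice to represent all classes, and for each of them the metric trees
  with hair of length 1 form a compact space.\<close>

lemma W_compact:
  assumes S: "arity_set n S" shows "compact_space (opspace (W P) S)"
proof -
  have "finite S" using S by (simp add: arity_set_def)
  then obtain F where F: "finite F" "\<And>T. T \<in> F \<Longrightarrow> labeled_tree S T"
    "\<And>T. labeled_tree S T \<Longrightarrow> \<exists>T'\<in>F. \<exists>f. tree_mor id f T T' \<and> (\<forall>v. \<not> contracts T f v)"
    using finite_tree_representatives by metis
  define K where "K T = (\<Pi>\<^sub>E v\<in>verts T. (if v = root T then {1::real} else {0..1}) \<times> Ops (ocld T v))" for T
  define D where "D = (\<Union>T\<in>F. Pair T ` K T)"
  have "compactin (metric_trees P S) (Pair T ` K T)" if T: "T \<in> F" for T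
  proof (rule image_compactin)
    let ?Z = "product_topology (\<lambda>v. prod_topology (top_of_set {0..1}) (opspace P (ocld T v))) (verts T)"
    show "continuous_map ?Z (metric_trees P S) (Pair T)"
      unfolding metric_trees_def
      by (rule continuous_map_component_injection[of T _ "\<lambda>T. product_topology (\<lambda>v. prod_topology (top_of_set {0..1}) (opspace P (ocld T v))) (verts T)"])
         (use F(2)[OF T] in simp)
    have Tin: "tree_in S T" using F(2)[OF T] S by (rule tree_inI)
    have "compactin (prod_topology (top_of_set {0..1}) (opspace P (ocld T v)))
       ((if v = root T then {1::real} else {0..1}) \<times> Ops (ocld T v))" if "v \<in> verts T" for v
      using compact_ops[OF tin_ocld[OF Tin that]]
      by (auto simp: compactin_Times compactin_subtopology compact_space_def)
    then show "compactin ?Z (K T)" unfolding K_def compactin_PiE by blast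
  qed
  then have "compactin (metric_trees P S) D" unfolding D_def by (intro compactin_Union) (use F(1) in auto)
  moreover have "continuous_map (metric_trees P S) (W01_space P S) (W_class P S)"
    unfolding W01_space_def by (rule quotient_imp_continuous_map[OF quotient_map_quotient_topology])
  ultimately have "compactin (W01_space P S) (W_class P S ` D)" by (rule image_compactin)
  moreover have "W_class P S ` D = topspace (opspace (W P) S)"
  proof (intro equalityI subsetI)
    fix c assume "c \<in> W_class P S ` D"
    then obtain T x where T: "T \<in> F" "x \<in> K T" "c = W_class P S (T, x)" by (auto simp: D_def)
    have "K T \<subseteq> (\<Pi>\<^sub>E v\<in>verts T. {0..1} \<times> Ops (ocld T v))"
      unfolding K_def by (rule PiE_mono) auto
    then have "x \<in> (\<Pi>\<^sub>E v\<in>verts T. {0..1} \<times> Ops (ocld T v))" using T(2) by blast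
    then have p: "(T, x) \<in> mtrees S" using F(2)[OF T(1)] by (simp add: mtrees_iff)
    have "x (root T) \<in> {1} \<times> Ops (ocld T (root T))"
      using PiE_mem[OF T(2)[unfolded K_def] lt_root[OF F(2)[OF T(1)]]] by simp
    then have "hair (T, x) = 1" by (auto simp: hair_def)
    then have "c = point S (value (T, x))" using T(3) W_class_eq[OF S p] by (simp add: point_def)
    then show "c \<in> topspace (opspace (W P) S)" using W_topspace[OF S] mtreesD(6)[OF S p] by blast
  next
    fix c assume c: "c \<in> topspace (opspace (W P) S)"
    obtain a where a: "a \<in> Ops S" "c = metric_class S a 1" using c unfolding W_topspace[OF S] by (auto simp: point_def)
    obtain p where "p \<in> metric_class S a 1" using metric_class_ex[OF S a(1), of 1] by auto
    then obtain T x where p: "(T, x) \<in> mtrees S" "value (T, x) = a" "hair (T, x) = 1"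
      by (cases p) (auto simp: metric_class_def)
    have lT: "labeled_tree S T" using p(1) by (simp add: mtrees_iff)
    obtain T' f where T': "T' \<in> F" "tree_mor id f T T'" "\<And>v. \<not> contracts T f v" using F(3)[OF lT] by blast
    obtain x' where x': "(T', x') \<in> mtrees S" "metric_mor P id f (T, x) (T', x')"
      using metric_mor_ex[OF S S p(1) F(2)[OF T'(1)] T'(2)] T'(3) by metis
    have v: "value (T', x') = a" "hair (T', x') = 1"
      using metric_mor_value[OF S S p(1) x'] p oprel_id[OF S a(1)] by auto
    have "x' \<in> K T'"
      unfolding K_def
    proof (rule PiE_I)
      show "x' u \<in> (if u = root T' then {1} else {0..1}) \<times> Ops (ocld T' u)" if "u \<in> verts T'" for u
        using mtreesD(4,5)[OF S x'(1) that] v(2) by (simp add: hair_def mem_Times_iff)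
      show "x' u = undefined" if "u \<notin> verts T'" for u
        using x'(1) that unfolding mtrees_iff by (auto simp: PiE_def extensional_def)
    qed
    then have "(T', x') \<in> D" using T'(1) by (auto simp: D_def)
    moreover have "W_class P S (T', x') = c" using W_class_eq[OF S x'(1)] v a(2) by simp
    ultimately show "c \<in> W_class P S ` D" by blast
  qed
  ultimately have "compactin (W01_space P S) (topspace (opspace (W P) S))" by simp
  then show ?thesis
    unfolding compact_space_def by (simp add: compactin_subtopology)
qed

lemma class_value_homeomorphic:
  assumes S: "arity_set n S" shows "homeomorphic_map (opspace (W P) S) (opspace P S) class_value"
proof (rule continuous_imp_homeomorphic_map[OF class_value_continuous[OF S] W_compact[OF S] Hausdorff_ops[OF S]])
  show "class_value ` topspace (opspace (W P) S) = Ops S"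
    unfolding W_topspace[OF S] point_def using class_value_metric_class[OF S] by (force simp: image_iff)
  show "inj_on class_value (topspace (opspace (W P) S))"
    by (rule inj_onI) (metis point_value(2)[OF S])
qed

text \<open>All relabeled representatives have the same value and hair, and one exists because a tree can be
renamed.\<close>

lemma W_relabel_class:
  assumes S: "arity_set n S" and s: "bij_betw \<sigma> S S'" and a: "a \<in> Ops S" and t: "t \<in> {0..1}"
  shows "W_relabel P S S' \<sigma> (metric_class S a t) = metric_class S' (oprelabel P S S' \<sigma> a) t"
proof -
  note S' = arity_bij[OF S s]
  let ?A = "{W_class P S' p' | p'. p' \<in> mtrees S' \<and> (\<exists>p\<in>metric_class S a t. \<exists>f. metric_mor P \<sigma> f p p')}"
  have one: "W_class P S' p' = metric_class S' (oprelabel P S S' \<sigma> a) t"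
    if p': "p' \<in> mtrees S'" and p: "p \<in> metric_class S a t" and f: "metric_mor P \<sigma> f p p'" for p p' f
  proof -
    obtain T x T' x' where e: "p = (T, x)" "p' = (T', x')" by (metis surj_pair)
    have pm: "(T, x) \<in> mtrees S" "value (T, x) = a" "hair (T, x) = t" using p e by (auto simp: metric_class_def)
    show ?thesis
      using metric_mor_value[OF S S' pm(1) p'[unfolded e(2)] f[unfolded e]] pm W_class_eq[OF S' p'] e by simp
  qed
  obtain p where p: "p \<in> metric_class S a t" using metric_class_ex[OF S a t] by auto
  obtain T x where e: "p = (T, x)" by (metis surj_pair)
  have pm: "(T, x) \<in> mtrees S" using p e by (simp add: metric_class_def)
  obtain T' f where T': "labeled_tree S' T'" "tree_mor \<sigma> f T T'" "\<And>v. \<not> contracts T f v"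
    using rename_ex[OF tin_lt[OF mtreesD(1)[OF S pm]] s] by blast
  obtain x' where x': "(T', x') \<in> mtrees S'" "metric_mor P \<sigma> f (T, x) (T', x')"
    using metric_mor_ex[OF S S' pm T'(1,2)] T'(3) by metis
  have "W_class P S' (T', x') \<in> ?A" using x' p e by blast
  then have "?A = {metric_class S' (oprelabel P S S' \<sigma> a) t}" using one by blast
  then show ?thesis unfolding W_relabel_def by simp
qed

lemma fiber_mtree:
  assumes S: "arity_set n S" and p: "(G, x) \<in> mtrees S" and T: "tree_in S T" and f: "tree_mor id f G T" and w: "w \<in> verts T"
  shows "(fiber G f w, restrict x (verts (fiber G f w))) \<in> mtrees (labels (fiber G f w))"
    "value (fiber G f w, restrict x (verts (fiber G f w))) =
       eval 2 1 (fiber G f w) (level x) (restrict (label G x) (verts (fiber G f w)))"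
    "hair (fiber G f w, restrict x (verts (fiber G f w))) = fst (x (fiber_root G f w))"
proof -
  let ?F = "fiber G f w" let ?y = "restrict x (verts ?F)"
  note G = mtreesD[OF S p] note F = fiber_in[OF G(1) T f w]
  have oc: "ocld ?F v = ocld G v" if "v \<in> verts ?F" for v using ocld_fiber[OF tin_lt[OF G(1)] f, of v] that by auto
  show F1: "(?F, ?y) \<in> mtrees (labels ?F)"
    unfolding mtrees_iff
  proof (intro conjI tin_lt[OF F] PiE_I)
    show "?y v \<in> {0..1} \<times> Ops (ocld ?F v)" if "v \<in> verts ?F" for v
      using that G(4,5)[of v] oc[OF that] by (simp add: mem_Times_iff)
  qed auto
  have lab: "label ?F ?y = restrict (label G x) (verts ?F)"
    unfolding label_def by (rule restrict_ext) simp
  note FL = mtreesD[OF tin_arity[OF F] F1]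
  have "eval 2 1 ?F (level ?y) (label ?F ?y) = eval 2 1 ?F (level x) (label ?F ?y)"
    by (rule eval_level_cong[OF F fiber_levels[OF f G(3)] FL(2)]) (simp add: level_def)
  then show "value (?F, ?y) = eval 2 1 ?F (level x) (restrict (label G x) (verts ?F))"
    unfolding value_def using lab by simp
  show "hair (?F, ?y) = fst (x (fiber_root G f w))" using mor_froot[OF f w] by (simp add: hair_def)
qed

text \<open>In a grafting of trees with hair of length \<open>1\<close> the new edges have this length, hence level \<open>2\<close>, the final
time of the process. So all graftings have the value of the composite. As \<open>W_comp\<close> is a union over
all graftings, one has to be constructed as well.\<close>

lemma W_comp_class:
  assumes T: "tree_in S T" and y: "y \<in> topspace (tree_space (W P) T)"
  shows "W_comp P T y = point S (opcomp P T (\<lambda>v\<in>verts T. class_value (y v)))"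
proof -
  note S = tin_arity[OF T] note lT = tin_lt[OF T]
  define b where "b = (\<lambda>v\<in>verts T. class_value (y v))"
  have yv: "y v \<in> topspace (opspace (W P) (ocld T v))" if "v \<in> verts T" for v
    using y that unfolding tree_space_def by auto
  have bv: "b v \<in> Ops (ocld T v)" "y v = metric_class (ocld T v) (b v) 1" if v: "v \<in> verts T" for v
    using point_value[OF tin_ocld[OF T v] yv[OF v]] v unfolding b_def point_def by auto
  have b: "b \<in> pts T" unfolding pts_iff using bv(1) by (auto intro!: PiE_I simp: b_def)
  have rel: "W_relabel P (labels (fiber G f v)) (ocld T v) (glue G id f)
       (W_class P (labels (fiber G f v)) (fiber G f v, restrict x (verts (fiber G f v)))) =
     metric_class (ocld T v) (oprelabel P (labels (fiber G f v)) (ocld T v) (glue G id f)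
        (eval 2 1 (fiber G f v) (level x) (restrict (label G x) (verts (fiber G f v))))) (fst (x (fiber_root G f v)))"
    and relin: "oprelabel P (labels (fiber G f v)) (ocld T v) (glue G id f)
        (eval 2 1 (fiber G f v) (level x) (restrict (label G x) (verts (fiber G f v)))) \<in> Ops (ocld T v)"
      "fst (x (fiber_root G f v)) \<in> {0..1}"
    if p: "(G, x) \<in> mtrees S" and f: "tree_mor id f G T" and v: "v \<in> verts T" for G x f v
  proof -
    note G = mtreesD[OF S p] note F = fiber_in[OF G(1) T f v] note fm = fiber_mtree[OF S p T f v]
    note d = mtreesD[OF tin_arity[OF F] fm(1)]
    note g = glue_bij[OF tin_lt[OF G(1)] lT f v]
    show "W_relabel P (labels (fiber G f v)) (ocld T v) (glue G id f)
       (W_class P (labels (fiber G f v)) (fiber G f v, restrict x (verts (fiber G f v)))) =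
     metric_class (ocld T v) (oprelabel P (labels (fiber G f v)) (ocld T v) (glue G id f)
        (eval 2 1 (fiber G f v) (level x) (restrict (label G x) (verts (fiber G f v))))) (fst (x (fiber_root G f v)))"
      unfolding W_class_eq[OF tin_arity[OF F] fm(1)]
      using W_relabel_class[OF tin_arity[OF F] g d(6,7)] unfolding fm(2,3) .
    show "oprelabel P (labels (fiber G f v)) (ocld T v) (glue G id f)
        (eval 2 1 (fiber G f v) (level x) (restrict (label G x) (verts (fiber G f v)))) \<in> Ops (ocld T v)"
      using oprel_in[OF tin_arity[OF F] g d(6)] unfolding fm(2) .
    show "fst (x (fiber_root G f v)) \<in> {0..1}" using d(7) unfolding fm(3) .
  qed
  have one: "W_class P (labels T) (G, x) = point S (opcomp P T b)"
    if p': "(G, x) \<in> mtrees (labels T)" and gr: "grafting P T y G x" for G x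
  proof -
    have p: "(G, x) \<in> mtrees S" using p' lt_labels[OF lT] by simp
    note G = mtreesD[OF S p]
    obtain f where f: "tree_mor id f G T" and e: "\<And>v. v \<in> verts T \<Longrightarrow>
       W_relabel P (labels (fiber G f v)) (ocld T v) (glue G id f)
       (W_class P (labels (fiber G f v)) (fiber G f v, restrict x (verts (fiber G f v)))) = y v"
      using gr unfolding grafting_def by blast
    have fib: "oprelabel P (labels (fiber G f v)) (ocld T v) (glue G id f)
        (eval 2 1 (fiber G f v) (level x) (restrict (label G x) (verts (fiber G f v)))) = b v"
      "fst (x (fiber_root G f v)) = 1" if v: "v \<in> verts T" for v
    proof -
      have "metric_class (ocld T v) (oprelabel P (labels (fiber G f v)) (ocld T v) (glue G id f)
        (eval 2 1 (fiber G f v) (level x) (restrict (label G x) (verts (fiber G f v))))) (fst (x (fiber_root G f v))) =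
        metric_class (ocld T v) (b v) 1"
        unfolding rel[OF p f v, symmetric] e[OF v] by (rule bv(2)[OF v])
      note i = metric_class_inj[OF tin_ocld[OF T v] relin[OF p f v] this]
      show "oprelabel P (labels (fiber G f v)) (ocld T v) (glue G id f)
        (eval 2 1 (fiber G f v) (level x) (restrict (label G x) (verts (fiber G f v)))) = b v" by (rule i(1))
      show "fst (x (fiber_root G f v)) = 1" by (rule i(2))
    qed
    have "level x u = 2" if u: "u \<in> verts G" "u \<noteq> root G" "\<not> contracts G f u" for u
      using fib(2)[OF mor_verts[OF f u(1)]] fiber_root_iff[OF f u(1)] u(3) by (simp add: level_def)
    then have "value (G, x) = opcomp P T (\<lambda>w\<in>verts T. oprelabel P (labels (fiber G f w)) (ocld T w) (glue G id f)
       (eval 2 1 (fiber G f w) (level x) (restrict (label G x) (verts (fiber G f w)))))"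
      using eval_graft[OF G(1) T f G(3) _ G(2)] by (simp add: value_def)
    also have "(\<lambda>w\<in>verts T. oprelabel P (labels (fiber G f w)) (ocld T w) (glue G id f)
       (eval 2 1 (fiber G f w) (level x) (restrict (label G x) (verts (fiber G f w))))) = restrict b (verts T)"
      by (rule restrict_ext) (rule fib(1))
    finally have "value (G, x) = opcomp P T b" using pts_restrict[OF b] by simp
    moreover have "hair (G, x) = 1"
      using fib(2)[OF lt_root[OF lT]] froot_root[OF f lt_root[OF tin_lt[OF G(1)]]] by (simp add: hair_def)
    ultimately show ?thesis using W_class_eq[OF S p] lt_labels[OF lT] by (simp add: point_def)
  qed
  \<comment> \<open>A grafting of chosen representatives.\<close>
  have "\<exists>Tr X. \<forall>v\<in>verts T. (Tr v, X v) \<in> y v"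
  proof -
    have "\<forall>v\<in>verts T. \<exists>p. p \<in> y v" using metric_class_ex[OF tin_ocld[OF T] bv(1), of _ 1] bv(2) by fastforce
    then obtain p where "\<forall>v\<in>verts T. p v \<in> y v" by metis
    then show ?thesis by (intro exI[of _ "\<lambda>v. fst (p v)"] exI[of _ "\<lambda>v. snd (p v)"]) simp
  qed
  then obtain Tr X where TX: "\<And>v. v \<in> verts T \<Longrightarrow> (Tr v, X v) \<in> metric_class (ocld T v) (b v) 1" using bv(2) by metis
  have pm: "(Tr v, X v) \<in> mtrees (ocld T v)" and pv: "value (Tr v, X v) = b v" and ph: "hair (Tr v, X v) = 1"
    if "v \<in> verts T" for v using TX[OF that] by (auto simp: metric_class_def)
  note R = mtreesD[OF tin_ocld[OF T] pm]
  obtain G f \<tau> k z where G: "tree_in S G" and f: "tree_mor id f G T"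
    and k: "\<And>w. w \<in> verts T \<Longrightarrow> tree_mor (\<tau> w) (k w) (Tr w) (fiber G f w)"
    and kc: "\<And>w v. w \<in> verts T \<Longrightarrow> \<not> contracts (Tr w) (k w) v"
    and gl: "\<And>w s. w \<in> verts T \<Longrightarrow> s \<in> ocld T w \<Longrightarrow> glue G id f (\<tau> w s) = s"
    and z: "z \<in> pts G"
    and zr: "\<And>w. w \<in> verts T \<Longrightarrow> restrict z (verts (fiber G f w)) = tree_map P (\<tau> w) (k w) (Tr w) (fiber G f w) (label (Tr w) (X w))"
    using graft_ex[OF T R(1) R(2)] by metis
  define x where "x = (\<lambda>u\<in>verts G. (if contracts G f u then fst (X (f u) (fiber_root (Tr (f u)) (k (f u)) u)) else 1, z u))"
  have p: "(G, x) \<in> mtrees S"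
    unfolding mtrees_iff
  proof (intro conjI tin_lt[OF G] PiE_I)
    fix u assume u: "u \<in> verts G"
    note w = mor_verts[OF f u]
    have "fiber_root (Tr (f u)) (k (f u)) u \<in> verts (Tr (f u))" by (rule froot_in[OF k[OF w]]) (use u in simp)
    then have "fst (X (f u) (fiber_root (Tr (f u)) (k (f u)) u)) \<in> {0..1}" by (rule R(4)[OF w w])
    then show "x u \<in> {0..1} \<times> Ops (ocld G u)" using u pts_D[OF z u] by (simp add: x_def)
  qed (simp add: x_def)
  have "grafting P T y G x"
    unfolding grafting_def
  proof (intro exI[of _ f] conjI f ballI)
    fix w assume w: "w \<in> verts T"
    let ?F = "fiber G f w" let ?x = "restrict x (verts ?F)"
    note F = fiber_in[OF G T f w] note fm = fiber_mtree[OF S p T f w]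
    note t = tin_mor_bij[OF R(1)[OF w w] F k[OF w]]
    note g = glue_bij[OF tin_lt[OF G] lT f w]
    have "?x = (\<lambda>u\<in>verts ?F. (fst (X w (fiber_root (Tr w) (k w) u)),
        tree_map P (\<tau> w) (k w) (Tr w) ?F (label (Tr w) (X w)) u))"
    proof (rule restrict_ext)
      fix u assume u: "u \<in> verts ?F"
      then have uG: "u \<in> verts G" "f u = w" by auto
      have "fst (x u) = fst (X w (fiber_root (Tr w) (k w) u))"
      proof (cases "contracts G f u")
        case True
        then show ?thesis using uG by (simp add: x_def)
      next
        case False
        then have "u = root ?F" using fiber_root_iff[OF f uG(1)] uG(2) by simp
        then have "fiber_root (Tr w) (k w) u = root (Tr w)"
          using froot_root[OF k[OF w] lt_root[OF tin_lt[OF R(1)[OF w w]]]] by simp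
        then show ?thesis using ph[OF w] False uG by (simp add: x_def hair_def)
      qed
      moreover have "snd (x u) = tree_map P (\<tau> w) (k w) (Tr w) ?F (label (Tr w) (X w)) u"
        using fun_cong[OF zr[OF w], of u] u uG by (simp add: x_def)
      ultimately show "x u = (fst (X w (fiber_root (Tr w) (k w) u)), tree_map P (\<tau> w) (k w) (Tr w) ?F (label (Tr w) (X w)) u)"
        by (simp add: prod_eq_iff)
    qed
    then have "metric_mor P (\<tau> w) (k w) (Tr w, X w) (?F, ?x)"
      using k[OF w] kc[OF w] unfolding metric_mor_def prod.case tree_map_label contracts_def by blast
    from metric_mor_value[OF tin_ocld[OF T w] tin_arity[OF F] pm[OF w] fm(1) this]
    have v: "value (?F, ?x) = oprelabel P (ocld T w) (labels ?F) (\<tau> w) (b w)" "hair (?F, ?x) = 1"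
      using pv[OF w] ph[OF w] by auto
    have "W_relabel P (labels ?F) (ocld T w) (glue G id f) (W_class P (labels ?F) (?F, ?x)) =
       metric_class (ocld T w) (oprelabel P (labels ?F) (ocld T w) (glue G id f) (oprelabel P (ocld T w) (labels ?F) (\<tau> w) (b w))) 1"
      unfolding W_class_eq[OF tin_arity[OF F] fm(1)] v
      by (rule W_relabel_class[OF tin_arity[OF F] g oprel_in[OF tin_ocld[OF T w] t bv(1)[OF w]]]) simp
    also have "oprelabel P (labels ?F) (ocld T w) (glue G id f) (oprelabel P (ocld T w) (labels ?F) (\<tau> w) (b w)) = b w"
      unfolding oprel_comp[OF tin_ocld[OF T w] t g bv(1)[OF w]]
      by (rule oprel_id'[OF tin_ocld[OF T w] bv(1)[OF w]]) (simp add: gl[OF w])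
    finally show "W_relabel P (labels ?F) (ocld T w) (glue G id f) (W_class P (labels ?F) (?F, ?x)) = y w"
      unfolding bv(2)[OF w] .
  qed
  then have "{W_class P (labels T) (G, x) | G x. (G, x) \<in> mtrees (labels T) \<and> grafting P T y G x} = {point S (opcomp P T b)}"
    using one p lt_labels[OF lT] by blast
  then show ?thesis unfolding W_comp_def b_def by simp
qed

lemma W_operad_iso:
  shows "operad_iso n P (W P) (\<lambda>S. inv_into (topspace (opspace (W P) S)) class_value)"
    and "\<And>S. arity_set n S \<Longrightarrow> class_value ` Decom (W P) S = Decom P S"
    and "\<And>S. arity_set n S \<Longrightarrow> Decom (W P) S \<subseteq> topspace (opspace (W P) S)"
proof -
  have pt: "class_value (point S a) = a" "point S a \<in> topspace (opspace (W P) S)" if "arity_set n S" "a \<in> Ops S" for S a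
    using class_value_metric_class[OF that, of 1] W_topspace[OF that(1)] that(2) by (auto simp: point_def)
  have rel: "oprelabel (W P) S S' \<sigma> c = point S' (oprelabel P S S' \<sigma> (class_value c))"
    if S: "arity_set n S" and s: "bij_betw \<sigma> S S'" and c: "c \<in> topspace (opspace (W P) S)" for S S' \<sigma> c
  proof -
    note pv = point_value[OF S c]
    have "oprelabel (W P) S S' \<sigma> (point S (class_value c)) = point S' (oprelabel P S S' \<sigma> (class_value c))"
      using W_relabel_class[OF S s pv(1), of 1] by (simp add: point_def)
    then show ?thesis using pv(2) by simp
  qed
  have yb: "(\<lambda>v\<in>verts T. class_value (y v)) \<in> pts T" if T: "tree_in S T" and y: "y \<in> topspace (tree_space (W P) T)" for S T y
    unfolding pts_iff
  proof (rule PiE_I)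
    fix v assume v: "v \<in> verts T"
    have "y v \<in> topspace (opspace (W P) (ocld T v))" using y v unfolding tree_space_def by auto
    from point_value(1)[OF tin_ocld[OF T v] this] v
    show "(\<lambda>v\<in>verts T. class_value (y v)) v \<in> Ops (ocld T v)" by simp
  qed simp
  have comp: "opcomp (W P) T y = point S (opcomp P T (\<lambda>v\<in>verts T. class_value (y v)))"
    if "tree_in S T" "y \<in> topspace (tree_space (W P) T)" for S T y
    using W_comp_class[OF that] by simp
  note tr = transport_operad[of "W P" "\<lambda>_. class_value"]
  have H: "homeomorphic_map (opspace (W P) S) (opspace P S) class_value" if "arity_set n S" for S
    by (rule class_value_homeomorphic[OF that])
  have A1: "oprelabel (W P) S S' \<sigma> c \<in> topspace (opspace (W P) S')"
    and A2: "class_value (oprelabel (W P) S S' \<sigma> c) = oprelabel P S S' \<sigma> (class_value c)"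
    if S: "arity_set n S" and s: "bij_betw \<sigma> S S'" and c: "c \<in> topspace (opspace (W P) S)" for S S' \<sigma> c
    unfolding rel[OF that] using pt[OF arity_bij[OF S s] oprel_in[OF S s point_value(1)[OF S c]]] by auto
  have A3: "opcomp (W P) T y \<in> topspace (opspace (W P) S)"
    and A4: "class_value (opcomp (W P) T y) = opcomp P T (\<lambda>v\<in>verts T. class_value (y v))"
    if "tree_in S T" "y \<in> topspace (tree_space (W P) T)" for S T y
    unfolding comp[OF that] using pt[OF tin_arity[OF that(1)] opcomp_in[OF that(1) yb[OF that]]] by auto
  show "operad_iso n P (W P) (\<lambda>S. inv_into (topspace (opspace (W P) S)) class_value)"
    by (rule tr(1)[OF H A1 A2 A3 A4])
  show "class_value ` Decom (W P) S = Decom P S" if "arity_set n S" for S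
    by (rule tr(2)[OF H A1 A2 A3 A4 that])
  show "Decom (W P) S \<subseteq> topspace (opspace (W P) S)" if S: "arity_set n S" for S
    using A3[OF tree_inI[OF _ S]] unfolding Decom_def by blast
qed

text \<open>The last contraction takes place at a time between \<open>1\<close> and \<open>2\<close>, and the boundary point that it
produces is scaled by at least \<open>1 / 2\<close> afterwards. Conversely, every such scaled boundary point is reached
by a tree whose last contraction produces that boundary point.\<close>

lemma W_decomposable_value:
  assumes S: "arity_set n S"
  shows "class_value ` W_decomposable P S = {sc S u b | u b. 1 / 2 \<le> u \<and> u \<le> 1 \<and> b \<in> Decom P S}"
proof (intro equalityI subsetI)
  fix a assume "a \<in> class_value ` W_decomposable P S"
  then obtain c T x where c: "c \<in> topspace (opspace (W P) S)" "(T, x) \<in> c" "decomposable T" "a = class_value c"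
    unfolding W_decomposable_def by blast
  have "(T, x) \<in> metric_class S a 1" using point_value(2)[OF S c(1)] c(2,4) by (simp add: point_def)
  then have p: "(T, x) \<in> mtrees S" "value (T, x) = a" by (auto simp: metric_class_def)
  note T = mtreesD[OF S p(1)]
  obtain b u where b: "b \<in> Decom P S" "1 / 2 \<le> u" "u \<le> 1" "eval 2 1 T (level x) (label T x) = sc S u b"
    using eval_decomposable[OF T(1,3) c(3) T(2)] by blast
  then have "a = sc S u b" using p(2) by (simp add: value_def)
  then show "a \<in> {sc S u b | u b. 1 / 2 \<le> u \<and> u \<le> 1 \<and> b \<in> Decom P S}" using b(1-3) by blast
next
  fix a assume "a \<in> {sc S u b | u b. 1 / 2 \<le> u \<and> u \<le> 1 \<and> b \<in> Decom P S}"
  then obtain u b where u: "1 / 2 \<le> u" "u \<le> 1" and b: "b \<in> Decom P S" and a: "a = sc S u b" by blast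
  obtain T l x where R: "reached S 2 a T l x" and d: "decomposable T"
    using eval_surjective_Decom[OF S b u] a by auto
  from reached_metric_tree[OF S R, of 1] obtain y where y: "(T, y) \<in> point S a" unfolding point_def by auto
  then have aO: "a \<in> Ops S" using mtreesD(6)[OF S] by (auto simp: point_def metric_class_def)
  have "point S a \<in> topspace (opspace (W P) S)" unfolding W_topspace[OF S] using aO by blast
  then have "point S a \<in> W_decomposable P S" using d y unfolding W_decomposable_def by blast
  moreover have "class_value (point S a) = a" using class_value_metric_class[OF S aO, of 1] by (simp add: point_def)
  ultimately show "a \<in> class_value ` W_decomposable P S" by force
qed

end

section \<open>Scalings from collars\<close>

text \<open>The factor \<open>l\<close> multiplies the distance \<open>1 - t\<close> of a point \<open>c (y, t)\<close> of the collar from its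
inner end. At the inner end this is the identity, so it extends continuously by the identity.\<close>

lemma collar_scaling:
  assumes X: "compact_space X" "Hausdorff_space X" and B: "closedin X B" and c: "is_collar X B N c"
  obtains s where "is_scaling X B s"
    "\<And>y t l. y \<in> B \<Longrightarrow> t \<in> {0..1} \<Longrightarrow> l \<in> {0..1} \<Longrightarrow> s l (c (y, t)) = c (y, 1 - l * (1 - t))"
    "\<And>z l. z \<in> topspace X \<Longrightarrow> z \<notin> N \<Longrightarrow> s l z = z"
proof -
  let ?P = "prod_topology (subtopology X B) (top_of_set {0..1::real})"
  have BX: "B \<subseteq> topspace X" by (rule closedin_subset[OF B])
  have NX: "N \<subseteq> topspace X" and c0: "\<And>x. x \<in> B \<Longrightarrow> c (x, 0) = x" and op: "openin X (c ` (B \<times> {0..<1}))"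
    and hom: "homeomorphic_map ?P (subtopology X N) c" using c by (auto simp: is_collar_def)
  have tP: "topspace ?P = B \<times> {0..1}" using BX by auto
  obtain g where g: "homeomorphic_maps ?P (subtopology X N) c g" using hom unfolding homeomorphic_map_maps by blast
  have tN: "topspace (subtopology X N) = N" using NX by auto
  have cN: "c (y, t) \<in> N" if "y \<in> B" "t \<in> {0..1}" for y t
    using g that tP tN unfolding homeomorphic_maps_def continuous_map_def by auto
  have gc: "g (c (y, t)) = (y, t)" if "y \<in> B" "t \<in> {0..1}" for y t
  proof -
    have "(y, t) \<in> topspace ?P" unfolding tP using that by simp
    then show ?thesis using g unfolding homeomorphic_maps_def by blast
  qed
  have Nex: "\<exists>y\<in>B. \<exists>t\<in>{0..1}. z = c (y, t)" if "z \<in> N" for z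
  proof -
    have "z \<in> c ` (B \<times> {0..1})" using homeomorphic_imp_surjective_map[OF hom] tP tN that by auto
    then show ?thesis by auto
  qed
  have cinj: "y = y' \<and> t = t'" if "y \<in> B" "t \<in> {0..1}" "y' \<in> B" "t' \<in> {0..1}" "c (y, t) = c (y', t')" for y y' t t'
  proof -
    have "(y, t) = (y', t')" using gc[OF that(1,2)] gc[OF that(3,4)] unfolding that(5) by (rule trans[OF sym])
    then show ?thesis by simp
  qed
  define s where "s l z = (if z \<in> N then c (fst (g z), 1 - l * (1 - snd (g z))) else z)" for l z
  have sc: "s l (c (y, t)) = c (y, 1 - l * (1 - t))" if "y \<in> B" "t \<in> {0..1}" for y t l
    using cN[OF that] gc[OF that] by (simp add: s_def)
  have so: "s l z = z" if "z \<notin> N" for l z using that by (simp add: s_def)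
  have rng: "1 - l * (1 - t) \<in> {0..1}" if "l \<in> {0..1}" "t \<in> {0..1}" for l t :: real
    using that by (auto intro: mult_le_one mult_nonneg_nonneg)
  have cN2: "c (y, 1 - l * (1 - t)) \<in> N" if "y \<in> B" "t \<in> {0..1}" "l \<in> {0..1}" for y t l
    by (rule cN[OF that(1) rng[OF that(3,2)]])
  have closedN: "closedin X N"
  proof (rule compactin_imp_closedin[OF X(2)])
    have "compactin X B" by (rule closedin_compact_space[OF X(1) B])
    then have "compact_space (subtopology X B)" using BX by (simp add: compact_space_subtopology)
    then have "compact_space ?P" by (simp add: compact_space_prod_topology compact_space_subtopology)
    then have "compact_space (subtopology X N)"
      using hom homeomorphic_compact_space homeomorphic_map_imp_homeomorphic_space by blast
    then show "compactin X N" using NX by (simp add: compact_space_subtopology compactin_subspace)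
  qed
  let ?Z = "prod_topology (top_of_set {0..1::real}) X"
  have scont: "continuous_map ?Z X (\<lambda>(t, a). s t a)"
  proof (rule pasting_lemma_closed[where I = "{0, 1::nat}"
        and T = "\<lambda>i. if i = 0 then {0..1} \<times> N else {0..1} \<times> (topspace X - c ` (B \<times> {0..<1}))"
        and f = "\<lambda>i. if i = 0 then (\<lambda>(t, a). s t a) else snd"])
    fix i :: nat assume "i \<in> {0, 1}"
    show "closedin ?Z (if i = 0 then {0..1} \<times> N else {0..1} \<times> (topspace X - c ` (B \<times> {0..<1})))"
      using closedN op by (auto intro!: closedin_prod_Times_iff[THEN iffD2])
    show "continuous_map (subtopology ?Z (if i = 0 then {0..1} \<times> N else {0..1} \<times> (topspace X - c ` (B \<times> {0..<1})))) X
       (if i = 0 then (\<lambda>(t, a). s t a) else snd)"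
    proof (cases "i = 0")
      case True
      let ?A = "prod_topology (top_of_set {0..1::real}) (subtopology X N)"
      have Aeq: "subtopology ?Z ({0..1} \<times> N) = ?A"
        by (simp add: prod_topology_subtopology subtopology_subtopology)
      have gcont: "continuous_map (subtopology X N) ?P g" using g by (simp add: homeomorphic_maps_def)
      have g1: "continuous_map ?A (subtopology X B) (\<lambda>p. fst (g (snd p)))"
        using continuous_map_compose[OF continuous_map_snd continuous_map_fst_of[OF gcont]] by (simp add: o_def)
      have g2: "continuous_map ?A (top_of_set {0..1}) (\<lambda>p. snd (g (snd p)))"
        using continuous_map_compose[OF continuous_map_snd continuous_map_snd_of[OF gcont]] by (simp add: o_def)
      have f1: "continuous_map ?A (top_of_set {0..1}) fst" by (rule continuous_map_fst)
      have "continuous_map ?A euclideanreal (\<lambda>p. 1 - fst p * (1 - snd (g (snd p))))"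
        using continuous_map_into_fulltopology[OF f1] continuous_map_into_fulltopology[OF g2]
        by (intro continuous_map_diff continuous_map_real_mult) auto
      moreover have "1 - fst p * (1 - snd (g (snd p))) \<in> {0..1}" if "p \<in> topspace ?A" for p
      proof (rule rng)
        show "fst p \<in> {0..1}" using that by auto
        show "snd (g (snd p)) \<in> {0..1}" using funcset_mem[OF continuous_map_funspace[OF g2] that] by simp
      qed
      ultimately have "continuous_map ?A (top_of_set {0..1}) (\<lambda>p. 1 - fst p * (1 - snd (g (snd p))))"
        by (auto simp: continuous_map_in_subtopology)
      then have "continuous_map ?A (subtopology X N) (c \<circ> (\<lambda>p. (fst (g (snd p)), 1 - fst p * (1 - snd (g (snd p))))))"
        by (intro continuous_map_compose[OF continuous_map_pairedI[OF g1] homeomorphic_imp_continuous_map[OF hom]])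
      then have "continuous_map ?A X (c \<circ> (\<lambda>p. (fst (g (snd p)), 1 - fst p * (1 - snd (g (snd p))))))"
        by (rule continuous_map_into_fulltopology)
      then have "continuous_map ?A X (\<lambda>(t, a). s t a)"
        by (rule continuous_map_eq) (auto simp: s_def)
      then show ?thesis using True Aeq by simp
    next
      case False
      then show ?thesis by (simp add: continuous_map_from_subtopology continuous_map_snd)
    qed
  next
    fix i j p
    assume ij: "i \<in> {0, 1::nat}" "j \<in> {0, 1::nat}"
      and p: "p \<in> topspace ?Z \<inter> (if i = 0 then {0..1} \<times> N else {0..1} \<times> (topspace X - c ` (B \<times> {0..<1})))
        \<inter> (if j = 0 then {0..1} \<times> N else {0..1} \<times> (topspace X - c ` (B \<times> {0..<1})))"
    have key: "s l z = z" if z: "z \<in> N" "z \<notin> c ` (B \<times> {0..<1})" for l z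
    proof -
      obtain y t where yt: "y \<in> B" "t \<in> {0..1}" "z = c (y, t)" using Nex[OF z(1)] by blast
      have "t = 1"
      proof (rule ccontr)
        assume "t \<noteq> 1"
        then have "(y, t) \<in> B \<times> {0..<1}" using yt by auto
        then show False using z(2) yt(3) by blast
      qed
      then show ?thesis using sc[OF yt(1,2)] yt(3) by simp
    qed
    obtain l z where lz: "p = (l, z)" by (metis surj_pair)
    show "(if i = 0 then (\<lambda>(t, a). s t a) else snd) p = (if j = 0 then (\<lambda>(t, a). s t a) else snd) p"
      using p key[of z l] unfolding lz by (auto split: if_splits)
  next
    fix p assume p: "p \<in> topspace ?Z"
    obtain l z where lz: "p = (l, z)" by (metis surj_pair)
    show "\<exists>j. j \<in> {0, 1::nat} \<and> p \<in> (if j = 0 then {0..1} \<times> N else {0..1} \<times> (topspace X - c ` (B \<times> {0..<1}))) \<and>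
      (\<lambda>(t, a). s t a) p = (if j = 0 then (\<lambda>(t, a). s t a) else snd) p"
    proof (cases "z \<in> N")
      case True
      then show ?thesis using p lz by (intro exI[of _ 0]) auto
    next
      case False
      then have "z \<notin> c ` (B \<times> {0..<1})" using cN by force
      then show ?thesis using p lz so[OF False] by (intro exI[of _ 1]) auto
    qed
  qed simp
  have "is_scaling X B s"
    unfolding is_scaling_def
  proof (intro conjI ballI allI impI scont)
    fix a assume a: "a \<in> topspace X"
    show "s 1 a = a" using sc[of _ _ 1] Nex[of a] so[of a 1] by (cases "a \<in> N") auto
    show "s t (s u a) = s (t * u) a" if "t \<in> {0..1}" "u \<in> {0..1}" for t u
    proof (cases "a \<in> N")
      case True
      then obtain y v where y: "y \<in> B" "v \<in> {0..1}" "a = c (y, v)" using Nex by blast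
      show ?thesis using sc[OF y(1,2)] sc[OF y(1) rng[OF that(2) y(2)]] y(3) by (simp add: mult.assoc)
    qed (simp add: so)
    show "a = b" if b: "b \<in> topspace X" and h: "0 < t \<and> t \<le> 1 \<and> s t a = s t b" for b t
    proof -
      have t: "t \<in> {0..1}" "t \<noteq> 0" using h by auto
      have sN: "s t z \<in> N \<longleftrightarrow> z \<in> N" for z
        using Nex[of z] sc cN2[OF _ _ t(1)] so[of z t] by (cases "z \<in> N") auto
      show ?thesis
      proof (cases "a \<in> N")
        case True
        then have "b \<in> N" using sN[of a] sN[of b] h by simp
        then obtain y v y' v' where y: "y \<in> B" "v \<in> {0..1}" "a = c (y, v)" and y': "y' \<in> B" "v' \<in> {0..1}" "b = c (y', v')"
          using Nex True by metis
        have "c (y, 1 - t * (1 - v)) = c (y', 1 - t * (1 - v'))"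
          using h sc[OF y(1,2)] sc[OF y'(1,2)] y(3) y'(3) by simp
        from cinj[OF y(1) rng[OF t(1) y(2)] y'(1) rng[OF t(1) y'(2)] this]
        show ?thesis using t(2) y(3) y'(3) by simp
      next
        case False
        then have "b \<notin> N" using sN[of a] sN[of b] h by simp
        then show ?thesis using False h so by simp
      qed
    qed
    show "s t a \<notin> B" if t: "0 \<le> t \<and> t < 1" for t
    proof (cases "a \<in> N")
      case True
      then obtain y v where y: "y \<in> B" "v \<in> {0..1}" "a = c (y, v)" using Nex by blast
      have tt: "t \<in> {0..1}" using t by auto
      have "t * (1 - v) \<le> t * 1" using t y(2) by (intro mult_left_mono) auto
      then have pos: "1 - t * (1 - v) \<noteq> 0" using t by auto
      show ?thesis
      proof
        assume b: "s t a \<in> B"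
        then have "c (s t a, 0) = c (y, 1 - t * (1 - v))" using c0 sc[OF y(1,2)] y(3) by simp
        from cinj[OF b _ y(1) rng[OF tt y(2)] this] pos show False by simp
      qed
    next
      case False
      then have "a \<notin> B" using cN[of a 0] c0[of a] by auto
      then show ?thesis using so[OF False] by simp
    qed
    show "(\<exists>b\<in>topspace X. a = s t b) \<or> (\<exists>b\<in>B. \<exists>u. t \<le> u \<and> u \<le> 1 \<and> a = s u b)" if t: "0 < t \<and> t \<le> 1" for t
    proof (cases "a \<in> N")
      case True
      then obtain y v where y: "y \<in> B" "v \<in> {0..1}" "a = c (y, v)" using Nex by blast
      show ?thesis
      proof (cases "1 - t \<le> v")
        case True
        define v' where "v' = 1 - (1 - v) / t"
        have "(1 - v) / t \<le> 1" using True t by (simp add: field_simps)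
        moreover have "0 \<le> (1 - v) / t" using t y(2) by auto
        ultimately have v': "v' \<in> {0..1}" by (simp add: v'_def)
        have "s t (c (y, v')) = a" using sc[OF y(1) v', of t] t y(3) by (simp add: v'_def)
        moreover have "c (y, v') \<in> topspace X" using cN[OF y(1) v'] NX by auto
        ultimately show ?thesis by blast
      next
        case False
        have "s (1 - v) (c (y, 0)) = a" using sc[OF y(1), of 0 "1 - v"] y(3) by simp
        then show ?thesis using c0[OF y(1)] False y by (intro disjI2 bexI[of _ y] exI[of _ "1 - v"]) auto
      qed
    next
      case False
      then show ?thesis using so[OF False, of t] a by metis
    qed
  qed
  then show thesis by (rule that) (use sc so in auto)
qed

lemma half_collar:
  assumes c: "is_collar X B N c" and BX: "B \<subseteq> topspace X"
  shows "is_collar X B (c ` (B \<times> {0..1 / 2})) (\<lambda>(y, t). c (y, t / 2))"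
proof -
  let ?P = "prod_topology (subtopology X B) (top_of_set {0..1::real})"
  let ?N = "c ` (B \<times> {0..1 / 2})" let ?c = "\<lambda>(y, t). c (y, t / 2)"
  have NX: "N \<subseteq> topspace X" and c0: "\<And>x. x \<in> B \<Longrightarrow> c (x, 0) = x" and op: "openin X (c ` (B \<times> {0..<1}))"
    and hom: "homeomorphic_map ?P (subtopology X N) c" using c by (auto simp: is_collar_def)
  have tP: "topspace ?P = B \<times> {0..1}" using BX by auto
  have tN: "topspace (subtopology X N) = N" using NX by auto
  obtain g where g: "homeomorphic_maps ?P (subtopology X N) c g" using hom unfolding homeomorphic_map_maps by blast
  have gc: "g (c (y, t)) = (y, t)" if "y \<in> B" "t \<in> {0..1}" for y t
  proof -
    have "(y, t) \<in> topspace ?P" unfolding tP using that by simp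
    then show ?thesis using g unfolding homeomorphic_maps_def by blast
  qed
  have im: "c ` (B \<times> {0..1}) = N" using homeomorphic_imp_surjective_map[OF hom] tP tN by auto
  have N2: "?N \<subseteq> N" unfolding im[symmetric] by (intro image_mono) auto
  have ccont: "continuous_map ?P (subtopology X N) c" by (rule homeomorphic_imp_continuous_map[OF hom])
  have gcont: "continuous_map (subtopology X N) ?P g" using g by (simp add: homeomorphic_maps_def)
  have "homeomorphic_maps ?P (subtopology X ?N) ?c (\<lambda>z. (fst (g z), 2 * snd (g z)))"
    unfolding homeomorphic_maps_def
  proof (intro conjI ballI)
    have "continuous_map ?P (top_of_set {0..1}) snd" by (rule continuous_map_snd)
    then have "continuous_map ?P euclideanreal snd" by (rule continuous_map_into_fulltopology)
    then have "continuous_map ?P euclideanreal (\<lambda>p. snd p / 2)"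
      by (intro continuous_map_real_divide) auto
    then have "continuous_map ?P (top_of_set {0..1}) (\<lambda>p. snd p / 2)"
      by (auto simp: continuous_map_in_subtopology)
    then have "continuous_map ?P (subtopology X N) (c \<circ> (\<lambda>p. (fst p, snd p / 2)))"
      by (intro continuous_map_compose[OF continuous_map_pairedI[OF continuous_map_fst] ccont])
    then have "continuous_map ?P X (c \<circ> (\<lambda>p. (fst p, snd p / 2)))" by (rule continuous_map_into_fulltopology)
    then have "continuous_map ?P X ?c" by (rule continuous_map_eq) auto
    moreover have "?c p \<in> ?N" if "p \<in> topspace ?P" for p using that tP by auto
    ultimately show "continuous_map ?P (subtopology X ?N) ?c" by (simp add: continuous_map_in_subtopology Pi_iff)
    have gN: "continuous_map (subtopology X ?N) ?P g" by (rule continuous_map_from_subtopology_mono[OF gcont N2])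
    have g2: "continuous_map (subtopology X ?N) (top_of_set {0..1}) (\<lambda>z. snd (g z))"
      using continuous_map_snd_of[OF gN] by (simp add: o_def)
    then have "continuous_map (subtopology X ?N) euclideanreal (\<lambda>z. 2 * snd (g z))"
      by (intro continuous_map_real_mult) (auto dest: continuous_map_into_fulltopology)
    moreover have "2 * snd (g z) \<in> {0..1}" if "z \<in> topspace (subtopology X ?N)" for z
      using that gc by auto
    ultimately have "continuous_map (subtopology X ?N) (top_of_set {0..1}) (\<lambda>z. 2 * snd (g z))"
      by (auto simp: continuous_map_in_subtopology)
    moreover have "continuous_map (subtopology X ?N) (subtopology X B) (\<lambda>z. fst (g z))"
      using continuous_map_fst_of[OF gN] by (simp add: o_def)
    ultimately show "continuous_map (subtopology X ?N) ?P (\<lambda>z. (fst (g z), 2 * snd (g z)))"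
      by (intro continuous_map_pairedI)
    show "(fst (g (?c p)), 2 * snd (g (?c p))) = p" if "p \<in> topspace ?P" for p
      using that gc by auto
    show "?c (fst (g z), 2 * snd (g z)) = z" if "z \<in> topspace (subtopology X ?N)" for z
      using that gc by auto
  qed
  then have H: "homeomorphic_map ?P (subtopology X ?N) ?c" using homeomorphic_map_maps by blast
  have "openin (subtopology X N) {z \<in> topspace (subtopology X N). snd (g z) \<in> {..<1 / 2}}"
  proof (rule openin_continuous_map_preimage)
    have "continuous_map (subtopology X N) (top_of_set {0..1}) (\<lambda>z. snd (g z))"
      using continuous_map_snd_of[OF gcont] by (simp add: o_def)
    then show "continuous_map (subtopology X N) euclideanreal (\<lambda>z. snd (g z))"
      by (rule continuous_map_into_fulltopology)
  qed auto
  then obtain W where W: "openin X W" "{z \<in> N. snd (g z) < 1 / 2} = W \<inter> N"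
    using tN by (auto simp: openin_subtopology)
  have "?c ` (B \<times> {0..<1}) = W \<inter> c ` (B \<times> {0..<1})"
  proof (intro equalityI subsetI)
    fix z assume "z \<in> ?c ` (B \<times> {0..<1})"
    then obtain y t where y: "y \<in> B" "0 \<le> t" "t < 1" "z = c (y, t / 2)" by auto
    have "z \<in> c ` (B \<times> {0..1})" using y by (intro image_eqI[of _ _ "(y, t / 2)"]) auto
    then have "z \<in> N" using im by simp
    moreover have "snd (g z) < 1 / 2" using gc[of y "t / 2"] y by simp
    ultimately have "z \<in> W" using W(2) by blast
    moreover have "z \<in> c ` (B \<times> {0..<1})" using y by (intro image_eqI[of _ _ "(y, t / 2)"]) auto
    ultimately show "z \<in> W \<inter> c ` (B \<times> {0..<1})" by blast
  next
    fix z assume "z \<in> W \<inter> c ` (B \<times> {0..<1})"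
    then obtain y t where y: "y \<in> B" "0 \<le> t" "t < 1" "z = c (y, t)" "z \<in> W" by auto
    have "z \<in> c ` (B \<times> {0..1})" using y by (intro image_eqI[of _ _ "(y, t)"]) auto
    then have "snd (g z) < 1 / 2" using im W(2) y(5) by blast
    then have "t < 1 / 2" using gc[of y t] y by simp
    then show "z \<in> ?c ` (B \<times> {0..<1})" using y by (intro image_eqI[of _ _ "(y, 2 * t)"]) auto
  qed
  then have "openin X (?c ` (B \<times> {0..<1}))" using W(1) op by auto
  then show ?thesis unfolding is_collar_def using H c0 N2 NX by auto
qed

context trunc_operad
begin

text \<open>A scaling is carried from \<open>{1..m}\<close> to any set of \<open>m\<close> inputs along a numbering. Different numberings
differ by a permutation of \<open>{1..m}\<close>, so equivariance makes the result independent of the choice.\<close>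

lemma scaling_all_inputs:
  assumes cs: "\<And>m. arity_set n {1..m} \<Longrightarrow> is_scaling (opspace P {1..m}) (Decom P {1..m}) (cs m)"
    and eq: "\<And>m \<pi> t a. arity_set n {1..m} \<Longrightarrow> \<pi> permutes {1..m} \<Longrightarrow> a \<in> Ops {1..m} \<Longrightarrow> t \<in> {0..1} \<Longrightarrow>
       oprelabel P {1..m} {1..m} \<pi> (cs m t a) = cs m t (oprelabel P {1..m} {1..m} \<pi> a)"
  obtains sc where "\<And>S. arity_set n S \<Longrightarrow> is_scaling (opspace P S) (Decom P S) (sc S)"
    "\<And>S S' \<sigma> a t. arity_set n S \<Longrightarrow> bij_betw \<sigma> S S' \<Longrightarrow> a \<in> Ops S \<Longrightarrow> t \<in> {0..1} \<Longrightarrow>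
       oprelabel P S S' \<sigma> (sc S t a) = sc S' t (oprelabel P S S' \<sigma> a)"
    "\<And>m t a. arity_set n {1..m} \<Longrightarrow> a \<in> Ops {1..m} \<Longrightarrow> t \<in> {0..1} \<Longrightarrow> sc {1..m} t a = cs m t a"
proof -
  define I where "I S = {1..card S}" for S :: "nat set"
  \<comment> \<open>The numbering of \<open>{1..m}\<close> is the identity, so that the given scalings are extended.\<close>
  define \<beta> where "\<beta> S = (if S = I S then id else SOME b. bij_betw b (I S) S)" for S
  have \<beta>: "bij_betw (\<beta> S) (I S) S" if "arity_set n S" for S
  proof (cases "S = I S")
    case True
    then show ?thesis by (simp add: \<beta>_def)
  next
    case False
    have "finite S" using that by (simp add: arity_set_def)
    then have "\<exists>b. bij_betw b (I S) S" unfolding I_def by (rule finite_same_card_bij[rotated]) simp_all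
    then have "bij_betw (SOME b. bij_betw b (I S) S) (I S) S" by (rule someI_ex)
    then show ?thesis using False by (simp add: \<beta>_def)
  qed
  define \<gamma> where "\<gamma> S = inv_into (I S) (\<beta> S)" for S
  have \<gamma>: "bij_betw (\<gamma> S) S (I S)" if "arity_set n S" for S unfolding \<gamma>_def by (rule bij_betw_inv_into[OF \<beta>[OF that]])
  have I: "arity_set n (I S)" if "arity_set n S" for S by (rule arity_bij[OF that \<gamma>[OF that]])
  define up where "up S = oprelabel P (I S) S (\<beta> S)" for S
  define dn where "dn S = oprelabel P S (I S) (\<gamma> S)" for S
  have upin: "up S a \<in> Ops S" if "arity_set n S" "a \<in> Ops (I S)" for S a
    unfolding up_def by (rule oprel_in[OF I[OF that(1)] \<beta>[OF that(1)] that(2)])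
  have dnin: "dn S a \<in> Ops (I S)" if "arity_set n S" "a \<in> Ops S" for S a
    unfolding dn_def by (rule oprel_in[OF that(1) \<gamma>[OF that(1)] that(2)])
  have updn: "up S (dn S a) = a" if "arity_set n S" "a \<in> Ops S" for S a
    unfolding up_def dn_def oprel_comp[OF that(1) \<gamma>[OF that(1)] \<beta>[OF that(1)] that(2)]
    by (rule oprel_id'[OF that]) (use bij_betw_inv_into_right[OF \<beta>[OF that(1)]] in \<open>simp add: \<gamma>_def\<close>)
  have dnup: "dn S (up S a) = a" if "arity_set n S" "a \<in> Ops (I S)" for S a
    unfolding up_def dn_def oprel_comp[OF I[OF that(1)] \<beta>[OF that(1)] \<gamma>[OF that(1)] that(2)]
    by (rule oprel_id'[OF I[OF that(1)] that(2)]) (use bij_betw_inv_into_left[OF \<beta>[OF that(1)]] in \<open>simp add: \<gamma>_def\<close>)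
  define sc where "sc S t a = up S (cs (card S) t (dn S a))" for S t a
  have scI: "is_scaling (opspace P (I S)) (Decom P (I S)) (cs (card S))" if "arity_set n S" for S
    using cs[of "card S"] I[OF that] by (simp add: I_def)
  have csin: "cs (card S) t a \<in> Ops (I S)" if "arity_set n S" "a \<in> Ops (I S)" "t \<in> {0..1}" for S t a
    using continuous_map_funspace[of "prod_topology (top_of_set {0..1}) (opspace P (I S))" "opspace P (I S)" "\<lambda>(t, a). cs (card S) t a"]
      scI[OF that(1)] that(2,3) unfolding is_scaling_def by (force simp: Pi_iff)
  have A: "is_scaling (opspace P S) (Decom P S) (sc S)" if S: "arity_set n S" for S
  proof -
    note J = scI[OF S, unfolded is_scaling_def]
    show ?thesis
      unfolding is_scaling_def
    proof (intro conjI ballI allI impI)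
      let ?Z = "prod_topology (top_of_set {0..1::real}) (opspace P S)"
      have d: "continuous_map ?Z (opspace P (I S)) (dn S \<circ> snd)"
        unfolding dn_def by (rule continuous_map_compose[OF continuous_map_snd oprel_cont[OF S \<gamma>[OF S]]])
      have "continuous_map ?Z (opspace P S) (up S \<circ> ((\<lambda>(t, a). cs (card S) t a) \<circ> (\<lambda>p. (fst p, (dn S \<circ> snd) p))))"
        unfolding up_def
        by (intro continuous_map_compose[OF _ oprel_cont[OF I[OF S] \<beta>[OF S]]]
            continuous_map_compose[OF continuous_map_pairedI[OF continuous_map_fst d] J[THEN conjunct1]])
      then show "continuous_map ?Z (opspace P S) (\<lambda>(t, a). sc S t a)"
        by (rule continuous_map_eq) (auto simp: sc_def)
    next
      fix a assume a: "a \<in> Ops S"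
      note da = dnin[OF S a]
      show "sc S 1 a = a" using J da updn[OF S a] by (simp add: sc_def)
      show "sc S t (sc S u a) = sc S (t * u) a" if "t \<in> {0..1}" "u \<in> {0..1}" for t u
        using J da that dnup[OF S csin[OF S da that(2)]] by (simp add: sc_def)
      show "a = b" if b: "b \<in> Ops S" and h: "0 < t \<and> t \<le> 1 \<and> sc S t a = sc S t b" for b t
      proof -
        note db = dnin[OF S b]
        have t: "t \<in> {0..1}" using h by auto
        have "cs (card S) t (dn S a) = cs (card S) t (dn S b)"
          using h dnup[OF S csin[OF S da t]] dnup[OF S csin[OF S db t]] unfolding sc_def by metis
        then have "dn S a = dn S b" using J da db h by blast
        then show ?thesis using updn[OF S a] updn[OF S b] by metis
      qed
      show "sc S t a \<notin> Decom P S" if t: "0 \<le> t \<and> t < 1" for t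
      proof
        assume "sc S t a \<in> Decom P S"
        then have "dn S (sc S t a) \<in> Decom P (I S)" unfolding dn_def by (rule oprel_Decom[OF S \<gamma>[OF S]])
        moreover have "dn S (sc S t a) = cs (card S) t (dn S a)"
          unfolding sc_def by (rule dnup[OF S csin[OF S da]]) (use t in auto)
        moreover have "cs (card S) t (dn S a) \<notin> Decom P (I S)" using J da t by blast
        ultimately show False by simp
      qed
      show "(\<exists>b\<in>Ops S. a = sc S t b) \<or> (\<exists>b\<in>Decom P S. \<exists>u. t \<le> u \<and> u \<le> 1 \<and> a = sc S u b)" if t: "0 < t \<and> t \<le> 1" for t
      proof -
        have "(\<exists>b\<in>Ops (I S). dn S a = cs (card S) t b) \<or> (\<exists>b\<in>Decom P (I S). \<exists>u. t \<le> u \<and> u \<le> 1 \<and> dn S a = cs (card S) u b)"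
          using J da t by blast
        then show ?thesis
        proof
          assume "\<exists>b\<in>Ops (I S). dn S a = cs (card S) t b"
          then obtain b where b: "b \<in> Ops (I S)" "dn S a = cs (card S) t b" by blast
          have "sc S t (up S b) = up S (dn S a)" using dnup[OF S b(1)] b(2) by (simp add: sc_def)
          then have "a = sc S t (up S b)" using updn[OF S a] by simp
          then show ?thesis using upin[OF S b(1)] by blast
        next
          assume "\<exists>b\<in>Decom P (I S). \<exists>u. t \<le> u \<and> u \<le> 1 \<and> dn S a = cs (card S) u b"
          then obtain b u where b: "b \<in> Decom P (I S)" "t \<le> u" "u \<le> 1" "dn S a = cs (card S) u b" by blast
          have bO: "b \<in> Ops (I S)" using Decom_subset[OF I[OF S]] b(1) by blast
          have "sc S u (up S b) = up S (dn S a)" using dnup[OF S bO] b(4) by (simp add: sc_def)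
          then have "a = sc S u (up S b)" using updn[OF S a] by simp
          moreover have "up S b \<in> Decom P S" unfolding up_def by (rule oprel_Decom[OF I[OF S] \<beta>[OF S] b(1)])
          ultimately show ?thesis using b(2,3) by blast
        qed
      qed
    qed
  qed
  have R: "oprelabel P S S' \<sigma> (sc S t a) = sc S' t (oprelabel P S S' \<sigma> a)"
    if S: "arity_set n S" and s: "bij_betw \<sigma> S S'" and a: "a \<in> Ops S" and t: "t \<in> {0..1}" for S S' \<sigma> a t
  proof -
    note S' = arity_bij[OF S s]
    have cd: "card S' = card S" using bij_betw_same_card[OF s] by simp
    have II: "I S' = I S" by (simp add: I_def cd)
    note da = dnin[OF S a] note ra = oprel_in[OF S s a]
    note cin = csin[OF S da t]
    \<comment> \<open>The relabeling \<open>\<sigma>\<close>, read in the chosen numberings, is a permutation.\<close>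
    define \<pi> where "\<pi> x = (if x \<in> I S then \<gamma> S' (\<sigma> (\<beta> S x)) else x)" for x
    have "bij_betw (\<gamma> S' \<circ> (\<sigma> \<circ> \<beta> S)) (I S) (I S)"
      using bij_betw_trans[OF bij_betw_trans[OF \<beta>[OF S] s] \<gamma>[OF S']] unfolding II .
    then have pb: "bij_betw \<pi> (I S) (I S)"
      by (simp add: \<pi>_def cong: bij_betw_cong)
    have pp: "\<pi> permutes I S" by (rule bij_imp_permutes[OF pb]) (simp add: \<pi>_def)
    have bg: "\<beta> S (\<gamma> S x) = x" if "x \<in> S" for x unfolding \<gamma>_def by (rule bij_betw_inv_into_right[OF \<beta>[OF S] that])
    have bg': "\<beta> S' (\<gamma> S' x) = x" if "x \<in> S'" for x unfolding \<gamma>_def by (rule bij_betw_inv_into_right[OF \<beta>[OF S'] that])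
    have gI: "\<gamma> S x \<in> I S" if "x \<in> S" for x using \<gamma>[OF S] that by (auto simp: bij_betw_def)
    have sS: "\<sigma> x \<in> S'" if "x \<in> S" for x using s that by (auto simp: bij_betw_def)
    have bS: "\<beta> S x \<in> S" if "x \<in> I S" for x using \<beta>[OF S] that by (auto simp: bij_betw_def)
    have d1: "dn S' (oprelabel P S S' \<sigma> a) = oprelabel P (I S) (I S) \<pi> (dn S a)"
    proof -
      have "dn S' (oprelabel P S S' \<sigma> a) = oprelabel P S (I S) (\<gamma> S' \<circ> \<sigma>) a"
        unfolding dn_def by (subst oprel_comp[OF S s \<gamma>[OF S'] a]) (simp add: II)
      also have "\<dots> = oprelabel P S (I S) (\<pi> \<circ> \<gamma> S) a"
        by (rule oprel_cong[OF S bij_betw_trans[OF \<gamma>[OF S] pb] _ a]) (simp add: \<pi>_def gI bg)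
      also have "\<dots> = oprelabel P (I S) (I S) \<pi> (dn S a)"
        unfolding dn_def by (rule oprel_comp[OF S \<gamma>[OF S] pb a, symmetric])
      finally show ?thesis .
    qed
    have e: "oprelabel P (I S) (I S) \<pi> (cs (card S) t (dn S a)) = cs (card S) t (oprelabel P (I S) (I S) \<pi> (dn S a))"
      using eq[of "card S" \<pi> "dn S a" t] I[OF S] pp da t by (simp add: I_def)
    have "sc S' t (oprelabel P S S' \<sigma> a) = oprelabel P (I S) S' (\<beta> S') (oprelabel P (I S) (I S) \<pi> (cs (card S) t (dn S a)))"
      unfolding sc_def cd d1 e[symmetric] up_def II ..
    also have "\<dots> = oprelabel P (I S) S' (\<beta> S' \<circ> \<pi>) (cs (card S) t (dn S a))"
      by (rule oprel_comp[OF I[OF S] pb \<beta>[OF S', unfolded II] cin])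
    also have "\<dots> = oprelabel P (I S) S' (\<sigma> \<circ> \<beta> S) (cs (card S) t (dn S a))"
      by (rule oprel_cong[OF I[OF S] bij_betw_trans[OF \<beta>[OF S] s] _ cin]) (simp add: \<pi>_def bg' sS bS)
    also have "\<dots> = oprelabel P S S' \<sigma> (sc S t a)"
      unfolding sc_def up_def by (rule oprel_comp[OF I[OF S] \<beta>[OF S] s cin, symmetric])
    finally show ?thesis by simp
  qed
  have C: "sc {1..m} t a = cs m t a" if m: "arity_set n {1..m}" and a: "a \<in> Ops {1..m}" and t: "t \<in> {0..1}" for m t a
  proof -
    have Im: "I {1..m} = {1..m}" by (simp add: I_def)
    have b: "\<beta> {1..m} = id" unfolding \<beta>_def Im by simp
    have g: "\<gamma> {1..m} x = x" if "x \<in> {1..m}" for x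
      using bij_betw_inv_into_left[OF \<beta>[OF m], of x] that unfolding \<gamma>_def Im b by simp
    have d: "dn {1..m} a = a" unfolding dn_def Im by (rule oprel_id'[OF m a]) (rule g)
    have "cs m t a \<in> Ops {1..m}" using csin[OF m, of a t] a t unfolding Im by simp
    then show ?thesis unfolding sc_def d up_def Im b using oprel_id[OF m] by simp
  qed
  show thesis by (rule that[OF A R C])
qed

end

section \<open>Homeomorphism invariance\<close>

lemma homeomorphic_map_inverse:
  assumes "homeomorphic_map X Y k"
  obtains j where "homeomorphic_map Y X j" "\<And>x. x \<in> topspace X \<Longrightarrow> j (k x) = x" "\<And>y. y \<in> topspace Y \<Longrightarrow> k (j y) = y"
proof -
  obtain j where j: "homeomorphic_maps X Y k j" using assms unfolding homeomorphic_map_maps by blast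
  then have "homeomorphic_map Y X j" using homeomorphic_maps_sym homeomorphic_map_maps by blast
  then show thesis by (rule that) (use j in \<open>auto simp: homeomorphic_maps_def\<close>)
qed

lemma locally_modelled_image:
  assumes k: "homeomorphic_map X Y k" and l: "locally_modelled_at X M x"
  shows "locally_modelled_at Y M (k x)"
proof -
  obtain U V where U: "openin X U" "x \<in> U" "openin M V" "subtopology X U homeomorphic_space subtopology M V"
    using l by (auto simp: locally_modelled_at_def)
  have UX: "U \<subseteq> topspace X" by (rule openin_subset[OF U(1)])
  have kU: "openin Y (k ` U)" using homeomorphic_map_openness[OF k UX] U(1) by blast
  have "homeomorphic_map (subtopology X U) (subtopology Y (k ` U)) k"
    by (rule homeomorphic_map_subtopologies[OF k])
       (use UX openin_subset[OF kU] in \<open>auto\<close>)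
  then have "subtopology X U homeomorphic_space subtopology Y (k ` U)"
    by (rule homeomorphic_map_imp_homeomorphic_space)
  then have "subtopology Y (k ` U) homeomorphic_space subtopology M V"
    using U(4) homeomorphic_space_sym homeomorphic_space_trans by blast
  then show ?thesis unfolding locally_modelled_at_def using kU U by blast
qed

lemma locally_modelled_iff:
  assumes k: "homeomorphic_map X Y k" and x: "x \<in> topspace X"
  shows "locally_modelled_at Y M (k x) \<longleftrightarrow> locally_modelled_at X M x"
proof
  assume h: "locally_modelled_at Y M (k x)"
  obtain j where j: "homeomorphic_map Y X j" "\<And>x. x \<in> topspace X \<Longrightarrow> j (k x) = x" using homeomorphic_map_inverse[OF k] by metis
  show "locally_modelled_at X M x" using locally_modelled_image[OF j(1) h] j(2)[OF x] by simp
qed (rule locally_modelled_image[OF k])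

lemma manifold_boundary_image:
  assumes k: "homeomorphic_map X Y k"
  shows "k ` manifold_boundary d X = manifold_boundary d Y"
proof -
  have kt: "k ` topspace X = topspace Y" by (rule homeomorphic_imp_surjective_map[OF k])
  show ?thesis
  proof (intro equalityI subsetI)
    fix y assume "y \<in> k ` manifold_boundary d X"
    then obtain x where x: "x \<in> topspace X" "\<not> locally_modelled_at X (Euclidean_space (nat d)) x" "y = k x"
      unfolding manifold_boundary_def by blast
    then show "y \<in> manifold_boundary d Y"
      unfolding manifold_boundary_def using locally_modelled_iff[OF k x(1)] kt by blast
  next
    fix y assume y: "y \<in> manifold_boundary d Y"
    then obtain x where x: "x \<in> topspace X" "y = k x" using kt unfolding manifold_boundary_def by blast
    then show "y \<in> k ` manifold_boundary d X"
      using y locally_modelled_iff[OF k x(1)] unfolding manifold_boundary_def by blast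
  qed
qed

lemma manifold_boundary_closed: "closedin X (manifold_boundary d X)"
proof -
  have "topspace X - manifold_boundary d X =
     \<Union> {U. openin X U \<and> (\<exists>V. openin (Euclidean_space (nat d)) V \<and>
       subtopology X U homeomorphic_space subtopology (Euclidean_space (nat d)) V)}"
    unfolding manifold_boundary_def locally_modelled_at_def using openin_subset by blast
  then have "openin X (topspace X - manifold_boundary d X)" by auto
  moreover have "manifold_boundary d X \<subseteq> topspace X" by (auto simp: manifold_boundary_def)
  ultimately show ?thesis by (simp add: closedin_def)
qed

lemma topological_manifold_image:
  assumes k: "homeomorphic_map X Y k" and m: "topological_manifold d X"
  shows "topological_manifold d Y"
  unfolding topological_manifold_def
proof (intro conjI ballI)
  show "Hausdorff_space Y"
    using m homeomorphic_Hausdorff_space[OF homeomorphic_map_imp_homeomorphic_space[OF k]]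
    by (simp add: topological_manifold_def)
  have kt: "k ` topspace X = topspace Y" by (rule homeomorphic_imp_surjective_map[OF k])
  have kc: "continuous_map X Y k" by (rule homeomorphic_imp_continuous_map[OF k])
  have "second_countable_space X" using m by (simp add: topological_manifold_def)
  then obtain \<B> where B0: "countable \<B>" "\<forall>B\<in>\<B>. openin X B"
    "\<forall>U x. openin X U \<and> x \<in> U \<longrightarrow> (\<exists>B\<in>\<B>. x \<in> B \<and> B \<subseteq> U)"
    unfolding second_countable_space_def by (elim exE conjE)
  have B: "countable \<B>" "\<And>B. B \<in> \<B> \<Longrightarrow> openin X B"
    "\<And>U x. openin X U \<Longrightarrow> x \<in> U \<Longrightarrow> \<exists>B\<in>\<B>. x \<in> B \<and> B \<subseteq> U"
    using B0 by simp_all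
  show "second_countable_space Y"
    unfolding second_countable_space_def
  proof (intro exI[of _ "(`) k ` \<B>"] conjI ballI allI impI)
    show "countable ((`) k ` \<B>)" using B(1) by simp
    show "openin Y A" if A: "A \<in> (`) k ` \<B>" for A
    proof -
      obtain A' where A': "A' \<in> \<B>" "A = k ` A'" using A by blast
      then show ?thesis using B(2)[OF A'(1)] homeomorphic_map_openness[OF k openin_subset[OF B(2)[OF A'(1)]]] by simp
    qed
    fix U y assume h: "openin Y U \<and> y \<in> U"
    then have "y \<in> topspace Y" using openin_subset[of Y U] by auto
    then obtain x where x: "x \<in> topspace X" "y = k x" unfolding kt[symmetric] by blast
    have "openin X {x \<in> topspace X. k x \<in> U}" using openin_continuous_map_preimage[OF kc] h by blast
    moreover have "x \<in> {x \<in> topspace X. k x \<in> U}" using x h by simp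
    ultimately obtain A where "A \<in> \<B>" "x \<in> A" "A \<subseteq> {x \<in> topspace X. k x \<in> U}" using B(3) by blast
    then show "\<exists>A\<in>(`) k ` \<B>. y \<in> A \<and> A \<subseteq> U" using x by blast
  qed
  fix y assume "y \<in> topspace Y"
  then obtain x where x: "x \<in> topspace X" "y = k x" unfolding kt[symmetric] by blast
  show "0 \<le> d" using m x by (auto simp: topological_manifold_def)
  show "locally_modelled_at Y (half_space (nat d)) y"
    using m x locally_modelled_image[OF k] by (auto simp: topological_manifold_def)
qed

lemma collar_neighborhood_preimage:
  assumes k: "homeomorphic_map X Y k" and B: "B \<subseteq> topspace X" and N: "N \<subseteq> topspace X"
    and c: "collar_neighborhood Y (k ` B) (k ` N)"
  shows "collar_neighborhood X B N"
proof -
  obtain c where c: "is_collar Y (k ` B) (k ` N) c" using c by (auto simp: collar_neighborhood_def)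
  obtain j where j: "homeomorphic_map Y X j" "\<And>x. x \<in> topspace X \<Longrightarrow> j (k x) = x" "\<And>y. y \<in> topspace Y \<Longrightarrow> k (j y) = y"
    using homeomorphic_map_inverse[OF k] by metis
  have kt: "k ` topspace X = topspace Y" by (rule homeomorphic_imp_surjective_map[OF k])
  have jk: "j ` k ` A = A" if "A \<subseteq> topspace X" for A using that j(2) by (force simp: image_iff)
  let ?PX = "prod_topology (subtopology X B) (top_of_set {0..1::real})"
  let ?PY = "prod_topology (subtopology Y (k ` B)) (top_of_set {0..1::real})"
  have kY: "k ` A \<subseteq> topspace Y" if "A \<subseteq> topspace X" for A using that kt by blast
  have hB: "homeomorphic_map (subtopology X B) (subtopology Y (k ` B)) k"
    by (rule homeomorphic_map_subtopologies[OF k]) (use B kY[OF B] in auto)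
  have hN: "homeomorphic_map (subtopology Y (k ` N)) (subtopology X N) j"
    by (rule homeomorphic_map_subtopologies[OF j(1)]) (use jk[OF N] N kY[OF N] in \<open>auto simp: Int_absorb1\<close>)
  obtain j' where j': "homeomorphic_maps (subtopology X B) (subtopology Y (k ` B)) k j'"
    using hB unfolding homeomorphic_map_maps by blast
  have "homeomorphic_maps (top_of_set {0..1::real}) (top_of_set {0..1}) id id" by (simp add: homeomorphic_maps_id)
  then have "homeomorphic_maps ?PX ?PY (\<lambda>(x, t). (k x, id t)) (\<lambda>(y, t). (j' y, id t))"
    unfolding homeomorphic_maps_prod using j' by blast
  then have h1: "homeomorphic_map ?PX ?PY (\<lambda>(x, t). (k x, id t))" using homeomorphic_map_maps by blast
  have h2: "homeomorphic_map ?PY (subtopology Y (k ` N)) c" using c by (simp add: is_collar_def)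
  have H: "homeomorphic_map ?PX (subtopology X N) (j \<circ> (c \<circ> (\<lambda>(x, t). (k x, id t))))"
    by (rule homeomorphic_map_compose[OF homeomorphic_map_compose[OF h1 h2] hN])
  have "is_collar X B N (j \<circ> (c \<circ> (\<lambda>(x, t). (k x, id t))))"
    unfolding is_collar_def
  proof (intro conjI ballI N H)
    show "(j \<circ> (c \<circ> (\<lambda>(x, t). (k x, id t)))) (x, 0) = x" if "x \<in> B" for x
      using that c j(2) B by (auto simp: is_collar_def)
    have "(j \<circ> (c \<circ> (\<lambda>(x, t). (k x, id t)))) ` (B \<times> {0..<1}) = j ` (c ` (k ` B \<times> {0..<1}))"
      by (force simp: image_iff)
    moreover have o: "openin Y (c ` (k ` B \<times> {0..<1}))" using c by (simp add: is_collar_def)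
    ultimately show "openin X ((j \<circ> (c \<circ> (\<lambda>(x, t). (k x, id t)))) ` (B \<times> {0..<1}))"
      using homeomorphic_map_openness[OF j(1) openin_subset[OF o]] by simp
  qed
  then show ?thesis by (auto simp: collar_neighborhood_def)
qed

section \<open>Manifold operads\<close>

lemma colim_step_opcomp:
  assumes P: "trunc_operad n P" and S: "arity_set n S" and e: "equivclp (colim_step P S) p q"
    and p: "p \<in> topspace (colim_sum P S)"
  shows "q \<in> topspace (colim_sum P S) \<and> opcomp P (fst q) (snd q) = opcomp P (fst p) (snd p)"
proof -
  interpret trunc_operad n P by (rule P)
  have step: "opcomp P (fst v) (snd v) = opcomp P (fst u) (snd u)" if st: "colim_step P S u v" for u v
  proof -
    obtain f where f: "tree_mor id f (fst u) (fst v)" and v: "snd v = tree_map P id f (fst u) (fst v) (snd u)"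
      and t: "u \<in> topspace (colim_sum P S)" "v \<in> topspace (colim_sum P S)"
      using st unfolding colim_step_def by blast
    have u: "tree_in S (fst u)" "snd u \<in> pts (fst u)" and v': "tree_in S (fst v)"
      using t tree_inI[OF _ S] by (auto simp: colim_sum_def)
    show ?thesis
      unfolding v opcomp_nat[OF u(1) v' f u(2)] by (rule oprel_id[OF S opcomp_in[OF u]])
  qed
  show ?thesis using e
  proof (induction rule: equivclp_induct)
    case (step y z)
    have "y \<in> topspace (colim_sum P S) \<and> z \<in> topspace (colim_sum P S)" using step(2) unfolding colim_step_def by blast
    then show ?case using step \<open>\<And>u v. colim_step P S u v \<Longrightarrow> opcomp P (fst v) (snd v) = opcomp P (fst u) (snd u)\<close> by metis
  qed (use p in simp)
qed

text \<open>Each class of the colimit is sent to the common composite of its representatives.\<close>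

lemma manifold_operad_unique:
  assumes M: "manifold_operad n d P"
  shows "unique_operad n P"
proof -
  have Decom: "Decom P S \<subseteq> topspace (opspace P S)" if "arity_set n S" for S
    using M that unfolding manifold_operad_def manifold_boundary_def by blast
  have P: "trunc_operad n P"
    by unfold_locales (use M Decom in \<open>auto simp: manifold_operad_def\<close>)
  then interpret trunc_operad n P .
  show ?thesis
  proof (unfold_locales)
    fix S T x T' x'
    assume S: "arity_set n S" and T: "labeled_tree S T" "decomposable T" "x \<in> pts T"
      and T': "labeled_tree S T'" "decomposable T'" "x' \<in> pts T'" and e: "opcomp P T x = opcomp P T' x'"
    let ?p = "(T, x)" and ?q = "(T', x')"
    have p: "?p \<in> topspace (colim_sum P S)" and q: "?q \<in> topspace (colim_sum P S)"
      using T T' by (auto simp: colim_sum_def)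
    have cm: "colim_map P (colim_class P S r) = opcomp P (fst r) (snd r)" if r: "r \<in> topspace (colim_sum P S)" for r
    proof -
      have "(\<lambda>(T, x). opcomp P T x) ` colim_class P S r = {opcomp P (fst r) (snd r)}"
      proof (intro equalityI subsetI)
        fix a assume "a \<in> (\<lambda>(T, x). opcomp P T x) ` colim_class P S r"
        then obtain u where u: "equivclp (colim_step P S) r u" "a = opcomp P (fst u) (snd u)"
          by (auto simp: colim_class_def)
        then show "a \<in> {opcomp P (fst r) (snd r)}" using colim_step_opcomp[OF P S u(1) r] by simp
      next
        fix a assume "a \<in> {opcomp P (fst r) (snd r)}"
        then show "a \<in> (\<lambda>(T, x). opcomp P T x) ` colim_class P S r"
          by (intro image_eqI[of _ _ r]) (auto simp: colim_class_def case_prod_beta)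
      qed
      then show ?thesis by (simp add: colim_map_def)
    qed
    have "homeomorphic_map (tree_colim P S) (subtopology (opspace P S) (Decom P S)) (colim_map P)"
      using M S unfolding manifold_operad_def by blast
    then have "inj_on (colim_map P) (topspace (tree_colim P S))" by (rule homeomorphic_imp_injective_map)
    then have inj: "inj_on (colim_map P) (colim_class P S ` topspace (colim_sum P S))"
      unfolding tree_colim_def topspace_quotient_topology .
    have "colim_map P (colim_class P S ?p) = colim_map P (colim_class P S ?q)"
      unfolding cm[OF p] cm[OF q] fst_conv snd_conv by (rule e)
    then have "colim_class P S ?p = colim_class P S ?q"
      by (rule inj_onD[OF inj]) (rule imageI[OF p], rule imageI[OF q])
    moreover have "?q \<in> colim_class P S ?q" unfolding colim_class_def by simp
    ultimately have "?q \<in> colim_class P S ?p" by (simp only:)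
    then show "equivclp (colim_step P S) ?p ?q" unfolding colim_class_def mem_Collect_eq .
  qed
qed

theorem proposition2p2p8:
  fixes P :: "'a operad" and n :: enat and d :: nat
  assumes "manifold_operad n d P"
    and "collarable n d P"
  shows "(\<exists>h. operad_iso n P (W P) h) \<and>
    (\<forall>m::nat. 2 \<le> m \<and> enat m \<le> n \<longrightarrow>
       topological_manifold (arity_dim d m) (opspace (W P) {1..m}) \<and>
       manifold_boundary (arity_dim d m) (opspace (W P) {1..m}) = Decom (W P) {1..m} \<and>
       collar_neighborhood (opspace (W P) {1..m}) (manifold_boundary (arity_dim d m) (opspace (W P) {1..m}))
         (W_decomposable P {1..m}))"
proof -
  note M = assms(1) and C = assms(2)
  interpret unique_operad n P by (rule manifold_operad_unique[OF M])
  have man: "compact_space (opspace P S)" "topological_manifold (arity_dim d (card S)) (opspace P S)"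
    "manifold_boundary (arity_dim d (card S)) (opspace P S) = Decom P S" "Hausdorff_space (opspace P S)"
    if "arity_set n S" for S
    using M that unfolding manifold_operad_def topological_manifold_def by blast+
  have ar: "arity_set n {1..m} \<longleftrightarrow> 2 \<le> m \<and> enat m \<le> n" for m by (simp add: arity_set_def)
  have "\<exists>N c. is_collar (opspace P {1..m}) (Decom P {1..m}) N c \<and>
       (\<forall>\<pi>. \<pi> permutes {1..m} \<longrightarrow> (\<forall>x\<in>Decom P {1..m}. \<forall>t\<in>{0..1}.
          c (oprelabel P {1..m} {1..m} \<pi> x, t) = oprelabel P {1..m} {1..m} \<pi> (c (x, t))))"
    if m: "arity_set n {1..m}" for m
  proof -
    have bm: "manifold_boundary (arity_dim d m) (opspace P {1..m}) = Decom P {1..m}" using man(3)[OF m] by simp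
    have "2 \<le> m \<and> enat m \<le> n" using m ar by simp
    from mp[OF spec[OF C[unfolded collarable_def Let_def]] this] show ?thesis unfolding bm .
  qed
  then obtain NN cc where cc: "\<And>m. arity_set n {1..m} \<Longrightarrow> is_collar (opspace P {1..m}) (Decom P {1..m}) (NN m) (cc m)"
    and ceq: "\<And>m \<pi> x t. arity_set n {1..m} \<Longrightarrow> \<pi> permutes {1..m} \<Longrightarrow> x \<in> Decom P {1..m} \<Longrightarrow> t \<in> {0..1} \<Longrightarrow>
       cc m (oprelabel P {1..m} {1..m} \<pi> x, t) = oprelabel P {1..m} {1..m} \<pi> (cc m (x, t))"
    by metis
  have closed: "closedin (opspace P {1..m}) (Decom P {1..m})" if m: "arity_set n {1..m}" for m
    using manifold_boundary_closed[of "opspace P {1..m}" "arity_dim d (card {1..m})"] man(3)[OF m] by simp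
  have "\<exists>s. is_scaling (opspace P {1..m}) (Decom P {1..m}) s \<and>
     (\<forall>y\<in>Decom P {1..m}. \<forall>t\<in>{0..1}. \<forall>l\<in>{0..1}. s l (cc m (y, t)) = cc m (y, 1 - l * (1 - t))) \<and>
     (\<forall>z l. z \<in> Ops {1..m} \<longrightarrow> z \<notin> NN m \<longrightarrow> s l z = z)" if m: "arity_set n {1..m}" for m
    using collar_scaling[OF man(1,4)[OF m] closed[OF m] cc[OF m]] by metis
  then obtain cs where cs: "\<And>m. arity_set n {1..m} \<Longrightarrow> is_scaling (opspace P {1..m}) (Decom P {1..m}) (cs m)"
    and csc: "\<And>m y t l. arity_set n {1..m} \<Longrightarrow> y \<in> Decom P {1..m} \<Longrightarrow> t \<in> {0..1} \<Longrightarrow> l \<in> {0..1} \<Longrightarrow>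
       cs m l (cc m (y, t)) = cc m (y, 1 - l * (1 - t))"
    and cso: "\<And>m z l. arity_set n {1..m} \<Longrightarrow> z \<in> Ops {1..m} \<Longrightarrow> z \<notin> NN m \<Longrightarrow> cs m l z = z"
    by metis
  have colN: "cc m ` (Decom P {1..m} \<times> {0..1}) = NN m" "NN m \<subseteq> Ops {1..m}" if m: "arity_set n {1..m}" for m
  proof -
    show N: "NN m \<subseteq> Ops {1..m}" using cc[OF m] by (simp add: is_collar_def)
    have "homeomorphic_map (prod_topology (subtopology (opspace P {1..m}) (Decom P {1..m})) (top_of_set {0..1}))
       (subtopology (opspace P {1..m}) (NN m)) (cc m)" using cc[OF m] by (simp add: is_collar_def)
    from homeomorphic_imp_surjective_map[OF this]
    show "cc m ` (Decom P {1..m} \<times> {0..1}) = NN m"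
      using N Decom_subset[OF m] by (simp add: Int_absorb1)
  qed
  \<comment> \<open>Permutations act on the collar through its boundary factor, so they commute with the scaling. That a
    permutation also preserves the complement of the collar follows from its inverse.\<close>
  have cseq: "oprelabel P {1..m} {1..m} \<pi> (cs m t a) = cs m t (oprelabel P {1..m} {1..m} \<pi> a)"
    if m: "arity_set n {1..m}" and \<pi>: "\<pi> permutes {1..m}" and a: "a \<in> Ops {1..m}" and t: "t \<in> {0..1}" for m \<pi> t a
  proof -
    have b: "bij_betw \<pi> {1..m} {1..m}" by (rule permutes_imp_bij[OF \<pi>])
    have inN: "oprelabel P {1..m} {1..m} \<rho> z \<in> NN m" if \<rho>: "\<rho> permutes {1..m}" and z: "z \<in> NN m" for \<rho> z
    proof -
      obtain y u where y: "y \<in> Decom P {1..m}" "u \<in> {0..1}" "z = cc m (y, u)" using z colN(1)[OF m] by blast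
      have "oprelabel P {1..m} {1..m} \<rho> z = cc m (oprelabel P {1..m} {1..m} \<rho> y, u)"
        using ceq[OF m \<rho> y(1,2)] y(3) by simp
      then show ?thesis using oprel_Decom[OF m permutes_imp_bij[OF \<rho>] y(1)] y(2) colN(1)[OF m] by blast
    qed
    show ?thesis
    proof (cases "a \<in> NN m")
      case True
      then obtain y u where y: "y \<in> Decom P {1..m}" "u \<in> {0..1}" "a = cc m (y, u)" using colN(1)[OF m] by blast
      have "0 \<le> t * (1 - u)" using t y(2) by auto
      moreover have "t * (1 - u) \<le> 1" using t y(2) by (intro mult_le_one) auto
      ultimately have r: "1 - t * (1 - u) \<in> {0..1}" by simp
      have "oprelabel P {1..m} {1..m} \<pi> (cs m t a) = cc m (oprelabel P {1..m} {1..m} \<pi> y, 1 - t * (1 - u))"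
        using csc[OF m y(1,2) t] ceq[OF m \<pi> y(1) r] y(3) by simp
      also have "\<dots> = cs m t (cc m (oprelabel P {1..m} {1..m} \<pi> y, u))"
        using csc[OF m oprel_Decom[OF m b y(1)] y(2) t] by simp
      also have "\<dots> = cs m t (oprelabel P {1..m} {1..m} \<pi> a)" using ceq[OF m \<pi> y(1,2)] y(3) by simp
      finally show ?thesis .
    next
      case False
      have pa: "oprelabel P {1..m} {1..m} \<pi> a \<in> Ops {1..m}" by (rule oprel_in[OF m b a])
      have "oprelabel P {1..m} {1..m} \<pi> a \<notin> NN m"
      proof
        assume "oprelabel P {1..m} {1..m} \<pi> a \<in> NN m"
        then have "oprelabel P {1..m} {1..m} (inv \<pi>) (oprelabel P {1..m} {1..m} \<pi> a) \<in> NN m"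
          by (rule inN[OF permutes_inv[OF \<pi>]])
        moreover have "oprelabel P {1..m} {1..m} (inv \<pi>) (oprelabel P {1..m} {1..m} \<pi> a) = a"
          unfolding oprel_comp[OF m b permutes_imp_bij[OF permutes_inv[OF \<pi>]] a]
          by (rule oprel_id'[OF m a]) (simp add: permutes_inverses[OF \<pi>])
        ultimately show False using False by simp
      qed
      then show ?thesis using cso[OF m a False] cso[OF m pa] by simp
    qed
  qed
  obtain sc where sc: "\<And>S. arity_set n S \<Longrightarrow> is_scaling (opspace P S) (Decom P S) (sc S)"
    and scr: "\<And>S S' \<sigma> a t. arity_set n S \<Longrightarrow> bij_betw \<sigma> S S' \<Longrightarrow> a \<in> Ops S \<Longrightarrow> t \<in> {0..1} \<Longrightarrow>
       oprelabel P S S' \<sigma> (sc S t a) = sc S' t (oprelabel P S S' \<sigma> a)"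
    and scc: "\<And>m t a. arity_set n {1..m} \<Longrightarrow> a \<in> Ops {1..m} \<Longrightarrow> t \<in> {0..1} \<Longrightarrow> sc {1..m} t a = cs m t a"
  proof (rule scaling_all_inputs[of cs])
    show "is_scaling (opspace P {1..m}) (Decom P {1..m}) (cs m)" if "arity_set n {1..m}" for m
      by (rule cs[OF that])
    show "oprelabel P {1..m} {1..m} \<pi> (cs m t a) = cs m t (oprelabel P {1..m} {1..m} \<pi> a)"
      if "arity_set n {1..m}" "\<pi> permutes {1..m}" "a \<in> Ops {1..m}" "t \<in> {0..1}" for m \<pi> t a
      by (rule cseq[OF that])
  qed (rule that, assumption+)
  interpret compact_operad n P sc
  proof (unfold_locales, goal_cases)
    case 1 then show ?case using sc by blast
  next
    case 2 then show ?case using scr by blast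
  next
    case 3 then show ?case using man(1) by blast
  next
    case 4 then show ?case using man(4) by blast
  qed
  have "topological_manifold (arity_dim d m) (opspace (W P) {1..m}) \<and>
       manifold_boundary (arity_dim d m) (opspace (W P) {1..m}) = Decom (W P) {1..m} \<and>
       collar_neighborhood (opspace (W P) {1..m}) (manifold_boundary (arity_dim d m) (opspace (W P) {1..m}))
         (W_decomposable P {1..m})" if "2 \<le> m \<and> enat m \<le> n" for m
  proof -
    have m: "arity_set n {1..m}" using that ar by simp
    let ?X = "opspace (W P) {1..m}" and ?Y = "opspace P {1..m}"
    have k: "homeomorphic_map ?X ?Y class_value" by (rule class_value_homeomorphic[OF m])
    obtain j where j: "homeomorphic_map ?Y ?X j" using homeomorphic_map_inverse[OF k] by metis
    have man1: "topological_manifold (arity_dim d m) ?X"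
      using topological_manifold_image[OF j] man(2)[OF m] by simp
    have bX: "manifold_boundary (arity_dim d m) ?X \<subseteq> topspace ?X" by (auto simp: manifold_boundary_def)
    have bd: "class_value ` manifold_boundary (arity_dim d m) ?X = Decom P {1..m}"
      using manifold_boundary_image[OF k, of "arity_dim d m"] man(3)[OF m] by simp
    then have bW: "manifold_boundary (arity_dim d m) ?X = Decom (W P) {1..m}"
      using W_operad_iso(2,3)[OF m] homeomorphic_imp_injective_map[OF k] bX
      by (metis inj_on_image_eq_iff)
    have "class_value ` W_decomposable P {1..m} = cc m ` (Decom P {1..m} \<times> {0..1 / 2})"
    proof -
      \<comment> \<open>A boundary point is at distance 1 from the inner end, and the factor \<open>u\<close> leaves the distance \<open>u\<close>.\<close>
      have e: "sc {1..m} u b = cc m (b, 1 - u)" if "b \<in> Decom P {1..m}" "u \<in> {0..1}" for u b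
      proof -
        have "cc m (b, 0) = b" using cc[OF m] that(1) by (simp add: is_collar_def)
        then show ?thesis using scc[OF m _ that(2), of b] csc[OF m that(1) _ that(2), of 0] Decom_subset[OF m] that(1) by auto
      qed
      show ?thesis
        unfolding W_decomposable_value[OF m]
      proof (intro equalityI subsetI)
        fix z assume "z \<in> {sc {1..m} u b |u b. 1 / 2 \<le> u \<and> u \<le> 1 \<and> b \<in> Decom P {1..m}}"
        then obtain u b where u: "1 / 2 \<le> u" "u \<le> 1" "b \<in> Decom P {1..m}" "z = sc {1..m} u b" by blast
        then have "z = cc m (b, 1 - u)" using e[of b u] by simp
        then show "z \<in> cc m ` (Decom P {1..m} \<times> {0..1 / 2})" using u by (intro image_eqI[of _ _ "(b, 1 - u)"]) auto
      next
        fix z assume "z \<in> cc m ` (Decom P {1..m} \<times> {0..1 / 2})"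
        then obtain b t where b: "b \<in> Decom P {1..m}" "0 \<le> t" "t \<le> 1 / 2" "z = cc m (b, t)" by auto
        then have "z = sc {1..m} (1 - t) b" using e[of b "1 - t"] by simp
        moreover have "1 / 2 \<le> 1 - t" "1 - t \<le> 1" using b by auto
        ultimately show "z \<in> {sc {1..m} u b |u b. 1 / 2 \<le> u \<and> u \<le> 1 \<and> b \<in> Decom P {1..m}}" using b(1) by blast
      qed
    qed
    then have "collar_neighborhood ?Y (class_value ` manifold_boundary (arity_dim d m) ?X) (class_value ` W_decomposable P {1..m})"
      unfolding bd collar_neighborhood_def using half_collar[OF cc[OF m] Decom_subset[OF m]] by auto
    moreover have "W_decomposable P {1..m} \<subseteq> topspace ?X" by (auto simp: W_decomposable_def)
    ultimately have "collar_neighborhood ?X (manifold_boundary (arity_dim d m) ?X) (W_decomposable P {1..m})"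
      by (intro collar_neighborhood_preimage[OF k bX])
    then show ?thesis using man1 bW by blast
  qed
  then show ?thesis using W_operad_iso(1) by blast
qed

end
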